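(* Let $A\in\mathbb R^{n\times n}$, $B\in\mathbb R^{n\times m}$, $C\in\mathbb R^{m\times n}$, let $f:\mathbb R^m\to\mathbb R^m$ be locally Lipschitz, and consider the forced Lur'e equation $$\dot x(t)=Ax(t)-Bf(Cx(t))+Bv(t).\qquad(\ast)$$ Let $w\in S^1(\mathbb R_+,\mathbb R^m)\cap L^\infty(\mathbb R_+,\mathbb R^m)$, and assume that: (i) the pair $(C,A)$ is detectable; (ii) there exists a symmetric positive semi-definite $P\in\mathbb R^{n\times n}$ such that $\begin{pmatrix}A^\top P+PA & PB-C^\top\\ B^\top P-C & 0\end{pmatrix}\le 0$; (iii) for every compact $\Gamma\subset\mathbb R^m$ there exist $\theta_\Gamma,\alpha_\Gamma\in\mathcal K_\infty$ and $\mu_\Gamma,c_\Gamma\ge0$ with $\mu_\Gamma c_\Gamma\ge1$ such that, for all $y\in\mathbb R^m$ and $z\in\Gamma$: $\|f(y+z)-f(z)\|\le\theta_\Gamma(\|y\|)$; $\|y\|\alpha_\Gamma(\|y\|)\le\langle y,f(y+z)-f(z)\rangle$; and $\|f(y+z)-f(z)\|\le c_\Gamma\langle y,f(y+z)-f(z)\rangle$ if $\|y\|>\mu_\Gamma$; (iv) there exists $(w,z)\in\mathcal B$ with bounded $z$. Then there exists a unique $z^{\rm ap}\in AP(\mathbb R_+,\mathbb R^n)$ such that $(w,z^{\rm ap})\in\mathcal B$ and, for every $\varepsilon>0$, there exists $\delta>0$ such that $P_1(w,\delta)\subset P(z^{\rm ap},\varepsilon)$. Moreover: (a) If $(v,x)\in\mathcal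 B$ with $v-w\in L^1(\mathbb R_+,\mathbb R^m)$, then $\lim_{t\to\infty}(x(t)-z^{\rm ap}(t))=0$, that is, $x\in AAP(\mathbb R_+,\mathbb R^n)$ with $x^{\rm ap}=z^{\rm ap}$. (b) If $w$ is periodic with period $\tau$, then $z^{\rm ap}$ is $\tau$-periodic. (c) $(w_{\rm e},z^{\rm ap}_{\rm e})\in\mathcal{BB}$ and there is no other bounded function $\hat x:\mathbb R\to\mathbb R^n$ such that $(w_{\rm e},\hat x)\in\mathcal{BB}$. (d) ${\rm mod}(z^{\rm ap}_{\rm e})\subseteq{\rm mod}(\widetilde{w_{\rm e}})$, and ${\rm mod}(\widetilde{w_{\rm e}})={\rm mod}(w_{\rm e})$ if $w\in AP(\mathbb R_+,\mathbb R^m)$. Furthermore: (1) If $(v,x)\in\mathcal B^\infty$ with $v\in L^\infty(\mathbb R_+,\mathbb R^m)$ and $\|v-w\|_{L^\infty(t,\infty)}\to0$ as $t\to\infty$, then $\lim_{t\to\infty}(x(t)-z^{\rm ap}(t))=0$. (2) There exists $\theta\in\mathcal K$ such that, for all $(v,x^{\rm ap})\in\mathcal B^\infty$ with $v\in S^1(\mathbb R_+,\mathbb R^m)\cap L^\infty(\mathbb R_+,\mathbb R^m)$ and $x^{\rm ap}\in AP(\mathbb R_+,\mathbb R^n)$, $$\|x^{\rm ap}-z^{\rm ap}\|_{L^\infty}\le\theta(\|v-w\|_{L^\infty}).$$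
   Context: $\mathcal K$: continuous strictly increasing functions $\mathbb R_+\to\mathbb R_+$ vanishing at $0$; $\mathcal K_\infty$: unbounded functions in $\mathcal K$. $(C,A)$ is detectable if there is $H$ with $A-HC$ Hurwitz. Matrix inequalities are in the sense of semi-definiteness. $\mathcal B$ is the set of $(v,x)\in L^1_{\rm loc}(\mathbb R_+,\mathbb R^m)\times W^{1,1}_{\rm loc}(\mathbb R_+,\mathbb R^n)$ satisfying $(\ast)$ a.e. on $\mathbb R_+$; $\mathcal B^\infty:=\{(v,x)\in\mathcal B: v\in L^\infty_{\rm loc}(\mathbb R_+,\mathbb R^m)\}$. $\mathcal{BB}$ is the set of $(v,x)\in L^1_{\rm loc}(\mathbb R,\mathbb R^m)\times W^{1,1}_{\rm loc}(\mathbb R,\mathbb R^n)$ satisfying $(\ast)$ a.e. on $\mathbb R$. Let $\mathcal T=\mathbb R_+$ or $\mathbb R$ and $X$ a Banach space. $S\subseteq\mathcal T$ is relatively dense if there is $l>0$ with $[a,a+l]\cap S\ne\emptyset$ for all $a\in\mathcal T$. For $v\in C(\mathcal T,X)$ and $\varepsilon>0$, $P(v,\varepsilon)$ is the set of $\tau\in\mathcal T$ with $\|v(t)-v(t+\tau)\|\le\varepsilon$ for all $t\in\mathcal T$; $AP(\mathcal T,X)$ (Bohr almost periodic functions) is the set of $v\in C(\mathcal T,X)$ with $P(v,\varepsilon)$ relatively dense for every $\varepsilon>0$. For $v\in L^1_{\rm loc}(\mathcal T,X)$, $P_1(v,\varepsilon)$ is the set of $\tau\in\mathcal T$ with $\sup_{a\in\mathcal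 T}\int_a^{a+1}\|v(s+\tau)-v(s)\|\,{\rm d}s\le\varepsilon$; $S^1(\mathcal T,X)$ (Stepanov almost periodic functions) is the set of $v\in L^1_{\rm loc}(\mathcal T,X)$ with $P_1(v,\varepsilon)$ relatively dense for every $\varepsilon>0$. $C_0(\mathbb R_+,X)$: continuous functions converging to $0$ at $\infty$. $AAP(\mathbb R_+,X):=AP(\mathbb R_+,X)\oplus C_0(\mathbb R_+,X)$ (the sum is direct); for $v\in AAP(\mathbb R_+,X)$, $v^{\rm ap}$ is the unique element of $AP(\mathbb R_+,X)$ with $v-v^{\rm ap}\in C_0(\mathbb R_+,X)$. Each $v\in AP(\mathbb R_+,X)$ has a unique extension $v_{\rm e}\in AP(\mathbb R,X)$, given by $v_{\rm e}(t)=\lim_{k\to\infty}v(t+\tau_k)$ with $\tau_k\in P(v,1/k)$, $\tau_k\to\infty$. Analogously, each $v\in S^1(\mathbb R_+,X)$ has a unique extension $v_{\rm e}\in S^1(\mathbb R,X)$ (same formula with $\tau_k\in P_1(v,1/k)$ and the limit in $L^1_{\rm loc}$); these agree on $AP(\mathbb R_+,X)$. For $v\in AP(\mathbb R,X)$, the generalized Fourier coefficients are $\hat v(\lambda):=\lim_{T\to\infty}\frac1{2T}\int_{-T}^Te^{-i\lambda t}v(t)\,{\rm d}t$, $\lambda\in\mathbb R$ (values in the complexification of $X$ if $X$ is real); $\sigma_{\rm f}(v):=\{\lambda:\hat v(\lambda)\ne0\}$, which is countable; and ${\rm mod}(v):=\{\sum_{\lambda\in\sigma_{\rm f}(v)}m(\lambda)\lambda:\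 m:\sigma_{\rm f}(v)\to\mathbb Z\text{ has finite support}\}$. The Bochner transform of $v\in L^1_{\rm loc}(\mathbb R,X)$ is $\tilde v:\mathbb R\to L^1([0,1],X)$, $(\tilde v(t))(s):=v(t+s)$; $v\in S^1(\mathbb R,X)$ if and only if $\tilde v\in AP(\mathbb R,L^1([0,1],X))$. *)

theory Defs
  imports "HOL-Analysis.Analysis" "HOL-Probability.Essential_Supremum"
begin

section \<open>The Banach space of integrable functions on the unit interval\<close>

lemma L1_complete:
  fixes s :: "nat \<Rightarrow> 'a \<Rightarrow> 'b::{banach, second_countable_topology}"
  assumes int [measurable]: "\<And>n. integrable M (s n)"
    and Cau: "\<And>e. e > 0 \<Longrightarrow> \<exists>N. \<forall>i\<ge>N. \<forall>j\<ge>N. (LINT x|M. norm (s i x - s j x)) < e"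
  shows "\<exists>g. integrable M g \<and> (\<lambda>n. LINT x|M. norm (s n x - g x)) \<longlonglongrightarrow> 0"
proof -
  obtain r where r: "strict_mono r" and aeC: "AE x in M. Cauchy (\<lambda>i. s (r i) x)"
    using cauchy_L1_AE_cauchy_subseq[OF int Cau] by blast
  have [measurable]: "\<And>n. s n \<in> borel_measurable M" using int by auto
  define g where "g x = lim (\<lambda>i. s (r i) x)" for x
  have gm [measurable]: "g \<in> borel_measurable M"
    unfolding g_def by (rule borel_measurable_lim_metric) auto
  have lim: "AE x in M. (\<lambda>i. s (r i) x) \<longlonglongrightarrow> g x"
    using aeC unfolding g_def by eventually_elim (simp add: Cauchy_convergent_iff convergent_LIMSEQ_iff)
  have bnd: "\<exists>N. \<forall>n\<ge>N. (\<integral>\<^sup>+x. norm (s n x - g x) \<partial>M) \<le> ennreal e" if "e > 0" for e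
  proof -
    obtain N where N: "\<And>i j. i \<ge> N \<Longrightarrow> j \<ge> N \<Longrightarrow> (LINT x|M. norm (s i x - s j x)) < e"
      using Cau[OF \<open>e > 0\<close>] by blast
    have "(\<integral>\<^sup>+x. norm (s n x - g x) \<partial>M) \<le> ennreal e" if n: "n \<ge> N" for n
    proof -
      have "AE x in M. ennreal (norm (s n x - g x)) = liminf (\<lambda>i. ennreal (norm (s n x - s (r i) x)))"
        using lim
      proof eventually_elim
        case (elim x)
        have "(\<lambda>i. ennreal (norm (s n x - s (r i) x))) \<longlonglongrightarrow> ennreal (norm (s n x - g x))"
          by (intro tendsto_ennrealI tendsto_norm tendsto_diff tendsto_const elim)
        from lim_imp_Liminf[OF _ this] show ?case by simp
      qed
      then have "(\<integral>\<^sup>+x. norm (s n x - g x) \<partial>M)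
          = (\<integral>\<^sup>+x. liminf (\<lambda>i. ennreal (norm (s n x - s (r i) x))) \<partial>M)"
        by (rule nn_integral_cong_AE)
      also have "\<dots> \<le> liminf (\<lambda>i. \<integral>\<^sup>+x. norm (s n x - s (r i) x) \<partial>M)"
        by (rule nn_integral_liminf) auto
      also have "\<dots> \<le> liminf (\<lambda>i. ennreal e)"
      proof (rule Liminf_mono)
        show "eventually (\<lambda>i. (\<integral>\<^sup>+x. norm (s n x - s (r i) x) \<partial>M) \<le> ennreal e) sequentially"
          unfolding eventually_sequentially
        proof (intro exI[of _ N] allI impI)
          fix i assume "N \<le> i"
          then have "N \<le> r i" using seq_suble[OF r, of i] by linarith
          have "(\<integral>\<^sup>+x. norm (s n x - s (r i) x) \<partial>M) = ennreal (LINT x|M. norm (s n x - s (r i) x))"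
            by (intro nn_integral_eq_integral) (auto intro!: int)
          then show "(\<integral>\<^sup>+x. norm (s n x - s (r i) x) \<partial>M) \<le> ennreal e"
            using N[OF n \<open>N \<le> r i\<close>] by (simp add: ennreal_leI)
        qed
      qed
      also have "\<dots> = ennreal e" by (simp add: Liminf_const)
      finally show ?thesis .
    qed
    then show ?thesis by blast
  qed
  obtain N1 where N1: "(\<integral>\<^sup>+x. norm (s N1 x - g x) \<partial>M) \<le> ennreal 1"
    using bnd[of 1] by auto
  have "integrable M (\<lambda>x. s N1 x - g x)"
    by (rule integrableI_bounded) (use N1 in \<open>auto simp: le_less_trans\<close>)
  from Bochner_Integration.integrable_diff[OF int[of N1] this] have gi: "integrable M g" by simp
  have "(\<lambda>n. LINT x|M. norm (s n x - g x)) \<longlonglongrightarrow> 0"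
  proof (rule LIMSEQ_I)
    fix e :: real assume "e > 0"
    then obtain N where N: "\<And>n. n \<ge> N \<Longrightarrow> (\<integral>\<^sup>+x. norm (s n x - g x) \<partial>M) \<le> ennreal (e/2)"
      using bnd[of "e/2"] by auto
    have "norm ((LINT x|M. norm (s n x - g x)) - 0) < e" if "n \<ge> N" for n
    proof -
      have "ennreal (LINT x|M. norm (s n x - g x)) = (\<integral>\<^sup>+x. norm (s n x - g x) \<partial>M)"
        by (intro nn_integral_eq_integral[symmetric]) (auto intro!: int gi)
      also have "\<dots> \<le> ennreal (e/2)" by (rule N[OF that])
      finally have "(LINT x|M. norm (s n x - g x)) \<le> e/2"
        using \<open>e > 0\<close> by (subst (asm) ennreal_le_iff) auto
      then show ?thesis using \<open>e > 0\<close> by simp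
    qed
    then show "\<exists>no. \<forall>n\<ge>no. norm ((LINT x|M. norm (s n x - g x)) - 0) < e" by blast
  qed
  with gi show ?thesis by blast
qed

abbreviation lebesgue01 :: "real measure" where
  "lebesgue01 \<equiv> lebesgue_on {0..1}"

definition L1rel :: "(real \<Rightarrow> 'a::{banach, second_countable_topology}) \<Rightarrow> (real \<Rightarrow> 'a) \<Rightarrow> bool" where
  "L1rel f g \<longleftrightarrow> integrable lebesgue01 f \<and> integrable lebesgue01 g \<and> (AE s in lebesgue01. f s = g s)"

lemma part_equivp_L1rel: "part_equivp (L1rel :: (real \<Rightarrow> 'a::{banach, second_countable_topology}) \<Rightarrow> _)"
proof (rule part_equivpI)
  show "\<exists>f::real \<Rightarrow> 'a. L1rel f f"
    by (intro exI[of _ "\<lambda>_. 0"]) (simp add: L1rel_def)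
  show "symp (L1rel :: (real \<Rightarrow> 'a) \<Rightarrow> _)"
    by (auto simp: symp_def L1rel_def elim: AE_mp)
  show "transp (L1rel :: (real \<Rightarrow> 'a) \<Rightarrow> _)"
    unfolding transp_def L1rel_def by (auto elim: eventually_elim2)
qed

text \<open>\<^term>\<open>abs_L1unit f\<close> is the class of \<open>f\<close> in \<open>L\<^sup>1([0,1], 'a)\<close>; it is meaningful only if
  \<open>f\<close> is integrable on \<open>[0,1]\<close>.\<close>

quotient_type (overloaded) 'a L1unit = "real \<Rightarrow> 'a::{banach, second_countable_topology}"
  / partial: L1rel
  by (rule part_equivp_L1rel)

instantiation L1unit :: ("{banach, second_countable_topology}") real_normed_vector
begin

lift_definition zero_L1unit :: "'a L1unit" is "\<lambda>_. 0"
  by (simp add: L1rel_def)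

lift_definition plus_L1unit :: "'a L1unit \<Rightarrow> 'a L1unit \<Rightarrow> 'a L1unit" is "\<lambda>f g s. f s + g s"
  by (auto simp: L1rel_def elim: eventually_elim2)

lift_definition minus_L1unit :: "'a L1unit \<Rightarrow> 'a L1unit \<Rightarrow> 'a L1unit" is "\<lambda>f g s. f s - g s"
  by (auto simp: L1rel_def elim: eventually_elim2)

lift_definition uminus_L1unit :: "'a L1unit \<Rightarrow> 'a L1unit" is "\<lambda>f s. - f s"
  by (auto simp: L1rel_def)

lift_definition scaleR_L1unit :: "real \<Rightarrow> 'a L1unit \<Rightarrow> 'a L1unit" is "\<lambda>c f s. c *\<^sub>R f s"
  by (auto simp: L1rel_def elim: eventually_mono)

lift_definition norm_L1unit :: "'a L1unit \<Rightarrow> real" is "\<lambda>f. LINT s|lebesgue01. norm (f s)"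
  by (intro integral_cong_AE) (auto simp: L1rel_def elim: eventually_mono)

definition "dist_L1unit (F :: 'a L1unit) G = norm (F - G)"
definition "sgn_L1unit (F :: 'a L1unit) = inverse (norm F) *\<^sub>R F"
definition "(uniformity :: ('a L1unit \<times> 'a L1unit) filter) =
  (INF e\<in>{0<..}. principal {(F, G). dist F G < e})"
definition "open_L1unit (U :: 'a L1unit set) \<longleftrightarrow>
  (\<forall>F\<in>U. eventually (\<lambda>(F', G). F' = F \<longrightarrow> G \<in> U) uniformity)"

instance
proof
  fix F G K :: "'a L1unit" and a b :: real and U :: "'a L1unit set"
  show "F + G + K = F + (G + K)" by transfer (auto simp: L1rel_def add.assoc)
  show "F + G = G + F" by transfer (auto simp: L1rel_def add.commute)
  show "0 + F = F" by transfer (auto simp: L1rel_def)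
  show "- F + F = 0" by transfer (auto simp: L1rel_def)
  show "F - G = F + - G" by transfer (auto simp: L1rel_def)
  show "a *\<^sub>R (F + G) = a *\<^sub>R F + a *\<^sub>R G" by transfer (auto simp: L1rel_def scaleR_add_right)
  show "(a + b) *\<^sub>R F = a *\<^sub>R F + b *\<^sub>R F" by transfer (auto simp: L1rel_def scaleR_add_left)
  show "a *\<^sub>R b *\<^sub>R F = (a * b) *\<^sub>R F" by transfer (auto simp: L1rel_def)
  show "1 *\<^sub>R F = F" by transfer (auto simp: L1rel_def)
  show "dist F G = norm (F - G)" by (rule dist_L1unit_def)
  show "sgn F = inverse (norm F) *\<^sub>R F" by (rule sgn_L1unit_def)
  show "(uniformity :: ('a L1unit \<times> 'a L1unit) filter) =
      (INF e\<in>{0<..}. principal {(F, G). dist F G < e})" by (rule uniformity_L1unit_def)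
  show "open U = (\<forall>F\<in>U. \<forall>\<^sub>F (F', G) in uniformity. F' = F \<longrightarrow> G \<in> U)"
    by (rule open_L1unit_def)
  show "norm F = 0 \<longleftrightarrow> F = 0"
    by transfer (auto simp: L1rel_def integral_nonneg_eq_0_iff_AE)
  show "norm (F + G) \<le> norm F + norm G"
  proof (transfer, clarsimp simp: L1rel_def)
    fix f g :: "real \<Rightarrow> 'a"
    assume i: "integrable lebesgue01 f" "integrable lebesgue01 g"
    have "(LINT s|lebesgue01. norm (f s + g s)) \<le> (LINT s|lebesgue01. norm (f s) + norm (g s))"
      using i by (intro integral_mono) (auto intro: norm_triangle_ineq)
    also have "\<dots> = (LINT s|lebesgue01. norm (f s)) + (LINT s|lebesgue01. norm (g s))"
      using i by simp
    finally show "(LINT s|lebesgue01. norm (f s + g s))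
      \<le> (LINT s|lebesgue01. norm (f s)) + (LINT s|lebesgue01. norm (g s))" .
  qed
  show "norm (a *\<^sub>R F) = \<bar>a\<bar> * norm F" by transfer simp
qed

end

instance L1unit :: ("{banach, second_countable_topology}") banach
proof
  fix X :: "nat \<Rightarrow> 'a L1unit" assume X: "Cauchy X"
  define s where "s n = rep_L1unit (X n)" for n
  have rel: "L1rel (s n) (s n)" for n
    unfolding s_def by (rule Quotient3_rep_reflp[OF Quotient3_L1unit])
  have abs: "X n = abs_L1unit (s n)" for n
    unfolding s_def by (simp add: Quotient3_abs_rep[OF Quotient3_L1unit])
  have int: "integrable lebesgue01 (s n)" for n using rel by (simp add: L1rel_def)
  have dist: "norm (abs_L1unit f - abs_L1unit g) = (LINT x|lebesgue01. norm (f x - g x))"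
    if "integrable lebesgue01 f" "integrable lebesgue01 g" for f g :: "real \<Rightarrow> 'a"
    using that by (simp add: minus_L1unit.abs_eq norm_L1unit.abs_eq L1rel_def)
  have "\<exists>g. integrable lebesgue01 g \<and> (\<lambda>n. LINT x|lebesgue01. norm (s n x - g x)) \<longlonglongrightarrow> 0"
  proof (rule L1_complete[OF int])
    fix e :: real assume "e > 0"
    then obtain N where "\<forall>i\<ge>N. \<forall>j\<ge>N. norm (X i - X j) < e"
      using X unfolding Cauchy_def dist_norm by blast
    then show "\<exists>N. \<forall>i\<ge>N. \<forall>j\<ge>N. (LINT x|lebesgue01. norm (s i x - s j x)) < e"
      by (auto simp: abs dist int)
  qed
  then obtain g where g: "integrable lebesgue01 g"
    "(\<lambda>n. LINT x|lebesgue01. norm (s n x - g x)) \<longlonglongrightarrow> 0" by blast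
  then have "(\<lambda>n. norm (X n - abs_L1unit g)) \<longlonglongrightarrow> 0"
    by (simp add: abs dist int)
  then have "X \<longlonglongrightarrow> abs_L1unit g"
    by (simp add: LIM_zero_iff tendsto_norm_zero_iff)
  then show "convergent X" by (auto simp: convergent_def)
qed


section \<open>Function classes\<close>

text \<open>A function on a time domain \<open>T\<close> (\<open>{0..}\<close> or \<open>UNIV\<close>) is represented by a function on all
  of \<^typ>\<open>real\<close> whose values outside \<open>T\<close> are irrelevant. Elements of Lebesgue spaces are
  represented by functions, so equality of such elements is equality almost everywhere on \<open>T\<close>.\<close>

definition class_K :: "(real \<Rightarrow> real) set" where
  "class_K = {\<theta>. continuous_on {0..} \<theta> \<and> strict_mono_on {0..} \<theta> \<and> \<theta> 0 = 0}"

definition class_K_inf :: "(real \<Rightarrow> real) set" where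
  "class_K_inf = {\<theta> \<in> class_K. \<not> bounded (\<theta> ` {0..})}"

definition L1loc :: "real set \<Rightarrow> (real \<Rightarrow> 'a::{banach, second_countable_topology}) set" where
  "L1loc T = {v. \<forall>a b. {a..b} \<subseteq> T \<longrightarrow> set_integrable lebesgue {a..b} v}"

text \<open>\<open>W\<^sup>1\<^sup>,\<^sup>1\<^sub>l\<^sub>o\<^sub>c\<close> consists of the primitives of locally integrable functions; we always mean the
  continuous representative.\<close>

definition W11loc :: "real set \<Rightarrow> (real \<Rightarrow> 'a::euclidean_space) set" where
  "W11loc T = {x. \<exists>g \<in> L1loc T. \<forall>a\<in>T. \<forall>b\<in>T. a \<le> b \<longrightarrow> x b - x a = integral {a..b} g}"

definition Linf :: "real set \<Rightarrow> (real \<Rightarrow> 'a::real_normed_vector) set" where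
  "Linf T = {v. v \<in> borel_measurable (lebesgue_on T) \<and> (\<exists>M. AE t in lebesgue_on T. norm (v t) \<le> M)}"

definition Linf_loc :: "real set \<Rightarrow> (real \<Rightarrow> 'a::real_normed_vector) set" where
  "Linf_loc T = {v. \<forall>a b. {a..b} \<subseteq> T \<longrightarrow> v \<in> Linf {a..b}}"

text \<open>Only meaningful for elements of \<^term>\<open>Linf T\<close>, where the essential supremum is finite.\<close>

definition Linf_norm :: "real set \<Rightarrow> (real \<Rightarrow> 'a::real_normed_vector) \<Rightarrow> real" where
  "Linf_norm T v = real_of_ereal (esssup (lebesgue_on T) (\<lambda>t. ereal (norm (v t))))"

definition C0 :: "(real \<Rightarrow> 'a::banach) set" where
  "C0 = {v. continuous_on {0..} v \<and> (v \<longlongrightarrow> 0) at_top}"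


section \<open>Almost periodic functions\<close>

definition relatively_dense :: "real set \<Rightarrow> real set \<Rightarrow> bool" where
  "relatively_dense T S \<longleftrightarrow> S \<subseteq> T \<and> (\<exists>l>0. \<forall>a\<in>T. {a..a + l} \<inter> S \<noteq> {})"

definition bohr_periods :: "real set \<Rightarrow> (real \<Rightarrow> 'a::banach) \<Rightarrow> real \<Rightarrow> real set" where
  "bohr_periods T v \<epsilon> = {\<tau> \<in> T. \<forall>t\<in>T. norm (v t - v (t + \<tau>)) \<le> \<epsilon>}"

definition AP :: "real set \<Rightarrow> (real \<Rightarrow> 'a::banach) set" where
  "AP T = {v. continuous_on T v \<and> (\<forall>\<epsilon>>0. relatively_dense T (bohr_periods T v \<epsilon>))}"

text \<open>The bound for all \<open>a\<close> says that the supremum over \<open>a\<close> (possibly infinite) is at most \<open>\<epsilon>\<close>.\<close>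

definition stepanov_periods ::
    "real set \<Rightarrow> (real \<Rightarrow> 'a::{banach, second_countable_topology}) \<Rightarrow> real \<Rightarrow> real set" where
  "stepanov_periods T v \<epsilon> =
    {\<tau> \<in> T. \<forall>a\<in>T. integral {a..a + 1} (\<lambda>s. norm (v (s + \<tau>) - v s)) \<le> \<epsilon>}"

definition S1 :: "real set \<Rightarrow> (real \<Rightarrow> 'a::{banach, second_countable_topology}) set" where
  "S1 T = {v \<in> L1loc T. \<forall>\<epsilon>>0. relatively_dense T (stepanov_periods T v \<epsilon>)}"

definition AAP :: "(real \<Rightarrow> 'a::banach) set" where
  "AAP = {v. \<exists>u\<in>AP {0..}. \<exists>c\<in>C0. \<forall>t\<ge>0. v t = u t + c t}"

text \<open>The almost periodic part is unique as a function on \<open>{0..}\<close>; the choice below only fixes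
  irrelevant values at negative times.\<close>

definition ap_part :: "(real \<Rightarrow> 'a::banach) \<Rightarrow> real \<Rightarrow> 'a" where
  "ap_part v = (SOME u. u \<in> AP {0..} \<and> (\<lambda>t. v t - u t) \<in> C0)"

definition ap_ext :: "(real \<Rightarrow> 'a::banach) \<Rightarrow> real \<Rightarrow> 'a" where
  "ap_ext v = (THE u. u \<in> AP UNIV \<and> (\<forall>t\<ge>0. u t = v t))"

text \<open>The Stepanov extension is unique up to null sets; the choice below picks a representative.\<close>

definition s1_ext :: "(real \<Rightarrow> 'a::{banach, second_countable_topology}) \<Rightarrow> real \<Rightarrow> 'a" where
  "s1_ext v = (SOME u. u \<in> S1 UNIV \<and> (AE t in lebesgue_on {0..}. u t = v t))"

definition bochner_transform ::
    "(real \<Rightarrow> 'a::{banach, second_countable_topology}) \<Rightarrow> real \<Rightarrow> 'a L1unit" where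
  "bochner_transform v t = abs_L1unit (\<lambda>s. v (t + s))"


section \<open>Generalized Fourier coefficients and the module of a function\<close>

text \<open>The complexification of a real Banach space \<open>'a\<close> is \<open>'a \<times> 'a\<close>, where \<open>(x, y)\<close> stands for
  \<open>x + i y\<close>; this is complex scalar multiplication on it.\<close>

definition cscale :: "complex \<Rightarrow> 'a::real_vector \<times> 'a \<Rightarrow> 'a \<times> 'a" where
  "cscale c p = (Re c *\<^sub>R fst p - Im c *\<^sub>R snd p, Re c *\<^sub>R snd p + Im c *\<^sub>R fst p)"

definition fourier_coeff :: "(real \<Rightarrow> 'a::banach) \<Rightarrow> real \<Rightarrow> 'a \<times> 'a" where
  "fourier_coeff v \<omega> = Lim at_top (\<lambda>T::real.
     (1 / (2 * T)) *\<^sub>R integral {-T..T} (\<lambda>t. cscale (exp (- \<i> * of_real \<omega> * of_real t)) (v t, 0)))"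

definition freq_spectrum :: "(real \<Rightarrow> 'a::banach) \<Rightarrow> real set" where
  "freq_spectrum v = {\<omega>. fourier_coeff v \<omega> \<noteq> 0}"

definition freq_module :: "(real \<Rightarrow> 'a::banach) \<Rightarrow> real set" where
  "freq_module v = {\<Sum>\<omega> | \<omega> \<in> freq_spectrum v \<and> m \<omega> \<noteq> 0. of_int (m \<omega>) * \<omega> | m :: real \<Rightarrow> int.
     finite {\<omega> \<in> freq_spectrum v. m \<omega> \<noteq> 0}}"


section \<open>Matrices and the forced Lur'e equation\<close>

definition pos_semidef :: "real^'k^'k \<Rightarrow> bool" where
  "pos_semidef M \<longleftrightarrow> transpose M = M \<and> (\<forall>x. x \<bullet> (M *v x) \<ge> 0)"

definition neg_semidef :: "real^'k^'k \<Rightarrow> bool" where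
  "neg_semidef M \<longleftrightarrow> transpose M = M \<and> (\<forall>x. x \<bullet> (M *v x) \<le> 0)"

definition block_matrix :: "real^'n^'n \<Rightarrow> real^'m^'n \<Rightarrow> real^'n^'m \<Rightarrow> real^'m^'m
    \<Rightarrow> real^('n + 'm)^('n + 'm)" where
  "block_matrix M11 M12 M21 M22 = (\<chi> i j.
     case i of
       Inl a \<Rightarrow> (case j of Inl b \<Rightarrow> M11 $ a $ b | Inr b \<Rightarrow> M12 $ a $ b)
     | Inr a \<Rightarrow> (case j of Inl b \<Rightarrow> M21 $ a $ b | Inr b \<Rightarrow> M22 $ a $ b))"

definition hurwitz :: "real^'n^'n \<Rightarrow> bool" where
  "hurwitz M \<longleftrightarrow> (\<forall>(\<mu>::complex) (u::complex^'n).
     u \<noteq> 0 \<and> map_matrix complex_of_real M *v u = \<mu> *s u \<longrightarrow> Re \<mu> < 0)"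

definition detectable :: "real^'n^'m \<Rightarrow> real^'n^'n \<Rightarrow> bool" where
  "detectable C A \<longleftrightarrow> (\<exists>H :: real^'m^'n. hurwitz (A - H ** C))"

text \<open>The equation is imposed on the pointwise derivative, which exists and agrees with the weak
  derivative almost everywhere for \<open>x\<close> in \<^term>\<open>W11loc T\<close>.\<close>

definition behaviour :: "real set \<Rightarrow> real^'n^'n \<Rightarrow> real^'m^'n \<Rightarrow> real^'n^'m
    \<Rightarrow> (real^'m \<Rightarrow> real^'m) \<Rightarrow> ((real \<Rightarrow> real^'m) \<times> (real \<Rightarrow> real^'n)) set" where
  "behaviour T A B C f = {(v, x). v \<in> L1loc T \<and> x \<in> W11loc T \<and>
     (AE t in lebesgue_on T. (x has_vector_derivative
        (A *v x t - B *v f (C *v x t) + B *v v t)) (at t within T))}"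

definition behaviour_inf :: "real^'n^'n \<Rightarrow> real^'m^'n \<Rightarrow> real^'n^'m
    \<Rightarrow> (real^'m \<Rightarrow> real^'m) \<Rightarrow> ((real \<Rightarrow> real^'m) \<times> (real \<Rightarrow> real^'n)) set" where
  "behaviour_inf A B C f = {(v, x) \<in> behaviour {0..} A B C f. v \<in> Linf_loc {0..}}"

end

theory Submission
  imports Defs "HOL-Computational_Algebra.Fundamental_Theorem_Algebra"
begin

text \<open>
  The difference \<open>e\<close> of two solutions satisfies a passivity inequality for \<open>V e = \<langle>e, P e\<rangle>\<close>, where the
  sector condition on \<open>f\<close> provides dissipation, and an input-to-state inequality for a norm \<open>N\<close> that
  is contracted by the output injection \<open>A - H C\<close>. Adding a large multiple of \<open>V\<close> to \<open>N\<close> shows that \<open>e\<close>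
  eventually becomes small, uniformly in the solutions, when the difference of the inputs is small in
  the Stepanov sense. Comparing a bounded solution with its own translates, every Stepanov almost
  period of \<open>w\<close> is asymptotically an almost period of the solution, and limits of translates along
  almost periods tending to infinity give the almost periodic response on the whole line. The
  convergence, uniqueness and gain statements follow from the same estimate. For the frequency
  modules, a frequency \<open>\<omega>\<close> outside the module of \<open>w\<close> admits almost periods \<open>\<tau>\<close> of \<open>w\<close>, hence of the
  response, with \<open>\<omega> \<tau>\<close> far from \<open>2 \<pi> \<int>\<close>, by an approximation argument of Kronecker type; this
  kills the coefficient at \<open>\<omega>\<close>.
\<close>

section \<open>Almost periodic functions\<close>

text \<open>\<open>V\<close> is only semidefinite: through \<open>P_B\<close> it bounds the output
  difference, not the state. \<open>N\<close> bounds the state but is driven by the output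
  difference and by the difference of the nonlinearities. The growth condition joins them: for
  reference outputs in a compact set, \<open>norm y + norm (f (y + z) - f z)\<close> is at most a
  prescribed small number plus a constant times \<open>y \<bullet> (f (y + z) - f z)\<close>, so the
  drive of \<open>N\<close> is paid for by the dissipation of \<open>V\<close>. Since the inputs are
  close only in the mean over unit intervals, no pointwise decay is available and all estimates
  concern increments over intervals. The remaining obstacle is the cross term of output and input
  differences in the increment of \<open>V\<close>: dissipation dominates it for large outputs if
  the input difference is essentially bounded; for an integrable one the output difference is
  bounded first. The module inclusion needs uniqueness of Fourier series. It is proved by sampling:
  vanishing coefficients make the discrete transform of the samples small, which contradicts the
  many large autocorrelations that almost periods produce. Functions with values in
  \<open>L1unit\<close> are reduced to real ones by separating functionals.\<close>

definition time_domain :: "real set \<Rightarrow> bool" where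
  "time_domain T \<longleftrightarrow> T = {0..} \<or> T = UNIV"

lemma time_domain_intros [simp]: "time_domain {0..}" "time_domain UNIV"
  by (auto simp: time_domain_def)

lemma time_domain_add: "time_domain T \<Longrightarrow> t \<in> T \<Longrightarrow> 0 \<le> s \<Longrightarrow> t + s \<in> T"
  by (auto simp: time_domain_def)

lemma time_domain_nonneg: "time_domain T \<Longrightarrow> 0 \<le> t \<Longrightarrow> t \<in> T"
  by (auto simp: time_domain_def)

lemma AP_continuous: "v \<in> AP T \<Longrightarrow> continuous_on T v"
  by (simp add: AP_def)

lemma bohr_periodsD: "\<tau> \<in> bohr_periods T v e \<Longrightarrow> t \<in> T \<Longrightarrow> norm (v t - v (t + \<tau>)) \<le> e"
  by (simp add: bohr_periods_def)

lemma AP_large_period: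
  assumes "v \<in> AP T" "time_domain T" "e > 0"
  obtains \<tau> where "\<tau> \<in> bohr_periods T v e" "\<tau> \<ge> c" "\<tau> \<ge> 0"
proof -
  have "relatively_dense T (bohr_periods T v e)" using assms by (simp add: AP_def)
  moreover have "max c 0 \<in> T" using assms(2) by (auto intro: time_domain_nonneg)
  ultimately obtain l where "{max c 0..max c 0 + l} \<inter> bohr_periods T v e \<noteq> {}"
    unfolding relatively_dense_def by blast
  then show thesis using that by auto
qed

text \<open>Moving both points by one large almost period changes the two values little, so an
  inequality that holds far to the right holds everywhere. This is how eventual bounds are pulled
  back.\<close>

lemma AP_norm_diff_le:
  assumes v: "v \<in> AP T" and T: "time_domain T" and t: "t \<in> T" and s: "s \<in> T"
    and le: "\<And>\<sigma>. \<sigma> \<ge> c \<Longrightarrow> \<sigma> \<ge> 0 \<Longrightarrow> norm (v (t + \<sigma>) - v (s + \<sigma>)) \<le> e"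
  shows "norm (v t - v s) \<le> e"
proof (rule field_le_epsilon)
  fix h :: real assume "h > 0"
  then obtain \<sigma> where \<sigma>: "\<sigma> \<in> bohr_periods T v (h/2)" "\<sigma> \<ge> c" "\<sigma> \<ge> 0"
    using AP_large_period[OF v T, of "h/2"] by (metis half_gt_zero)
  have "norm (v t - v (t + \<sigma>)) \<le> h/2" "norm (v s - v (s + \<sigma>)) \<le> h/2"
    using \<sigma> t s by (auto simp: bohr_periods_def)
  moreover have "norm (v (t + \<sigma>) - v (s + \<sigma>)) \<le> e" by (rule le[OF \<sigma>(2,3)])
  ultimately show "norm (v t - v s) \<le> e + h"
    by norm
qed

text \<open>On the half-line \<open>t - \<tau>1\<close> may leave the domain. The comparison is
  therefore made at \<open>t + \<sigma>\<close> with \<open>\<sigma> \<ge> \<tau>1\<close>, through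
  the common point \<open>t + \<sigma> - \<tau>1\<close>, and then pulled back.\<close>

lemma bohr_periods_diff:
  assumes v: "v \<in> AP T" and T: "time_domain T"
    and \<tau>: "\<tau>1 \<in> bohr_periods T v e1" "\<tau>2 \<in> bohr_periods T v e2" "\<tau>1 \<le> \<tau>2"
  shows "\<tau>2 - \<tau>1 \<in> bohr_periods T v (e1 + e2)"
  unfolding bohr_periods_def
proof safe
  show "\<tau>2 - \<tau>1 \<in> T" using T \<tau>(3) by (auto intro: time_domain_nonneg)
  fix t assume t: "t \<in> T"
  show "norm (v t - v (t + (\<tau>2 - \<tau>1))) \<le> e1 + e2"
  proof (rule AP_norm_diff_le[OF v T t time_domain_add[OF T t], of _ "\<tau>1"])
    fix \<sigma> assume "\<tau>1 \<le> \<sigma>" "0 \<le> \<sigma>"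
    then have "t + (\<sigma> - \<tau>1) \<in> T" using T t by (intro time_domain_add) auto
    then have "norm (v (t + (\<sigma> - \<tau>1)) - v (t + (\<sigma> - \<tau>1) + \<tau>1)) \<le> e1"
       "norm (v (t + (\<sigma> - \<tau>1)) - v (t + (\<sigma> - \<tau>1) + \<tau>2)) \<le> e2"
      using \<tau> by (auto simp: bohr_periods_def)
    moreover have eq: "t + (\<sigma> - \<tau>1) + \<tau>1 = t + \<sigma>" "t + (\<sigma> - \<tau>1) + \<tau>2 = t + (\<tau>2 - \<tau>1) + \<sigma>" by auto
    ultimately have "norm (v (t + (\<sigma> - \<tau>1)) - v (t + \<sigma>)) \<le> e1"
       "norm (v (t + (\<sigma> - \<tau>1)) - v (t + (\<tau>2 - \<tau>1) + \<sigma>)) \<le> e2" by (simp_all only: eq)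
    then show "norm (v (t + \<sigma>) - v (t + (\<tau>2 - \<tau>1) + \<sigma>)) \<le> e1 + e2"
      by norm
  qed (use \<tau>(3) in auto)
qed

text \<open>A large almost period of \<open>u1\<close> is one of \<open>u2\<close> too, up to the
  error of the limit. Both functions at \<open>t\<close> can thus be compared with their values at a
  far point, where they nearly agree.\<close>

lemma AP_eqI_tendsto:
  assumes u: "u1 \<in> AP T" "u2 \<in> AP T" and T: "time_domain T"
    and lim: "((\<lambda>t. u1 t - u2 t) \<longlongrightarrow> 0) at_top" and t: "t \<in> T"
  shows "u1 t = u2 t"
proof -
  have "norm (u1 t - u2 t) \<le> 0"
  proof (rule field_le_epsilon)
    fix e :: real assume "e > 0"
    define \<eta> where "\<eta> = e/5"
    have "\<eta> > 0" using \<open>e > 0\<close> by (simp add: \<eta>_def)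
    obtain c where c: "\<And>s. s \<ge> c \<Longrightarrow> norm (u1 s - u2 s) \<le> \<eta>"
      using tendstoD[OF lim \<open>\<eta> > 0\<close>] by (auto simp: eventually_at_top_linorder dist_norm intro: less_imp_le)
    obtain \<tau> where \<tau>: "\<tau> \<in> bohr_periods T u1 \<eta>" "\<tau> \<ge> c - t" "\<tau> \<ge> 0"
      using AP_large_period[OF u(1) T \<open>\<eta> > 0\<close>] by blast
    have t\<tau>: "t + \<tau> \<in> T" using T t \<tau> by (intro time_domain_add)
    have "norm (u2 t - u2 (t + \<tau>)) \<le> 3 * \<eta>"
    proof (rule AP_norm_diff_le[OF u(2) T t t\<tau>, of "c - t"])
      fix \<sigma> assume \<sigma>: "\<sigma> \<ge> c - t" "\<sigma> \<ge> 0"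
      have "norm (u1 (t + \<sigma>) - u1 (t + \<tau> + \<sigma>)) \<le> \<eta>"
        using \<tau>(1) time_domain_add[OF T t \<sigma>(2)] by (auto simp: bohr_periods_def algebra_simps)
      moreover have "norm (u1 (t + \<sigma>) - u2 (t + \<sigma>)) \<le> \<eta>" using \<sigma> by (intro c) auto
      moreover have "norm (u1 (t + \<tau> + \<sigma>) - u2 (t + \<tau> + \<sigma>)) \<le> \<eta>" using \<sigma> \<tau> by (intro c) auto
      ultimately show "norm (u2 (t + \<sigma>) - u2 (t + \<tau> + \<sigma>)) \<le> 3 * \<eta>"
        by norm
    qed
    moreover have "norm (u1 t - u1 (t + \<tau>)) \<le> \<eta>" using \<tau>(1) t by (auto simp: bohr_periods_def)
    moreover have "norm (u1 (t + \<tau>) - u2 (t + \<tau>)) \<le> \<eta>" using \<tau> by (intro c) auto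
    ultimately have "norm (u1 t - u2 t) \<le> 5 * \<eta>" by norm
    then show "norm (u1 t - u2 t) \<le> 0 + e" by (simp add: \<eta>_def)
  qed
  then show ?thesis by simp
qed

lemma AP_eqI_half_line:
  assumes "u1 \<in> AP UNIV" "u2 \<in> AP UNIV" "\<And>t. t \<ge> 0 \<Longrightarrow> u1 t = u2 t"
  shows "u1 = u2"
proof
  fix t
  have "((\<lambda>t. u1 t - u2 t) \<longlongrightarrow> 0) at_top"
    by (rule tendsto_eventually) (use assms(3) in \<open>auto simp: eventually_at_top_linorder\<close>)
  then show "u1 t = u2 t" using assms by (intro AP_eqI_tendsto[of u1 UNIV]) auto
qed

lemma bohr_periods_half_line_imp:
  assumes v: "v \<in> AP UNIV" and \<tau>: "\<And>t. t \<ge> c \<Longrightarrow> norm (v t - v (t + \<tau>)) \<le> e"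
  shows "\<tau> \<in> bohr_periods UNIV v e"
  unfolding bohr_periods_def
proof safe
  fix t
  show "norm (v t - v (t + \<tau>)) \<le> e"
  proof (rule AP_norm_diff_le[OF v, where c = "c - t"])
    fix \<sigma> assume "\<sigma> \<ge> c - t"
    then have "norm (v (t + \<sigma>) - v (t + \<sigma> + \<tau>)) \<le> e" by (intro \<tau>) simp
    then show "norm (v (t + \<sigma>) - v (t + \<tau> + \<sigma>)) \<le> e" by (simp add: algebra_simps)
  qed auto
qed simp

lemma bohr_periods_uminus: "\<tau> \<in> bohr_periods UNIV v e \<Longrightarrow> - \<tau> \<in> bohr_periods UNIV v e"
proof -
  assume \<tau>: "\<tau> \<in> bohr_periods UNIV v e"
  have "norm (v t - v (t + - \<tau>)) \<le> e" for t
  proof -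
    show ?thesis using bohr_periodsD[OF \<tau>, of "t - \<tau>"] by (simp add: norm_minus_commute)
  qed
  then show ?thesis by (simp add: bohr_periods_def)
qed

text \<open>An interval of length \<open>l\<close> lies to the right of the origin, contains it, or
  is mirrored to the right; membership of \<open>0\<close> serves the middle case.\<close>

lemma relatively_dense_reflect:
  assumes dense: "relatively_dense {0..} S" and sub: "S \<subseteq> S'" "uminus ` S \<subseteq> S'" and "0 \<in> S'"
  shows "relatively_dense UNIV S'"
proof -
  obtain l where l: "l > 0" "\<And>a. a \<ge> 0 \<Longrightarrow> {a..a + l} \<inter> S \<noteq> {}"
    using dense unfolding relatively_dense_def by auto
  have "{a..a + l} \<inter> S' \<noteq> {}" for a
  proof -
    consider "a \<ge> 0" | "- l \<le> a" "a < 0" | "a < - l" by linarith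
    then show ?thesis
    proof cases
      case 1 then show ?thesis using l(2)[of a] sub(1) by blast
    next
      case 2
      then have "0 \<in> {a..a + l}" by auto
      then show ?thesis using \<open>0 \<in> S'\<close> by blast
    next
      case 3
      then have "{- a - l..- a - l + l} \<inter> S \<noteq> {}" by (intro l(2)) simp
      then obtain x where "x \<in> {- a - l..- a - l + l}" "x \<in> S" by blast
      then have "- x \<in> {a..a + l}" "- x \<in> S'" using sub(2) by auto
      then show ?thesis by blast
    qed
  qed
  then show ?thesis using l(1) unfolding relatively_dense_def by blast
qed

lemma zero_bohr_period: "time_domain T \<Longrightarrow> e \<ge> 0 \<Longrightarrow> 0 \<in> bohr_periods T v e"
  by (auto simp: bohr_periods_def time_domain_nonneg)

lemma AP_restrict:
  assumes v: "v \<in> AP UNIV" shows "v \<in> AP {0..}"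
  unfolding AP_def
proof safe
  show "continuous_on {0..} v" using AP_continuous[OF v] continuous_on_subset by blast
  fix e :: real assume "e > 0"
  then obtain l where "l > 0" "\<And>a. {a..a + l} \<inter> bohr_periods UNIV v e \<noteq> {}"
    using v unfolding AP_def relatively_dense_def by blast
  moreover have "{a..a + l} \<inter> bohr_periods UNIV v e \<subseteq> {a..a + l} \<inter> bohr_periods {0..} v e" if "a \<ge> 0" for a
    using that by (auto simp: bohr_periods_def)
  ultimately have "\<exists>l>0. \<forall>a\<in>{0..}. {a..a + l} \<inter> bohr_periods {0..} v e \<noteq> {}"
    by (metis atLeast_iff subset_empty)
  then show "relatively_dense {0..} (bohr_periods {0..} v e)"
    unfolding relatively_dense_def by (simp add: bohr_periods_def Collect_mono_iff subset_eq)
qed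

section \<open>Extension from the half-line to the line\<close>

text \<open>The limit only sees \<open>v\<close> near infinity, so almost periods of
  \<open>v\<close> are needed only from some time on. This covers both the extension of an almost
  periodic function and the response, whose approximating solution is almost periodic only
  asymptotically.\<close>

lemma AP_line_limit:
  fixes v u :: "real \<Rightarrow> 'a::banach"
  assumes cont: "continuous_on {0..} v" and \<tau>: "filterlim \<tau> at_top sequentially"
    and unif: "\<And>c. uniform_limit {c..} (\<lambda>k t. v (t + \<tau> k)) u sequentially"
    and per: "\<And>e. e > 0 \<Longrightarrow> \<exists>S. relatively_dense {0..} S \<and>
      (\<forall>\<sigma>\<in>S. \<exists>c. \<forall>t\<ge>c. norm (v t - v (t + \<sigma>)) \<le> e)"
  shows "u \<in> AP UNIV"
    and "(\<forall>t\<ge>c. norm (v t - v (t + \<sigma>)) \<le> e) \<Longrightarrow> \<sigma> \<in> bohr_periods UNIV u e"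
proof -
  have lim: "(\<lambda>k. v (t + \<tau> k)) \<longlonglongrightarrow> u t" for t
    by (rule tendsto_uniform_limitI[OF unif[of t]]) simp
  show P: "\<sigma> \<in> bohr_periods UNIV u e" if "\<forall>t\<ge>c. norm (v t - v (t + \<sigma>)) \<le> e" for c \<sigma> e
    unfolding bohr_periods_def
  proof safe
    fix t
    have "(\<lambda>k. norm (v (t + \<tau> k) - v (t + \<sigma> + \<tau> k))) \<longlonglongrightarrow> norm (u t - u (t + \<sigma>))"
      by (intro tendsto_intros lim)
    moreover have "eventually (\<lambda>k. \<tau> k \<ge> c - t) sequentially"
      using \<tau> by (simp add: filterlim_at_top)
    then have "eventually (\<lambda>k. norm (v (t + \<tau> k) - v (t + \<sigma> + \<tau> k)) \<le> e) sequentially"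
    proof eventually_elim
      case (elim k)
      then have "norm (v (t + \<tau> k) - v (t + \<tau> k + \<sigma>)) \<le> e" using that by auto
      then show ?case by (simp add: algebra_simps)
    qed
    ultimately show "norm (u t - u (t + \<sigma>)) \<le> e"
      by (rule tendsto_upperbound) simp
  qed simp
  show "u \<in> AP UNIV"
    unfolding AP_def
  proof safe
    have "isCont u t" for t
    proof -
      have "continuous_on {t - 1..} u"
      proof (rule uniform_limit_theorem[OF _ unif])
        have "eventually (\<lambda>k. \<tau> k \<ge> 1 - t) sequentially"
          using \<tau> by (simp add: filterlim_at_top)
        then show "eventually (\<lambda>k. continuous_on {t - 1..} (\<lambda>t. v (t + \<tau> k))) sequentially"
          by eventually_elim (auto intro!: continuous_on_compose2[OF cont] continuous_intros)
      qed simp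
      then have "continuous_on {t - 1<..} u" by (rule continuous_on_subset) auto
      then show ?thesis by (simp add: continuous_on_eq_continuous_at)
    qed
    then show "continuous_on UNIV u" by (simp add: continuous_at_imp_continuous_on)
    fix e :: real assume "e > 0"
    then obtain S where S: "relatively_dense {0..} S"
      "\<And>\<sigma>. \<sigma> \<in> S \<Longrightarrow> \<exists>c. \<forall>t\<ge>c. norm (v t - v (t + \<sigma>)) \<le> e" using per by blast
    show "relatively_dense UNIV (bohr_periods UNIV u e)"
    proof (rule relatively_dense_reflect[OF S(1)])
      show *: "S \<subseteq> bohr_periods UNIV u e" using S(2) P by blast
      show "uminus ` S \<subseteq> bohr_periods UNIV u e" using bohr_periods_uminus * by blast
      show "0 \<in> bohr_periods UNIV u e" using \<open>e > 0\<close> by (intro zero_bohr_period) auto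
    qed
  qed
qed

lemma uniform_limit_of_Cauchy:
  fixes v :: "real \<Rightarrow> 'a::banach"
  assumes "\<And>c e. e > 0 \<Longrightarrow> \<exists>N. \<forall>j\<ge>N. \<forall>k\<ge>N. \<forall>t\<ge>c. norm (v (t + \<tau> j) - v (t + \<tau> k)) < e"
  obtains u where "\<And>c. uniform_limit {c..} (\<lambda>k t. v (t + \<tau> k)) u sequentially"
proof -
  define u where "u t = lim (\<lambda>k. v (t + \<tau> k))" for t
  have "uniformly_Cauchy_on {c..} (\<lambda>k t. v (t + \<tau> k))" for c
    unfolding uniformly_Cauchy_on_def dist_norm using assms[of _ c] by (metis atLeast_iff)
  then have "uniformly_convergent_on {c..} (\<lambda>k t. v (t + \<tau> k))" for c
    by (rule Cauchy_uniformly_convergent)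
  then have "uniform_limit {c..} (\<lambda>k t. v (t + \<tau> k)) u sequentially" for c
    unfolding u_def using uniformly_convergent_uniform_limit_iff by blast
  then show thesis using that by blast
qed

text \<open>Translates along ever better almost periods tending to infinity are uniformly Cauchy on
  every \<open>{c..}\<close>: for \<open>t \<ge> 0\<close> both \<open>v (t + \<tau> j)\<close> and
  \<open>v (t + \<tau> k)\<close> are close to \<open>v t\<close>, and negative \<open>t\<close> are
  reduced to this by a shift of at least \<open>- t\<close>.\<close>

lemma AP_extension:
  fixes v :: "real \<Rightarrow> 'a::banach"
  assumes v: "v \<in> AP {0..}"
  obtains u where "u \<in> AP UNIV" "\<And>t. t \<ge> 0 \<Longrightarrow> u t = v t"
    "\<And>r. bohr_periods {0..} v r \<subseteq> bohr_periods UNIV u r"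
proof -
  have "\<exists>\<tau>. \<tau> \<in> bohr_periods {0..} v (inverse (Suc k)) \<and> \<tau> \<ge> real k" for k
    using AP_large_period[OF v, of "inverse (Suc k)" "real k"] by auto
  then obtain \<tau> where \<tau>: "\<And>k. \<tau> k \<in> bohr_periods {0..} v (inverse (Suc k))" "\<And>k. \<tau> k \<ge> real k"
    by metis
  have near: "norm (v t - v (t + \<tau> k)) \<le> inverse (Suc k)" if "t \<ge> 0" for t k
    using \<tau>(1)[of k] that by (simp add: bohr_periods_def)
  have \<tau>lim: "filterlim \<tau> at_top sequentially"
    by (rule filterlim_at_top_mono[OF filterlim_real_sequentially]) (simp add: \<tau>(2))
  have inv0: "\<exists>N. \<forall>k\<ge>N. inverse (Suc k) < e" if "e > 0" for e :: real
    using LIMSEQ_inverse_real_of_nat that by (simp add: LIMSEQ_iff)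
  have Cau: "\<exists>N. \<forall>j\<ge>N. \<forall>k\<ge>N. \<forall>t\<ge>c. norm (v (t + \<tau> j) - v (t + \<tau> k)) < e" if "e > 0" for c e
  proof -
    obtain N where N: "\<And>k. k \<ge> N \<Longrightarrow> inverse (Suc k) < e/2" using inv0[of "e/2"] \<open>e > 0\<close> by auto
    obtain N' :: nat where N': "real N' \<ge> - c" using real_arch_simple by blast
    have "norm (v (t + \<tau> j) - v (t + \<tau> k)) < e" if "j \<ge> max N N'" "k \<ge> max N N'" "t \<ge> c" for j k t
    proof -
      have nn: "real N' \<le> real j" "real N' \<le> real k" using that by auto
      have "t + \<tau> j \<ge> 0" using nn(1) that(3) N' \<tau>(2)[of j] by linarith
      moreover have "t + \<tau> k \<ge> 0" using nn(2) that(3) N' \<tau>(2)[of k] by linarith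
      ultimately have "norm (v (t + \<tau> j) - v (t + \<tau> k)) \<le> inverse (Suc j) + inverse (Suc k)"
      proof (rule_tac AP_norm_diff_le[OF v time_domain_intros(1), where c = "- t"])
        fix \<sigma> assume \<sigma>: "- t \<le> \<sigma>"
        then have "norm (v (t + \<sigma>) - v (t + \<sigma> + \<tau> j)) \<le> inverse (Suc j)"
           "norm (v (t + \<sigma>) - v (t + \<sigma> + \<tau> k)) \<le> inverse (Suc k)" by (intro near, simp)+
        then have "norm (v (t + \<sigma>) - v (t + \<tau> j + \<sigma>)) \<le> inverse (Suc j)"
           "norm (v (t + \<sigma>) - v (t + \<tau> k + \<sigma>)) \<le> inverse (Suc k)" by (simp_all only: ac_simps)
        then show "norm (v (t + \<tau> j + \<sigma>) - v (t + \<tau> k + \<sigma>)) \<le> inverse (Suc j) + inverse (Suc k)" by norm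
      qed auto
      then show ?thesis using N[of j] N[of k] that by auto
    qed
    then show ?thesis by blast
  qed
  obtain u where u: "\<And>c. uniform_limit {c..} (\<lambda>k t. v (t + \<tau> k)) u sequentially"
    using uniform_limit_of_Cauchy[OF Cau] by blast
  have per: "\<exists>S. relatively_dense {0..} S \<and> (\<forall>\<sigma>\<in>S. \<exists>c. \<forall>t\<ge>c. norm (v t - v (t + \<sigma>)) \<le> r)"
    if "r > 0" for r
  proof (intro exI conjI ballI)
    show "relatively_dense {0..} (bohr_periods {0..} v r)" using v that by (simp add: AP_def)
    show "\<forall>t\<ge>0. norm (v t - v (t + \<sigma>)) \<le> r" if "\<sigma> \<in> bohr_periods {0..} v r" for \<sigma>
      using that by (simp add: bohr_periods_def)
  qed
  show thesis
  proof
    show "u \<in> AP UNIV"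
      by (rule AP_line_limit(1)[OF AP_continuous[OF v] \<tau>lim u per])
    show "bohr_periods {0..} v r \<subseteq> bohr_periods UNIV u r" for r
    proof
      fix \<sigma> assume "\<sigma> \<in> bohr_periods {0..} v r"
      then have "\<forall>t\<ge>0. norm (v t - v (t + \<sigma>)) \<le> r" by (simp add: bohr_periods_def)
      then show "\<sigma> \<in> bohr_periods UNIV u r"
        using AP_line_limit(2)[OF AP_continuous[OF v] \<tau>lim u per] by blast
    qed
    show "u t = v t" if "t \<ge> 0" for t
    proof (rule LIMSEQ_unique)
      show "(\<lambda>k. v (t + \<tau> k)) \<longlonglongrightarrow> u t" by (rule tendsto_uniform_limitI[OF u[of t]]) simp
      have "(\<lambda>k. v t - v (t + \<tau> k)) \<longlonglongrightarrow> 0"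
        by (rule Lim_null_comparison[OF _ LIMSEQ_inverse_real_of_nat]) (use near[OF that] in auto)
      then show "(\<lambda>k. v (t + \<tau> k)) \<longlonglongrightarrow> v t"
        using tendsto_diff[OF tendsto_const[of "v t"], of _ 0] by fastforce
    qed
  qed
qed

lemma ap_ext_eqI:
  assumes "u \<in> AP UNIV" "\<And>t. t \<ge> 0 \<Longrightarrow> u t = v t"
  shows "ap_ext v = u"
  unfolding ap_ext_def
  by (rule the_equality) (use assms AP_eqI_half_line in force)+

section \<open>Boundedness, uniform continuity and operations on almost periodic functions\<close>

text \<open>Up to \<open>e\<close>, all values of \<open>u\<close> already occur on one compact
  interval; compactness arguments there carry over to the whole line.\<close>

lemma AP_shift_to_compact:
  assumes u: "u \<in> AP UNIV" and "e > 0"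
  obtains l where "l > 0" "\<And>t. \<exists>s\<in>{0..l}. t - s \<in> bohr_periods UNIV u e"
proof -
  obtain l where l: "l > 0" "\<And>a. {a..a + l} \<inter> bohr_periods UNIV u e \<noteq> {}"
    using u \<open>e > 0\<close> unfolding AP_def relatively_dense_def by blast
  have "\<exists>s\<in>{0..l}. t - s \<in> bohr_periods UNIV u e" for t
  proof -
    obtain \<tau> where "\<tau> \<in> {t - l..t - l + l}" "\<tau> \<in> bohr_periods UNIV u e" using l(2)[of "t - l"] by blast
    then show ?thesis by (intro bexI[of _ "t - \<tau>"]) auto
  qed
  then show thesis using that l(1) by blast
qed

lemma AP_bounded:
  assumes u: "u \<in> AP UNIV"
  obtains M where "M > 0" "\<And>t. norm (u t) \<le> M"
proof -
  obtain l where l: "l > 0" "\<And>t. \<exists>s\<in>{0..l}. t - s \<in> bohr_periods UNIV u 1"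
    using AP_shift_to_compact[OF u, of 1] by auto
  have "bounded (u ` {0..l})"
    by (intro compact_imp_bounded compact_continuous_image continuous_on_subset[OF AP_continuous[OF u]]) auto
  then obtain M where M: "\<And>s. s \<in> {0..l} \<Longrightarrow> norm (u s) \<le> M" unfolding bounded_iff by blast
  have "norm (u t) \<le> \<bar>M\<bar> + 1" for t
  proof -
    obtain s where s: "s \<in> {0..l}" "t - s \<in> bohr_periods UNIV u 1" using l(2) by blast
    have "norm (u s - u t) \<le> 1" using bohr_periodsD[OF s(2), of s] by simp
    then show ?thesis using M[OF s(1)] by norm
  qed
  then show thesis using that[of "\<bar>M\<bar> + 1"] by auto
qed

lemma AP_uniformly_continuous:
  assumes u: "u \<in> AP UNIV" and "e > 0"
  obtains d where "d > 0" "\<And>s t. \<bar>s - t\<bar> < d \<Longrightarrow> norm (u s - u t) < e"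
proof -
  obtain l where l: "l > 0" "\<And>t. \<exists>s\<in>{0..l}. t - s \<in> bohr_periods UNIV u (e/3)"
    using AP_shift_to_compact[OF u, of "e/3"] \<open>e > 0\<close> by auto
  \<comment> \<open>The margin 1 on both sides keeps \<open>s - t + s'\<close> in the interval,
    since \<open>s\<close> and \<open>t\<close> will differ by less than 1.\<close>
  have "uniformly_continuous_on {- 1..l + 1} u"
    by (intro compact_uniformly_continuous continuous_on_subset[OF AP_continuous[OF u]]) auto
  then obtain d where d: "d > 0" "\<And>s t. s \<in> {- 1..l + 1} \<Longrightarrow> t \<in> {- 1..l + 1} \<Longrightarrow> dist s t < d \<Longrightarrow> dist (u s) (u t) < e/3"
    using \<open>e > 0\<close> unfolding uniformly_continuous_on_def by (metis divide_pos_pos zero_less_numeral)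
  have "norm (u s - u t) < e" if "\<bar>s - t\<bar> < min d 1" for s t
  proof -
    obtain s' where s': "s' \<in> {0..l}" "t - s' \<in> bohr_periods UNIV u (e/3)" using l(2) by blast
    have "norm (u s' - u t) \<le> e/3" "norm (u (s - t + s') - u s) \<le> e/3"
      using bohr_periodsD[OF s'(2), of s'] bohr_periodsD[OF s'(2), of "s - t + s'"] by simp_all
    moreover have "dist (u (s - t + s')) (u s') < e/3"
      using that s'(1) by (intro d(2)) (auto simp: dist_real_def)
    ultimately show ?thesis unfolding dist_norm by norm
  qed
  then show thesis using that[of "min d 1"] d(1) by auto
qed

lemma AP_compose:
  assumes u: "u \<in> AP UNIV" and h: "uniformly_continuous_on (range u) h"
  shows "(\<lambda>t. h (u t)) \<in> AP UNIV"
  unfolding AP_def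
proof safe
  show "continuous_on UNIV (\<lambda>t. h (u t))"
    by (rule continuous_on_compose2[OF uniformly_continuous_imp_continuous[OF h] AP_continuous[OF u]]) simp
  fix e :: real assume "e > 0"
  then obtain d where d: "d > 0" "\<And>x y. x \<in> range u \<Longrightarrow> y \<in> range u \<Longrightarrow> dist y x < d \<Longrightarrow> dist (h y) (h x) < e"
    using h unfolding uniformly_continuous_on_def by metis
  have "bohr_periods UNIV u (d/2) \<subseteq> bohr_periods UNIV (\<lambda>t. h (u t)) e"
  proof
    fix \<tau> assume \<tau>: "\<tau> \<in> bohr_periods UNIV u (d/2)"
    have "norm (h (u t) - h (u (t + \<tau>))) \<le> e" for t
    proof -
      have "norm (u t - u (t + \<tau>)) \<le> d/2" using \<tau> by (simp add: bohr_periods_def)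
      then have "dist (u t) (u (t + \<tau>)) < d" using d(1) by (simp add: dist_norm)
      from d(2)[OF _ _ this] show ?thesis by (simp add: dist_norm)
    qed
    then show "\<tau> \<in> bohr_periods UNIV (\<lambda>t. h (u t)) e" by (simp add: bohr_periods_def)
  qed
  moreover have "relatively_dense UNIV (bohr_periods UNIV u (d/2))"
    using u d(1) by (simp add: AP_def)
  ultimately show "relatively_dense UNIV (bohr_periods UNIV (\<lambda>t. h (u t)) e)"
    unfolding relatively_dense_def disjoint_iff by (simp add: subset_eq) meson
qed

text \<open>Pairs of almost periods of \<open>u\<close> and \<open>v\<close> from intervals of length \<open>l\<close> differ by at most \<open>l\<close>;
  two such pairs with almost equal offsets yield a common almost period.\<close>

lemma AP_common_periods:
  assumes u: "u \<in> AP UNIV" and v: "v \<in> AP UNIV" and "e > 0"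
  shows "relatively_dense {0..} (bohr_periods {0..} u e \<inter> bohr_periods {0..} v e)"
proof -
  define \<eta> where "\<eta> = e/3"
  have "\<eta> > 0" using \<open>e > 0\<close> by (simp add: \<eta>_def)
  obtain l1 where l1: "l1 > 0" "\<And>a. a \<ge> 0 \<Longrightarrow> {a..a + l1} \<inter> bohr_periods {0..} u \<eta> \<noteq> {}"
    using AP_restrict[OF u] \<open>\<eta> > 0\<close> unfolding AP_def relatively_dense_def by auto
  obtain l2 where l2: "l2 > 0" "\<And>a. a \<ge> 0 \<Longrightarrow> {a..a + l2} \<inter> bohr_periods {0..} v \<eta> \<noteq> {}"
    using AP_restrict[OF v] \<open>\<eta> > 0\<close> unfolding AP_def relatively_dense_def by auto
  obtain \<rho> where \<rho>: "\<rho> > 0" "\<And>s t. \<bar>s - t\<bar> < \<rho> \<Longrightarrow> norm (v s - v t) < \<eta>"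
    using AP_uniformly_continuous[OF v \<open>\<eta> > 0\<close>] by blast
  define l where "l = max l1 l2"
  have "l > 0" using l1(1) by (simp add: l_def)
  have "\<exists>x. x \<in> {l * real n..l * real n + l} \<and> x \<in> bohr_periods {0..} u \<eta>" for n
  proof -
    have "{l * real n..l * real n + l1} \<inter> bohr_periods {0..} u \<eta> \<noteq> {}" using \<open>l > 0\<close> by (intro l1(2)) auto
    then obtain x where "x \<in> {l * real n..l * real n + l1}" "x \<in> bohr_periods {0..} u \<eta>" by blast
    then show ?thesis by (intro exI[of _ x]) (auto simp: l_def)
  qed
  then obtain x where x: "\<And>n. x n \<in> {l * real n..l * real n + l}" "\<And>n. x n \<in> bohr_periods {0..} u \<eta>"
    by metis
  have "\<exists>y. y \<in> {l * real n..l * real n + l} \<and> y \<in> bohr_periods {0..} v \<eta>" for n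
  proof -
    have "{l * real n..l * real n + l2} \<inter> bohr_periods {0..} v \<eta> \<noteq> {}" using \<open>l > 0\<close> by (intro l2(2)) auto
    then obtain y where "y \<in> {l * real n..l * real n + l2}" "y \<in> bohr_periods {0..} v \<eta>" by blast
    then show ?thesis by (intro exI[of _ y]) (auto simp: l_def)
  qed
  then obtain y where y: "\<And>n. y n \<in> {l * real n..l * real n + l}" "\<And>n. y n \<in> bohr_periods {0..} v \<eta>"
    by metis
  \<comment> \<open>The offsets \<open>x n - y n\<close> lie between \<open>- l\<close> and
    \<open>l\<close>; \<open>c\<close> sorts them into finitely many cells of width
    \<open>\<rho>\<close>.\<close>
  define c where "c n = \<lfloor>(x n - y n) / \<rho>\<rfloor>" for n
  have "range c \<subseteq> {- \<lceil>l / \<rho>\<rceil> - 1..\<lceil>l / \<rho>\<rceil>}"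
  proof
    fix k assume "k \<in> range c"
    then obtain n where k: "k = c n" by blast
    have "\<bar>x n - y n\<bar> \<le> l" using x(1)[of n] y(1)[of n] by auto
    then have "\<bar>(x n - y n) / \<rho>\<bar> \<le> l / \<rho>" using \<rho>(1) by (simp add: divide_right_mono)
    then have "\<lfloor>(x n - y n) / \<rho>\<rfloor> \<le> \<lceil>l / \<rho>\<rceil>" "- \<lceil>l / \<rho>\<rceil> - 1 \<le> \<lfloor>(x n - y n) / \<rho>\<rfloor>" by linarith+
    then show "k \<in> {- \<lceil>l / \<rho>\<rceil> - 1..\<lceil>l / \<rho>\<rceil>}" unfolding k c_def by simp
  qed
  then have fin: "finite (range c)" by (rule finite_subset) simp
  \<comment> \<open>One representative index per cell. All of them are at most \<open>n0\<close>, so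
    subtracting the period of a representative costs a bounded amount, which preserves relative
    density.\<close>
  define r where "r k = (LEAST n. c n = k)" for k
  have r: "c (r k) = k" "c n = k \<Longrightarrow> r k \<le> n" if "k \<in> range c" for k n
    using that unfolding r_def by (auto intro: LeastI Least_le)
  obtain n0 where n0: "\<And>k. k \<in> range c \<Longrightarrow> r k \<le> n0"
    using fin by (metis finite_imageI finite_nat_set_iff_bounded_le imageI)
  have "{a..a + (l * n0 + 3 * l)} \<inter> (bohr_periods {0..} u e \<inter> bohr_periods {0..} v e) \<noteq> {}" if "a \<ge> 0" for a
  proof -
    \<comment> \<open>The subtracted \<open>x m\<close> can be as large as
      \<open>l * n0 + l\<close>; starting \<open>n\<close> this far beyond \<open>a\<close>
      guarantees \<open>x n - x m \<ge> a\<close>.\<close>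
    define n where "n = nat \<lceil>a / l\<rceil> + n0 + 1"
    have "0 \<le> \<lceil>a / l\<rceil>" using that \<open>l > 0\<close> by (simp add: less_le_trans[of _ 0])
    then have "real n = of_int \<lceil>a / l\<rceil> + real n0 + 1" unfolding n_def by simp
    then have "real n \<ge> a / l + real n0 + 1" "real n \<le> a / l + real n0 + 2" by linarith+
    then have "l * real n \<ge> l * (a / l + real n0 + 1)" "l * real n \<le> l * (a / l + real n0 + 2)"
      using \<open>l > 0\<close> by (simp_all only: mult_le_cancel_left_pos)
    moreover have "l * (a / l) = a" using \<open>l > 0\<close> by simp
    ultimately have n: "l * real n \<ge> a + l * n0 + l" "l * real n \<le> a + l * n0 + 2 * l"
      by (auto simp: distrib_left mult.commute[of l 2])
    define m where "m = r (c n)"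
    have m: "c m = c n" "m \<le> n0" using r(1)[of "c n"] n0[of "c n"] by (auto simp: m_def)
    define \<tau> where "\<tau> = x n - x m"
    define \<tau>' where "\<tau>' = y n - y m"
    have lm: "0 \<le> l * real m" "l * real m \<le> l * n0" using m(2) \<open>l > 0\<close> by auto
    have bounds: "a \<le> \<tau>" "\<tau> \<le> a + (l * n0 + 3 * l)" "0 \<le> \<tau>'"
      using n lm x(1)[of n] x(1)[of m] y(1)[of n] y(1)[of m] that unfolding \<tau>_def \<tau>'_def atLeastAtMost_iff by linarith+
    have \<tau>u: "\<tau> \<in> bohr_periods {0..} u (\<eta> + \<eta>)"
      unfolding \<tau>_def using bounds(1) that by (intro bohr_periods_diff[OF AP_restrict[OF u]] x(2)) (auto simp: \<tau>_def)
    have \<tau>'v: "\<tau>' \<in> bohr_periods {0..} v (\<eta> + \<eta>)"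
      unfolding \<tau>'_def using bounds(3) by (intro bohr_periods_diff[OF AP_restrict[OF v]] y(2)) (auto simp: \<tau>'_def)
    have "\<bar>(x n - y n) / \<rho> - (x m - y m) / \<rho>\<bar> < 1"
      using m(1) unfolding c_def by linarith
    then have "\<bar>((x n - y n) - (x m - y m)) / \<rho>\<bar> < 1" by (simp add: diff_divide_distrib)
    then have close: "\<bar>\<tau>' - \<tau>\<bar> < \<rho>" using \<rho>(1) by (simp add: \<tau>_def \<tau>'_def field_simps abs_less_iff)
    have "\<tau> \<in> bohr_periods {0..} v e"
    proof -
      have "norm (v t - v (t + \<tau>)) \<le> e" if "t \<ge> 0" for t
      proof -
        have "norm (v t - v (t + \<tau>')) \<le> \<eta> + \<eta>" using \<tau>'v that by (auto simp: bohr_periods_def)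
        moreover have "norm (v (t + \<tau>') - v (t + \<tau>)) < \<eta>" using close by (intro \<rho>(2)) auto
        ultimately have "norm (v t - v (t + \<tau>)) \<le> 3 * \<eta>" by norm
        then show ?thesis by (simp add: \<eta>_def)
      qed
      then show ?thesis using bounds(1) \<open>a \<ge> 0\<close> by (auto simp: bohr_periods_def)
    qed
    moreover have "\<tau> \<in> bohr_periods {0..} u e" using \<tau>u \<open>\<eta> > 0\<close> by (force simp: bohr_periods_def \<eta>_def)
    ultimately show ?thesis using bounds by fastforce
  qed
  moreover have "l * n0 + 3 * l > 0" using \<open>l > 0\<close> by (simp add: add_nonneg_pos)
  ultimately show ?thesis unfolding relatively_dense_def
    by (intro conjI exI[of _ "l * n0 + 3 * l"]) (auto simp: bohr_periods_def)
qed

lemma AP_Pair: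
  assumes u: "u \<in> AP UNIV" and v: "v \<in> AP UNIV"
  shows "(\<lambda>t. (u t, v t)) \<in> AP UNIV"
  unfolding AP_def
proof safe
  show "continuous_on UNIV (\<lambda>t. (u t, v t))"
    using u v by (intro continuous_intros AP_continuous)
  fix e :: real assume "e > 0"
  have *: "bohr_periods {0..} u (e/2) \<inter> bohr_periods {0..} v (e/2) \<subseteq> bohr_periods UNIV (\<lambda>t. (u t, v t)) e"
  proof
    fix \<tau> assume "\<tau> \<in> bohr_periods {0..} u (e/2) \<inter> bohr_periods {0..} v (e/2)"
    then have "\<tau> \<in> bohr_periods UNIV u (e/2)" "\<tau> \<in> bohr_periods UNIV v (e/2)"
      by (auto intro!: bohr_periods_half_line_imp[where c = 0] u v simp: bohr_periods_def[where T = "{0..}"])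
    then have "norm (u t - u (t + \<tau>)) + norm (v t - v (t + \<tau>)) \<le> e" for t
      using bohr_periodsD[of \<tau> UNIV u "e/2" t] bohr_periodsD[of \<tau> UNIV v "e/2" t] by auto
    then show "\<tau> \<in> bohr_periods UNIV (\<lambda>t. (u t, v t)) e"
      unfolding bohr_periods_def by (auto intro: order_trans[OF norm_Pair_le])
  qed
  show "relatively_dense UNIV (bohr_periods UNIV (\<lambda>t. (u t, v t)) e)"
    using \<open>e > 0\<close> * bohr_periods_uminus
    by (intro relatively_dense_reflect[OF AP_common_periods[OF u v, of "e/2"] *]) (auto intro!: zero_bohr_period)
qed

lemma AP_bounded_linear:
  assumes "u \<in> AP UNIV" "bounded_linear h"
  shows "(\<lambda>t. h (u t)) \<in> AP UNIV"
  by (rule AP_compose[OF assms(1)], rule bounded_linear.uniformly_continuous_on[OF assms(2)], rule uniformly_continuous_on_id)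

text \<open>On the bounded range of the pair the bilinear map is Lipschitz, so
  \<open>AP_compose\<close> applies.\<close>

lemma AP_bilinear:
  fixes u :: "real \<Rightarrow> 'a::banach" and v :: "real \<Rightarrow> 'b::banach" and h :: "'a \<Rightarrow> 'b \<Rightarrow> 'c::banach"
  assumes u: "u \<in> AP UNIV" and v: "v \<in> AP UNIV" and h: "bounded_bilinear h"
  shows "(\<lambda>t. h (u t) (v t)) \<in> AP UNIV"
proof -
  interpret bounded_bilinear h by (rule h)
  obtain M N where M: "M > 0" "\<And>t. norm (u t) \<le> M" and N: "N > 0" "\<And>t. norm (v t) \<le> N"
    using AP_bounded[OF u] AP_bounded[OF v] by metis
  obtain K where K: "K > 0" "\<And>a b. norm (h a b) \<le> norm a * norm b * K" using pos_bounded by blast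
  define L where "L = K * (M + N)"
  have "L > 0" using K M N by (simp add: L_def)
  have Lip: "dist (h (u s) (v s)) (h (u t) (v t)) \<le> L * dist (u s, v s) (u t, v t)" for s t
  proof -
    have le: "norm (u s - u t) \<le> dist (u s, v s) (u t, v t)" "norm (v s - v t) \<le> dist (u s, v s) (u t, v t)"
      unfolding dist_norm[symmetric] using dist_fst_le[of "(u s, v s)" "(u t, v t)"] dist_snd_le[of "(u s, v s)" "(u t, v t)"]
      by simp_all
    have "h (u s) (v s) - h (u t) (v t) = h (u s - u t) (v s) + h (u t) (v s - v t)"
      by (simp add: diff_left diff_right)
    then have "norm (h (u s) (v s) - h (u t) (v t)) \<le> norm (u s - u t) * norm (v s) * K + norm (u t) * norm (v s - v t) * K"
      by (simp add: norm_triangle_le add_mono K(2))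
    also have "\<dots> \<le> dist (u s, v s) (u t, v t) * N * K + M * dist (u s, v s) (u t, v t) * K"
      using M N K(1) le by (intro add_mono mult_right_mono mult_mono) auto
    finally show ?thesis by (simp add: L_def dist_norm algebra_simps)
  qed
  have "uniformly_continuous_on (range (\<lambda>t. (u t, v t))) (\<lambda>p. h (fst p) (snd p))"
    unfolding uniformly_continuous_on_def
  proof (intro allI impI)
    fix e :: real assume "e > 0"
    have "dist (h (u s) (v s)) (h (u t) (v t)) < e" if "dist (u s, v s) (u t, v t) < e / L" for s t
      using Lip[of s t] that \<open>L > 0\<close> by (simp add: pos_less_divide_eq mult.commute)
    then show "\<exists>d>0. \<forall>x\<in>range (\<lambda>t. (u t, v t)). \<forall>x'\<in>range (\<lambda>t. (u t, v t)). dist x' x < d \<longrightarrow>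
        dist (h (fst x') (snd x')) (h (fst x) (snd x)) < e"
      using \<open>e > 0\<close> \<open>L > 0\<close> by (intro exI[of _ "e / L"]) auto
  qed
  from AP_compose[OF AP_Pair[OF u v] this] show ?thesis by simp
qed

section \<open>Mean values\<close>

text \<open>Uniform in the position of the window, so that it covers the symmetric windows of
  \<open>fourier_coeff\<close> and is invariant under translation; multiplied out by
  \<open>T\<close> to avoid quotients.\<close>

definition has_mean :: "(real \<Rightarrow> 'a::banach) \<Rightarrow> 'a \<Rightarrow> bool" where
  "has_mean u m \<longleftrightarrow> (\<forall>\<epsilon>>0. \<exists>T0>0. \<forall>T\<ge>T0. \<forall>a. norm (integral {a..a + T} u - T *\<^sub>R m) \<le> \<epsilon> * T)"

lemma norm_integral_le:
  fixes u :: "real \<Rightarrow> 'a::banach"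
  assumes "continuous_on UNIV u" "\<And>t. norm (u t) \<le> M" "T \<ge> 0"
  shows "norm (integral {a..a + T} u) \<le> M * T"
  using integral_bound[of a "a + T" u M] assms continuous_on_subset by fastforce

lemma integral_split_add:
  fixes u :: "real \<Rightarrow> 'a::banach"
  assumes "continuous_on UNIV u" "S \<ge> 0" "T \<ge> 0"
  shows "integral {a..a + (S + T)} u = integral {a..a + S} u + integral {a + S..a + S + T} u"
proof -
  have "u integrable_on {a..a + (S + T)}"
    by (intro integrable_continuous_interval continuous_on_subset[OF assms(1)]) simp
  from Henstock_Kurzweil_Integration.integral_combine[OF _ _ this, of "a + S"] assms(2,3) show ?thesis by (simp add: add.assoc)
qed

lemma integral_blocks_bound:
  fixes u :: "real \<Rightarrow> 'a::banach"
  assumes cont: "continuous_on UNIV u" and T: "T > 0"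
    and blk: "\<And>b. norm (integral {b..b + T} u - c) \<le> k * T"
  shows "norm (integral {a..a + real n * T} u - real n *\<^sub>R c) \<le> k * (real n * T)"
proof (induction n)
  case (Suc n)
  have eq: "integral {a..a + (real n * T + T)} u = integral {a..a + real n * T} u + integral {a + real n * T..a + real n * T + T} u"
    using T by (intro integral_split_add cont) auto
  have "norm ((integral {a..a + real n * T} u - real n *\<^sub>R c) + (integral {a + real n * T..a + real n * T + T} u - c)) \<le>
     k * (real n * T) + k * T"
    by (intro norm_triangle_le add_mono Suc blk)
  moreover have "(integral {a..a + real n * T} u - real n *\<^sub>R c) + (integral {a + real n * T..a + real n * T + T} u - c)
     = integral {a..a + (real n * T + T)} u - real (Suc n) *\<^sub>R c" unfolding eq by (simp add: algebra_simps)
  moreover have "real n * T + T = real (Suc n) * T" by (simp add: algebra_simps)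
  ultimately show ?case by (simp add: algebra_simps)
qed simp

text \<open>The incomplete last block costs \<open>M * T\<close> in the integral and another
  \<open>M * T\<close> in rounding \<open>S / T\<close>, whatever the length \<open>S\<close>
  is.\<close>

lemma integral_blocks_bound_real:
  fixes u :: "real \<Rightarrow> 'a::banach"
  assumes cont: "continuous_on UNIV u" and M: "\<And>t. norm (u t) \<le> M" and T: "T > 0" and S: "S \<ge> 0"
    and blk: "\<And>b. norm (integral {b..b + T} u - c) \<le> k * T" and c: "norm c \<le> M * T"
  shows "norm (integral {a..a + S} u - (S / T) *\<^sub>R c) \<le> k * S + 2 * M * T"
proof -
  define n where "n = nat \<lfloor>S / T\<rfloor>"
  have "0 \<le> S / T" using S T by simp
  then have "0 \<le> \<lfloor>S / T\<rfloor>" by (simp only: zero_le_floor)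
  then have "real n = of_int \<lfloor>S / T\<rfloor>" by (simp add: n_def)
  then have n: "real n \<le> S / T" "S / T < real n + 1" by linarith+
  define r where "r = S - real n * T"
  have "real n * T \<le> S" using n(1) T by (simp add: pos_le_divide_eq)
  moreover have "S < real n * T + T" using n(2) T by (simp add: pos_divide_less_eq algebra_simps)
  ultimately have r: "r \<ge> 0" "r \<le> T" by (auto simp: r_def)
  have M0: "M \<ge> 0" using M[of 0] norm_ge_zero order_trans by blast
  have k0: "k \<ge> 0" using blk[of 0] T by (metis norm_ge_zero order_trans zero_le_mult_iff not_less less_le)
  have eq: "integral {a..a + S} u = integral {a..a + real n * T} u + integral {a + real n * T..a + real n * T + r} u"
    using integral_split_add[OF cont, of "real n * T" r a] r T by (simp add: r_def)
  have "norm (integral {a + real n * T..a + real n * T + r} u) \<le> M * r"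
    by (intro norm_integral_le cont M r)
  also have "\<dots> \<le> M * T" using r M0 by (intro mult_left_mono) auto
  finally have 1: "norm (integral {a + real n * T..a + real n * T + r} u) \<le> M * T" .
  have "norm ((S / T - real n) *\<^sub>R c) = \<bar>S / T - real n\<bar> * norm c" by simp
  also have "\<dots> \<le> 1 * (M * T)" using n c by (intro mult_mono) auto
  finally have 2: "norm ((S / T - real n) *\<^sub>R c) \<le> M * T" by simp
  have "norm (integral {a..a + real n * T} u - real n *\<^sub>R c) \<le> k * (real n * T)"
    by (rule integral_blocks_bound[OF cont T blk])
  also have "\<dots> \<le> k * S" using k0 \<open>real n * T \<le> S\<close> by (intro mult_left_mono)
  finally have 3: "norm (integral {a..a + real n * T} u - real n *\<^sub>R c) \<le> k * S" .
  have "integral {a..a + S} u - (S / T) *\<^sub>R c = (integral {a..a + real n * T} u - real n *\<^sub>R c)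
    + (integral {a + real n * T..a + real n * T + r} u - (S / T - real n) *\<^sub>R c)"
    unfolding eq by (simp add: algebra_simps)
  also have "norm \<dots> \<le> k * S + (M * T + M * T)"
    by (intro norm_triangle_le add_mono order_refl 3 norm_triangle_le_diff 1 2)
  finally show ?thesis by simp
qed

text \<open>Shift the window at \<open>a\<close> by an almost period to within \<open>l\<close> of
  the window at \<open>b\<close>. The shift costs \<open>r / 2\<close> per unit of length, and the
  parts that do not overlap have length at most \<open>l\<close> each, negligible for large
  \<open>T\<close>.\<close>

lemma AP_integral_translates:
  fixes u :: "real \<Rightarrow> 'a::banach"
  assumes u: "u \<in> AP UNIV" and "r > 0"
  obtains T0 where "T0 > 0" "\<And>T a b. T \<ge> T0 \<Longrightarrow> norm (integral {a..a + T} u - integral {b..b + T} u) \<le> r * T"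
proof -
  note cont = AP_continuous[OF u]
  obtain M where M: "M > 0" "\<And>t. norm (u t) \<le> M" using AP_bounded[OF u] by blast
  obtain l where l: "l > 0" "\<And>t. \<exists>s\<in>{0..l}. t - s \<in> bohr_periods UNIV u (r/2)"
    using AP_shift_to_compact[OF u, of "r/2"] \<open>r > 0\<close> by auto
  have "norm (integral {a..a + T} u - integral {b..b + T} u) \<le> r * T" if T: "T \<ge> 4 * l * M / r" for T a b
  proof -
    have T0: "T \<ge> 0" by (rule order_trans[OF _ T]) (use l M \<open>r > 0\<close> in auto)
    obtain s where s: "0 \<le> s" "s \<le> l" "b - a - s \<in> bohr_periods UNIV u (r/2)" using l(2)[of "b - a"] by auto
    define \<tau> where "\<tau> = b - a - s"
    have "integral {a + \<tau>..a + \<tau> + T} u = integral {a..a + T} (\<lambda>x. u (x + \<tau>))"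
      using integral_shift_Icc_real[of a "a + T" u \<tau>] by (simp add: o_def algebra_simps)
    then have "norm (integral {a..a + T} u - integral {a + \<tau>..a + \<tau> + T} u) = norm (integral {a..a + T} (\<lambda>x. u x - u (x + \<tau>)))"
      by (subst Henstock_Kurzweil_Integration.integral_diff)
        (auto intro!: integrable_continuous_interval continuous_on_subset[OF cont] continuous_on_compose2[OF cont] continuous_intros)
    also have "\<dots> \<le> (r/2) * T"
      using bohr_periodsD[OF s(3)] T0 unfolding \<tau>_def
      by (intro norm_integral_le) (auto intro!: continuous_intros continuous_on_compose2[OF cont])
    finally have 1: "norm (integral {a..a + T} u - integral {a + \<tau>..a + \<tau> + T} u) \<le> (r/2) * T" .
    have e: "b - s + (s + T) = b + T" "b - s + s = b" "b - s + (T + s) = b + T" "a + \<tau> = b - s" by (simp_all add: \<tau>_def)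
    have E1: "integral {b - s..b + T} u = integral {b - s..b} u + integral {b..b + T} u"
      using integral_split_add[OF cont s(1) T0, of "b - s"] unfolding e .
    have E2: "integral {b - s..b + T} u = integral {b - s..b - s + T} u + integral {b - s + T..b - s + T + s} u"
      using integral_split_add[OF cont T0 s(1), of "b - s"] unfolding e .
    have Ms: "norm (integral {b - s..b} u) \<le> M * s" "norm (integral {b - s + T..b - s + T + s} u) \<le> M * s"
      using norm_integral_le[OF cont M(2) s(1), of "b - s"] norm_integral_le[OF cont M(2) s(1), of "b - s + T"] unfolding e by simp_all
    have "integral {a + \<tau>..a + \<tau> + T} u - integral {b..b + T} u
        = integral {b - s..b} u - integral {b - s + T..b - s + T + s} u"
      using E1 E2 unfolding e by (simp add: algebra_simps)
    then have "norm (integral {a + \<tau>..a + \<tau> + T} u - integral {b..b + T} u) \<le> M * s + M * s"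
      using Ms by (simp only: norm_triangle_le_diff[OF add_mono])
    moreover have "M * s \<le> M * l" using M s by (intro mult_left_mono) auto
    moreover have "4 * l * M \<le> r * T" using T \<open>r > 0\<close> by (simp add: pos_divide_le_eq mult.commute)
    ultimately have 2: "norm (integral {a + \<tau>..a + \<tau> + T} u - integral {b..b + T} u) \<le> (r/2) * T"
      by (simp add: mult.commute)
    show ?thesis using norm_diff_triangle_le[OF 1 2] by (simp add: field_simps)
  qed
  moreover have "4 * l * M / r > 0" using l M \<open>r > 0\<close> by simp
  ultimately show thesis using that by blast
qed

lemma has_meanI:
  fixes u :: "real \<Rightarrow> 'a::banach"
  assumes "\<And>e. e > 0 \<Longrightarrow> \<exists>T0>0. \<forall>T\<ge>T0. \<forall>a. norm (integral {a..a + T} u - T *\<^sub>R m) \<le> e * T"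
  shows "has_mean u m"
  using assms by (simp add: has_mean_def)

lemma has_meanE:
  assumes "has_mean u m" "e > 0"
  obtains T0 where "T0 > 0" "\<And>T a. T \<ge> T0 \<Longrightarrow> norm (integral {a..a + T} u - T *\<^sub>R m) \<le> e * T"
  using assms by (meson has_mean_def)

text \<open>Blocks of one suitable length have nearly equal integrals, so every long window has an
  average within \<open>r\<close> of a single block average. As \<open>r\<close> is arbitrary, the
  averages over \<open>[0, n]\<close> are Cauchy and their limit is the mean, uniformly in the
  position.\<close>

lemma AP_has_mean:
  fixes u :: "real \<Rightarrow> 'a::banach"
  assumes u: "u \<in> AP UNIV"
  obtains m where "has_mean u m"
proof -
  note cont = AP_continuous[OF u]
  obtain M where M: "M > 0" "\<And>t. norm (u t) \<le> M" using AP_bounded[OF u] by blast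
  have est: "\<exists>c. \<exists>S0>0. \<forall>S\<ge>S0. \<forall>a. norm (integral {a..a + S} u - S *\<^sub>R c) \<le> r * S" if "r > 0" for r
  proof -
    obtain T where T: "T > 0" "\<And>a b. norm (integral {a..a + T} u - integral {b..b + T} u) \<le> r/2 * T"
      using AP_integral_translates[OF u, of "r/2"] \<open>r > 0\<close> by (metis half_gt_zero order_refl)
    have le: "norm (integral {a..a + S} u - (S / T) *\<^sub>R integral {0..0 + T} u) \<le> r/2 * S + 2 * M * T" if "S \<ge> 0" for S a
    proof (rule integral_blocks_bound_real[OF cont M(2) T(1) that])
      show "norm (integral {b..b + T} u - integral {0..0 + T} u) \<le> r/2 * T" for b by (rule T(2))
      show "norm (integral {0..0 + T} u) \<le> M * T" using T(1) by (intro norm_integral_le[OF cont M(2)]) simp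
    qed
    have "norm (integral {a..a + S} u - S *\<^sub>R ((1 / T) *\<^sub>R integral {0..0 + T} u)) \<le> r * S" if "S \<ge> 4 * M * T / r" for S a
    proof -
      have "S \<ge> 0" by (rule order_trans[OF _ that]) (use T M \<open>r > 0\<close> in auto)
      moreover have "2 * M * T \<le> r/2 * S" using that \<open>r > 0\<close> by (simp add: pos_divide_le_eq ac_simps)
      ultimately show ?thesis using le[of S a] by simp
    qed
    moreover have "4 * M * T / r > 0" using T M \<open>r > 0\<close> by simp
    ultimately show ?thesis by blast
  qed
  define A where "A n = (1 / real n) *\<^sub>R integral {0..0 + real n} u" for n :: nat
  have A_close: "norm (A n - c) \<le> r" if "\<forall>a. norm (integral {a..a + real n} u - real n *\<^sub>R c) \<le> r * real n" "n > 0" for n c r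
  proof -
    have "real n * norm (A n - c) = norm (real n *\<^sub>R (A n - c))" by simp
    also have "real n *\<^sub>R (A n - c) = integral {0..0 + real n} u - real n *\<^sub>R c"
      using that(2) by (simp add: A_def algebra_simps)
    finally have "real n * norm (A n - c) \<le> real n * r" using spec[OF that(1), of 0] by (simp add: mult.commute)
    then show ?thesis using that(2) by simp
  qed
  have "Cauchy A"
    unfolding Cauchy_def
  proof (intro allI impI)
    fix e :: real assume "e > 0"
    then obtain c S0 where c: "S0 > 0" "\<And>S a. S \<ge> S0 \<Longrightarrow> norm (integral {a..a + S} u - S *\<^sub>R c) \<le> e/3 * S"
      using est[of "e/3"] by auto
    obtain N :: nat where N: "real N \<ge> S0" using real_arch_simple by blast
    have near: "norm (A n - c) \<le> e/3" if "n \<ge> N" for n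
    proof (rule A_close)
      have "real n \<ge> S0" using that N by linarith
      then show "\<forall>a. norm (integral {a..a + real n} u - real n *\<^sub>R c) \<le> e/3 * real n" using c(2) by blast
      show "n > 0" using \<open>real n \<ge> S0\<close> c(1) by (cases n) auto
    qed
    have "dist (A m) (A n) < e" if "m \<ge> N" "n \<ge> N" for m n
    proof -
      have "norm (A m - A n) \<le> e/3 + e/3"
        using near[OF that(1)] near[OF that(2)] by (metis norm_diff_triangle_le norm_minus_commute)
      then show ?thesis using \<open>e > 0\<close> by (simp add: dist_norm)
    qed
    then show "\<exists>M. \<forall>m\<ge>M. \<forall>n\<ge>M. dist (A m) (A n) < e" by blast
  qed
  then obtain m where m: "A \<longlonglongrightarrow> m" by (auto simp: Cauchy_convergent_iff convergent_def)
  have "has_mean u m"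
  proof (rule has_meanI)
    fix r :: real assume "r > 0"
    then obtain c S0 where c: "S0 > 0" "\<And>S a. S \<ge> S0 \<Longrightarrow> norm (integral {a..a + S} u - S *\<^sub>R c) \<le> r/2 * S"
      using est[of "r/2"] by auto
    have "norm (m - c) \<le> r/2"
    proof (rule tendsto_upperbound)
      show "(\<lambda>n. norm (A n - c)) \<longlonglongrightarrow> norm (m - c)" by (intro tendsto_intros m)
      obtain N :: nat where N: "real N \<ge> S0" using real_arch_simple by blast
      have "norm (A n - c) \<le> r/2" if "n \<ge> N" for n
      proof (rule A_close)
        have "real n \<ge> S0" using that N by linarith
        then show "\<forall>a. norm (integral {a..a + real n} u - real n *\<^sub>R c) \<le> r/2 * real n" using c(2) by blast
        show "n > 0" using \<open>real n \<ge> S0\<close> c(1) by (cases n) auto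
      qed
      then show "\<forall>\<^sub>F n in sequentially. norm (A n - c) \<le> r/2"
        by (auto simp: eventually_sequentially)
    qed simp
    have "norm (integral {a..a + S} u - S *\<^sub>R m) \<le> r * S" if "S \<ge> S0" for S a
    proof -
      have "norm (S *\<^sub>R c - S *\<^sub>R m) = \<bar>S\<bar> * norm (m - c)"
        by (metis norm_minus_commute norm_scaleR scaleR_diff_right)
      also have "\<dots> \<le> r/2 * S" using \<open>norm (m - c) \<le> r/2\<close> that c(1) by (simp add: mult.commute mult_left_mono)
      finally have "norm (S *\<^sub>R c - S *\<^sub>R m) \<le> r/2 * S" .
      from norm_diff_triangle_le[OF c(2)[OF that, of a] this] show ?thesis by (simp add: mult.commute)
    qed
    then show "\<exists>T0>0. \<forall>T\<ge>T0. \<forall>a. norm (integral {a..a + T} u - T *\<^sub>R m) \<le> r * T" using c(1) by blast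
  qed
  then show thesis by (rule that)
qed

lemma has_mean_norm_diff_le:
  fixes u v :: "real \<Rightarrow> 'a::banach"
  assumes cont: "continuous_on UNIV u" "continuous_on UNIV v"
    and m: "has_mean u m1" "has_mean v m2" and le: "\<And>t. norm (u t - v t) \<le> e"
  shows "norm (m1 - m2) \<le> e"
proof (rule field_le_epsilon)
  fix r :: real assume "r > 0"
  then have "r/2 > 0" by simp
  from has_meanE[OF m(1) this] has_meanE[OF m(2) this] obtain T1 T2 where
    T1: "T1 > 0" "\<And>T a. T \<ge> T1 \<Longrightarrow> norm (integral {a..a + T} u - T *\<^sub>R m1) \<le> r/2 * T" and
    T2: "T2 > 0" "\<And>T a. T \<ge> T2 \<Longrightarrow> norm (integral {a..a + T} v - T *\<^sub>R m2) \<le> r/2 * T"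
    by metis
  define T where "T = max T1 T2"
  have T: "T > 0" using T1(1) by (simp add: T_def)
  have "integral {0..0 + T} (\<lambda>t. u t - v t) = integral {0..0 + T} u - integral {0..0 + T} v"
    by (intro Henstock_Kurzweil_Integration.integral_diff integrable_continuous_interval continuous_on_subset[OF cont(1)] continuous_on_subset[OF cont(2)]) auto
  moreover have "norm (integral {0..0 + T} (\<lambda>t. u t - v t)) \<le> e * T"
    using T le by (intro norm_integral_le continuous_intros cont) auto
  ultimately have 1: "norm (integral {0..0 + T} u - integral {0..0 + T} v) \<le> e * T" by simp
  have 2: "norm (T *\<^sub>R m1 - integral {0..0 + T} u) \<le> r/2 * T"
    using T1(2)[of T 0] by (simp add: T_def norm_minus_commute)
  have 3: "norm (integral {0..0 + T} v - T *\<^sub>R m2) \<le> r/2 * T" using T2(2)[of T 0] by (simp add: T_def)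
  have "norm (T *\<^sub>R m1 - T *\<^sub>R m2) \<le> r/2 * T + e * T + r/2 * T"
    by (rule norm_diff_triangle_le[OF norm_diff_triangle_le[OF 2 1] 3])
  moreover have "norm (T *\<^sub>R m1 - T *\<^sub>R m2) = T * norm (m1 - m2)"
    using T by (simp add: scaleR_diff_right[symmetric])
  ultimately have "T * norm (m1 - m2) \<le> T * (e + r)" by (simp add: algebra_simps)
  then show "norm (m1 - m2) \<le> e + r" using T by simp
qed

lemma has_mean_unique:
  assumes "continuous_on UNIV u" "has_mean u m1" "has_mean u m2"
  shows "m1 = m2"
  using has_mean_norm_diff_le[OF assms(1,1) assms(2,3), of 0] by simp

lemma has_mean_bounded_linear:
  fixes u :: "real \<Rightarrow> 'a::banach" and h :: "'a \<Rightarrow> 'b::banach"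
  assumes cont: "continuous_on UNIV u" and m: "has_mean u m" and h: "bounded_linear h"
  shows "has_mean (\<lambda>t. h (u t)) (h m)"
proof (rule has_meanI)
  interpret bounded_linear h by (rule h)
  obtain K where K: "K > 0" "\<And>x. norm (h x) \<le> norm x * K" using pos_bounded by blast
  fix e :: real assume "e > 0"
  then have "e / K > 0" using K by simp
  from has_meanE[OF m this] obtain T0 where T0: "T0 > 0" "\<And>T a. T \<ge> T0 \<Longrightarrow> norm (integral {a..a + T} u - T *\<^sub>R m) \<le> e / K * T"
    by metis
  have "norm (integral {a..a + T} (\<lambda>t. h (u t)) - T *\<^sub>R h m) \<le> e * T" if "T \<ge> T0" for T a
  proof -
    have "integral {a..a + T} (h \<circ> u) = h (integral {a..a + T} u)"
      by (intro integral_linear h integrable_continuous_interval continuous_on_subset[OF cont]) auto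
    then have "integral {a..a + T} (\<lambda>t. h (u t)) - T *\<^sub>R h m = h (integral {a..a + T} u - T *\<^sub>R m)"
      by (simp add: o_def diff scaleR)
    then have "norm (integral {a..a + T} (\<lambda>t. h (u t)) - T *\<^sub>R h m) \<le> norm (integral {a..a + T} u - T *\<^sub>R m) * K"
      using K(2) by simp
    also have "\<dots> \<le> (e / K * T) * K" using T0(2)[OF that] K(1) by (intro mult_right_mono) auto
    finally show ?thesis using K(1) by simp
  qed
  then show "\<exists>T0>0. \<forall>T\<ge>T0. \<forall>a. norm (integral {a..a + T} (\<lambda>t. h (u t)) - T *\<^sub>R h m) \<le> e * T"
    using T0(1) by blast
qed

text \<open>The pair has some mean by almost periodicity; uniqueness of the means of its components
  identifies it.\<close>

lemma has_mean_Pair: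
  fixes u :: "real \<Rightarrow> 'a::banach" and v :: "real \<Rightarrow> 'b::banach"
  assumes u: "u \<in> AP UNIV" and v: "v \<in> AP UNIV" and "has_mean u m" "has_mean v n"
  shows "has_mean (\<lambda>t. (u t, v t)) (m, n)"
proof -
  have uv: "(\<lambda>t. (u t, v t)) \<in> AP UNIV" by (rule AP_Pair[OF u v])
  then obtain p where p: "has_mean (\<lambda>t. (u t, v t)) p" using AP_has_mean by blast
  have "has_mean (\<lambda>t. fst (u t, v t)) (fst p)" "has_mean (\<lambda>t. snd (u t, v t)) (snd p)"
    by (intro has_mean_bounded_linear[OF AP_continuous[OF uv] p] bounded_linear_fst bounded_linear_snd)+
  then have "fst p = m" "snd p = n"
    using has_mean_unique[OF AP_continuous[OF u]] has_mean_unique[OF AP_continuous[OF v]] assms by auto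
  then show ?thesis using p by (metis prod.collapse)
qed

lemma has_mean_linear_combination:
  fixes u :: "real \<Rightarrow> 'a::banach" and v :: "real \<Rightarrow> 'b::banach"
  assumes "u \<in> AP UNIV" "v \<in> AP UNIV" "has_mean u m" "has_mean v n" "bounded_linear g" "bounded_linear h"
  shows "has_mean (\<lambda>t. g (u t) + h (v t)) (g m + h n)"
  using has_mean_bounded_linear[OF AP_continuous[OF AP_Pair[OF assms(1,2)]] has_mean_Pair[OF assms(1-4)],
    of "\<lambda>p. g (fst p) + h (snd p)"] assms(5,6)
  by (simp add: bounded_linear_add bounded_linear_compose[OF _ bounded_linear_fst] bounded_linear_compose[OF _ bounded_linear_snd])

lemma has_mean_translate:
  fixes u :: "real \<Rightarrow> 'a::banach"
  assumes "has_mean u m"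
  shows "has_mean (\<lambda>t. u (t + \<tau>)) m"
proof (rule has_meanI)
  fix e :: real assume "e > 0"
  from has_meanE[OF assms this] obtain T0 where T0: "T0 > 0" "\<And>T a. T \<ge> T0 \<Longrightarrow> norm (integral {a..a + T} u - T *\<^sub>R m) \<le> e * T" by metis
  have "integral {a..a + T} (\<lambda>t. u (t + \<tau>)) = integral {a + \<tau>..a + \<tau> + T} u" for a T
    using integral_shift_Icc_real[of a "a + T" u \<tau>] by (simp add: o_def algebra_simps)
  then show "\<exists>T0>0. \<forall>T\<ge>T0. \<forall>a. norm (integral {a..a + T} (\<lambda>t. u (t + \<tau>)) - T *\<^sub>R m) \<le> e * T"
    using T0 by auto
qed

text \<open>Almost periods repeat the neighbourhood of \<open>t0\<close> in every window of length
  \<open>l + d\<close>, so each such window contributes at least \<open>\<kappa> * d\<close> to the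
  integral.\<close>

lemma AP_mean_pos:
  fixes u :: "real \<Rightarrow> real"
  assumes u: "u \<in> AP UNIV" and nn: "\<And>t. u t \<ge> 0" and pos: "u t0 > 0" and m: "has_mean u m"
  shows "m > 0"
proof -
  note cont = AP_continuous[OF u]
  \<comment> \<open>One quarter is lost to the almost period, up to two to uniform continuity, and
    one remains.\<close>
  define \<kappa> where "\<kappa> = u t0 / 4"
  have "\<kappa> > 0" using pos by (simp add: \<kappa>_def)
  obtain d where d: "d > 0" "\<And>s t. \<bar>s - t\<bar> < d \<Longrightarrow> norm (u s - u t) < \<kappa>"
    using AP_uniformly_continuous[OF u \<open>\<kappa> > 0\<close>] by blast
  obtain l where l: "l > 0" "\<And>t. \<exists>s\<in>{0..l}. t - s \<in> bohr_periods UNIV u \<kappa>"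
    using AP_shift_to_compact[OF u \<open>\<kappa> > 0\<close>] by blast
  define L where "L = l + d"
  have L: "L > 0" using l d by (simp add: L_def)
  have blk: "integral {a..a + L} u \<ge> \<kappa> * d" for a
  proof -
    obtain s where s: "0 \<le> s" "s \<le> l" "a + l - t0 - s \<in> bohr_periods UNIV u \<kappa>" using l(2)[of "a + l - t0"] by auto
    define b where "b = a + l - s"
    have "t0 + (a + l - t0 - s) = b" by (simp add: b_def)
    then have "norm (u t0 - u b) \<le> \<kappa>" using bohr_periodsD[OF s(3), of t0] by (simp only: UNIV_I)
    then have "u t0 - u b \<le> \<kappa>" by (simp only: real_norm_def abs_le_iff)
    moreover have "u t0 = 4 * \<kappa>" by (simp add: \<kappa>_def)
    ultimately have ub: "u b \<ge> 3 * \<kappa>" by linarith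
    \<comment> \<open>The modulus of continuity holds for distances strictly below \<open>d\<close>;
      the endpoint \<open>b + d\<close> is reached in two steps through the midpoint.\<close>
    have near: "u t \<ge> \<kappa>" if "t \<in> {b..b + d}" for t
    proof (cases "t = b + d")
      case False
      then have "norm (u t - u b) < \<kappa>" using that by (intro d(2)) auto
      then show ?thesis using ub \<open>\<kappa> > 0\<close> by auto
    next
      case True
      have "norm (u t - u (b + d/2)) < \<kappa>" "norm (u (b + d/2) - u b) < \<kappa>" using d(1) True by (intro d(2); simp add: field_simps)+
      then show ?thesis using ub by auto
    qed
    have int: "u integrable_on {x..y}" for x y by (intro integrable_continuous_interval continuous_on_subset[OF cont]) auto
    have "\<kappa> * d = integral {b..b + d} (\<lambda>t. \<kappa>)" using d(1) by simp
    also have "\<dots> \<le> integral {b..b + d} u" using near int by (intro integral_le) auto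
    also have "\<dots> \<le> integral {a..a + L} u" using s d(1) nn int by (intro integral_subset_le) (auto simp: b_def L_def)
    finally show ?thesis .
  qed
  have many: "integral {0..0 + real n * L} u \<ge> real n * (\<kappa> * d)" for n
  proof (induction n)
    case (Suc n)
    have "integral {0..0 + (real n * L + L)} u = integral {0..0 + real n * L} u + integral {0 + real n * L..0 + real n * L + L} u"
      using L by (intro integral_split_add cont) auto
    then show ?case using Suc blk[of "0 + real n * L"] by (simp add: algebra_simps)
  qed simp
  define \<epsilon> where "\<epsilon> = \<kappa> * d / (2 * L)"
  have "\<epsilon> > 0" using \<open>\<kappa> > 0\<close> d L by (simp add: \<epsilon>_def)
  from has_meanE[OF m this] obtain T0 where T0: "T0 > 0" "\<And>T a. T \<ge> T0 \<Longrightarrow> norm (integral {a..a + T} u - T *\<^sub>R m) \<le> \<epsilon> * T" by metis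
  obtain n :: nat where n: "real n \<ge> T0 / L" using real_arch_simple by blast
  have "real n * L \<ge> T0" using n L by (simp add: pos_divide_le_eq)
  then have "norm (integral {0..0 + real n * L} u - (real n * L) *\<^sub>R m) \<le> \<epsilon> * (real n * L)" by (rule T0(2))
  moreover have "\<epsilon> * (real n * L) = real n * (\<kappa> * d) / 2" using L by (simp add: \<epsilon>_def field_simps)
  ultimately have "integral {0..0 + real n * L} u - real n * L * m \<le> real n * (\<kappa> * d) / 2"
    by (simp only: real_norm_def abs_le_iff real_scaleR_def)
  then have "real n * L * m \<ge> real n * (\<kappa> * d) / 2" using many[of n] by linarith
  moreover have "real n > 0" using \<open>real n * L \<ge> T0\<close> T0(1) by (cases n) auto
  ultimately have "L * m \<ge> \<kappa> * d / 2" by (simp add: field_simps)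
  moreover have "\<kappa> * d / 2 > 0" using \<open>\<kappa> > 0\<close> d by simp
  ultimately show ?thesis using L by (metis less_le_trans zero_less_mult_pos)
qed

section \<open>The discrete Fourier transform\<close>

text \<open>The character \<open>exp (2 pi i x / n)\<close> of the integers modulo \<open>n\<close>.
  Arguments are integers rather than residues, so that shifts need no reduction.\<close>

definition root_char :: "nat \<Rightarrow> int \<Rightarrow> complex" where
  "root_char n x = cis (2 * pi * of_int x / real n)"

text \<open>Normalised by \<open>1 / n\<close>, so that for samples of a function the coefficients
  approximate mean values.\<close>

definition dft :: "nat \<Rightarrow> (int \<Rightarrow> complex) \<Rightarrow> int \<Rightarrow> complex" where
  "dft n g k = (\<Sum>j\<in>{0..<int n}. g j * root_char n (- (k * j))) / of_nat n"

definition autocorr :: "nat \<Rightarrow> (int \<Rightarrow> complex) \<Rightarrow> int \<Rightarrow> complex" where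
  "autocorr n g j = (\<Sum>i\<in>{0..<int n}. g (i + j) * cnj (g i)) / of_nat n"

lemma root_char_add: "root_char n (x + y) = root_char n x * root_char n y"
  by (simp add: root_char_def cis_mult add_divide_distrib algebra_simps)

lemma root_char_0 [simp]: "root_char n 0 = 1"
  by (simp add: root_char_def)

lemma root_char_uminus: "root_char n (- x) = cnj (root_char n x)"
  by (simp add: root_char_def cis_cnj)

lemma norm_root_char [simp]: "norm (root_char n x) = 1"
  by (simp add: root_char_def)

lemma root_char_cancel: "root_char n (- x) * root_char n x = 1"
  by (simp add: root_char_add[symmetric])

lemma root_char_multiple: "n > 0 \<Longrightarrow> root_char n (int n * x) = 1"
  using cis_multiple_2pi[of "of_int x"] by (simp add: root_char_def mult.assoc)

lemma root_char_eq_1: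
  assumes n: "n > 0" and x: "0 < \<bar>x\<bar>" "\<bar>x\<bar> < int n"
  shows "root_char n x \<noteq> 1"
proof
  assume "root_char n x = 1"
  then have "cos (2 * pi * of_int x / real n) = 1" by (simp add: root_char_def complex_eq_iff)
  then obtain m :: int where "2 * pi * of_int x / real n = of_int m * (2 * pi)"
    by (auto simp: cos_one_2pi_int)
  then have "of_int x = (of_int m * real n :: real)" using n by (simp add: field_simps)
  then have "x = m * int n" by (metis of_int_eq_iff of_int_mult of_int_of_nat_eq)
  then have "int n dvd x" by simp
  then show False using x dvd_imp_le_int[of x "int n"] by auto
qed

lemma sum_periodic_shift:
  fixes \<phi> :: "int \<Rightarrow> 'a::comm_monoid_add"
  assumes n: "n > 0" and per: "\<And>x. \<phi> (x + int n) = \<phi> x"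
  shows "(\<Sum>j\<in>{0..<int n}. \<phi> (j + s)) = (\<Sum>j\<in>{0..<int n}. \<phi> j)"
proof -
  have per_nat: "\<phi> (x + int n * int k) = \<phi> x" for x k
  proof (induction k)
    case (Suc k)
    have "\<phi> (x + int n * int (Suc k)) = \<phi> ((x + int n * int k) + int n)" by (simp add: algebra_simps)
    then show ?case using per Suc by simp
  qed simp
  have per_int: "\<phi> (x + int n * k) = \<phi> x" for x k
  proof (cases "k \<ge> 0")
    case True then show ?thesis using per_nat[of x "nat k"] by simp
  next
    case False then show ?thesis using per_nat[of "x + int n * k" "nat (- k)"] by simp
  qed
  have per_mod: "\<phi> (x mod int n) = \<phi> x" for x
    using per_int[of "x mod int n" "x div int n"] by (simp add: add.commute)
  have mod_shift: "(k mod int n + l) mod int n = (k + l) mod int n" for k l by (rule mod_add_left_eq)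
  show ?thesis
    by (rule sum.reindex_bij_witness[where i = "\<lambda>j. (j - s) mod int n" and j = "\<lambda>j. (j + s) mod int n"])
      (use n per_mod mod_shift[of _ "- s"] mod_shift[of _ s] in auto)
qed

text \<open>Shifting \<open>k\<close> by one multiplies the sum by \<open>root_char n x\<close>,
  which differs from 1 unless \<open>x = 0\<close>.\<close>

lemma root_char_orthogonal:
  assumes n: "n > 0" and x: "\<bar>x\<bar> < int n"
  shows "(\<Sum>k\<in>{0..<int n}. root_char n (k * x)) = (if x = 0 then of_nat n else 0)"
proof (cases "x = 0")
  case False
  have "(\<Sum>k\<in>{0..<int n}. root_char n ((k + 1) * x)) = (\<Sum>k\<in>{0..<int n}. root_char n (k * x))"
    using n by (intro sum_periodic_shift[where \<phi> = "\<lambda>k. root_char n (k * x)"])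
      (auto simp: distrib_right root_char_add root_char_multiple)
  then have "(\<Sum>k\<in>{0..<int n}. root_char n (k * x)) * root_char n x = (\<Sum>k\<in>{0..<int n}. root_char n (k * x))"
    by (simp add: distrib_right root_char_add sum_distrib_right)
  then have "(\<Sum>k\<in>{0..<int n}. root_char n (k * x)) * (root_char n x - 1) = 0"
    by (simp add: right_diff_distrib)
  moreover have "root_char n x \<noteq> 1" using root_char_eq_1[OF n _ x] False by auto
  ultimately show ?thesis using False by simp
qed (use n in simp)

lemma complex_norm_sq: "complex_of_real ((norm z)\<^sup>2) = z * cnj z"
  by (rule complex_norm_square)

lemma dft_parseval:
  assumes n: "n > 0"
  shows "(\<Sum>k\<in>{0..<int n}. (norm (dft n g k))\<^sup>2) = (\<Sum>j\<in>{0..<int n}. (norm (g j))\<^sup>2) / n"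
proof -
  let ?I = "{0..<int n}"
  have ker: "(\<Sum>k\<in>?I. root_char n (- (k * j)) * cnj (root_char n (- (k * i)))) = (if i = j then of_nat n else 0)"
    if "i \<in> ?I" "j \<in> ?I" for i j
  proof -
    have "root_char n (- (k * j)) * cnj (root_char n (- (k * i))) = root_char n (k * (i - j))" for k
      by (simp add: root_char_uminus[symmetric] root_char_add[symmetric] algebra_simps)
    then show ?thesis using root_char_orthogonal[OF n, of "i - j"] that by auto
  qed
  have "complex_of_real (\<Sum>k\<in>?I. (norm (dft n g k))\<^sup>2) = (\<Sum>k\<in>?I. dft n g k * cnj (dft n g k))"
    by (simp only: of_real_sum complex_norm_sq)
  also have "\<dots> = (\<Sum>k\<in>?I. (\<Sum>j\<in>?I. \<Sum>i\<in>?I. g j * cnj (g i) * (root_char n (- (k * j)) * cnj (root_char n (- (k * i))))) / (of_nat n * of_nat n))"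
    unfolding dft_def by (simp add: sum_product algebra_simps)
  also have "\<dots> = (\<Sum>k\<in>?I. \<Sum>j\<in>?I. \<Sum>i\<in>?I. g j * cnj (g i) * (root_char n (- (k * j)) * cnj (root_char n (- (k * i))))) / (of_nat n * of_nat n)"
    by (simp only: sum_divide_distrib)
  also have "(\<Sum>k\<in>?I. \<Sum>j\<in>?I. \<Sum>i\<in>?I. g j * cnj (g i) * (root_char n (- (k * j)) * cnj (root_char n (- (k * i)))))
     = (\<Sum>j\<in>?I. \<Sum>i\<in>?I. \<Sum>k\<in>?I. g j * cnj (g i) * (root_char n (- (k * j)) * cnj (root_char n (- (k * i)))))"
    by (subst sum.swap, rule sum.cong[OF refl], rule sum.swap)
  also have "\<dots> = (\<Sum>j\<in>?I. \<Sum>i\<in>?I. g j * cnj (g i) * (if i = j then of_nat n else 0))"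
    by (intro sum.cong refl) (simp only: sum_distrib_left[symmetric] ker)
  also have "\<dots> = (\<Sum>j\<in>?I. g j * cnj (g j) * of_nat n)"
    by (intro sum.cong refl) (simp add: if_distrib[where f = "\<lambda>x. _ * x"] sum.delta cong: if_cong)
  also have "\<dots> / (of_nat n * of_nat n) = complex_of_real ((\<Sum>j\<in>?I. (norm (g j))\<^sup>2) / n)"
    using n by (simp add: sum_distrib_right[symmetric] complex_norm_sq del: of_real_power)
  finally show ?thesis by (simp only: of_real_eq_iff)
qed

lemma autocorr_periodic: "(\<And>x. g (x + int n) = g x) \<Longrightarrow> autocorr n g (j + int n) = autocorr n g j"
  by (simp add: autocorr_def add.assoc[symmetric])

text \<open>The discrete Wiener-Khinchin identity.\<close>

lemma dft_autocorr:
  assumes n: "n > 0" and per: "\<And>x. g (x + int n) = g x"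
  shows "dft n (autocorr n g) k = dft n g k * cnj (dft n g k)"
proof -
  let ?I = "{0..<int n}"
  let ?G = "\<lambda>j. g j * root_char n (- (k * j))"
  have inner: "(\<Sum>j\<in>?I. g (i + j) * root_char n (- (k * j))) = root_char n (k * i) * (\<Sum>j\<in>?I. ?G j)" for i
  proof -
    have "(\<Sum>j\<in>?I. ?G (j + i)) = (\<Sum>j\<in>?I. ?G j)"
    proof (rule sum_periodic_shift[OF n])
      fix x
      have "- (k * (x + int n)) = - (k * x) + int n * (- k)" by (simp add: algebra_simps)
      then show "?G (x + int n) = ?G x" using per root_char_multiple[OF n, of "- k"] by (simp only: root_char_add mult_1_right)
    qed
    moreover have "g (i + j) * root_char n (- (k * j)) = root_char n (k * i) * ?G (j + i)" for j
    proof -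
      have "root_char n (k * i) * root_char n (- (k * (j + i))) = root_char n (- (k * j))"
        by (simp only: root_char_add[symmetric]) (simp add: algebra_simps)
      then show ?thesis by (simp add: algebra_simps)
    qed
    ultimately show ?thesis by (simp add: sum_distrib_left[symmetric])
  qed
  have "dft n (autocorr n g) k = (\<Sum>j\<in>?I. \<Sum>i\<in>?I. cnj (g i) * (g (i + j) * root_char n (- (k * j)))) / (of_nat n * of_nat n)"
  proof -
    have "autocorr n g j * root_char n (- (k * j)) = (\<Sum>i\<in>?I. cnj (g i) * (g (i + j) * root_char n (- (k * j)))) / of_nat n" for j
      by (simp add: autocorr_def sum_distrib_left mult_ac)
    then show ?thesis unfolding dft_def by (simp add: sum_divide_distrib[symmetric])
  qed
  also have "(\<Sum>j\<in>?I. \<Sum>i\<in>?I. cnj (g i) * (g (i + j) * root_char n (- (k * j))))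
     = (\<Sum>i\<in>?I. cnj (g i) * (root_char n (k * i) * (\<Sum>j\<in>?I. ?G j)))"
    by (subst sum.swap) (simp only: sum_distrib_left[symmetric] inner)
  also have "\<dots> = (\<Sum>j\<in>?I. ?G j) * cnj (\<Sum>i\<in>?I. ?G i)"
    by (simp add: sum_distrib_left root_char_uminus[symmetric] algebra_simps)
  finally show ?thesis by (simp add: dft_def)
qed

text \<open>By Parseval for the autocorrelation its energy is a sum of fourth powers of the
  coefficients of \<open>g\<close>. One square is bounded by \<open>h\<close>, and the other is
  turned back into the energy of \<open>g\<close>.\<close>

lemma autocorr_energy_le:
  assumes n: "n > 0" and per: "\<And>x. g (x + int n) = g x"
    and h: "\<And>k. k \<in> {0..<int n} \<Longrightarrow> norm (dft n g k) \<le> h"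
  shows "(\<Sum>j\<in>{0..<int n}. (norm (autocorr n g j))\<^sup>2) \<le> h\<^sup>2 * (\<Sum>j\<in>{0..<int n}. (norm (g j))\<^sup>2)"
proof -
  let ?I = "{0..<int n}"
  have "(\<Sum>j\<in>?I. (norm (autocorr n g j))\<^sup>2) / n = (\<Sum>k\<in>?I. (norm (dft n (autocorr n g) k))\<^sup>2)"
    by (rule dft_parseval[OF n, symmetric])
  also have "\<dots> = (\<Sum>k\<in>?I. (norm (dft n g k))\<^sup>2 * (norm (dft n g k))\<^sup>2)"
    by (simp add: dft_autocorr[where g = g, OF n per] norm_mult power_mult_distrib)
  also have "\<dots> \<le> (\<Sum>k\<in>?I. h\<^sup>2 * (norm (dft n g k))\<^sup>2)"
    by (intro sum_mono mult_right_mono power_mono h) auto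
  also have "\<dots> = h\<^sup>2 * ((\<Sum>j\<in>?I. (norm (g j))\<^sup>2) / n)"
    by (simp add: sum_distrib_left[symmetric] dft_parseval[OF n])
  finally show ?thesis using n by (simp add: field_simps)
qed

section \<open>Uniqueness of Fourier series of almost periodic functions\<close>

text \<open>Vanishing of the coefficient at \<open>\<mu>\<close> in real form, which makes sense in
  a real Banach space without complexification.\<close>

definition fourier_null :: "real \<Rightarrow> (real \<Rightarrow> 'a::banach) \<Rightarrow> bool" where
  "fourier_null \<mu> f \<longleftrightarrow> has_mean (\<lambda>t. cos (\<mu> * t) *\<^sub>R f t) 0 \<and> has_mean (\<lambda>t. sin (\<mu> * t) *\<^sub>R f t) 0"

lemma AP_periodic:
  assumes cont: "continuous_on UNIV f" and "p > 0" and per: "\<And>t. f (t + p) = f t"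
  shows "f \<in> AP UNIV"
proof -
  have per_nat: "f (t + real k * p) = f t" for t k
  proof (induction k)
    case (Suc k)
    have "f (t + real (Suc k) * p) = f (t + real k * p + p)" by (simp add: algebra_simps)
    then show ?case using per Suc by simp
  qed simp
  have per_int: "f (t + of_int k * p) = f t" for t k
  proof (cases "k \<ge> 0")
    case True then show ?thesis using per_nat[of t "nat k"] by simp
  next
    case False then show ?thesis using per_nat[of "t + of_int k * p" "nat (- k)"] by simp
  qed
  have "{a..a + p} \<inter> bohr_periods UNIV f e \<noteq> {}" if "e > 0" for a e
  proof -
    have "a / p \<le> of_int \<lceil>a / p\<rceil>" "of_int \<lceil>a / p\<rceil> \<le> a / p + 1" by linarith+
    then have "a / p * p \<le> of_int \<lceil>a / p\<rceil> * p" "of_int \<lceil>a / p\<rceil> * p \<le> (a / p + 1) * p"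
      using \<open>p > 0\<close> by (simp_all only: mult_le_cancel_right_pos)
    moreover have "a / p * p = a" "(a / p + 1) * p = a + p" using \<open>p > 0\<close> by (auto simp: distrib_right)
    ultimately have "of_int \<lceil>a / p\<rceil> * p \<in> {a..a + p}" by simp
    moreover have "of_int \<lceil>a / p\<rceil> * p \<in> bohr_periods UNIV f e" using per_int that by (simp add: bohr_periods_def)
    ultimately show ?thesis by blast
  qed
  then have "relatively_dense UNIV (bohr_periods UNIV f e)" if "e > 0" for e
    using that \<open>p > 0\<close> unfolding relatively_dense_def by blast
  then show ?thesis using cont by (simp add: AP_def)
qed

lemma AP_cos: "(\<lambda>t. cos (\<mu> * t) :: real) \<in> AP UNIV"
proof (cases "\<mu> = 0")
  case True then show ?thesis by (intro AP_periodic[where p = 1]) auto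
next
  case False
  have "cos (\<mu> * (t + 2 * pi / \<bar>\<mu>\<bar>)) = cos (\<mu> * t)" for t
  proof (cases "\<mu> > 0")
    case True
    then have "\<mu> * (t + 2 * pi / \<bar>\<mu>\<bar>) = \<mu> * t + 2 * pi" by (simp add: field_simps)
    then show ?thesis by simp
  next
    case neg: False
    then have "\<mu> * (t + 2 * pi / \<bar>\<mu>\<bar>) = \<mu> * t - 2 * pi" using False by (simp add: field_simps)
    then show ?thesis by (simp add: cos_diff)
  qed
  then show ?thesis using False by (intro AP_periodic[where p = "2 * pi / \<bar>\<mu>\<bar>"]) (auto intro!: continuous_intros)
qed

lemma AP_translate:
  assumes u: "u \<in> AP UNIV" shows "(\<lambda>t. u (t + s)) \<in> AP UNIV"
proof -
  have "bohr_periods UNIV u e \<subseteq> bohr_periods UNIV (\<lambda>t. u (t + s)) e" for e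
  proof
    fix \<tau> assume "\<tau> \<in> bohr_periods UNIV u e"
    then have "norm (u (t + s) - u (t + s + \<tau>)) \<le> e" for t by (rule bohr_periodsD) simp
    then show "\<tau> \<in> bohr_periods UNIV (\<lambda>t. u (t + s)) e" by (simp add: bohr_periods_def ac_simps)
  qed
  moreover have "\<forall>e>0. relatively_dense UNIV (bohr_periods UNIV u e)" using u by (simp add: AP_def)
  ultimately have "\<forall>e>0. relatively_dense UNIV (bohr_periods UNIV (\<lambda>t. u (t + s)) e)"
    unfolding relatively_dense_def disjoint_iff by (simp add: subset_eq) meson
  moreover have "continuous_on UNIV (\<lambda>t. u (t + s))"
    by (rule continuous_on_compose2[OF AP_continuous[OF u]]) (auto intro!: continuous_intros)
  ultimately show ?thesis by (simp add: AP_def)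
qed

lemma AP_sin: "(\<lambda>t. sin (\<mu> * t) :: real) \<in> AP UNIV"
proof (cases "\<mu> = 0")
  case True then show ?thesis by (intro AP_periodic[where p = 1]) auto
next
  case False
  have "(\<lambda>t. sin (\<mu> * t)) = (\<lambda>t. cos (\<mu> * (t + - (pi / 2) / \<mu>)))"
    using False by (simp add: algebra_simps cos_diff fun_eq_iff)
  then show ?thesis by (simp only: AP_translate[OF AP_cos])
qed

lemma AP_cos_scaleR: "u \<in> AP UNIV \<Longrightarrow> (\<lambda>t. cos (\<mu> * t) *\<^sub>R u t) \<in> AP UNIV"
  and AP_sin_scaleR: "u \<in> AP UNIV \<Longrightarrow> (\<lambda>t. sin (\<mu> * t) *\<^sub>R u t) \<in> AP UNIV"
  by (rule AP_bilinear[OF AP_cos _ bounded_bilinear_scaleR], assumption,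
      rule AP_bilinear[OF AP_sin _ bounded_bilinear_scaleR], assumption)

lemma norm_cis_minus_1_sq: "(norm (cis x - 1))\<^sup>2 = 2 - 2 * cos x"
proof -
  have "(norm (cis x - 1))\<^sup>2 = (cos x - 1)\<^sup>2 + (sin x)\<^sup>2" by (simp add: cmod_power2)
  also have "\<dots> = 2 - 2 * cos x" using sin_cos_squared_add[of x] by (simp add: power2_eq_square algebra_simps)
  finally show ?thesis .
qed

lemma norm_cis_minus_1_le: "norm (cis x - 1) \<le> \<bar>x\<bar>"
proof -
  have "cos x = 1 - 2 * (sin (x / 2))\<^sup>2" using cos_double_sin[of "x / 2"] by simp
  then have "(norm (cis x - 1))\<^sup>2 = 4 * (sin (x / 2))\<^sup>2" by (simp add: norm_cis_minus_1_sq)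
  also have "\<dots> \<le> 4 * (x / 2)\<^sup>2"
    using abs_sin_x_le_abs_x[of "x / 2"] by (simp only: abs_le_square_iff mult_le_cancel_left_pos zero_less_numeral)
  also have "\<dots> = \<bar>x\<bar>\<^sup>2" by (simp add: power2_eq_square)
  finally show ?thesis by (rule power2_le_imp_le) simp
qed

text \<open>Uniform in \<open>\<mu>\<close> because a small change of \<open>\<mu>\<close> barely matters on one block of fixed length.\<close>

lemma low_frequency_bound:
  fixes f :: "real \<Rightarrow> real"
  assumes f: "f \<in> AP UNIV" and null: "\<And>\<mu>. fourier_null \<mu> f" and "h > 0"
  obtains N0 where "N0 > 0"
    "\<And>N \<mu>. N \<ge> N0 \<Longrightarrow> \<bar>\<mu>\<bar> \<le> R \<Longrightarrow> norm (integral {0..0 + N} (\<lambda>t. of_real (f t) * cis (- (\<mu> * t)))) \<le> h * N"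
proof -
  obtain M where M: "M > 0" "\<And>t. norm (f t) \<le> M" using AP_bounded[OF f] by blast
  define g where "g \<mu> t = complex_of_real (f t) * cis (- (\<mu> * t))" for \<mu> t
  have contf: "continuous_on UNIV f" by (rule AP_continuous[OF f])
  have contg: "continuous_on UNIV (g \<mu>)" for \<mu>
    unfolding g_def cis_conv_exp by (intro continuous_intros contf)
  have intg: "g \<mu> integrable_on {a..b}" for \<mu> a b
    by (intro integrable_continuous_interval continuous_on_subset[OF contg]) auto
  have Mg: "norm (g \<mu> t) \<le> M" for \<mu> t using M(2)[of t] by (simp add: g_def norm_mult)
  have mean: "has_mean (g \<mu>) 0" for \<mu>
  proof -
    have "bounded_linear (\<lambda>x. - \<i> * complex_of_real x)"
      by (intro bounded_linear_compose[OF bounded_linear_mult_right bounded_linear_of_real])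
    from has_mean_linear_combination[OF AP_cos_scaleR[OF f] AP_sin_scaleR[OF f] _ _ bounded_linear_of_real this, of \<mu> 0 \<mu> 0] null[of \<mu>]
    have "has_mean (\<lambda>t. complex_of_real (cos (\<mu> * t) *\<^sub>R f t) + - \<i> * complex_of_real (sin (\<mu> * t) *\<^sub>R f t)) 0"
      by (simp add: fourier_null_def)
    moreover have "(\<lambda>t. complex_of_real (cos (\<mu> * t) *\<^sub>R f t) + - \<i> * complex_of_real (sin (\<mu> * t) *\<^sub>R f t)) = g \<mu>"
      by (auto simp: g_def fun_eq_iff complex_eq_iff)
    ultimately show ?thesis by simp
  qed
  have "\<exists>T \<rho>. T > 0 \<and> \<rho> > 0 \<and> (\<forall>\<nu>. \<bar>\<nu> - \<mu>\<bar> < \<rho> \<longrightarrow> (\<forall>a. norm (integral {a..a + T} (g \<nu>)) \<le> h/2 * T))" for \<mu>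
  proof -
    have "h/4 > 0" using \<open>h > 0\<close> by simp
    from has_meanE[OF mean this, of \<mu>] obtain T where T: "T > 0" "\<And>a. norm (integral {a..a + T} (g \<mu>)) \<le> h/4 * T"
      by (metis order_refl diff_zero scaleR_zero_right)
    \<comment> \<open>Over a block of length \<open>T\<close> a frequency change below
      \<open>\<rho>\<close> turns the phase by at most \<open>\<rho> * T\<close>, and
      \<open>M * (\<rho> * T) = h / 4\<close>.\<close>
    define \<rho> where "\<rho> = h / (4 * M * T)"
    have "\<rho> > 0" using \<open>h > 0\<close> M T by (simp add: \<rho>_def)
    have "norm (integral {a..a + T} (g \<nu>)) \<le> h/2 * T" if \<nu>: "\<bar>\<nu> - \<mu>\<bar> < \<rho>" for \<nu> a
    proof -
      \<comment> \<open>The constant phase \<open>z\<close> cancels the frequency difference at the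
        left end of the block. What remains depends on \<open>t - a\<close> only, hence is small
        uniformly in the position \<open>a\<close>.\<close>
      define z where "z = cis (- ((\<nu> - \<mu>) * a))"
      have nz: "norm z = 1" by (simp add: z_def)
      have diff: "norm (g \<nu> t - z * g \<mu> t) \<le> h/4" if t: "t \<in> {a..a + T}" for t
      proof -
        have "g \<nu> t = z * g \<mu> t * cis (- ((\<nu> - \<mu>) * (t - a)))"
          by (simp add: g_def z_def cis_mult algebra_simps)
        then have "norm (g \<nu> t - z * g \<mu> t) = norm (g \<mu> t) * norm (cis (- ((\<nu> - \<mu>) * (t - a))) - 1)"
          by (metis (no_types, lifting) mult.right_neutral nz norm_mult right_diff_distrib' mult.left_neutral)
        also have "\<dots> \<le> M * \<bar>(\<nu> - \<mu>) * (t - a)\<bar>"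
        proof (intro mult_mono Mg)
          show "norm (cis (- ((\<nu> - \<mu>) * (t - a))) - 1) \<le> \<bar>(\<nu> - \<mu>) * (t - a)\<bar>"
            by (rule norm_cis_minus_1_le[of "- ((\<nu> - \<mu>) * (t - a))", simplified abs_minus_cancel])
        qed (use M in auto)
        also have "\<dots> \<le> M * (\<rho> * T)" using \<nu> t M(1) T(1)
          by (intro mult_left_mono) (auto simp: abs_mult intro!: mult_mono)
        also have "\<dots> = h/4" using M(1) T(1) by (simp add: \<rho>_def)
        finally show ?thesis .
      qed
      have intz: "(\<lambda>t. z * g \<mu> t) integrable_on {a..a + T}"
        by (intro integrable_continuous_interval continuous_intros continuous_on_subset[OF contg]) auto
      have "norm (integral {a..a + T} (\<lambda>t. g \<nu> t - z * g \<mu> t)) \<le> h/4 * (a + T - a)"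
        using T(1) diff by (intro integral_bound) (auto intro!: continuous_intros continuous_on_subset[OF contg])
      moreover have "integral {a..a + T} (\<lambda>t. g \<nu> t - z * g \<mu> t) = integral {a..a + T} (g \<nu>) - z * integral {a..a + T} (g \<mu>)"
        using intg intz by (subst Henstock_Kurzweil_Integration.integral_diff) auto
      moreover have "norm (z * integral {a..a + T} (g \<mu>)) \<le> h/4 * T" using T(2)[of a] nz by (simp add: norm_mult)
      moreover have "norm (integral {a..a + T} (g \<nu>)) \<le> norm (z * integral {a..a + T} (g \<mu>)) + norm (integral {a..a + T} (g \<nu>) - z * integral {a..a + T} (g \<mu>))"
        by (rule norm_triangle_sub)
      ultimately show ?thesis by simp
    qed
    then show ?thesis using T(1) \<open>\<rho> > 0\<close> by blast
  qed
  then obtain T \<rho> where T: "\<And>\<mu>. T \<mu> > 0" and \<rho>: "\<And>\<mu>. \<rho> \<mu> > 0"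
    and blk: "\<And>\<mu> \<nu> a. \<bar>\<nu> - \<mu>\<bar> < \<rho> \<mu> \<Longrightarrow> norm (integral {a..a + T \<mu>} (g \<nu>)) \<le> h/2 * T \<mu>"
    by metis
  have "{- R..R} \<subseteq> (\<Union>\<mu>\<in>{- R..R}. ball \<mu> (\<rho> \<mu>))" using \<rho> by force
  from compactE_image[OF compact_Icc _ this] obtain D where D: "D \<subseteq> {- R..R}" "finite D" "{- R..R} \<subseteq> (\<Union>\<mu>\<in>D. ball \<mu> (\<rho> \<mu>))"
    by auto
  \<comment> \<open>The sum dominates each of finitely many thresholds, beyond which the remainder
    \<open>2 * M * T \<mu>\<close> of the block estimate is at most
    \<open>h / 2 * N\<close>.\<close>
  define N0 where "N0 = 1 + (\<Sum>\<mu>\<in>D. 4 * M * T \<mu> / h)"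
  have N0: "4 * M * T \<mu> / h \<le> N0" if "\<mu> \<in> D" for \<mu>
  proof -
    have "4 * M * T \<mu> / h \<le> (\<Sum>\<mu>\<in>D. 4 * M * T \<mu> / h)"
      using T M(1) \<open>h > 0\<close> D(2) that by (intro member_le_sum) (auto intro!: divide_nonneg_pos simp: less_imp_le)
    then show ?thesis by (simp add: N0_def)
  qed
  have "N0 > 0" using T M(1) \<open>h > 0\<close> by (simp add: N0_def add_pos_nonneg sum_nonneg divide_nonneg_pos less_imp_le)
  moreover have "norm (integral {0..0 + N} (g \<nu>)) \<le> h * N" if N: "N \<ge> N0" and \<nu>: "\<bar>\<nu>\<bar> \<le> R" for N \<nu>
  proof -
    have "\<nu> \<in> {- R..R}" using \<nu> by (simp add: abs_le_iff)
    then obtain \<mu> where \<mu>: "\<mu> \<in> D" "\<bar>\<nu> - \<mu>\<bar> < \<rho> \<mu>" using D(3) by (auto simp: dist_real_def abs_minus_commute)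
    have "norm (integral {0..0 + N} (g \<nu>) - (N / T \<mu>) *\<^sub>R 0) \<le> h/2 * N + 2 * M * T \<mu>"
      using blk[OF \<mu>(2)] \<open>N0 > 0\<close> N T[of \<mu>] M(1)
      by (intro integral_blocks_bound_real[OF contg Mg]) auto
    moreover have "2 * M * T \<mu> \<le> h/2 * N" using order_trans[OF N0[OF \<mu>(1)] N] \<open>h > 0\<close>
      by (simp add: pos_divide_le_eq mult_ac)
    ultimately show ?thesis by simp
  qed
  ultimately show thesis using that[of N0] unfolding g_def by simp
qed

lemma riemann_sum_bound:
  fixes g :: "real \<Rightarrow> complex"
  assumes cont: "continuous_on UNIV g" and "h > 0"
    and osc: "\<And>s t. \<bar>s - t\<bar> \<le> h \<Longrightarrow> norm (g s - g t) \<le> \<eta>"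
  shows "norm (integral {0..0 + real n * h} g - h *\<^sub>R (\<Sum>j<n. g (h * real j))) \<le> \<eta> * (real n * h)"
proof (induction n)
  case (Suc n)
  let ?a = "real n * h"
  have "norm (integral {?a..?a + h} (\<lambda>t. g t - g ?a)) \<le> \<eta> * (?a + h - ?a)"
    using \<open>h > 0\<close> by (intro integral_bound osc) (auto intro!: continuous_intros continuous_on_subset[OF cont])
  moreover have "integral {?a..?a + h} (\<lambda>t. g t - g ?a) = integral {?a..?a + h} g - h *\<^sub>R g ?a"
    using \<open>h > 0\<close> by (subst Henstock_Kurzweil_Integration.integral_diff)
      (auto intro!: integrable_continuous_interval continuous_on_subset[OF cont])
  ultimately have 1: "norm (integral {?a..?a + h} g - h *\<^sub>R g ?a) \<le> \<eta> * h" by simp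
  have eq: "integral {0..0 + (real n * h + h)} g = integral {0..0 + real n * h} g + integral {0 + real n * h..0 + real n * h + h} g"
    using \<open>h > 0\<close> by (intro integral_split_add cont) auto
  have "integral {0..0 + real (Suc n) * h} g - h *\<^sub>R (\<Sum>j<Suc n. g (h * real j))
    = (integral {0..0 + ?a} g - h *\<^sub>R (\<Sum>j<n. g (h * real j))) + (integral {?a..?a + h} g - h *\<^sub>R g ?a)"
    using eq by (simp add: algebra_simps)
  also have "norm \<dots> \<le> \<eta> * ?a + \<eta> * h" by (intro norm_triangle_le add_mono Suc 1)
  finally show ?case by (simp add: algebra_simps)
qed simp

text \<open>Up to \<open>e\<close> the function has only finitely many different translates. Hence
  some class contains at least the fraction \<open>1 / p\<close> of the grid points, with
  \<open>p\<close> independent of the mesh and of the number of points.\<close>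

lemma AP_grid_pigeonhole:
  assumes f: "f \<in> AP UNIV" and "e > 0"
  obtains p :: nat where "p > 0" "\<And>h n. n > 0 \<Longrightarrow> \<exists>J j0. J \<subseteq> {0..<int n} \<and> j0 \<in> J \<and> n \<le> card J * p \<and>
     (\<forall>j\<in>J. \<forall>x. norm (f (x + of_int (j - j0) * h) - f x) \<le> e)"
proof -
  have "e/3 > 0" using \<open>e > 0\<close> by simp
  obtain l where l: "l > 0" "\<And>t. \<exists>s\<in>{0..l}. t - s \<in> bohr_periods UNIV f (e/3)"
    using AP_shift_to_compact[OF f \<open>e/3 > 0\<close>] by blast
  obtain d where d: "d > 0" "\<And>s t. \<bar>s - t\<bar> < d \<Longrightarrow> norm (f s - f t) < e/3"
    using AP_uniformly_continuous[OF f \<open>e/3 > 0\<close>] by blast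
  obtain S where S: "\<And>t. 0 \<le> S t" "\<And>t. S t \<le> l" "\<And>t. t - S t \<in> bohr_periods UNIV f (e/3)"
    using l(2) by (metis atLeastAtMost_iff)
  define c where "c t = \<lfloor>S t / d\<rfloor>" for t
  define K where "K = {0..\<lfloor>l / d\<rfloor>}"
  have cK: "c t \<in> K" for t
    using S[of t] d(1) unfolding c_def K_def by (auto intro!: floor_mono divide_right_mono)
  have finK: "finite K" by (simp add: K_def)
  have "card K > 0" using cK finK by (metis card_gt_0_iff empty_iff)
  have close: "norm (f (x + t) - f (x + t')) \<le> e" if "c t = c t'" for x t t'
  proof -
    have "\<bar>S t / d - S t' / d\<bar> < 1" using that unfolding c_def by linarith
    then have "\<bar>(S t - S t') / d\<bar> < 1" by (simp add: diff_divide_distrib)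
    then have "\<bar>S t - S t'\<bar> < d" using d(1) by (simp add: abs_less_iff field_simps)
    then have "norm (f (x + S t) - f (x + S t')) < e/3" by (intro d(2)) simp
    moreover have "norm (f (x + S t) - f (x + t)) \<le> e/3" using bohr_periodsD[OF S(3)[of t], of "x + S t"] by simp
    moreover have "norm (f (x + S t') - f (x + t')) \<le> e/3" using bohr_periodsD[OF S(3)[of t'], of "x + S t'"] by simp
    ultimately have "norm (f (x + t) - f (x + t')) \<le> e/3 + e/3 + e/3" by norm
    then show ?thesis by simp
  qed
  have main: "\<exists>J j0. J \<subseteq> {0..<int n} \<and> j0 \<in> J \<and> n \<le> card J * card K \<and>
     (\<forall>j\<in>J. \<forall>x. norm (f (x + of_int (j - j0) * h) - f x) \<le> e)" if "n > 0" for h n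
  proof -
    define J where "J k = {j \<in> {0..<int n}. c (of_int j * h) = k}" for k
    have "\<exists>k\<in>K. n \<le> card (J k) * card K"
    proof (rule ccontr)
      assume "\<not> ?thesis"
      then have lt: "card (J k) * card K < n" if "k \<in> K" for k using that by force
      have "{0..<int n} = (\<Union>k\<in>K. J k)" using cK by (auto simp: J_def)
      then have "n = card (\<Union>k\<in>K. J k)" by (metis card_atLeastLessThan_int diff_zero nat_int)
      also have "\<dots> \<le> (\<Sum>k\<in>K. card (J k))" by (rule card_UN_le[OF finK])
      finally have "n * card K \<le> (\<Sum>k\<in>K. card (J k) * card K)" by (simp add: sum_distrib_right[symmetric])
      also have "\<dots> < (\<Sum>k\<in>K. n)" using lt finK \<open>card K > 0\<close> by (intro sum_strict_mono) auto
      also have "\<dots> = n * card K" by simp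
      finally show False by simp
    qed
    then obtain k where k: "n \<le> card (J k) * card K" by blast
    then have "card (J k) > 0" using that by (cases "card (J k)") auto
    then obtain j0 where j0: "j0 \<in> J k" by (metis card_gt_0_iff ex_in_conv)
    have "norm (f (x + of_int (j - j0) * h) - f x) \<le> e" if "j \<in> J k" for j x
    proof -
      have "c (of_int j * h) = c (of_int j0 * h)" using that j0 by (simp add: J_def)
      from close[OF this, of "x - of_int j0 * h"] show ?thesis by (simp add: algebra_simps)
    qed
    moreover have "J k \<subseteq> {0..<int n}" by (auto simp: J_def)
    ultimately show ?thesis using j0 k by blast
  qed
  show thesis by (rule that[OF \<open>card K > 0\<close> main])
qed

text \<open>A cyclic shift by \<open>s\<close> multiplies the coefficient by a number at distance at
  least 1 from 1, yet changes \<open>g\<close> by at most \<open>e\<close>; so the coefficient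
  itself is at most \<open>e\<close>.\<close>

lemma dft_high_frequency:
  assumes n: "n > 0" and per: "\<And>x. g (x + int n) = g x"
    and e: "\<And>j. j \<in> {0..<int n} \<Longrightarrow> norm (g (j + s) - g j) \<le> e"
    and ge: "norm (root_char n (k * s) - 1) \<ge> 1"
  shows "norm (dft n g k) \<le> e"
proof -
  let ?I = "{0..<int n}"
  let ?G = "\<lambda>j. g j * root_char n (- (k * j))"
  have perG: "?G (x + int n) = ?G x" for x
  proof -
    have "- (k * (x + int n)) = - (k * x) + int n * (- k)" by (simp add: algebra_simps)
    then show ?thesis using per root_char_multiple[OF n, of "- k"] by (simp only: root_char_add mult_1_right)
  qed
  have "(\<Sum>j\<in>?I. ?G j) = (\<Sum>j\<in>?I. ?G (j + s))" by (rule sum_periodic_shift[where \<phi> = ?G, OF n perG, symmetric])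
  also have "\<dots> = (\<Sum>j\<in>?I. g (j + s) * root_char n (- (k * j))) * root_char n (- (k * s))"
  proof -
    have "- (k * (j + s)) = - (k * j) + - (k * s)" for j by (simp add: distrib_left)
    then show ?thesis by (simp only: root_char_add sum_distrib_right mult.assoc)
  qed
  finally have "root_char n (k * s) * (\<Sum>j\<in>?I. ?G j) =
      (\<Sum>j\<in>?I. g (j + s) * root_char n (- (k * j))) * (root_char n (- (k * s)) * root_char n (k * s))"
    by (simp add: mult_ac)
  then have "root_char n (k * s) * (\<Sum>j\<in>?I. ?G j) = (\<Sum>j\<in>?I. g (j + s) * root_char n (- (k * j)))"
    by (simp only: root_char_cancel mult_1_right)
  then have "(root_char n (k * s) - 1) * (\<Sum>j\<in>?I. ?G j) = (\<Sum>j\<in>?I. (g (j + s) - g j) * root_char n (- (k * j)))"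
    by (simp add: left_diff_distrib sum_subtractf)
  then have "norm (root_char n (k * s) - 1) * norm (\<Sum>j\<in>?I. ?G j) = norm (\<Sum>j\<in>?I. (g (j + s) - g j) * root_char n (- (k * j)))"
    by (simp only: norm_mult[symmetric])
  also have "\<dots> \<le> (\<Sum>j\<in>?I. e)" using e by (intro sum_norm_le) (simp add: norm_mult)
  finally have "norm (root_char n (k * s) - 1) * norm (\<Sum>j\<in>?I. ?G j) \<le> real n * e" by simp
  moreover have "1 * norm (\<Sum>j\<in>?I. ?G j) \<le> norm (root_char n (k * s) - 1) * norm (\<Sum>j\<in>?I. ?G j)"
    using ge by (intro mult_right_mono) auto
  ultimately have "norm (\<Sum>j\<in>?I. ?G j) \<le> real n * e" by linarith
  then show ?thesis using n by (simp add: dft_def norm_divide pos_divide_le_eq mult.commute)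
qed

lemma norm_cis_minus_1_ge:
  assumes "pi / 3 \<le> x" "x \<le> pi"
  shows "norm (cis x - 1) \<ge> 1"
proof -
  have "cos x \<le> cos (pi / 3)" using assms by (intro cos_monotone_0_pi_le) auto
  then have c: "cos x \<le> 1/2" by (simp add: cos_60)
  then have "1\<^sup>2 \<le> (norm (cis x - 1))\<^sup>2" by (simp add: norm_cis_minus_1_sq)
  then show ?thesis by (rule power2_le_imp_le) simp
qed

text \<open>Steps smaller than \<open>pi / 3\<close> cannot jump over the interval from
  \<open>pi / 3\<close> to \<open>pi\<close>.\<close>

lemma angle_multiple:
  assumes "0 < \<theta>" "\<theta> \<le> pi"
  obtains s :: nat where "pi / 3 \<le> real s * \<theta>" "real s * \<theta> \<le> pi"
proof (cases "\<theta> \<ge> pi / 3")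
  case True then show thesis using that[of 1] assms by simp
next
  case False
  define s where "s = nat \<lceil>pi / 3 / \<theta>\<rceil>"
  have "0 \<le> \<lceil>pi / 3 / \<theta>\<rceil>" using assms by (simp add: less_le_trans[of _ 0])
  then have "real s = of_int \<lceil>pi / 3 / \<theta>\<rceil>" by (simp add: s_def)
  then have "pi / 3 / \<theta> \<le> real s" "real s \<le> pi / 3 / \<theta> + 1" by linarith+
  then have "pi / 3 / \<theta> * \<theta> \<le> real s * \<theta>" "real s * \<theta> \<le> (pi / 3 / \<theta> + 1) * \<theta>"
    using assms(1) by (simp_all only: mult_le_cancel_right_pos)
  moreover have "pi / 3 / \<theta> * \<theta> = pi / 3" "(pi / 3 / \<theta> + 1) * \<theta> = pi / 3 + \<theta>" using assms by (auto simp: field_simps)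
  ultimately show thesis using that[of s] False pi_gt_zero by linarith
qed

lemma sum_int_lessThan: "(\<Sum>j\<in>{0..<int n}. \<phi> j) = (\<Sum>j<n. \<phi> (int j))"
  by (rule sum.reindex_bij_witness[where i = int and j = nat]) auto

text \<open>For low frequencies the coefficient is a Riemann sum of an integral controlled by
  \<open>low_frequency_bound\<close>. For high ones a time shift below \<open>d1\<close> turns the
  phase by at least \<open>pi / 3\<close> while \<open>f\<close> hardly changes, and
  \<open>dft_high_frequency\<close> applies. The sampled length being an almost period of
  \<open>f\<close> makes the cyclic shift harmless.\<close>

lemma sampled_dft_small:
  fixes f :: "real \<Rightarrow> real"
  assumes f: "f \<in> AP UNIV" and null: "\<And>\<mu>. fourier_null \<mu> f" and "\<eta> > 0"
  obtains N0 h0 where "N0 > 0" "h0 > 0"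
    "\<And>h n k. n > 0 \<Longrightarrow> 0 < h \<Longrightarrow> h \<le> h0 \<Longrightarrow> real n * h \<ge> N0 \<Longrightarrow> real n * h \<in> bohr_periods UNIV f (\<eta>/2) \<Longrightarrow>
      norm (dft n (\<lambda>x. complex_of_real (f (h * of_int (x mod int n)))) k) \<le> \<eta>"
proof -
  obtain M where M: "M > 0" "\<And>t. norm (f t) \<le> M" using AP_bounded[OF f] by blast
  have "\<eta>/2 > 0" "\<eta>/4 > 0" using \<open>\<eta> > 0\<close> by auto
  obtain d1 where d1: "d1 > 0" "\<And>s t. \<bar>s - t\<bar> < d1 \<Longrightarrow> norm (f s - f t) < \<eta>/2"
    using AP_uniformly_continuous[OF f \<open>\<eta>/2 > 0\<close>] by blast
  \<comment> \<open>Above this frequency a phase shift of at most \<open>pi\<close> is a time shift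
    of less than \<open>d1\<close>.\<close>
  define R where "R = pi / d1"
  have "R > 0" using d1 by (simp add: R_def)
  obtain N0 where N0: "N0 > 0"
    "\<And>N \<mu>. N \<ge> N0 \<Longrightarrow> \<bar>\<mu>\<bar> \<le> R \<Longrightarrow> norm (integral {0..0 + N} (\<lambda>t. of_real (f t) * cis (- (\<mu> * t)))) \<le> \<eta>/2 * N"
    using low_frequency_bound[OF f null \<open>\<eta>/2 > 0\<close>] by blast
  obtain d2 where d2: "d2 > 0" "\<And>s t. \<bar>s - t\<bar> < d2 \<Longrightarrow> norm (f s - f t) < \<eta>/4"
    using AP_uniformly_continuous[OF f \<open>\<eta>/4 > 0\<close>] by blast
  \<comment> \<open>The first bound controls the oscillation of \<open>f\<close> over one mesh cell,
    the second that of the phase for frequencies up to \<open>R\<close>.\<close>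
  define h0 where "h0 = min (d2/2) (\<eta> / (4 * M * R))"
  have "h0 > 0" using d2 \<open>\<eta> > 0\<close> M \<open>R > 0\<close> by (simp add: h0_def)
  have main: "norm (dft n (\<lambda>x. complex_of_real (f (h * of_int (x mod int n)))) k) \<le> \<eta>"
    if n: "n > 0" and h: "0 < h" "h \<le> h0" and N: "real n * h \<ge> N0" "real n * h \<in> bohr_periods UNIV f (\<eta>/2)"
      and k: "2 * \<bar>k\<bar> \<le> int n" for h n k
  proof -
    define g where "g x = complex_of_real (f (h * of_int (x mod int n)))" for x
    define \<mu> where "\<mu> = 2 * pi * of_int k / (real n * h)"
    have nh: "real n * h > 0" using n h by simp
    have rc: "root_char n (- (k * x)) = cis (- (\<mu> * (h * of_int x)))" for x
      using n h by (simp add: root_char_def \<mu>_def field_simps)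
    have "norm (dft n g k) \<le> \<eta>"
    proof (cases "\<bar>\<mu>\<bar> \<le> R")
      case True
      define G where "G t = complex_of_real (f t) * cis (- (\<mu> * t))" for t
      have contG: "continuous_on UNIV G"
        unfolding G_def cis_conv_exp by (intro continuous_intros AP_continuous[OF f])
      have osc: "norm (G s - G t) \<le> \<eta>/2" if st: "\<bar>s - t\<bar> \<le> h" for s t
      proof -
        have eq: "G s - G t = of_real (f s - f t) * cis (- (\<mu> * s)) + of_real (f t) * (cis (- (\<mu> * t)) * (cis (- (\<mu> * (s - t))) - 1))"
          by (simp add: G_def right_diff_distrib cis_mult algebra_simps)
        have "norm (f s - f t) < \<eta>/4" using st h d2 by (intro d2(2)) (auto simp: h0_def)
        then have 1: "norm (of_real (f s - f t) * cis (- (\<mu> * s))) \<le> \<eta>/4" by (simp add: norm_mult del: of_real_diff)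
        have "norm (cis (- (\<mu> * (s - t))) - 1) \<le> \<bar>- (\<mu> * (s - t))\<bar>" by (rule norm_cis_minus_1_le)
        also have "\<dots> \<le> R * h" using True st by (simp add: abs_mult) (intro mult_mono, auto)
        also have "\<dots> \<le> R * (\<eta> / (4 * M * R))" using h \<open>R > 0\<close> by (intro mult_left_mono) (auto simp: h0_def)
        finally have c: "norm (cis (- (\<mu> * (s - t))) - 1) \<le> \<eta> / (4 * M)" using \<open>R > 0\<close> by simp
        have "norm (of_real (f t) * (cis (- (\<mu> * t)) * (cis (- (\<mu> * (s - t))) - 1))) = norm (f t) * norm (cis (- (\<mu> * (s - t))) - 1)"
          by (simp add: norm_mult)
        also have "\<dots> \<le> M * (\<eta> / (4 * M))" using M c by (intro mult_mono) auto
        finally have 2: "norm (of_real (f t) * (cis (- (\<mu> * t)) * (cis (- (\<mu> * (s - t))) - 1))) \<le> \<eta>/4" using M by simp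
        from norm_triangle_le[OF add_mono[OF 1 2]] show ?thesis unfolding eq by simp
      qed
      have "norm (integral {0..0 + real n * h} G - h *\<^sub>R (\<Sum>j<n. G (h * real j))) \<le> \<eta>/2 * (real n * h)"
        by (rule riemann_sum_bound[OF contG h(1) osc])
      moreover have "norm (integral {0..0 + real n * h} G) \<le> \<eta>/2 * (real n * h)"
        unfolding G_def by (rule N0(2)[OF N(1) True])
      ultimately have le: "norm (h *\<^sub>R (\<Sum>j<n. G (h * real j))) \<le> \<eta> * (real n * h)"
        using norm_triangle_sub[of "h *\<^sub>R (\<Sum>j<n. G (h * real j))" "integral {0..0 + real n * h} G"]
        by (simp add: norm_minus_commute)
      have "(\<Sum>j\<in>{0..<int n}. g j * root_char n (- (k * j))) = (\<Sum>j<n. G (h * real j))"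
        unfolding sum_int_lessThan by (intro sum.cong refl) (simp add: g_def G_def rc)
      then have "norm (dft n g k) = norm (\<Sum>j<n. G (h * real j)) / real n"
        by (simp add: dft_def norm_divide)
      also have "\<dots> \<le> \<eta>" using le n h(1) by (simp add: pos_divide_le_eq mult.commute mult.left_commute)
      finally show ?thesis .
    next
      case False
      define \<theta> where "\<theta> = \<bar>\<mu>\<bar> * h"
      have "\<bar>\<mu>\<bar> > R" using False by simp
      have \<theta>eq: "\<theta> = 2 * pi * of_int \<bar>k\<bar> / real n" using n h by (simp add: \<theta>_def \<mu>_def abs_mult abs_divide)
      have "real_of_int (2 * \<bar>k\<bar>) \<le> of_int (int n)" using k by (simp only: of_int_le_iff)
      then have "pi * (2 * of_int \<bar>k\<bar>) \<le> pi * real n" by (intro mult_left_mono) auto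
      then have "\<theta> \<le> pi" using n by (simp add: \<theta>eq pos_divide_le_eq mult_ac)
      have "\<theta> > 0" using \<open>\<bar>\<mu>\<bar> > R\<close> \<open>R > 0\<close> h by (simp add: \<theta>_def)
      obtain s :: nat where s: "pi / 3 \<le> real s * \<theta>" "real s * \<theta> \<le> pi" using angle_multiple[OF \<open>\<theta> > 0\<close> \<open>\<theta> \<le> pi\<close>] by blast
      have kn: "2 * pi / real n \<le> \<theta>"
      proof -
        have "k \<noteq> 0" using \<open>\<theta> > 0\<close> by (auto simp: \<theta>eq)
        then have "1 \<le> real_of_int \<bar>k\<bar>" by linarith
        then have "2 * pi * 1 \<le> 2 * pi * real_of_int \<bar>k\<bar>" by (intro mult_left_mono) auto
        then show ?thesis using n unfolding \<theta>eq by (intro divide_right_mono) auto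
      qed
      have "real s * (2 * pi / real n) \<le> real s * \<theta>" using kn by (intro mult_left_mono) auto
      then have "real s * (2 * pi / real n) \<le> pi" using s(2) by linarith
      then have "real s * 2 \<le> real n" using n by (simp add: pos_divide_le_eq field_simps)
      then have sn: "int s \<le> int n" by linarith
      have sh: "real s * h < d1"
      proof -
        have "real s * h * \<bar>\<mu>\<bar> \<le> pi" using s(2) by (simp add: \<theta>_def mult_ac)
        moreover have "real s > 0" using s(1) pi_gt_zero by (cases s) auto
        then have "real s * h * R < real s * h * \<bar>\<mu>\<bar>" using \<open>\<bar>\<mu>\<bar> > R\<close> h by simp
        ultimately have "real s * h * R < pi" by linarith
        then show ?thesis using d1(1) by (simp add: R_def pos_divide_less_eq field_simps)
      qed
      show ?thesis
      proof (rule dft_high_frequency[OF n, where s = "int s"])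
        show "g (x + int n) = g x" for x by (simp add: g_def)
        show "norm (root_char n (k * int s) - 1) \<ge> 1"
        proof (cases "k \<ge> 0")
          case True
          then have "root_char n (k * int s) = cis (real s * \<theta>)" by (simp add: root_char_def \<theta>eq mult_ac)
          then show ?thesis using norm_cis_minus_1_ge[OF s] by simp
        next
          case False
          then have "root_char n (k * int s) = cnj (cis (real s * \<theta>))" by (simp add: root_char_def \<theta>eq mult_ac cis_cnj)
          then have "root_char n (k * int s) - 1 = cnj (cis (real s * \<theta>) - 1)" by simp
          then show ?thesis using norm_cis_minus_1_ge[OF s] by (simp only: complex_mod_cnj)
        qed
        fix j assume j: "j \<in> {0..<int n}"
        have gj: "g j = of_real (f (h * of_int j))" using j by (simp add: g_def)
        have a: "norm (f (h * of_int (j + int s)) - f (h * of_int j)) < \<eta>/2"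
          using sh h by (intro d1(2)) (simp add: distrib_left mult.commute)
        \<comment> \<open>Beyond the end of the window the sample wraps around once, and the almost
          period \<open>n * h\<close> compensates.\<close>
        have b: "norm (f (h * of_int ((j + int s) mod int n)) - f (h * of_int (j + int s))) \<le> \<eta>/2"
        proof (cases "j + int s < int n")
          case True then show ?thesis using j \<open>\<eta> > 0\<close> by simp
        next
          case False
          then have "(j + int s) mod int n = j + int s - int n" using j sn by (intro int_mod_pos_eq[where q = 1]) auto
          then have "real_of_int ((j + int s) mod int n) = of_int (j + int s) - real n" by simp
          then have "h * of_int ((j + int s) mod int n) = h * of_int (j + int s) - h * real n" by (simp only: right_diff_distrib)
          then have "h * of_int ((j + int s) mod int n) + real n * h = h * of_int (j + int s)" by (simp only: mult.commute[of h "real n"] diff_add_cancel)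
          then show ?thesis using bohr_periodsD[OF N(2), of "h * of_int ((j + int s) mod int n)"] by simp
        qed
        have "norm (g (j + int s) - g j) = norm (f (h * of_int ((j + int s) mod int n)) - f (h * of_int j))"
          unfolding gj by (simp add: g_def of_real_diff[symmetric] del: of_real_diff)
        then show "norm (g (j + int s) - g j) \<le> \<eta>"
          using norm_diff_triangle_le[OF b less_imp_le[OF a]] by simp
      qed
    qed
    then show ?thesis unfolding g_def .
  qed
  have "norm (dft n (\<lambda>x. complex_of_real (f (h * of_int (x mod int n)))) k) \<le> \<eta>"
    if n: "n > 0" and h: "0 < h" "h \<le> h0" and N: "real n * h \<ge> N0" "real n * h \<in> bohr_periods UNIV f (\<eta>/2)" for h n k
  proof -
    \<comment> \<open>The coefficients depend on \<open>k\<close> only modulo \<open>n\<close>, so a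
      representative with \<open>2 * \<bar>k\<bar> \<le> n\<close> can be used.\<close>
    have per: "dft n g (k' + int n * q) = dft n g k'" for g k' q
    proof -
      have "root_char n (- ((k' + int n * q) * j)) = root_char n (- (k' * j))" for j
      proof -
        have "- ((k' + int n * q) * j) = - (k' * j) + int n * (- (q * j))" by (simp add: algebra_simps)
        then show ?thesis by (simp only: root_char_add root_char_multiple[OF n] mult_1_right)
      qed
      then show ?thesis by (simp add: dft_def)
    qed
    define r where "r = k mod int n"
    have r: "0 \<le> r" "r < int n" "k = r + int n * (k div int n)" using n by (auto simp: r_def)
    show ?thesis
    proof (cases "2 * r \<le> int n")
      case True
      have "2 * \<bar>r\<bar> \<le> int n" using True r by simp
      from main[OF n h N this] show ?thesis using r(3) per by metis
    next
      case False
      have "2 * \<bar>r - int n\<bar> \<le> int n" using False r by simp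
      moreover have "k = (r - int n) + int n * (k div int n + 1)" using r(3) by (simp add: algebra_simps)
      ultimately show ?thesis using main[OF n h N] per by metis
    qed
  qed
  then show thesis by (rule that[OF N0(1) \<open>h0 > 0\<close>])
qed

text \<open>A nonzero \<open>f\<close> has mean square at least \<open>\<gamma>\<close> on the
  sampling grid, and by the pigeonhole lemma a fixed fraction of the autocorrelations is then at
  least \<open>\<gamma> / 2\<close>. Small discrete coefficients leave too little autocorrelation
  energy for this. The constants \<open>\<gamma>\<close>, \<open>p\<close> and \<open>\<eta>\<close>
  are fixed before the length \<open>N\<close> and the mesh \<open>h\<close> of the grid.\<close>

theorem AP_fourier_uniqueness_real:
  fixes f :: "real \<Rightarrow> real"
  assumes f: "f \<in> AP UNIV" and null: "\<And>\<mu>. fourier_null \<mu> f"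
  shows "f t = 0"
proof (rule ccontr)
  assume "f t \<noteq> 0"
  \<comment> \<open>The sampling window starts at 0, so a nonzero value at a nonnegative time is
    needed.\<close>
  have "\<exists>t0\<ge>0. f t0 \<noteq> 0"
  proof (rule ccontr)
    assume "\<not> ?thesis"
    moreover have "(\<lambda>t. 0) \<in> AP UNIV" by (rule AP_periodic[where p = 1]) auto
    ultimately have "f = (\<lambda>t. 0)" using AP_eqI_half_line[OF f] by blast
    then show False using \<open>f t \<noteq> 0\<close> by simp
  qed
  then obtain t0 where t0: "t0 \<ge> 0" "f t0 \<noteq> 0" by blast
  obtain M where M: "M > 0" "\<And>t. norm (f t) \<le> M" using AP_bounded[OF f] by blast
  \<comment> \<open>At most three \<open>\<kappa>\<close> are lost (rounding \<open>t0\<close> to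
    the grid, translating within the class, wrapping around), which leaves samples of modulus at
    least \<open>4 * \<kappa>\<close>.\<close>
  define \<kappa> where "\<kappa> = \<bar>f t0\<bar> / 8"
  have "\<kappa> > 0" using t0 by (simp add: \<kappa>_def)
  obtain p1 :: nat where p1: "p1 > 0" "\<And>h n. n > 0 \<Longrightarrow> \<exists>J j0. J \<subseteq> {0..<int n} \<and> j0 \<in> J \<and> n \<le> card J * p1 \<and>
     (\<forall>j\<in>J. \<forall>x. norm (f (x + of_int (j - j0) * h) - f x) \<le> \<kappa>)"
    using AP_grid_pigeonhole[OF f \<open>\<kappa> > 0\<close>] by blast
  \<comment> \<open>At least the fraction \<open>1 / p1\<close> of the samples contributes
    \<open>(4 * \<kappa>)\<^sup>2\<close> to the mean square.\<close>
  define \<gamma> where "\<gamma> = 16 * \<kappa>\<^sup>2 / p1"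
  have "\<gamma> > 0" using \<open>\<kappa> > 0\<close> p1(1) by (simp add: \<gamma>_def)
  \<comment> \<open>The second bound keeps the loss \<open>2 * \<epsilon> * M\<close> in an
    autocorrelation below \<open>\<gamma> / 2\<close>.\<close>
  define \<epsilon> where "\<epsilon> = min \<kappa> (\<gamma> / (4 * M))"
  have "\<epsilon> > 0" using \<open>\<kappa> > 0\<close> \<open>\<gamma> > 0\<close> M by (simp add: \<epsilon>_def)
  obtain p :: nat where p: "p > 0" "\<And>h n. n > 0 \<Longrightarrow> \<exists>J j0. J \<subseteq> {0..<int n} \<and> j0 \<in> J \<and> n \<le> card J * p \<and>
     (\<forall>j\<in>J. \<forall>x. norm (f (x + of_int (j - j0) * h) - f x) \<le> \<epsilon>)"
    using AP_grid_pigeonhole[OF f \<open>\<epsilon> > 0\<close>] by blast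
  \<comment> \<open>Chosen so that \<open>2 * p * (\<eta> * M) = \<gamma> / 2\<close>; the two
    energy estimates then yield the contradiction \<open>4 * p \<le> 1\<close>.\<close>
  define \<eta> where "\<eta> = \<gamma> / (4 * M * p)"
  have "\<eta> > 0" using \<open>\<gamma> > 0\<close> M p by (simp add: \<eta>_def)
  obtain N0 h0 where N0: "N0 > 0" "h0 > 0"
    "\<And>h n k. n > 0 \<Longrightarrow> 0 < h \<Longrightarrow> h \<le> h0 \<Longrightarrow> real n * h \<ge> N0 \<Longrightarrow> real n * h \<in> bohr_periods UNIV f (\<eta>/2) \<Longrightarrow>
      norm (dft n (\<lambda>x. complex_of_real (f (h * of_int (x mod int n)))) k) \<le> \<eta>"
    using sampled_dft_small[OF f null \<open>\<eta> > 0\<close>] by blast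
  obtain d where d: "d > 0" "\<And>s t. \<bar>s - t\<bar> < d \<Longrightarrow> norm (f s - f t) < \<kappa>"
    using AP_uniformly_continuous[OF f \<open>\<kappa> > 0\<close>] by blast
  define h1 where "h1 = min h0 (d/2)"
  have "h1 > 0" using N0 d by (simp add: h1_def)
  have "min \<epsilon> (\<eta>/2) > 0" using \<open>\<epsilon> > 0\<close> \<open>\<eta> > 0\<close> by simp
  then obtain N where N: "N \<in> bohr_periods UNIV f (min \<epsilon> (\<eta>/2))" "N \<ge> max N0 (t0 + 1)"
    using AP_large_period[OF f time_domain_intros(2)] by metis
  have "N > 0" using N(2) t0(1) by linarith
  define n where "n = nat \<lceil>N / h1\<rceil>"
  have "0 < \<lceil>N / h1\<rceil>" using \<open>N > 0\<close> \<open>h1 > 0\<close> by simp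
  then have n: "n > 0" "real n = of_int \<lceil>N / h1\<rceil>" by (auto simp: n_def)
  then have "N / h1 \<le> real n" by linarith
  define h where "h = N / real n"
  have h: "h > 0" "h \<le> h1" "real n * h = N"
    using n(1) \<open>N > 0\<close> \<open>h1 > 0\<close> \<open>N / h1 \<le> real n\<close> by (auto simp: h_def pos_divide_le_eq mult.commute)
  have Nper: "norm (f x - f (x + N)) \<le> min \<epsilon> (\<eta>/2)" for x using bohr_periodsD[OF N(1)] by blast
  define g where "g x = complex_of_real (f (h * of_int (x mod int n)))" for x
  have per: "g (x + int n) = g x" for x by (simp add: g_def)
  have Mg: "norm (g x) \<le> M" for x using M by (simp add: g_def)
  \<comment> \<open>Within one period on either side of the window, the periodic sample and
    \<open>f\<close> itself agree up to \<open>\<epsilon>\<close>, because \<open>N\<close> is an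
    almost period.\<close>
  have wrap: "norm (g x - of_real (f (h * of_int x))) \<le> \<epsilon>" if "- int n < x" "x < 2 * int n" for x
  proof -
    have hn: "h * of_int (int n) = N" using h(3) by (simp add: mult.commute)
    have "norm (f (h * of_int (x mod int n)) - f (h * of_int x)) \<le> \<epsilon>"
    proof -
      consider "x < 0" | "0 \<le> x" "x < int n" | "int n \<le> x" by linarith
      then show ?thesis
      proof cases
        case 1
        then have "x mod int n = x + int n" using that by (intro int_mod_pos_eq[where q = "- 1"]) auto
        then have "h * of_int (x mod int n) = h * of_int x + N" using hn by (simp add: distrib_left)
        moreover have "norm (f (h * of_int x + N) - f (h * of_int x)) \<le> \<epsilon>"
          using Nper[of "h * of_int x"] by (subst norm_minus_commute) simp
        ultimately show ?thesis by simp
      next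
        case 2 then show ?thesis using \<open>\<epsilon> > 0\<close> by simp
      next
        case 3
        then have "x mod int n = x - int n" using that by (intro int_mod_pos_eq[where q = 1]) auto
        then have "h * of_int x = h * of_int (x mod int n) + N" using hn by (simp add: right_diff_distrib)
        then show ?thesis using Nper[of "h * of_int (x mod int n)"] by simp
      qed
    qed
    then show ?thesis by (simp add: g_def of_real_diff[symmetric] del: of_real_diff)
  qed
  let ?I = "{0..<int n}"
  define c0 where "c0 = (\<Sum>i\<in>?I. (norm (g i))\<^sup>2) / n"
  have c0_large: "c0 \<ge> \<gamma>"
  proof -
    obtain J j0 where J: "J \<subseteq> ?I" "j0 \<in> J" "n \<le> card J * p1"
      "\<And>j x. j \<in> J \<Longrightarrow> norm (f (x + of_int (j - j0) * h) - f x) \<le> \<kappa>"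
      using p1(2)[OF n(1), of h] by blast
    define i0 where "i0 = \<lfloor>t0 / h\<rfloor>"
    have "0 \<le> t0 / h" using t0(1) h(1) by simp
    then have "i0 \<ge> 0" by (simp add: i0_def)
    have i0': "of_int i0 \<le> t0 / h" "t0 / h < of_int i0 + 1" by (auto simp: i0_def)
    have hi0: "of_int i0 * h \<le> t0" "t0 < of_int i0 * h + h"
      using i0' h(1) by (auto simp: pos_le_divide_eq pos_divide_less_eq distrib_right)
    have "of_int i0 * h < real n * h" using hi0(1) N(2) h(3) by linarith
    then have "i0 < int n" using h(1) by simp
    have "norm (f (of_int i0 * h) - f t0) < \<kappa>" using hi0 h d(1) by (intro d(2)) (auto simp: h1_def)
    have big: "norm (g (j + (i0 - j0))) \<ge> 4 * \<kappa>" if "j \<in> J" for j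
    proof -
      have "j \<in> ?I" "j0 \<in> ?I" using J(1,2) that by auto
      then have "norm (g (j + (i0 - j0)) - of_real (f (h * of_int (j + (i0 - j0))))) \<le> \<epsilon>"
        using \<open>i0 \<ge> 0\<close> \<open>i0 < int n\<close> by (intro wrap) auto
      moreover have "h * of_int (j + (i0 - j0)) = of_int i0 * h + of_int (j - j0) * h" by (simp add: algebra_simps)
      ultimately have "norm (g (j + (i0 - j0)) - of_real (f (of_int i0 * h + of_int (j - j0) * h))) \<le> \<kappa>"
        by (simp add: \<epsilon>_def)
      then have "\<bar>f (of_int i0 * h + of_int (j - j0) * h)\<bar> \<le> norm (g (j + (i0 - j0))) + \<kappa>"
        using norm_triangle_sub[of "complex_of_real (f (of_int i0 * h + of_int (j - j0) * h))" "g (j + (i0 - j0))"]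
        by (simp add: norm_minus_commute)
      moreover have "norm (f (of_int i0 * h + of_int (j - j0) * h) - f (of_int i0 * h)) \<le> \<kappa>" by (rule J(4)[OF that])
      moreover note \<open>norm (f (of_int i0 * h) - f t0) < \<kappa>\<close>
      moreover have "\<bar>f t0\<bar> = 8 * \<kappa>" by (simp add: \<kappa>_def)
      ultimately show ?thesis using \<open>\<kappa> > 0\<close> by (simp only: real_norm_def)
    qed
    have "real n * (16 * \<kappa>\<^sup>2) \<le> real (card J * p1) * (16 * \<kappa>\<^sup>2)" by (intro mult_right_mono) (use J(3) in \<open>simp_all del: of_nat_mult\<close>)
    also have "\<dots> = real p1 * (\<Sum>j\<in>J. (4 * \<kappa>)\<^sup>2)" by (simp add: power2_eq_square)
    also have "\<dots> \<le> real p1 * (\<Sum>j\<in>J. (norm (g (j + (i0 - j0))))\<^sup>2)"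
      using big \<open>\<kappa> > 0\<close> by (intro mult_left_mono sum_mono power_mono) auto
    also have "\<dots> \<le> real p1 * (\<Sum>j\<in>?I. (norm (g (j + (i0 - j0))))\<^sup>2)"
      using J(1) by (intro mult_left_mono sum_mono2) auto
    also have "(\<Sum>j\<in>?I. (norm (g (j + (i0 - j0))))\<^sup>2) = (\<Sum>j\<in>?I. (norm (g j))\<^sup>2)"
      using per by (intro sum_periodic_shift[where \<phi> = "\<lambda>j. (norm (g j))\<^sup>2", OF n(1)]) simp
    finally have "real n * (16 * \<kappa>\<^sup>2) \<le> real p1 * (real n * c0)" using n(1) by (simp add: c0_def)
    then have "16 * \<kappa>\<^sup>2 \<le> c0 * p1" using n(1) by (simp add: mult.left_commute mult.commute)
    then show ?thesis using p1(1) by (simp add: \<gamma>_def pos_divide_le_eq)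
  qed
  obtain J j0 where J: "J \<subseteq> ?I" "j0 \<in> J" "n \<le> card J * p"
    "\<And>j x. j \<in> J \<Longrightarrow> norm (f (x + of_int (j - j0) * h) - f x) \<le> \<epsilon>"
    using p(2)[OF n(1), of h] by blast
  have corr: "norm (autocorr n g (j - j0)) \<ge> \<gamma> / 2" if j: "j \<in> J" for j
  proof -
    have "j \<in> ?I" "j0 \<in> ?I" using J(1,2) j by auto
    have diff: "norm (g (i + (j - j0)) - g i) \<le> 2 * \<epsilon>" if i: "i \<in> ?I" for i
    proof -
      have "norm (g (i + (j - j0)) - of_real (f (h * of_int (i + (j - j0))))) \<le> \<epsilon>"
        using i \<open>j \<in> ?I\<close> \<open>j0 \<in> ?I\<close> by (intro wrap) auto
      moreover have "h * of_int (i + (j - j0)) = h * of_int i + of_int (j - j0) * h" by (simp add: algebra_simps)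
      ultimately have 1: "norm (g (i + (j - j0)) - of_real (f (h * of_int i + of_int (j - j0) * h))) \<le> \<epsilon>" by simp
      have "g i = of_real (f (h * of_int i))" using i by (simp add: g_def)
      then have 2: "norm (of_real (f (h * of_int i + of_int (j - j0) * h)) - g i) \<le> \<epsilon>"
        using J(4)[OF j, of "h * of_int i"] by (simp add: of_real_diff[symmetric] del: of_real_diff)
      from norm_diff_triangle_le[OF 1 2] show ?thesis by simp
    qed
    have c0: "of_real c0 = (\<Sum>i\<in>?I. g i * cnj (g i)) / of_nat n"
      by (simp add: c0_def complex_norm_sq[symmetric] del: of_real_power)
    have "autocorr n g (j - j0) - of_real c0 = (\<Sum>i\<in>?I. (g (i + (j - j0)) - g i) * cnj (g i)) / of_nat n"
      unfolding c0 autocorr_def by (simp add: left_diff_distrib sum_subtractf diff_divide_distrib)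
    then have "norm (autocorr n g (j - j0) - of_real c0) = norm (\<Sum>i\<in>?I. (g (i + (j - j0)) - g i) * cnj (g i)) / n"
      by (simp add: norm_divide)
    also have "\<dots> \<le> (\<Sum>i\<in>?I. 2 * \<epsilon> * M) / n"
      using diff Mg \<open>\<epsilon> > 0\<close> by (intro divide_right_mono sum_norm_le) (auto simp: norm_mult intro!: mult_mono)
    also have "\<dots> = 2 * \<epsilon> * M" using n(1) by simp
    also have "\<dots> \<le> 2 * (\<gamma> / (4 * M)) * M" using M(1) by (intro mult_right_mono mult_left_mono) (auto simp: \<epsilon>_def)
    also have "\<dots> = \<gamma> / 2" using M(1) by simp
    finally have "norm (autocorr n g (j - j0) - of_real c0) \<le> \<gamma> / 2" .
    moreover have "norm (complex_of_real c0) \<ge> \<gamma>" using c0_large by simp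
    ultimately show ?thesis
      using norm_triangle_sub[of "complex_of_real c0" "autocorr n g (j - j0)"] by (simp add: norm_minus_commute)
  qed
  have "real n * (\<gamma> / 2)\<^sup>2 \<le> real (card J * p) * (\<gamma> / 2)\<^sup>2"
    by (intro mult_right_mono) (use J(3) in \<open>simp_all del: of_nat_mult\<close>)
  also have "\<dots> = real p * (\<Sum>j\<in>J. (\<gamma> / 2)\<^sup>2)" by simp
  also have "\<dots> \<le> real p * (\<Sum>j\<in>J. (norm (autocorr n g (j + (- j0))))\<^sup>2)"
    using corr \<open>\<gamma> > 0\<close> by (intro mult_left_mono sum_mono power_mono) auto
  also have "\<dots> \<le> real p * (\<Sum>j\<in>?I. (norm (autocorr n g (j + (- j0))))\<^sup>2)"
    using J(1) by (intro mult_left_mono sum_mono2) auto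
  also have "(\<Sum>j\<in>?I. (norm (autocorr n g (j + (- j0))))\<^sup>2) = (\<Sum>j\<in>?I. (norm (autocorr n g j))\<^sup>2)"
    using autocorr_periodic[of g n, OF per] by (intro sum_periodic_shift[where \<phi> = "\<lambda>j. (norm (autocorr n g j))\<^sup>2", OF n(1)]) simp
  also have "real p * (\<Sum>j\<in>?I. (norm (autocorr n g j))\<^sup>2) \<le> real p * (\<eta>\<^sup>2 * (\<Sum>j\<in>?I. (norm (g j))\<^sup>2))"
  proof (intro mult_left_mono autocorr_energy_le n(1) per)
    fix k
    show "norm (dft n g k) \<le> \<eta>"
      unfolding g_def using n(1) h N \<open>h1 > 0\<close> by (intro N0(3)) (auto simp: h1_def bohr_periods_def)
  qed simp
  also have "\<dots> \<le> real p * (\<eta>\<^sup>2 * (\<Sum>j\<in>?I. M\<^sup>2))"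
    using Mg by (intro mult_left_mono sum_mono power_mono) auto
  also have "\<dots> = real n * (real p * (\<eta> * M)\<^sup>2)" by (simp add: power_mult_distrib)
  finally have "(\<gamma> / 2)\<^sup>2 \<le> real p * (\<eta> * M)\<^sup>2" using n(1) by simp
  then have "(\<gamma> / 2)\<^sup>2 * (4 * real p) \<le> real p * (\<eta> * M)\<^sup>2 * (4 * real p)" by (rule mult_right_mono) simp
  also have "real p * (\<eta> * M)\<^sup>2 * (4 * real p) = (2 * real p * (\<eta> * M))\<^sup>2" by (simp add: power2_eq_square)
  also have "2 * real p * (\<eta> * M) = \<gamma> / 2" using M(1) p(1) by (simp add: \<eta>_def)
  finally have "(\<gamma> / 2)\<^sup>2 * (4 * real p) \<le> (\<gamma> / 2)\<^sup>2 * 1" by simp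
  then have "4 * real p \<le> 1" using \<open>\<gamma> > 0\<close> by (simp only: mult_le_cancel_left_pos zero_less_power half_gt_zero)
  then show False using p(1) by simp
qed

section \<open>Bohr neighbourhoods and frequency modules\<close>

text \<open>Real form of the rule that a translation by \<open>\<tau>\<close> multiplies the
  coefficient at \<open>\<mu>\<close> by \<open>exp (i \<mu> \<tau>)\<close>: the pair of means is
  rotated.\<close>

lemma has_mean_cos_translate:
  fixes F :: "real \<Rightarrow> 'a::banach"
  assumes F: "F \<in> AP UNIV" and c: "has_mean (\<lambda>t. cos (\<mu> * t) *\<^sub>R F t) c" and s: "has_mean (\<lambda>t. sin (\<mu> * t) *\<^sub>R F t) s"
  shows "has_mean (\<lambda>t. cos (\<mu> * t) *\<^sub>R F (t + \<tau>)) (cos (\<mu> * \<tau>) *\<^sub>R c + sin (\<mu> * \<tau>) *\<^sub>R s)"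
    and "has_mean (\<lambda>t. sin (\<mu> * t) *\<^sub>R F (t + \<tau>)) (cos (\<mu> * \<tau>) *\<^sub>R s - sin (\<mu> * \<tau>) *\<^sub>R c)"
proof -
  note lc = has_mean_linear_combination[OF AP_cos_scaleR[OF F] AP_sin_scaleR[OF F] c s bounded_linear_scaleR_right bounded_linear_scaleR_right]
  have "has_mean (\<lambda>t. cos (\<mu> * \<tau>) *\<^sub>R (cos (\<mu> * (t + \<tau>)) *\<^sub>R F (t + \<tau>)) + sin (\<mu> * \<tau>) *\<^sub>R (sin (\<mu> * (t + \<tau>)) *\<^sub>R F (t + \<tau>)))
      (cos (\<mu> * \<tau>) *\<^sub>R c + sin (\<mu> * \<tau>) *\<^sub>R s)"
    by (rule has_mean_translate[OF lc])
  moreover have "cos (\<mu> * \<tau>) *\<^sub>R (cos (\<mu> * (t + \<tau>)) *\<^sub>R F (t + \<tau>)) + sin (\<mu> * \<tau>) *\<^sub>R (sin (\<mu> * (t + \<tau>)) *\<^sub>R F (t + \<tau>))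
      = cos (\<mu> * t) *\<^sub>R F (t + \<tau>)" for t
    using cos_diff[of "\<mu> * (t + \<tau>)" "\<mu> * \<tau>"] by (simp add: algebra_simps flip: scaleR_add_left)
  ultimately show "has_mean (\<lambda>t. cos (\<mu> * t) *\<^sub>R F (t + \<tau>)) (cos (\<mu> * \<tau>) *\<^sub>R c + sin (\<mu> * \<tau>) *\<^sub>R s)" by simp
  have "has_mean (\<lambda>t. (- sin (\<mu> * \<tau>)) *\<^sub>R (cos (\<mu> * (t + \<tau>)) *\<^sub>R F (t + \<tau>)) + cos (\<mu> * \<tau>) *\<^sub>R (sin (\<mu> * (t + \<tau>)) *\<^sub>R F (t + \<tau>)))
      ((- sin (\<mu> * \<tau>)) *\<^sub>R c + cos (\<mu> * \<tau>) *\<^sub>R s)"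
    by (rule has_mean_translate[OF lc])
  moreover have "(- sin (\<mu> * \<tau>)) *\<^sub>R (cos (\<mu> * (t + \<tau>)) *\<^sub>R F (t + \<tau>)) + cos (\<mu> * \<tau>) *\<^sub>R (sin (\<mu> * (t + \<tau>)) *\<^sub>R F (t + \<tau>))
      = sin (\<mu> * t) *\<^sub>R F (t + \<tau>)" for t
    using sin_diff[of "\<mu> * (t + \<tau>)" "\<mu> * \<tau>"] by (simp add: algebra_simps flip: scaleR_add_left scaleR_diff_left)
  ultimately show "has_mean (\<lambda>t. sin (\<mu> * t) *\<^sub>R F (t + \<tau>)) (cos (\<mu> * \<tau>) *\<^sub>R s - sin (\<mu> * \<tau>) *\<^sub>R c)"
    by (simp add: algebra_simps)
qed

lemma AP_minus: "u \<in> AP UNIV \<Longrightarrow> v \<in> AP UNIV \<Longrightarrow> (\<lambda>t. u t - v t) \<in> AP UNIV"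
  using AP_bounded_linear[OF AP_Pair, of u v "\<lambda>p. fst p - snd p"]
  by (simp add: bounded_linear_sub bounded_linear_fst bounded_linear_snd)

lemma has_mean_minus:
  fixes u v :: "real \<Rightarrow> 'a::banach"
  assumes "u \<in> AP UNIV" "v \<in> AP UNIV" "has_mean u m" "has_mean v n"
  shows "has_mean (\<lambda>t. u t - v t) (m - n)"
  using has_mean_linear_combination[OF assms bounded_linear_ident bounded_linear_minus[OF bounded_linear_ident]] by simp

text \<open>Replaces the dual space: a family of functionals that separates points carries scalar
  uniqueness over to vectors. Such families are exhibited for Euclidean spaces and for
  \<open>L1unit\<close>.\<close>

definition separating :: "('a::real_normed_vector \<Rightarrow> real) set \<Rightarrow> bool" where
  "separating L \<longleftrightarrow> (\<forall>h\<in>L. bounded_linear h) \<and> (\<forall>x. (\<forall>h\<in>L. h x = 0) \<longrightarrow> x = 0)"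

lemma fourier_null_bounded_linear:
  fixes F :: "real \<Rightarrow> 'a::banach" and h :: "'a \<Rightarrow> 'b::banach"
  assumes F: "F \<in> AP UNIV" and h: "bounded_linear h" and null: "fourier_null \<mu> F"
  shows "fourier_null \<mu> (\<lambda>t. h (F t))"
proof -
  interpret bounded_linear h by (rule h)
  have n: "has_mean (\<lambda>t. cos (\<mu> * t) *\<^sub>R F t) 0" "has_mean (\<lambda>t. sin (\<mu> * t) *\<^sub>R F t) 0"
    using null by (auto simp: fourier_null_def)
  have "has_mean (\<lambda>t. h (cos (\<mu> * t) *\<^sub>R F t)) (h 0)"
    by (rule has_mean_bounded_linear[OF AP_continuous[OF AP_cos_scaleR[OF F]] n(1) h])
  moreover have "has_mean (\<lambda>t. h (sin (\<mu> * t) *\<^sub>R F t)) (h 0)"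
    by (rule has_mean_bounded_linear[OF AP_continuous[OF AP_sin_scaleR[OF F]] n(2) h])
  ultimately show ?thesis by (simp add: fourier_null_def scaleR zero)
qed

lemma AP_fourier_uniqueness:
  fixes F :: "real \<Rightarrow> 'a::banach"
  assumes L: "separating (L :: ('a \<Rightarrow> real) set)" and F: "F \<in> AP UNIV" and null: "\<And>\<mu>. fourier_null \<mu> F"
  shows "F t = 0"
proof -
  have "h (F t) = 0" if "h \<in> L" for h
  proof (rule AP_fourier_uniqueness_real[of "\<lambda>t. h (F t)"])
    have h: "bounded_linear h" using L that by (auto simp: separating_def)
    show "(\<lambda>t. h (F t)) \<in> AP UNIV" by (rule AP_bounded_linear[OF F h])
    show "fourier_null \<mu> (\<lambda>t. h (F t))" for \<mu> by (rule fourier_null_bounded_linear[OF F h null])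
  qed
  then show ?thesis using L by (auto simp: separating_def)
qed

text \<open>One half of Bochner's criterion: translations reduce to \<open>[0, l]\<close> up to an
  almost period, and there finitely many suffice by uniform continuity.\<close>

lemma AP_translates_totally_bounded:
  assumes F: "F \<in> AP UNIV" and "e > 0"
  obtains K where "finite K" "\<And>t. \<exists>s\<in>K. \<forall>x. norm (F (x + t) - F (x + s)) \<le> e"
proof -
  have "e/2 > 0" using \<open>e > 0\<close> by simp
  obtain l where l: "l > 0" "\<And>t. \<exists>s\<in>{0..l}. t - s \<in> bohr_periods UNIV F (e/2)"
    using AP_shift_to_compact[OF F \<open>e/2 > 0\<close>] by blast
  obtain d where d: "d > 0" "\<And>s t. \<bar>s - t\<bar> < d \<Longrightarrow> norm (F s - F t) < e/2"
    using AP_uniformly_continuous[OF F \<open>e/2 > 0\<close>] by blast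
  have "{0..l} \<subseteq> (\<Union>s\<in>{0..l}. ball s d)" using d(1) by force
  from compactE_image[OF compact_Icc _ this] obtain K where K: "K \<subseteq> {0..l}" "finite K" "{0..l} \<subseteq> (\<Union>s\<in>K. ball s d)"
    by auto
  show thesis
  proof (rule that[OF K(2)])
    fix t
    obtain s where s: "s \<in> {0..l}" "t - s \<in> bohr_periods UNIV F (e/2)" using l(2) by blast
    then obtain s' where s': "s' \<in> K" "\<bar>s - s'\<bar> < d" using K(3) by (auto simp: dist_real_def abs_minus_commute)
    have "norm (F (x + t) - F (x + s')) \<le> e" for x
    proof -
      have 1: "norm (F (x + t) - F (x + s)) \<le> e/2"
        using bohr_periodsD[OF s(2), of "x + s"] by (simp add: norm_minus_commute)
      have 2: "norm (F (x + s) - F (x + s')) \<le> e/2" using s'(2) by (intro less_imp_le d(2)) simp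
      from norm_diff_triangle_le[OF 1 2] show ?thesis by simp
    qed
    then show "\<exists>s\<in>K. \<forall>x. norm (F (x + t) - F (x + s)) \<le> e" using s'(1) by blast
  qed
qed

text \<open>The closure of the translates of \<open>F\<close> is compact. If no Bohr neighbourhood worked, some
  limit point of translates would differ from \<open>F\<close> although it has the same Fourier coefficients.\<close>

theorem AP_bohr_neighbourhood:
  fixes F :: "real \<Rightarrow> 'a::banach"
  assumes L: "separating (L :: ('a \<Rightarrow> real) set)" and F: "F \<in> AP UNIV" and "d > 0"
  obtains S \<epsilon> where "finite S" "\<And>\<mu>. \<mu> \<in> S \<Longrightarrow> \<not> fourier_null \<mu> F" "\<epsilon> > 0"
    "\<And>\<tau>. (\<And>\<mu>. \<mu> \<in> S \<Longrightarrow> 1 - cos (\<mu> * \<tau>) < \<epsilon>) \<Longrightarrow> \<tau> \<in> bohr_periods UNIV F d"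
proof (rule ccontr)
  note obtain_rule = that
  assume neg: "\<not> thesis"
  \<comment> \<open>A \<open>good\<close> translation satisfies all cosine constraints of
    \<open>S\<close> but is not a \<open>d\<close>-almost period; if no Bohr neighbourhood worked,
    one would exist for every \<open>(S, \<epsilon>)\<close>.\<close>
  define good where "good S \<epsilon> \<tau> \<longleftrightarrow> (\<forall>\<mu>\<in>S. 1 - cos (\<mu> * \<tau>) < \<epsilon>) \<and> \<tau> \<notin> bohr_periods UNIV F d" for S :: "real set" and \<epsilon> \<tau> :: real
  define idx where "idx = {(S, \<epsilon>). finite S \<and> (\<forall>\<mu>\<in>S. \<not> fourier_null \<mu> F) \<and> \<epsilon> > (0::real)}"
  have ex_good: "\<exists>\<tau>. good S \<epsilon> \<tau>" if idx: "(S, \<epsilon>) \<in> idx" for S \<epsilon>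
  proof (rule ccontr)
    assume no: "\<not> (\<exists>\<tau>. good S \<epsilon> \<tau>)"
    have thesis
    proof (rule obtain_rule)
      show "finite S" "\<epsilon> > 0" "\<And>\<mu>. \<mu> \<in> S \<Longrightarrow> \<not> fourier_null \<mu> F" using idx by (auto simp: idx_def)
      show "\<tau> \<in> bohr_periods UNIV F d" if "\<And>\<mu>. \<mu> \<in> S \<Longrightarrow> 1 - cos (\<mu> * \<tau>) < \<epsilon>" for \<tau>
        using no that unfolding good_def by blast
    qed
    then show False using neg by blast
  qed
  obtain M where M: "\<And>t. norm (F t) \<le> M" using AP_bounded[OF F] by blast
  \<comment> \<open>Translates are viewed as bounded continuous functions, so that compactness of
    their closure is with respect to the supremum norm.\<close>
  define b where "b \<tau> = Bcontfun (\<lambda>t. F (t + \<tau>))" for \<tau>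
  have "(\<lambda>t. F (t + \<tau>)) \<in> bcontfun" for \<tau>
    by (rule bcontfun_normI[OF AP_continuous[OF AP_translate[OF F]] M])
  then have b: "apply_bcontfun (b \<tau>) t = F (t + \<tau>)" for \<tau> t by (simp add: b_def Bcontfun_inverse)
  define H where "H = closure (range b)"
  have "compact H"
    unfolding compact_eq_totally_bounded
  proof (intro conjI allI impI)
    show "complete H" by (simp add: H_def complete_eq_closed)
    fix e :: real assume "e > 0"
    then have "e/3 > 0" by simp
    then obtain K where K: "finite K" "\<And>t. \<exists>s\<in>K. \<forall>x. norm (F (x + t) - F (x + s)) \<le> e/3"
      using AP_translates_totally_bounded[OF F] by blast
    have "H \<subseteq> (\<Union>x\<in>b ` K. ball x e)"
    proof
      fix y assume "y \<in> H"
      then obtain \<tau> where \<tau>: "dist (b \<tau>) y < e/3" using \<open>e/3 > 0\<close> unfolding H_def closure_approachable by blast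
      obtain s where s: "s \<in> K" "\<forall>x. norm (F (x + \<tau>) - F (x + s)) \<le> e/3" using K(2) by blast
      have "dist (b s) (b \<tau>) \<le> e/3" by (rule dist_bound) (use s(2) in \<open>simp add: b dist_norm norm_minus_commute\<close>)
      then have "dist (b s) y < e" using \<tau> dist_triangle[of "b s" y "b \<tau>"] \<open>e > 0\<close> by linarith
      then show "y \<in> (\<Union>x\<in>b ` K. ball x e)" using s(1) by auto
    qed
    then show "\<exists>k. finite k \<and> H \<subseteq> (\<Union>x\<in>k. ball x e)" using K(1) by blast
  qed
  \<comment> \<open>These closed sets have the finite intersection property: finitely many
    constraints are implied by the one with the union of the frequency sets and the smallest
    tolerance.\<close>
  define V where "V p = closure (b ` {\<tau>. good (fst p) (snd p) \<tau>})" for p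
  have "H \<inter> (\<Inter>p\<in>idx. V p) \<noteq> {}"
  proof (rule compact_imp_fip_image[OF \<open>compact H\<close>])
    show "closed (V p)" for p by (simp add: V_def)
    fix I assume I: "finite I" "I \<subseteq> idx"
    define S where "S = (\<Union>p\<in>I. fst p)"
    define \<epsilon> where "\<epsilon> = Min (insert 1 (snd ` I))"
    have "(S, \<epsilon>) \<in> idx" using I unfolding idx_def S_def \<epsilon>_def by (auto simp: Min_gr_iff)
    then obtain \<tau> where \<tau>: "good S \<epsilon> \<tau>" using ex_good by blast
    have "b \<tau> \<in> V p" if "p \<in> I" for p
    proof -
      have "\<epsilon> \<le> snd p" using I(1) that by (auto simp: \<epsilon>_def)
      then have "good (fst p) (snd p) \<tau>" using \<tau> that by (force simp: good_def S_def)
      then show ?thesis unfolding V_def by (intro closure_subset[THEN subsetD]) auto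
    qed
    moreover have "b \<tau> \<in> H" unfolding H_def by (intro closure_subset[THEN subsetD]) auto
    ultimately show "H \<inter> (\<Inter>p\<in>I. V p) \<noteq> {}" by blast
  qed
  then obtain g where g: "g \<in> H" "\<And>S \<epsilon>. (S, \<epsilon>) \<in> idx \<Longrightarrow> g \<in> V (S, \<epsilon>)" by blast
  define G where "G = apply_bcontfun g"
  have appr: "\<exists>\<tau>. good S \<epsilon> \<tau> \<and> (\<forall>t. norm (G t - F (t + \<tau>)) \<le> e)" if pidx: "(S, \<epsilon>) \<in> idx" and "e > 0" for S \<epsilon> e
  proof -
    obtain \<tau> where \<tau>: "good S \<epsilon> \<tau>" "dist (b \<tau>) g < e"
      using g(2)[OF pidx] \<open>e > 0\<close> unfolding V_def closure_approachable by auto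
    have "norm (G t - F (t + \<tau>)) \<le> e" for t
      using dist_bounded[of "b \<tau>" t g] \<tau>(2) by (simp add: G_def b dist_norm norm_minus_commute)
    then show ?thesis using \<tau>(1) by blast
  qed
  \<comment> \<open>The empty constraint: it is used where only approximation of \<open>G\<close> by
    translates of \<open>F\<close> matters.\<close>
  have idx0: "({}, 1) \<in> idx" by (simp add: idx_def)
  have GAP: "G \<in> AP UNIV"
    unfolding AP_def
  proof safe
    show "continuous_on UNIV G" unfolding G_def by simp
    fix \<epsilon> :: real assume "\<epsilon> > 0"
    have "bohr_periods UNIV F \<epsilon> \<subseteq> bohr_periods UNIV G \<epsilon>"
    proof
      fix \<sigma> assume \<sigma>: "\<sigma> \<in> bohr_periods UNIV F \<epsilon>"
      have "norm (G t - G (t + \<sigma>)) \<le> \<epsilon>" for t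
      proof (rule field_le_epsilon)
        fix e :: real assume "e > 0"
        then obtain \<tau> where \<tau>: "\<And>t. norm (G t - F (t + \<tau>)) \<le> e/2" using appr[OF idx0, of "e/2"] by auto
        have 1: "norm (G t - F (t + \<tau>)) \<le> e/2" by (rule \<tau>)
        have 2: "norm (F (t + \<tau>) - F (t + \<sigma> + \<tau>)) \<le> \<epsilon>" using bohr_periodsD[OF \<sigma>, of "t + \<tau>"] by (simp add: ac_simps)
        have 3: "norm (F (t + \<sigma> + \<tau>) - G (t + \<sigma>)) \<le> e/2" using \<tau>[of "t + \<sigma>"] by (simp add: norm_minus_commute)
        from norm_diff_triangle_le[OF norm_diff_triangle_le[OF 1 2] 3] show "norm (G t - G (t + \<sigma>)) \<le> \<epsilon> + e" by simp
      qed
      then show "\<sigma> \<in> bohr_periods UNIV G \<epsilon>" by (simp add: bohr_periods_def)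
    qed
    moreover have "relatively_dense UNIV (bohr_periods UNIV F \<epsilon>)" using F \<open>\<epsilon> > 0\<close> by (simp add: AP_def)
    ultimately show "relatively_dense UNIV (bohr_periods UNIV G \<epsilon>)"
      unfolding relatively_dense_def disjoint_iff by (simp add: subset_eq) meson
  qed
  have "fourier_null \<mu> (\<lambda>t. G t - F t)" for \<mu>
  proof -
    obtain c s where c: "has_mean (\<lambda>t. cos (\<mu> * t) *\<^sub>R F t) c" and s: "has_mean (\<lambda>t. sin (\<mu> * t) *\<^sub>R F t) s"
      using AP_has_mean[OF AP_cos_scaleR[OF F]] AP_has_mean[OF AP_sin_scaleR[OF F]] by metis
    obtain c' s' where c': "has_mean (\<lambda>t. cos (\<mu> * t) *\<^sub>R G t) c'" and s': "has_mean (\<lambda>t. sin (\<mu> * t) *\<^sub>R G t) s'"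
      using AP_has_mean[OF AP_cos_scaleR[OF GAP]] AP_has_mean[OF AP_sin_scaleR[OF GAP]] by metis
    \<comment> \<open>The tolerance for \<open>1 - cos\<close> is taken as
      \<open>\<epsilon>\<^sup>2\<close> because the sine is of the order of the square root of
      \<open>1 - cos\<close>, hence of order \<open>\<epsilon>\<close>.\<close>
    have close: "norm (c' - c) \<le> \<epsilon> + \<epsilon>\<^sup>2 * norm c + 2 * \<epsilon> * norm s \<and> norm (s' - s) \<le> \<epsilon> + \<epsilon>\<^sup>2 * norm s + 2 * \<epsilon> * norm c"
      if "\<epsilon> > 0" for \<epsilon>
    proof -
      have "\<exists>\<tau>. (\<forall>t. norm (G t - F (t + \<tau>)) \<le> \<epsilon>) \<and> (1 - cos (\<mu> * \<tau>) < \<epsilon>\<^sup>2 \<or> (c = 0 \<and> s = 0))"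
      proof (cases "fourier_null \<mu> F")
        case True
        then have "c = 0" "s = 0" using c s
          by (auto simp: fourier_null_def intro: has_mean_unique AP_continuous AP_cos_scaleR AP_sin_scaleR F)
        then show ?thesis using appr[OF idx0 \<open>\<epsilon> > 0\<close>] by blast
      next
        case False
        then have "({\<mu>}, \<epsilon>\<^sup>2) \<in> idx" using \<open>\<epsilon> > 0\<close> by (simp add: idx_def)
        from appr[OF this \<open>\<epsilon> > 0\<close>] show ?thesis unfolding good_def by blast
      qed
      then obtain \<tau> where \<tau>: "\<And>t. norm (G t - F (t + \<tau>)) \<le> \<epsilon>" "1 - cos (\<mu> * \<tau>) < \<epsilon>\<^sup>2 \<or> (c = 0 \<and> s = 0)" by blast
      note tr = has_mean_cos_translate[OF F c s, of \<tau>]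
      note FT = AP_translate[OF F, of \<tau>]
      define C where "C = cos (\<mu> * \<tau>)"
      define S where "S = sin (\<mu> * \<tau>)"
      have trig_le: "norm (x *\<^sub>R G t - x *\<^sub>R F (t + \<tau>)) \<le> \<epsilon>" if "\<bar>x\<bar> \<le> 1" for x t
      proof -
        have "norm (x *\<^sub>R G t - x *\<^sub>R F (t + \<tau>)) = \<bar>x\<bar> * norm (G t - F (t + \<tau>))"
          by (simp flip: scaleR_diff_right)
        also have "\<dots> \<le> 1 * \<epsilon>" using \<tau>(1) that by (intro mult_mono) auto
        finally show ?thesis by simp
      qed
      have 1: "norm (c' - (C *\<^sub>R c + S *\<^sub>R s)) \<le> \<epsilon>" unfolding C_def S_def
        by (rule has_mean_norm_diff_le[OF AP_continuous[OF AP_cos_scaleR[OF GAP]] AP_continuous[OF AP_cos_scaleR[OF FT]] c' tr(1)])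
          (rule trig_le, simp)
      have 2: "norm (s' - (C *\<^sub>R s - S *\<^sub>R c)) \<le> \<epsilon>" unfolding C_def S_def
        by (rule has_mean_norm_diff_le[OF AP_continuous[OF AP_sin_scaleR[OF GAP]] AP_continuous[OF AP_sin_scaleR[OF FT]] s' tr(2)])
          (rule trig_le, simp)
      show ?thesis
      proof (cases "c = 0 \<and> s = 0")
        case True then show ?thesis using 1 2 by simp
      next
        case False
        then have C1: "1 - C < \<epsilon>\<^sup>2" using \<tau>(2) unfolding C_def by blast
        have "C \<le> 1" by (simp add: C_def)
        have "S\<^sup>2 = (1 - C) * (1 + C)" using sin_squared_eq[of "\<mu> * \<tau>"] by (simp add: C_def S_def power2_eq_square algebra_simps)
        also have "\<dots> \<le> \<epsilon>\<^sup>2 * 2"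
        proof -
          have "0 \<le> 1 + C" using cos_ge_minus_one[of "\<mu> * \<tau>"] unfolding C_def by linarith
          then show ?thesis using C1 \<open>C \<le> 1\<close> by (intro mult_mono) auto
        qed
        also have "\<dots> \<le> (2 * \<epsilon>)\<^sup>2" by (simp add: power2_eq_square)
        finally have S2: "\<bar>S\<bar> \<le> 2 * \<epsilon>" using \<open>\<epsilon> > 0\<close> abs_le_square_iff[of S "2 * \<epsilon>"] by simp
        have Sx: "norm (S *\<^sub>R x) \<le> 2 * \<epsilon> * norm x" for x :: 'a using S2 by (simp add: mult_right_mono)
        have Cx: "norm ((1 - C) *\<^sub>R x) \<le> \<epsilon>\<^sup>2 * norm x" for x :: 'a using C1 \<open>C \<le> 1\<close> by (simp add: mult_right_mono)
        have "c' - c = (c' - (C *\<^sub>R c + S *\<^sub>R s)) - (1 - C) *\<^sub>R c + S *\<^sub>R s" by (simp add: algebra_simps)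
        also have "norm \<dots> \<le> \<epsilon> + \<epsilon>\<^sup>2 * norm c + 2 * \<epsilon> * norm s"
          by (intro norm_triangle_le add_mono norm_triangle_le_diff 1 Sx Cx)
        finally have a: "norm (c' - c) \<le> \<epsilon> + \<epsilon>\<^sup>2 * norm c + 2 * \<epsilon> * norm s" .
        have "s' - s = (s' - (C *\<^sub>R s - S *\<^sub>R c)) - (1 - C) *\<^sub>R s - S *\<^sub>R c" by (simp add: algebra_simps)
        also have "norm \<dots> \<le> \<epsilon> + \<epsilon>\<^sup>2 * norm s + 2 * \<epsilon> * norm c"
          by (intro norm_triangle_le_diff add_mono 2 Sx Cx)
        finally show ?thesis using a by blast
      qed
    qed
    have lim: "((\<lambda>\<epsilon>::real. \<epsilon> + \<epsilon>\<^sup>2 * x + 2 * \<epsilon> * y) \<longlongrightarrow> 0) (at_right 0)" for x y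
      by (auto intro!: tendsto_eq_intros)
    have ev: "eventually (\<lambda>\<epsilon>::real. \<epsilon> > 0) (at_right 0)" by (simp add: eventually_at_right_less)
    have "norm (c' - c) \<le> 0"
      by (rule tendsto_lowerbound[OF lim[of "norm c" "norm s"]]) (use close ev in \<open>auto elim: eventually_mono\<close>)
    moreover have "norm (s' - s) \<le> 0"
      by (rule tendsto_lowerbound[OF lim[of "norm s" "norm c"]]) (use close ev in \<open>auto elim: eventually_mono\<close>)
    ultimately have "c' = c" "s' = s" by auto
    then have "has_mean (\<lambda>t. cos (\<mu> * t) *\<^sub>R G t - cos (\<mu> * t) *\<^sub>R F t) (c - c)"
      "has_mean (\<lambda>t. sin (\<mu> * t) *\<^sub>R G t - sin (\<mu> * t) *\<^sub>R F t) (s - s)"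
      using c s c' s' by (intro has_mean_minus AP_cos_scaleR AP_sin_scaleR GAP F; simp)+
    then show ?thesis by (simp add: fourier_null_def scaleR_diff_right)
  qed
  then have "G t - F t = 0" for t by (rule AP_fourier_uniqueness[OF L AP_minus[OF GAP F]])
  then have GF: "G t = F t" for t by simp
  \<comment> \<open>Once \<open>G = F\<close>, being within \<open>d\<close> of a
    \<open>good\<close> translate says that \<open>\<tau>\<close> is a \<open>d\<close>-almost
    period after all.\<close>
  obtain \<tau> where "good {} 1 \<tau>" "\<And>t. norm (G t - F (t + \<tau>)) \<le> d" using appr[OF idx0 \<open>d > 0\<close>] by blast
  then show False by (simp add: good_def bohr_periods_def GF)
qed

section \<open>Trigonometric polynomials and an approximation argument of Kronecker type\<close>

text \<open>Cosines suffice: polynomials in \<open>cos (\<mu> * t)\<close> are even, and the product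
  formula stays among cosines with frequencies in a group.\<close>

inductive trig_poly :: "real set \<Rightarrow> (real \<Rightarrow> real) \<Rightarrow> bool" for G where
  cosine: "\<nu> \<in> G \<Longrightarrow> trig_poly G (\<lambda>t. c * cos (\<nu> * t))"
| add: "trig_poly G p \<Longrightarrow> trig_poly G q \<Longrightarrow> trig_poly G (\<lambda>t. p t + q t)"

definition real_subgroup :: "real set \<Rightarrow> bool" where
  "real_subgroup G \<longleftrightarrow> 0 \<in> G \<and> (\<forall>x\<in>G. \<forall>y\<in>G. x + y \<in> G \<and> x - y \<in> G)"

lemma trig_poly_mult:
  assumes G: "real_subgroup G" and p: "trig_poly G p" and q: "trig_poly G q"
  shows "trig_poly G (\<lambda>t. p t * q t)"
  using p
proof induction
  case (cosine \<nu> c)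
  show ?case using q
  proof induction
    case (cosine \<nu>' c')
    have "\<nu> - \<nu>' \<in> G" "\<nu> + \<nu>' \<in> G" using G \<open>\<nu> \<in> G\<close> \<open>\<nu>' \<in> G\<close> by (auto simp: real_subgroup_def)
    then have "trig_poly G (\<lambda>t. c * c' / 2 * cos ((\<nu> - \<nu>') * t) + c * c' / 2 * cos ((\<nu> + \<nu>') * t))"
      by (intro trig_poly.intros)
    moreover have "c * c' / 2 * cos ((\<nu> - \<nu>') * t) + c * c' / 2 * cos ((\<nu> + \<nu>') * t) = c * cos (\<nu> * t) * (c' * cos (\<nu>' * t))" for t
      by (simp add: left_diff_distrib distrib_right cos_diff cos_add algebra_simps)
    ultimately show ?case by simp
  next
    case (add p q)
    from trig_poly.add[OF add.IH] show ?case by (simp add: distrib_left)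
  qed
next
  case (add p1 p2)
  from trig_poly.add[OF add.IH] show ?case by (simp add: distrib_right)
qed

lemma trig_poly_const: "real_subgroup G \<Longrightarrow> trig_poly G (\<lambda>t. c)"
  using trig_poly.cosine[of 0 G c] by (simp add: real_subgroup_def)

lemma trig_poly_polynomial_cos:
  assumes G: "real_subgroup G" "\<mu> \<in> G" and p: "real_polynomial_function (p :: real \<Rightarrow> real)"
  shows "trig_poly G (\<lambda>t. p (cos (\<mu> * t)))"
  using p
proof induction
  case (linear f)
  then interpret bounded_linear f .
  have lin: "f x = f 1 * x" for x using scaleR[of x 1] by simp
  have "(\<lambda>t. f (cos (\<mu> * t))) = (\<lambda>t. f 1 * cos (\<mu> * t))" by (rule ext) (rule lin)
  then show ?case by (simp only: trig_poly.cosine[OF G(2)])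
next
  case (const c)
  show ?case by (rule trig_poly_const[OF G(1)])
next
  case (add f g)
  from trig_poly.add[OF add.IH] show ?case .
next
  case (mult f g)
  from trig_poly_mult[OF G(1) mult.IH] show ?case .
qed

definition trig_limit :: "real set \<Rightarrow> (real \<Rightarrow> real) \<Rightarrow> bool" where
  "trig_limit G k \<longleftrightarrow> (\<forall>e>0. \<exists>q. trig_poly G q \<and> (\<forall>t. \<bar>k t - q t\<bar> \<le> e))"

lemma trig_limit_mult:
  assumes G: "real_subgroup G" and k: "trig_limit G k1" "trig_limit G k2"
    and bd: "\<And>t. \<bar>k1 t\<bar> \<le> 1" "\<And>t. \<bar>k2 t\<bar> \<le> 1"
  shows "trig_limit G (\<lambda>t. k1 t * k2 t)"
  unfolding trig_limit_def
proof (intro allI impI)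
  fix e :: real assume "e > 0"
  define d where "d = min 1 (e/3)"
  have d: "d > 0" "d \<le> 1" "3 * d \<le> e" using \<open>e > 0\<close> by (auto simp: d_def)
  obtain q1 q2 where q: "trig_poly G q1" "\<And>t. \<bar>k1 t - q1 t\<bar> \<le> d" "trig_poly G q2" "\<And>t. \<bar>k2 t - q2 t\<bar> \<le> d"
    using k d(1) unfolding trig_limit_def by metis
  have "\<bar>k1 t * k2 t - q1 t * q2 t\<bar> \<le> e" for t
  proof -
    have "k1 t * k2 t - q1 t * q2 t = k1 t * (k2 t - q2 t) + (k1 t - q1 t) * q2 t" by (simp add: algebra_simps)
    then have "\<bar>k1 t * k2 t - q1 t * q2 t\<bar> \<le> \<bar>k1 t\<bar> * \<bar>k2 t - q2 t\<bar> + \<bar>k1 t - q1 t\<bar> * \<bar>q2 t\<bar>"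
      by (metis abs_mult abs_triangle_ineq)
    also have "\<dots> \<le> 1 * d + d * 2"
    proof (intro add_mono mult_mono bd q)
      show "\<bar>q2 t\<bar> \<le> 2" using q(4)[of t] bd(2)[of t] d(2) by linarith
    qed (use d in auto)
    finally show ?thesis using d by simp
  qed
  then show "\<exists>q. trig_poly G q \<and> (\<forall>t. \<bar>k1 t * k2 t - q t\<bar> \<le> e)" using trig_poly_mult[OF G q(1,3)] by blast
qed

lemma has_mean_cos:
  assumes "\<omega> \<noteq> 0" shows "has_mean (\<lambda>t. cos (\<omega> * t)) (0::real)"
proof (rule has_meanI)
  fix e :: real assume "e > 0"
  have "norm (integral {a..a + T} (\<lambda>t. cos (\<omega> * t)) - T *\<^sub>R 0) \<le> e * T" if T: "T \<ge> 2 / (\<bar>\<omega>\<bar> * e)" for T a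
  proof -
    have T0: "T \<ge> 0" by (rule order_trans[OF _ T]) (use \<open>e > 0\<close> in auto)
    have "((\<lambda>t. cos (\<omega> * t)) has_integral (sin (\<omega> * (a + T)) / \<omega> - sin (\<omega> * a) / \<omega>)) {a..a + T}"
      using assms T0 by (intro fundamental_theorem_of_calculus)
       (auto intro!: derivative_eq_intros simp flip: has_real_derivative_iff_has_vector_derivative)
    then have "integral {a..a + T} (\<lambda>t. cos (\<omega> * t)) = (sin (\<omega> * (a + T)) - sin (\<omega> * a)) / \<omega>"
      by (simp add: integral_unique diff_divide_distrib)
    then have "norm (integral {a..a + T} (\<lambda>t. cos (\<omega> * t)) - T *\<^sub>R 0) = \<bar>sin (\<omega> * (a + T)) - sin (\<omega> * a)\<bar> / \<bar>\<omega>\<bar>"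
      by simp
    also have "\<dots> \<le> 2 / \<bar>\<omega>\<bar>"
      using abs_sin_le_one[of "\<omega> * (a + T)"] abs_sin_le_one[of "\<omega> * a"] by (intro divide_right_mono) linarith+
    also have "\<dots> \<le> e * T" using T \<open>e > 0\<close> assms by (simp add: divide_simps mult_ac)
    finally show ?thesis .
  qed
  moreover have "2 / (\<bar>\<omega>\<bar> * e) > 0" using assms \<open>e > 0\<close> by simp
  ultimately show "\<exists>T0>0. \<forall>T\<ge>T0. \<forall>a. norm (integral {a..a + T} (\<lambda>t. cos (\<omega> * t)) - T *\<^sub>R 0) \<le> e * T" by blast
qed

lemma AP_plus: "u \<in> AP UNIV \<Longrightarrow> v \<in> AP UNIV \<Longrightarrow> (\<lambda>t. u t + v t) \<in> AP UNIV"
  using AP_bounded_linear[OF AP_Pair, of u v "\<lambda>p. fst p + snd p"]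
  by (simp add: bounded_linear_add bounded_linear_fst bounded_linear_snd)

text \<open>The product formula leaves only the frequencies \<open>\<omega> - \<nu>\<close> and
  \<open>\<omega> + \<nu>\<close> with \<open>\<nu>\<close> in the group; they cannot vanish since
  \<open>\<omega>\<close> is outside it.\<close>

lemma trig_poly_mean:
  assumes G: "real_subgroup G" and \<omega>: "\<omega> \<notin> G" and p: "trig_poly G p"
  shows "(\<lambda>t. cos (\<omega> * t) * p t) \<in> AP UNIV \<and> has_mean (\<lambda>t. cos (\<omega> * t) * p t) 0"
  using p
proof induction
  case (cosine \<nu> c)
  have "0 + \<nu> \<in> G" "0 - \<nu> \<in> G" using G cosine by (auto simp: real_subgroup_def)
  then have ne: "\<omega> - \<nu> \<noteq> 0" "\<omega> + \<nu> \<noteq> 0" using \<omega> by (auto simp: add_eq_0_iff2)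
  have eq: "cos (\<omega> * t) * (c * cos (\<nu> * t)) = c / 2 * cos ((\<omega> - \<nu>) * t) + c / 2 * cos ((\<omega> + \<nu>) * t)" for t
    by (simp add: left_diff_distrib distrib_right cos_diff cos_add algebra_simps)
  have bl: "bounded_linear (\<lambda>x::real. c / 2 * x)" by (rule bounded_linear_mult_right)
  from has_mean_linear_combination[OF AP_cos AP_cos has_mean_cos[OF ne(1)] has_mean_cos[OF ne(2)] bl bl]
    AP_plus[OF AP_bounded_linear[OF AP_cos bl] AP_bounded_linear[OF AP_cos bl], of "\<omega> - \<nu>" "\<omega> + \<nu>"]
  show ?case unfolding eq by simp
next
  case (add p q)
  have eq: "cos (\<omega> * t) * (p t + q t) = cos (\<omega> * t) * p t + cos (\<omega> * t) * q t" for t by (simp add: distrib_left)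
  show ?case unfolding eq
    using add AP_plus[of "\<lambda>t. cos (\<omega> * t) * p t" "\<lambda>t. cos (\<omega> * t) * q t"]
      has_mean_linear_combination[OF _ _ _ _ bounded_linear_ident bounded_linear_ident, of "\<lambda>t. cos (\<omega> * t) * p t" "\<lambda>t. cos (\<omega> * t) * q t" 0 0] by simp
qed

text \<open>A product of bumps in \<open>cos (\<mu> t)\<close> for \<open>\<mu> \<in> S\<close> is a uniform limit of trigonometric polynomials
  with frequencies in \<open>G\<close>, hence uncorrelated with \<open>cos (\<omega> t)\<close>; so \<open>cos (\<omega> t)\<close> cannot be
  nonnegative on its support.\<close>

theorem kronecker_bohr_set:
  assumes G: "real_subgroup G" and S: "finite S" "S \<subseteq> G" and \<omega>: "\<omega> \<notin> G" and "r > 0"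
  obtains \<tau> where "\<And>\<mu>. \<mu> \<in> S \<Longrightarrow> 1 - cos (\<mu> * \<tau>) < r" "cos (\<omega> * \<tau>) < 0"
proof (rule ccontr)
  assume neg: "\<not> thesis"
  define e where "e = min r 1"
  have e: "e > 0" "e \<le> 1" "e \<le> r" using \<open>r > 0\<close> by (auto simp: e_def)
  \<comment> \<open>A bump in the cosine that vanishes wherever \<open>1 - cos\<close> is at least
    \<open>e\<close>; \<open>e \<le> 1\<close> keeps its values between 0 and 1, as products of
    limits require.\<close>
  define \<kappa> where "\<kappa> x = max 0 (x - (1 - e))" for x :: real
  define k where "k S t = (\<Prod>\<mu>\<in>S. \<kappa> (cos (\<mu> * t)))" for S and t :: real
  have \<kappa>_bd: "0 \<le> \<kappa> (cos x)" "\<kappa> (cos x) \<le> 1" for x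
    using cos_le_one[of x] e by (auto simp: \<kappa>_def simp del: cos_le_one)
  have k_bd: "0 \<le> k S' t" "k S' t \<le> 1" for S' t
    unfolding k_def using \<kappa>_bd by (auto intro!: prod_nonneg prod_le_1)
  have "k S \<in> AP UNIV \<and> trig_limit G (k S)"
    using S
  proof (induction S rule: finite_induct)
    case empty
    have "(\<lambda>t. 1::real) \<in> AP UNIV" by (rule AP_periodic[where p = 1]) auto
    moreover have "trig_limit G (\<lambda>t. 1)" unfolding trig_limit_def using trig_poly_const[OF G, of 1] by force
    ultimately show ?case by (simp add: k_def)
  next
    case (insert \<mu> S)
    have eq: "k (insert \<mu> S) = (\<lambda>t. \<kappa> (cos (\<mu> * t)) * k S t)" using insert(1,2) by (simp add: k_def fun_eq_iff)
    have "uniformly_continuous_on (range (\<lambda>t. cos (\<mu> * t))) \<kappa>"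
    proof -
      have "uniformly_continuous_on {-1..1} \<kappa>" unfolding \<kappa>_def
        by (intro compact_uniformly_continuous continuous_intros) auto
      moreover have "range (\<lambda>t. cos (\<mu> * t)) \<subseteq> {-1..1}" by auto
      ultimately show ?thesis unfolding uniformly_continuous_on_def by (meson subsetD)
    qed
    from AP_compose[OF AP_cos this] have 1: "(\<lambda>t. \<kappa> (cos (\<mu> * t))) \<in> AP UNIV" .
    have 2: "trig_limit G (\<lambda>t. \<kappa> (cos (\<mu> * t)))"
      unfolding trig_limit_def
    proof (intro allI impI)
      fix d :: real assume "d > 0"
      have "continuous_on {-1..1} \<kappa>" unfolding \<kappa>_def by (intro continuous_intros)
      then obtain p where p: "real_polynomial_function p" "\<And>x. x \<in> {-1..1} \<Longrightarrow> \<bar>\<kappa> x - p x\<bar> < d"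
        using Stone_Weierstrass_real_polynomial_function[of "{-1..1}" \<kappa> d] \<open>d > 0\<close> by auto
      have "\<bar>\<kappa> (cos (\<mu> * t)) - p (cos (\<mu> * t))\<bar> \<le> d" for t by (intro less_imp_le p(2)) simp
      moreover have "trig_poly G (\<lambda>t. p (cos (\<mu> * t)))" using insert(4) by (intro trig_poly_polynomial_cos G p) auto
      ultimately show "\<exists>q. trig_poly G q \<and> (\<forall>t. \<bar>\<kappa> (cos (\<mu> * t)) - q t\<bar> \<le> d)" by blast
    qed
    have IH: "k S \<in> AP UNIV" "trig_limit G (k S)" using insert by auto
    have "trig_limit G (k (insert \<mu> S))" unfolding eq using \<kappa>_bd k_bd[of S]
      by (intro trig_limit_mult[OF G 2 IH(2)]) auto
    moreover have "k (insert \<mu> S) \<in> AP UNIV" unfolding eq by (rule AP_bilinear[OF 1 IH(1) bounded_bilinear_mult])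
    ultimately show ?case by simp
  qed
  then have k: "k S \<in> AP UNIV" "trig_limit G (k S)" by auto
  define u where "u t = cos (\<omega> * t) * k S t" for t
  have uAP: "u \<in> AP UNIV" unfolding u_def by (rule AP_bilinear[OF AP_cos k(1) bounded_bilinear_mult])
  obtain m where m: "has_mean u m" using AP_has_mean[OF uAP] by blast
  have "m > 0"
  proof (rule AP_mean_pos[OF uAP _ _ m])
    show "u t \<ge> 0" for t
    proof (cases "\<forall>\<mu>\<in>S. 1 - cos (\<mu> * t) < r")
      case True
      then have "cos (\<omega> * t) \<ge> 0" using neg that by force
      then show ?thesis using k_bd by (simp add: u_def)
    next
      case False
      then obtain \<mu> where "\<mu> \<in> S" "r \<le> 1 - cos (\<mu> * t)" by force
      then have "\<kappa> (cos (\<mu> * t)) = 0" using e by (simp add: \<kappa>_def)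
      then have "k S t = 0" using S(1) \<open>\<mu> \<in> S\<close> by (auto simp: k_def)
      then show ?thesis by (simp add: u_def)
    qed
    show "u 0 > 0" using e by (simp add: u_def k_def \<kappa>_def)
  qed
  moreover have "\<bar>m\<bar> \<le> 0"
  proof (rule field_le_epsilon)
    fix d :: real assume "d > 0"
    then obtain q where q: "trig_poly G q" "\<And>t. \<bar>k S t - q t\<bar> \<le> d" using k(2) unfolding trig_limit_def by blast
    have "norm (m - 0) \<le> d"
    proof (rule has_mean_norm_diff_le[OF AP_continuous[OF uAP] _ m])
      show "continuous_on UNIV (\<lambda>t. cos (\<omega> * t) * q t)" "has_mean (\<lambda>t. cos (\<omega> * t) * q t) 0"
        using trig_poly_mean[OF G \<omega> q(1)] AP_continuous by auto
      fix t
      have "norm (u t - cos (\<omega> * t) * q t) = \<bar>cos (\<omega> * t)\<bar> * \<bar>k S t - q t\<bar>"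
        by (simp add: u_def right_diff_distrib[symmetric] abs_mult)
      also have "\<dots> \<le> 1 * d" using q(2) by (intro mult_mono) auto
      finally show "norm (u t - cos (\<omega> * t) * q t) \<le> d" by simp
    qed
    then show "\<bar>m\<bar> \<le> 0 + d" by simp
  qed
  ultimately show False by simp
qed

text \<open>Translating \<open>z\<close> by an almost period rotates the pair of means yet moves it
  by at most \<open>r\<close>. For a cosine below 0 the rotation minus the identity has determinant
  \<open>2 - 2 * C > 2\<close>, so it can be inverted with a bound that does not depend on
  \<open>r\<close>, and the means are of order \<open>r\<close>.\<close>

theorem AP_spectrum_in_module:
  fixes F :: "real \<Rightarrow> 'a::banach" and z :: "real \<Rightarrow> 'b::banach"
  assumes L: "separating (L :: ('a \<Rightarrow> real) set)" and F: "F \<in> AP UNIV" and z: "z \<in> AP UNIV"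
    and per: "\<And>r. r > 0 \<Longrightarrow> \<exists>d>0. \<forall>\<tau>\<ge>0. \<tau> \<in> bohr_periods UNIV F d \<longrightarrow> \<tau> \<in> bohr_periods UNIV z r"
    and G: "real_subgroup G" and FG: "\<And>\<mu>. \<not> fourier_null \<mu> F \<Longrightarrow> \<mu> \<in> G" and \<omega>: "\<not> fourier_null \<omega> z"
  shows "\<omega> \<in> G"
proof (rule ccontr)
  assume nG: "\<omega> \<notin> G"
  obtain c s where c: "has_mean (\<lambda>t. cos (\<omega> * t) *\<^sub>R z t) c" and s: "has_mean (\<lambda>t. sin (\<omega> * t) *\<^sub>R z t) s"
    using AP_has_mean[OF AP_cos_scaleR[OF z]] AP_has_mean[OF AP_sin_scaleR[OF z]] by metis
  have small: "2 * norm c \<le> 3 * r \<and> 2 * norm s \<le> 3 * r" if "r > 0" for r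
  proof -
    obtain d where d: "d > 0" "\<And>\<tau>. \<tau> \<ge> 0 \<Longrightarrow> \<tau> \<in> bohr_periods UNIV F d \<Longrightarrow> \<tau> \<in> bohr_periods UNIV z r"
      using per[OF \<open>r > 0\<close>] by blast
    obtain S e where S: "finite S" "\<And>\<mu>. \<mu> \<in> S \<Longrightarrow> \<not> fourier_null \<mu> F" "e > 0"
      "\<And>\<tau>. (\<And>\<mu>. \<mu> \<in> S \<Longrightarrow> 1 - cos (\<mu> * \<tau>) < e) \<Longrightarrow> \<tau> \<in> bohr_periods UNIV F d"
      using AP_bohr_neighbourhood[OF L F d(1)] by blast
    obtain \<tau>0 where \<tau>0: "\<And>\<mu>. \<mu> \<in> S \<Longrightarrow> 1 - cos (\<mu> * \<tau>0) < e" "cos (\<omega> * \<tau>0) < 0"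
      using kronecker_bohr_set[OF G S(1) _ nG S(3)] S(2) FG by blast
    \<comment> \<open>Almost periods pass from \<open>F\<close> to \<open>z\<close> only for
      nonnegative translations; the cosine conditions are even in \<open>\<tau>0\<close>.\<close>
    define \<tau> where "\<tau> = \<bar>\<tau>0\<bar>"
    have cos_abs: "cos (x * \<tau>) = cos (x * \<tau>0)" for x by (auto simp: \<tau>_def abs_if)
    have "\<tau> \<in> bohr_periods UNIV z r" using \<tau>0(1) by (intro d(2) S(4)) (auto simp: cos_abs, simp add: \<tau>_def)
    then have le: "norm (z (t + \<tau>) - z t) \<le> r" for t using bohr_periodsD[of \<tau> UNIV z r t] by (simp add: norm_minus_commute)
    note tr = has_mean_cos_translate[OF z c s, of \<tau>]
    note zT = AP_translate[OF z, of \<tau>]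
    define C where "C = cos (\<omega> * \<tau>)"
    define S' where "S' = sin (\<omega> * \<tau>)"
    have trig_le: "norm (x *\<^sub>R z (t + \<tau>) - x *\<^sub>R z t) \<le> r" if "\<bar>x\<bar> \<le> 1" for x t
    proof -
      have "norm (x *\<^sub>R z (t + \<tau>) - x *\<^sub>R z t) = \<bar>x\<bar> * norm (z (t + \<tau>) - z t)"
        by (simp flip: scaleR_diff_right)
      also have "\<dots> \<le> 1 * r" using le that by (intro mult_mono) auto
      finally show ?thesis by simp
    qed
    have 1: "norm ((C *\<^sub>R c + S' *\<^sub>R s) - c) \<le> r" unfolding C_def S'_def
      by (rule has_mean_norm_diff_le[OF AP_continuous[OF AP_cos_scaleR[OF zT]] AP_continuous[OF AP_cos_scaleR[OF z]] tr(1) c])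
        (rule trig_le, simp)
    have 2: "norm ((C *\<^sub>R s - S' *\<^sub>R c) - s) \<le> r" unfolding C_def S'_def
      by (rule has_mean_norm_diff_le[OF AP_continuous[OF AP_sin_scaleR[OF zT]] AP_continuous[OF AP_sin_scaleR[OF z]] tr(2) s])
        (rule trig_le, simp)
    have C: "C < 0" "\<bar>C - 1\<bar> \<le> 2" "\<bar>S'\<bar> \<le> 1" using \<tau>0(2) cos_ge_minus_one[of "\<omega> * \<tau>"] cos_abs[of \<omega>]
      by (auto simp: C_def S'_def simp del: cos_ge_minus_one)
    have CS: "C * C + S' * S' = 1" using sin_cos_squared_add2[of "\<omega> * \<tau>"] by (simp add: C_def S'_def power2_eq_square)
    then have CS': "S' * S' = 1 - C * C" by simp
    have CSx: "(S' * S') *\<^sub>R x = x - (C * C) *\<^sub>R x" for x :: 'b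
      by (simp add: CS' scaleR_diff_left)
    have twice: "(2 - 2 * C) *\<^sub>R x = (x - C *\<^sub>R x) + (x - C *\<^sub>R x)" for x :: 'b
      by (simp add: scaleR_diff_left scaleR_2 flip: scaleR_scaleR)
    have lin: "norm ((C - 1) *\<^sub>R u) \<le> 2 * r" "norm (S' *\<^sub>R u) \<le> r" if "norm u \<le> r" for u :: 'b
    proof -
      have "\<bar>C - 1\<bar> * norm u \<le> 2 * r" "\<bar>S'\<bar> * norm u \<le> 1 * r" using C that by (intro mult_mono; simp)+
      then show "norm ((C - 1) *\<^sub>R u) \<le> 2 * r" "norm (S' *\<^sub>R u) \<le> r" by simp_all
    qed
    \<comment> \<open>Cramer's rule for the rotation minus the identity; the determinant simplifies
      by \<open>CS\<close>.\<close>
    have "(2 - 2 * C) *\<^sub>R c = (C - 1) *\<^sub>R ((C *\<^sub>R c + S' *\<^sub>R s) - c) - S' *\<^sub>R ((C *\<^sub>R s - S' *\<^sub>R c) - s)"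
      unfolding twice by (simp add: algebra_simps CSx)
    also have "norm \<dots> \<le> 2 * r + r" by (intro norm_triangle_le_diff add_mono lin 1 2)
    finally have a: "\<bar>2 - 2 * C\<bar> * norm c \<le> 3 * r" by simp
    have "(2 - 2 * C) *\<^sub>R s = (C - 1) *\<^sub>R ((C *\<^sub>R s - S' *\<^sub>R c) - s) + S' *\<^sub>R ((C *\<^sub>R c + S' *\<^sub>R s) - c)"
      unfolding twice by (simp add: algebra_simps CSx)
    also have "norm \<dots> \<le> 2 * r + r" by (intro norm_triangle_le add_mono lin 1 2)
    finally have b: "\<bar>2 - 2 * C\<bar> * norm s \<le> 3 * r" by simp
    have "2 * norm c \<le> \<bar>2 - 2 * C\<bar> * norm c" "2 * norm s \<le> \<bar>2 - 2 * C\<bar> * norm s" using C by (intro mult_right_mono; simp)+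
    then show ?thesis using a b by linarith
  qed
  have zero: "x = 0" if "\<And>r. r > 0 \<Longrightarrow> 2 * norm x \<le> 3 * r" for x :: 'b
  proof (rule ccontr)
    assume "x \<noteq> 0"
    then show False using that[of "norm x / 3"] by simp
  qed
  have "c = 0" "s = 0" using small by (intro zero; blast)+
  then show False using c s \<omega> by (simp add: fourier_null_def)
qed

section \<open>Fourier coefficients and frequency modules\<close>

lemma fourier_coeff_eq:
  fixes v :: "real \<Rightarrow> 'a::banach"
  assumes v: "v \<in> AP UNIV" and c: "has_mean (\<lambda>t. cos (\<omega> * t) *\<^sub>R v t) c" and s: "has_mean (\<lambda>t. sin (\<omega> * t) *\<^sub>R v t) s"
  shows "fourier_coeff v \<omega> = (c, - s)"
proof -
  define P where "P t = (cos (\<omega> * t) *\<^sub>R v t, - (sin (\<omega> * t) *\<^sub>R v t))" for t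
  have ns: "(\<lambda>t. - (sin (\<omega> * t) *\<^sub>R v t)) \<in> AP UNIV" "has_mean (\<lambda>t. - (sin (\<omega> * t) *\<^sub>R v t)) (- s)"
    using AP_bounded_linear[OF AP_sin_scaleR[OF v] bounded_linear_minus[OF bounded_linear_ident]]
      has_mean_bounded_linear[OF AP_continuous[OF AP_sin_scaleR[OF v]] s bounded_linear_minus[OF bounded_linear_ident]] by auto
  have "has_mean P (c, - s)" unfolding P_def by (rule has_mean_Pair[OF AP_cos_scaleR[OF v] ns(1) c ns(2)])
  have eq: "cscale (exp (- \<i> * of_real \<omega> * of_real t)) (v t, 0) = P t" for t
  proof -
    have "exp (- \<i> * of_real \<omega> * of_real t) = cis (- (\<omega> * t))" by (simp add: cis_conv_exp algebra_simps)
    then show ?thesis by (simp add: cscale_def P_def)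
  qed
  have "((\<lambda>T. (1 / (2 * T)) *\<^sub>R integral {-T..T} P) \<longlongrightarrow> (c, - s)) at_top"
  proof (rule tendstoI)
    fix e :: real assume "e > 0"
    then have "e/2 > 0" by simp
    from has_meanE[OF \<open>has_mean P (c, - s)\<close> this] obtain T0 where
      T0: "T0 > 0" "\<And>T a. T \<ge> T0 \<Longrightarrow> norm (integral {a..a + T} P - T *\<^sub>R (c, - s)) \<le> e/2 * T" by metis
    have "dist ((1 / (2 * T)) *\<^sub>R integral {-T..T} P) (c, - s) < e" if "T \<ge> T0" for T
    proof -
      have T: "T > 0" using that T0(1) by simp
      have "2 * T * norm ((1 / (2 * T)) *\<^sub>R integral {-T..T} P - (c, - s)) = norm ((2 * T) *\<^sub>R ((1 / (2 * T)) *\<^sub>R integral {-T..T} P - (c, - s)))"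
        using T by simp
      also have "(2 * T) *\<^sub>R ((1 / (2 * T)) *\<^sub>R integral {-T..T} P - (c, - s)) = integral {- T..- T + 2 * T} P - (2 * T) *\<^sub>R (c, - s)"
        using T by (simp add: scaleR_diff_right del: scaleR_Pair)
      also have "norm \<dots> \<le> e/2 * (2 * T)" using that T by (intro T0(2)) simp
      finally have "norm ((1 / (2 * T)) *\<^sub>R integral {-T..T} P - (c, - s)) \<le> e/2" using T by simp
      then show ?thesis using \<open>e > 0\<close> by (simp add: dist_norm)
    qed
    then show "\<forall>\<^sub>F T in at_top. dist ((1 / (2 * T)) *\<^sub>R integral {-T..T} P) (c, - s) < e"
      by (auto simp: eventually_at_top_linorder)
  qed
  then have "Lim at_top (\<lambda>T. (1 / (2 * T)) *\<^sub>R integral {-T..T} P) = (c, - s)" by (intro tendsto_Lim) auto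
  then show ?thesis unfolding fourier_coeff_def eq .
qed

lemma freq_spectrum_eq:
  assumes v: "v \<in> AP UNIV"
  shows "freq_spectrum v = {\<omega>. \<not> fourier_null \<omega> v}"
proof -
  have "fourier_coeff v \<omega> = 0 \<longleftrightarrow> fourier_null \<omega> v" for \<omega>
  proof -
    obtain c s where c: "has_mean (\<lambda>t. cos (\<omega> * t) *\<^sub>R v t) c" and s: "has_mean (\<lambda>t. sin (\<omega> * t) *\<^sub>R v t) s"
      using AP_has_mean[OF AP_cos_scaleR[OF v]] AP_has_mean[OF AP_sin_scaleR[OF v]] by metis
    have "fourier_null \<omega> v \<longleftrightarrow> c = 0 \<and> s = 0"
    proof
      assume n: "fourier_null \<omega> v"
      have "c = 0"
        by (rule has_mean_unique[OF AP_continuous[OF AP_cos_scaleR[OF v]] c]) (use n in \<open>simp add: fourier_null_def\<close>)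
      moreover have "s = 0"
        by (rule has_mean_unique[OF AP_continuous[OF AP_sin_scaleR[OF v]] s]) (use n in \<open>simp add: fourier_null_def\<close>)
      ultimately show "c = 0 \<and> s = 0" by simp
    next
      assume "c = 0 \<and> s = 0"
      then show "fourier_null \<omega> v" using c s by (simp add: fourier_null_def)
    qed
    then show ?thesis by (simp add: fourier_coeff_eq[OF v c s] zero_prod_def)
  qed
  then show ?thesis by (auto simp: freq_spectrum_def)
qed

text \<open>Frees the sum from being indexed by the exact support of \<open>m\<close>, so that sums
  over different finite sets can be combined.\<close>

lemma freq_module_iff:
  "x \<in> freq_module v \<longleftrightarrow> (\<exists>m S. finite S \<and> S \<subseteq> freq_spectrum v \<and> x = (\<Sum>\<omega>\<in>S. of_int (m \<omega>) * \<omega>))"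
proof
  assume "x \<in> freq_module v"
  then obtain m where "finite {\<omega> \<in> freq_spectrum v. m \<omega> \<noteq> 0}"
    "x = (\<Sum>\<omega> | \<omega> \<in> freq_spectrum v \<and> m \<omega> \<noteq> 0. of_int (m \<omega>) * \<omega>)" by (auto simp: freq_module_def)
  then show "\<exists>m S. finite S \<and> S \<subseteq> freq_spectrum v \<and> x = (\<Sum>\<omega>\<in>S. of_int (m \<omega>) * \<omega>)"
    by (intro exI[of _ m] exI[of _ "{\<omega> \<in> freq_spectrum v. m \<omega> \<noteq> 0}"]) auto
next
  assume "\<exists>m S. finite S \<and> S \<subseteq> freq_spectrum v \<and> x = (\<Sum>\<omega>\<in>S. of_int (m \<omega>) * \<omega>)"
  then obtain m S where S: "finite S" "S \<subseteq> freq_spectrum v" "x = (\<Sum>\<omega>\<in>S. of_int (m \<omega>) * \<omega>)" by blast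
  define m' where "m' \<omega> = (if \<omega> \<in> S then m \<omega> else 0 :: int)" for \<omega>
  have sub: "{\<omega> \<in> freq_spectrum v. m' \<omega> \<noteq> 0} \<subseteq> S" by (auto simp: m'_def)
  have "x = (\<Sum>\<omega>\<in>S. of_int (m' \<omega>) * \<omega>)" by (simp add: S(3) m'_def)
  also have "\<dots> = (\<Sum>\<omega> | \<omega> \<in> freq_spectrum v \<and> m' \<omega> \<noteq> 0. of_int (m' \<omega>) * \<omega>)"
    using S sub by (intro sum.mono_neutral_right) auto
  finally show "x \<in> freq_module v" unfolding freq_module_def using finite_subset[OF sub S(1)] by blast
qed

lemma real_subgroup_freq_module: "real_subgroup (freq_module v)"
  unfolding real_subgroup_def
proof (intro conjI ballI)
  show "0 \<in> freq_module v" unfolding freq_module_iff by (rule exI[of _ "\<lambda>_. 0"], rule exI[of _ "{}"]) simp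
  fix x y assume x: "x \<in> freq_module v" and y: "y \<in> freq_module v"
  obtain m S where S: "finite S" "S \<subseteq> freq_spectrum v" "x = (\<Sum>\<omega>\<in>S. of_int (m \<omega>) * \<omega>)"
    using iffD1[OF freq_module_iff x] by blast
  obtain m' S' where S': "finite S'" "S' \<subseteq> freq_spectrum v" "y = (\<Sum>\<omega>\<in>S'. of_int (m' \<omega>) * \<omega>)"
    using iffD1[OF freq_module_iff y] by blast
  define a where "a \<omega> = (if \<omega> \<in> S then m \<omega> else 0)" for \<omega>
  define a' where "a' \<omega> = (if \<omega> \<in> S' then m' \<omega> else 0)" for \<omega>
  have xeq: "x = (\<Sum>\<omega>\<in>S \<union> S'. of_int (a \<omega>) * \<omega>)" unfolding S(3)
    using S(1) S'(1) by (intro sum.mono_neutral_cong_left) (auto simp: a_def)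
  have yeq: "y = (\<Sum>\<omega>\<in>S \<union> S'. of_int (a' \<omega>) * \<omega>)" unfolding S'(3)
    using S(1) S'(1) by (intro sum.mono_neutral_cong_left) (auto simp: a'_def)
  have "x + y = (\<Sum>\<omega>\<in>S \<union> S'. of_int (a \<omega> + a' \<omega>) * \<omega>)" unfolding xeq yeq by (simp add: sum.distrib distrib_right)
  then show "x + y \<in> freq_module v" unfolding freq_module_iff using S(1,2) S'(1,2)
    by (rule_tac exI[of _ "\<lambda>\<omega>. a \<omega> + a' \<omega>"], rule_tac exI[of _ "S \<union> S'"]) simp
  have "x - y = (\<Sum>\<omega>\<in>S \<union> S'. of_int (a \<omega> - a' \<omega>) * \<omega>)" unfolding xeq yeq by (simp add: sum_subtractf left_diff_distrib)
  then show "x - y \<in> freq_module v" unfolding freq_module_iff using S(1,2) S'(1,2)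
    by (rule_tac exI[of _ "\<lambda>\<omega>. a \<omega> - a' \<omega>"], rule_tac exI[of _ "S \<union> S'"]) simp
qed

lemma freq_spectrum_subset_module: "freq_spectrum v \<subseteq> freq_module v"
proof
  fix \<omega> assume "\<omega> \<in> freq_spectrum v"
  then show "\<omega> \<in> freq_module v" unfolding freq_module_iff by (rule_tac exI[of _ "\<lambda>_. 1"], rule_tac exI[of _ "{\<omega>}"]) simp
qed

lemma real_subgroup_of_int_mult:
  assumes G: "real_subgroup G" "x \<in> G" shows "of_int k * x \<in> G"
proof -
  have nat: "real n * x \<in> G" for n
  proof (induction n)
    case 0 then show ?case using G by (simp add: real_subgroup_def)
  next
    case (Suc n)
    then have "real n * x + x \<in> G" using G by (simp add: real_subgroup_def)
    then show ?case by (simp add: distrib_right add.commute)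
  qed
  show ?thesis
  proof (cases "k \<ge> 0")
    case True then show ?thesis using nat[of "nat k"] by simp
  next
    case False
    have "0 - real (nat (- k)) * x \<in> G" using G nat unfolding real_subgroup_def by blast
    then show ?thesis using False by simp
  qed
qed

lemma freq_module_subset:
  assumes G: "real_subgroup G" and sub: "freq_spectrum v \<subseteq> G"
  shows "freq_module v \<subseteq> G"
proof
  fix x assume xm: "x \<in> freq_module v"
  obtain m S where S: "finite S" "S \<subseteq> freq_spectrum v" and x: "x = (\<Sum>\<omega>\<in>S. of_int (m \<omega>) * \<omega>)"
    using iffD1[OF freq_module_iff xm] by blast
  have "(\<Sum>\<omega>\<in>S. of_int (m \<omega>) * \<omega>) \<in> G" using S
  proof (induction S rule: finite_induct)
    case empty then show ?case using G by (simp add: real_subgroup_def)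
  next
    case (insert \<omega> S)
    have "of_int (m \<omega>) * \<omega> \<in> G" using insert(4) sub by (intro real_subgroup_of_int_mult[OF G]) auto
    moreover have "(\<Sum>\<omega>\<in>S. of_int (m \<omega>) * \<omega>) \<in> G" using insert by auto
    ultimately show ?case using G insert(1,2) by (simp add: real_subgroup_def)
  qed
  then show "x \<in> G" by (simp add: x)
qed

section \<open>A contracting norm for Hurwitz matrices\<close>

lemma norm_vector_smult: "norm (c *s u) = norm c * norm (u :: complex^'n)"
  by (simp add: norm_vec_def norm_mult L2_set_right_distrib)

text \<open>\<open>apply_factors F [\<mu>\<^sub>1, \<dots>, \<mu>\<^sub>k]\<close> is the operator \<open>(F - \<mu>\<^sub>1) \<cdots> (F - \<mu>\<^sub>k)\<close>.\<close>

primrec apply_factors :: "complex^'n^'n \<Rightarrow> complex list \<Rightarrow> complex^'n \<Rightarrow> complex^'n" where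
  "apply_factors F [] u = u"
| "apply_factors F (\<mu> # L) u = apply_factors F L (F *v u - \<mu> *s u)"

lemma apply_factors_add: "apply_factors F L (u + v) = apply_factors F L u + apply_factors F L v"
proof (induction L arbitrary: u v)
  case (Cons \<mu> L)
  have "F *v (u + v) - \<mu> *s (u + v) = (F *v u - \<mu> *s u) + (F *v v - \<mu> *s v)"
    by (simp add: matrix_vector_right_distrib vector_add_ldistrib)
  then show ?case by (simp only: apply_factors.simps Cons.IH)
qed simp

lemma apply_factors_smult: "apply_factors F L (c *s u) = c *s apply_factors F L u"
proof (induction L arbitrary: u)
  case (Cons \<mu> L)
  have "F *v (c *s u) - \<mu> *s (c *s u) = c *s (F *v u - \<mu> *s u)"
    by (simp add: vector_scalar_commute vector_smult_assoc mult.commute vector_sub_rdistrib vec_eq_iff right_diff_distrib)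
  then show ?case by (simp only: apply_factors.simps Cons.IH)
qed simp

lemma apply_factors_0 [simp]: "apply_factors F L 0 = 0"
  using apply_factors_smult[of F L 0 0] by simp

lemma apply_factors_minus: "apply_factors F L (u - v) = apply_factors F L u - apply_factors F L v"
  using apply_factors_add[of F L "u - v" v] by simp

lemma apply_factors_commute: "apply_factors F L (F *v u) = F *v apply_factors F L u"
proof (induction L arbitrary: u)
  case (Cons \<mu> L)
  have "F *v (F *v u) - \<mu> *s (F *v u) = F *v (F *v u - \<mu> *s u)"
    by (simp add: matrix_vector_mult_diff_distrib vector_scalar_commute)
  then show ?case by (simp only: apply_factors.simps Cons.IH)
qed simp

lemma apply_factors_append: "apply_factors F (L @ L') u = apply_factors F L' (apply_factors F L u)"
  by (induction L arbitrary: u) auto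

lemma apply_factors_swap: "apply_factors F L (apply_factors F L' u) = apply_factors F L' (apply_factors F L u)"
proof (induction L arbitrary: u)
  case (Cons \<mu> L)
  have "F *v apply_factors F L' u - \<mu> *s apply_factors F L' u = apply_factors F L' (F *v u - \<mu> *s u)"
    by (simp add: apply_factors_minus apply_factors_commute apply_factors_smult)
  then show ?case by (simp only: apply_factors.simps Cons.IH)
qed simp

section \<open>Annihilating products of linear factors\<close>

definition poly_action :: "complex^'n^'n \<Rightarrow> complex poly \<Rightarrow> complex^'n \<Rightarrow> complex^'n" where
  "poly_action F p u = (\<Sum>i\<le>degree p. coeff p i *s ((*v) F ^^ i) u)"

lemma poly_action_bound:
  assumes "degree p \<le> N" shows "poly_action F p u = (\<Sum>i\<le>N. coeff p i *s ((*v) F ^^ i) u)"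
  unfolding poly_action_def
  by (rule sum.mono_neutral_left) (use assms in \<open>auto simp: coeff_eq_0 not_le\<close>)

lemma poly_action_add: "poly_action F (p + q) u = poly_action F p u + poly_action F q u"
proof -
  let ?N = "max (degree p) (degree q)"
  have "degree (p + q) \<le> ?N" by (rule degree_add_le_max)
  then show ?thesis
    by (simp add: poly_action_bound[where N = ?N] vector_sadd_rdistrib sum.distrib)
qed

lemma poly_action_smult: "poly_action F (smult c p) u = c *s poly_action F p u"
proof -
  have "degree (smult c p) \<le> degree p" by (rule degree_smult_le)
  then show ?thesis
    by (simp add: poly_action_bound[where N = "degree p"] vec_eq_iff sum_distrib_left mult_ac)
qed

lemma poly_action_pCons_0: "poly_action F (pCons 0 p) u = poly_action F p (F *v u)"
proof -
  have "poly_action F (pCons 0 p) u = (\<Sum>i\<le>Suc (degree p). coeff (pCons 0 p) i *s ((*v) F ^^ i) u)"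
    by (rule poly_action_bound) (simp add: degree_pCons_le)
  also have "\<dots> = (\<Sum>i\<le>degree p. coeff p i *s ((*v) F ^^ Suc i) u)"
    by (subst sum.atMost_Suc_shift) simp
  also have "\<dots> = poly_action F p (F *v u)"
    unfolding poly_action_def by (simp only: funpow_Suc_right o_apply)
  finally show ?thesis .
qed

lemma poly_action_sub: "poly_action F p (u + v) = poly_action F p u + poly_action F p v"
  and poly_action_vsmult: "poly_action F p (c *s u) = c *s poly_action F p u"
proof -
  have pw: "((*v) F ^^ i) (u + v) = ((*v) F ^^ i) u + ((*v) F ^^ i) v" "((*v) F ^^ i) (c *s u) = c *s ((*v) F ^^ i) u" for i
    by (induction i) (auto simp: matrix_vector_right_distrib vector_scalar_commute)
  show "poly_action F p (u + v) = poly_action F p u + poly_action F p v"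
    by (simp add: poly_action_def pw vector_add_ldistrib sum.distrib)
  show "poly_action F p (c *s u) = c *s poly_action F p u"
    by (simp add: poly_action_def pw vec_eq_iff sum_distrib_left mult_ac)
qed

lemma poly_action_linear_factor: "poly_action F ([:- \<mu>, 1:] * q) u = poly_action F q (F *v u - \<mu> *s u)"
proof -
  have "[:- \<mu>, 1:] * q = smult (- \<mu>) q + pCons 0 q" by simp
  then have "poly_action F ([:- \<mu>, 1:] * q) u = poly_action F q (F *v u) + (- \<mu>) *s poly_action F q u"
    by (simp only: poly_action_add poly_action_smult poly_action_pCons_0 add.commute)
  also have "\<dots> = poly_action F q (F *v u + (- \<mu>) *s u)"
    by (simp only: poly_action_sub poly_action_vsmult)
  also have "F *v u + (- \<mu>) *s u = F *v u - \<mu> *s u" by (simp add: vec_eq_iff)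
  finally show ?thesis .
qed

lemma poly_action_imp_factors:
  "p \<noteq> 0 \<Longrightarrow> poly_action F p u = 0 \<Longrightarrow> \<exists>L. apply_factors F L u = 0"
proof (induction "degree p" arbitrary: p u)
  case 0
  then obtain c where "p = [:c:]" by (metis degree_eq_zeroE)
  then have "c *s u = 0" "c \<noteq> 0" using 0 by (auto simp: poly_action_def)
  then have "u = 0" by (simp add: vector_mul_eq_0)
  then show ?case by (intro exI[of _ "[]"]) simp
next
  case (Suc n)
  have "\<not> constant (poly p)" using Suc.hyps(2) by (simp add: constant_degree)
  then obtain \<mu> where "poly p \<mu> = 0" using fundamental_theorem_of_algebra by blast
  then obtain q where p: "p = [:- \<mu>, 1:] * q" by (auto simp: poly_eq_0_iff_dvd elim: dvdE)
  have "q \<noteq> 0" using Suc.prems(1) p by auto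
  moreover have "degree p = degree [:- \<mu>, 1:] + degree q" unfolding p using \<open>q \<noteq> 0\<close> by (intro degree_mult_eq) auto
  then have "n = degree q" using Suc.hyps(2) by simp
  moreover have "poly_action F q (F *v u - \<mu> *s u) = 0" using Suc.prems(2) by (simp only: p poly_action_linear_factor)
  ultimately obtain L where "apply_factors F L (F *v u - \<mu> *s u) = 0" using Suc.hyps(1) by blast
  then show ?case by (intro exI[of _ "\<mu> # L"]) simp
qed

text \<open>With \<open>N\<close> the real dimension, the \<open>N + 1\<close> iterates of
  \<open>F\<close> on \<open>u\<close> are linearly dependent; real coefficients are enough.\<close>

lemma ex_annihilating_poly: "\<exists>p. p \<noteq> 0 \<and> poly_action F p u = (0 :: complex^'n)"
proof -
  define N where "N = DIM(complex^'n)"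
  define f where "f i = ((*v) F ^^ i) u" for i
  have "\<exists>c::nat \<Rightarrow> real. (\<exists>i\<le>N. c i \<noteq> 0) \<and> (\<Sum>i\<le>N. c i *\<^sub>R f i) = 0"
  \<comment> \<open>Dependence is a property of sets, so coinciding iterates are treated apart:
    their difference is the relation.\<close>
  proof (cases "inj_on f {..N}")
    case False
    then obtain i j where ij: "i \<le> N" "j \<le> N" "i \<noteq> j" "f i = f j" by (auto simp: inj_on_def)
    define c :: "nat \<Rightarrow> real" where "c k = (if k = i then 1 else if k = j then - 1 else 0)" for k
    have "(\<Sum>k\<le>N. c k *\<^sub>R f k) = (\<Sum>k\<in>{i, j}. c k *\<^sub>R f k)"
      using ij by (intro sum.mono_neutral_right) (auto simp: c_def)
    also have "\<dots> = 0" using ij by (simp add: c_def)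
    finally show ?thesis using ij by (intro exI[of _ c]) (auto simp: c_def)
  next
    case True
    have "card (f ` {..N}) = Suc N" using True by (simp add: card_image)
    then have "dependent (f ` {..N})" using independent_bound[of "f ` {..N}"] by (auto simp: N_def)
    then obtain c where c: "(\<Sum>v\<in>f ` {..N}. c v *\<^sub>R v) = 0" "\<exists>v\<in>f ` {..N}. c v \<noteq> 0"
      using dependent_finite[of "f ` {..N}"] by auto
    have "(\<Sum>i\<le>N. c (f i) *\<^sub>R f i) = 0" using c(1) by (simp add: sum.reindex[OF True])
    then show ?thesis using c(2) by (intro exI[of _ "\<lambda>i. c (f i)"]) auto
  qed
  then obtain c :: "nat \<Rightarrow> real" where c: "\<exists>i\<le>N. c i \<noteq> 0" "(\<Sum>i\<le>N. c i *\<^sub>R f i) = 0" by blast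
  define p where "p = (\<Sum>i\<le>N. monom (complex_of_real (c i)) i)"
  have coeff: "coeff p i = (if i \<le> N then complex_of_real (c i) else 0)" for i
    by (simp add: p_def coeff_sum)
  have "p \<noteq> 0" using c(1) coeff by (metis coeff_0 of_real_eq_0_iff)
  have "degree p \<le> N" by (rule degree_le) (simp add: coeff)
  then have "poly_action F p u = (\<Sum>i\<le>N. complex_of_real (c i) *s f i)"
    by (simp add: poly_action_bound[where N = N] coeff f_def)
  moreover have "complex_of_real r *s v = r *\<^sub>R v" for r and v :: "complex^'n"
    unfolding vec_eq_iff vector_smult_component vector_scaleR_component by (simp add: scaleR_conv_of_real)
  ultimately have "poly_action F p u = 0" using c(2) by simp
  with \<open>p \<noteq> 0\<close> show ?thesis by blast
qed

text \<open>Concatenate annihilating lists of the basis vectors. The factors commute, so the list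
  belonging to a given basis vector can be applied first.\<close>

lemma ex_annihilating_factors: "\<exists>L. \<forall>u. apply_factors F L u = (0 :: complex^'n)"
proof -
  have "\<exists>L. apply_factors F L (axis i 1) = 0" for i
    using ex_annihilating_poly[of F "axis i 1"] poly_action_imp_factors by blast
  then obtain L where L: "\<And>i. apply_factors F (L i) (axis i 1) = 0" by metis
  obtain xs :: "'n list" where xs: "set xs = UNIV" using finite_list[of "UNIV :: 'n set"] by auto
  have "apply_factors F (concat (map L ys)) (axis i 1) = 0" if "i \<in> set ys" for i ys
    using that
  proof (induction ys)
    case (Cons y ys)
    show ?case
    proof (cases "i = y")
      case True then show ?thesis by (simp add: apply_factors_append L)
    next
      case False
      then have "apply_factors F (concat (map L ys)) (axis i 1) = 0" using Cons by auto
      then show ?thesis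
        by (simp add: apply_factors_append apply_factors_swap[of F "concat (map L ys)" "L y"])
    qed
  qed simp
  then have ax: "apply_factors F (concat (map L xs)) (axis i 1) = 0" for i using xs by auto
  have sum: "apply_factors F K (\<Sum>i\<in>I. g i) = (\<Sum>i\<in>I. apply_factors F K (g i))" if "finite I" for K I and g :: "'n \<Rightarrow> complex^'n"
    using that by induction (auto simp: apply_factors_add)
  have "apply_factors F (concat (map L xs)) u = 0" for u
  proof -
    have "u = (\<Sum>i\<in>UNIV. u $ i *s axis i 1)" by (rule basis_expansion[symmetric])
    then have "apply_factors F (concat (map L xs)) u = (\<Sum>i\<in>UNIV. u $ i *s apply_factors F (concat (map L xs)) (axis i 1))"
      by (metis (no_types, lifting) sum[OF finite] apply_factors_smult sum.cong)
    then show ?thesis by (simp add: ax)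
  qed
  then show ?thesis by blast
qed

lemma ex_eigenvalue_factors:
  "\<exists>L'. (\<forall>\<mu>\<in>set L'. \<exists>u. u \<noteq> 0 \<and> F *v u = \<mu> *s u) \<and> (\<forall>u. apply_factors F L u = 0 \<longrightarrow> apply_factors F L' u = 0)"
proof (induction L)
  case Nil then show ?case by (intro exI[of _ "[]"]) simp
next
  case (Cons \<mu> L)
  then obtain L' where L': "\<forall>\<mu>\<in>set L'. \<exists>u. u \<noteq> 0 \<and> F *v u = \<mu> *s u"
    "\<And>u. apply_factors F L u = 0 \<Longrightarrow> apply_factors F L' u = 0" by blast
  show ?case
  proof (cases "\<exists>u. u \<noteq> 0 \<and> F *v u = \<mu> *s u")
    case True
    then show ?thesis using L' by (intro exI[of _ "\<mu> # L'"]) auto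
  next
    case False
    have "apply_factors F L' u = 0" if "apply_factors F (\<mu> # L) u = 0" for u
    proof -
      have "F *v apply_factors F L u - \<mu> *s apply_factors F L u = 0"
        using that by (simp add: apply_factors_minus apply_factors_commute apply_factors_smult)
      then have "apply_factors F L u = 0" using False by auto
      then show ?thesis by (rule L'(2))
    qed
    then show ?thesis using L'(1) by blast
  qed
qed

section \<open>Seminorms contracted by Euler steps\<close>

text \<open>For such \<open>h\<close> the quadratic term of
  \<open>(norm (1 + h \<mu>))\<^sup>2\<close> consumes at most half of the linear gain
  \<open>2 * \<alpha> * h\<close>; moreover \<open>\<alpha> * h \<le> 1\<close>, so the right-hand
  side is nonnegative and the square root can be taken.\<close>

lemma norm_one_plus_le:
  assumes \<alpha>: "\<alpha> = - Re \<mu>" "\<alpha> > 0" and h: "0 \<le> h" "h \<le> \<alpha> / ((norm \<mu>)\<^sup>2 + \<alpha>\<^sup>2)"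
  shows "norm (1 + of_real h * \<mu>) \<le> 1 - \<alpha> / 2 * h"
proof (rule power2_le_imp_le)
  have pos: "(norm \<mu>)\<^sup>2 + \<alpha>\<^sup>2 > 0" using \<alpha> by (simp add: add_nonneg_pos)
  have le: "h * ((norm \<mu>)\<^sup>2 + \<alpha>\<^sup>2) \<le> \<alpha>" using h pos by (simp add: pos_le_divide_eq)
  have "h * \<alpha>\<^sup>2 \<le> h * ((norm \<mu>)\<^sup>2 + \<alpha>\<^sup>2)" using h by (intro mult_left_mono) auto
  then have "h * \<alpha> * \<alpha> \<le> 1 * \<alpha>" using le by (simp add: power2_eq_square mult.assoc)
  then have h\<alpha>: "h * \<alpha> \<le> 1" using \<alpha>(2) by (simp only: mult_le_cancel_right_pos)
  then show "0 \<le> 1 - \<alpha> / 2 * h" by (simp add: mult.commute)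
  have "(norm (1 + of_real h * \<mu>))\<^sup>2 = 1 - 2 * \<alpha> * h + h * (h * (norm \<mu>)\<^sup>2)"
    unfolding cmod_power2 by (simp add: \<alpha>(1)) (simp add: power2_eq_square algebra_simps)
  also have "h * (h * (norm \<mu>)\<^sup>2) \<le> h * \<alpha>"
  proof (intro mult_left_mono h)
    have "h * (norm \<mu>)\<^sup>2 \<le> h * ((norm \<mu>)\<^sup>2 + \<alpha>\<^sup>2)" using h by (intro mult_left_mono) auto
    then show "h * (norm \<mu>)\<^sup>2 \<le> \<alpha>" using le by simp
  qed
  finally have "(norm (1 + of_real h * \<mu>))\<^sup>2 \<le> 1 - \<alpha> * h" by (simp add: mult.commute)
  also have "\<dots> \<le> (1 - \<alpha> / 2 * h)\<^sup>2" using \<alpha>(2) by (simp add: power2_eq_square algebra_simps)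
  finally show "(norm (1 + of_real h * \<mu>))\<^sup>2 \<le> (1 - \<alpha> / 2 * h)\<^sup>2" .
qed

lemma matrix_vector_norm_bound:
  fixes F :: "'a::real_normed_field^'n^'m"
  obtains K where "K > 0" "\<And>u. norm (F *v u) \<le> K * norm u"
proof -
  define K where "K = (\<Sum>i\<in>UNIV. \<Sum>j\<in>UNIV. norm (F $ i $ j)) + 1"
  have "norm (F *v u) \<le> K * norm u" for u
  proof -
    have "norm (F *v u) \<le> (\<Sum>i\<in>UNIV. norm ((F *v u) $ i))" unfolding norm_vec_def[of "F *v u"] by (rule L2_set_le_sum) simp
    also have "\<dots> \<le> (\<Sum>i\<in>UNIV. (\<Sum>j\<in>UNIV. norm (F $ i $ j)) * norm u)"
    proof (rule sum_mono)
      fix i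
      have "norm ((F *v u) $ i) \<le> (\<Sum>j\<in>UNIV. norm (F $ i $ j) * norm (u $ j))"
        unfolding matrix_vector_mult_def by (simp add: sum_norm_le norm_mult)
      also have "\<dots> \<le> (\<Sum>j\<in>UNIV. norm (F $ i $ j) * norm u)" by (intro sum_mono mult_left_mono Finite_Cartesian_Product.norm_nth_le) auto
      finally show "norm ((F *v u) $ i) \<le> (\<Sum>j\<in>UNIV. norm (F $ i $ j)) * norm u" by (simp add: sum_distrib_right)
    qed
    also have "\<dots> \<le> K * norm u" by (simp add: K_def sum_distrib_right[symmetric] distrib_right)
    finally show ?thesis .
  qed
  moreover have "K > 0" unfolding K_def by (intro add_nonneg_pos sum_nonneg) auto
  ultimately show thesis using that by blast
qed

text \<open>Contraction is stated for explicit Euler steps, as the increment estimate for solutions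
  uses it; no matrix exponential is involved. The lower bound and the contraction are restricted to
  vectors killed by the factors, so the induction over the factors can start with the zero
  seminorm.\<close>

definition contracting_seminorm ::
    "complex^'n^'n \<Rightarrow> complex list \<Rightarrow> (complex^'n \<Rightarrow> real) \<Rightarrow> real \<Rightarrow> real \<Rightarrow> real \<Rightarrow> bool" where
  "contracting_seminorm F L N a h0 \<beta> \<longleftrightarrow> a > 0 \<and> h0 > 0 \<and> \<beta> > 0 \<and> (\<forall>u. 0 \<le> N u \<and> N u \<le> \<beta> * norm u) \<and>
     (\<forall>u v. N (u + v) \<le> N u + N v) \<and> (\<forall>u. apply_factors F L u = 0 \<longrightarrow> norm u \<le> N u) \<and>
     (\<forall>u h. apply_factors F L u = 0 \<longrightarrow> 0 \<le> h \<longrightarrow> h \<le> h0 \<longrightarrow> N (u + of_real h *s (F *v u)) \<le> (1 - a * h) * N u)"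

text \<open>The weights of the successive factors are chosen geometrically, so that each factor absorbs the
  coupling term coming from the previous one.\<close>

lemma ex_contracting_seminorm:
  "\<forall>\<mu>\<in>set L. Re \<mu> < 0 \<Longrightarrow> \<exists>N a h0 \<beta>. contracting_seminorm F L N a h0 \<beta>"
proof (induction L)
  case Nil
  show ?case unfolding contracting_seminorm_def
    by (rule exI[of _ "\<lambda>_. 0"], rule exI[of _ 1], rule exI[of _ 1], rule exI[of _ 1]) auto
next
  case (Cons \<mu> L)
  then obtain N' a' h' \<beta>' where "contracting_seminorm F L N' a' h' \<beta>'" by auto
  then have IH: "a' > 0" "h' > 0" "\<beta>' > 0" "0 \<le> N' u" "N' u \<le> \<beta>' * norm u"
    "N' (u + v) \<le> N' u + N' v" "apply_factors F L u = 0 \<Longrightarrow> norm u \<le> N' u"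
    "apply_factors F L u = 0 \<Longrightarrow> 0 \<le> h \<Longrightarrow> h \<le> h' \<Longrightarrow> N' (u + of_real h *s (F *v u)) \<le> (1 - a' * h) * N' u"
    for u v h by (simp_all add: contracting_seminorm_def)
  define \<alpha> where "\<alpha> = - Re \<mu>"
  have \<alpha>: "\<alpha> > 0" using Cons.prems by (simp add: \<alpha>_def)
  \<comment> \<open>Taking \<open>a\<close> strictly below \<open>a'\<close> leaves a margin, and
    \<open>\<rho> * (a' - a) = 1\<close> is exactly what the coupling term
    \<open>h * N' (D u)\<close> costs.\<close>
  define a where "a = min (\<alpha> / 2) (a' / 2)"
  define \<rho> where "\<rho> = 1 / (a' - a)"
  have a: "a > 0" "a \<le> \<alpha> / 2" "a < a'" using \<alpha> IH(1) by (auto simp: a_def)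
  have \<rho>: "\<rho> > 0" "\<rho> * (a' - a) = 1" using a by (auto simp: \<rho>_def)
  define h0 where "h0 = min h' (\<alpha> / ((norm \<mu>)\<^sup>2 + \<alpha>\<^sup>2))"
  have "h0 > 0" using IH(2) \<alpha> by (simp add: h0_def add_nonneg_pos)
  define D where "D u = F *v u - \<mu> *s u" for u
  have D_add: "D (u + v) = D u + D v" for u v
    by (simp add: D_def matrix_vector_right_distrib vector_add_ldistrib)
  define N where "N u = norm u + \<rho> * N' (D u)" for u
  obtain K where K: "K > 0" "\<And>u. norm (F *v u) \<le> K * norm u" using matrix_vector_norm_bound[of F] by blast
  define \<beta> where "\<beta> = 1 + \<rho> * (\<beta>' * (K + norm \<mu>))"
  have "\<beta> > 0" using \<rho> IH(3) K by (simp add: \<beta>_def add_pos_nonneg)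
  moreover have "0 \<le> N u \<and> N u \<le> \<beta> * norm u" for u
  proof
    show "0 \<le> N u" using \<rho> IH(4) by (simp add: N_def)
    have "norm (D u) \<le> K * norm u + norm \<mu> * norm u"
      unfolding D_def by (intro norm_triangle_le_diff add_mono K(2)) (simp add: norm_vector_smult)
    then have "N' (D u) \<le> \<beta>' * ((K + norm \<mu>) * norm u)"
      using IH(3) by (intro order_trans[OF IH(5)] mult_left_mono) (auto simp: distrib_right)
    then have "\<rho> * N' (D u) \<le> \<rho> * (\<beta>' * ((K + norm \<mu>) * norm u))" using \<rho> by (intro mult_left_mono) auto
    then show "N u \<le> \<beta> * norm u" by (simp add: N_def \<beta>_def distrib_right mult.assoc)
  qed
  moreover have "N (u + v) \<le> N u + N v" for u v
  proof -
    have "\<rho> * N' (D u + D v) \<le> \<rho> * (N' (D u) + N' (D v))" using \<rho> IH(6) by (intro mult_left_mono) auto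
    then show ?thesis using norm_triangle_ineq[of u v] by (simp add: N_def D_add distrib_left)
  qed
  moreover have "norm u \<le> N u" for u using \<rho> IH(4) by (simp add: N_def)
  moreover have "N (u + of_real h *s (F *v u)) \<le> (1 - a * h) * N u"
    if u: "apply_factors F (\<mu> # L) u = 0" and h: "0 \<le> h" "h \<le> h0" for u h
  proof -
    have Du: "apply_factors F L (D u) = 0" using u by (simp add: D_def)
    have eq: "u + of_real h *s (F *v u) = (1 + of_real h * \<mu>) *s u + of_real h *s D u"
      by (simp add: D_def vec_eq_iff algebra_simps)
    have "norm (u + of_real h *s (F *v u)) \<le> norm (1 + of_real h * \<mu>) * norm u + h * norm (D u)"
    proof -
      have "norm (of_real h *s D u) = h * norm (D u)" using h(1) by (simp add: norm_vector_smult)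
      then show ?thesis unfolding eq
        using norm_triangle_ineq[of "(1 + of_real h * \<mu>) *s u" "of_real h *s D u"] by (simp only: norm_vector_smult[of "1 + of_real h * \<mu>" u])
    qed
    also have "\<dots> \<le> (1 - \<alpha> / 2 * h) * norm u + h * N' (D u)"
      by (intro add_mono mult_right_mono mult_left_mono norm_one_plus_le[OF \<alpha>_def \<alpha>] IH(7)[OF Du] h(1))
        (use h in \<open>simp_all add: h0_def\<close>)
    also have "\<dots> \<le> (1 - a * h) * norm u + h * N' (D u)"
      using a(2) h by (intro add_mono mult_right_mono diff_mono) (auto intro!: mult_right_mono simp: IH(4))
    finally have 1: "norm (u + of_real h *s (F *v u)) \<le> (1 - a * h) * norm u + h * N' (D u)" .
    have "D (u + of_real h *s (F *v u)) = D u + of_real h *s (F *v D u)"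
      by (simp add: D_def matrix_vector_right_distrib matrix_vector_mult_diff_distrib vector_scalar_commute vec_eq_iff algebra_simps)
    then have "N' (D (u + of_real h *s (F *v u))) \<le> (1 - a' * h) * N' (D u)"
      using IH(8)[OF Du] h by (simp add: h0_def)
    then have "\<rho> * N' (D (u + of_real h *s (F *v u))) \<le> \<rho> * ((1 - a' * h) * N' (D u))" using \<rho> by (intro mult_left_mono) auto
    then have "N (u + of_real h *s (F *v u)) \<le> (1 - a * h) * norm u + h * N' (D u) + \<rho> * ((1 - a' * h) * N' (D u))"
      using 1 by (simp add: N_def)
    also have "\<dots> = (1 - a * h) * norm u + (\<rho> * (a' - a)) * (h * N' (D u)) + \<rho> * ((1 - a' * h) * N' (D u))"
      by (simp add: \<rho>(2))
    also have "\<dots> = (1 - a * h) * N u" by (simp add: N_def algebra_simps)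
    finally show ?thesis .
  qed
  ultimately have "contracting_seminorm F (\<mu> # L) N a h0 \<beta>"
    using a(1) \<open>h0 > 0\<close> by (simp add: contracting_seminorm_def)
  then show ?case by blast
qed

theorem hurwitz_contracting_norm:
  fixes M :: "real^'n^'n"
  assumes M: "hurwitz M"
  obtains N :: "real^'n \<Rightarrow> real" and a h0 \<beta> where "a > 0" "h0 > 0" "\<beta> > 0" "\<And>x. norm x \<le> N x" "\<And>x. N x \<le> \<beta> * norm x"
    "\<And>x y. N (x + y) \<le> N x + N y" "\<And>x h. 0 \<le> h \<Longrightarrow> h \<le> h0 \<Longrightarrow> N (x + h *\<^sub>R (M *v x)) \<le> (1 - a * h) * N x"
proof -
  define F where "F = map_matrix complex_of_real M"
  obtain L0 where "\<And>u. apply_factors F L0 u = 0" using ex_annihilating_factors by blast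
  then obtain L where L: "\<And>\<mu>. \<mu> \<in> set L \<Longrightarrow> \<exists>u. u \<noteq> 0 \<and> F *v u = \<mu> *s u" "\<And>u. apply_factors F L u = 0"
    using ex_eigenvalue_factors[of F L0] by blast
  have "\<forall>\<mu>\<in>set L. Re \<mu> < 0" using L(1) M unfolding hurwitz_def F_def by blast
  from ex_contracting_seminorm[OF this, of F] obtain N a h0 \<beta> where "contracting_seminorm F L N a h0 \<beta>" by blast
  with L(2) have N: "a > 0" "h0 > 0" "\<beta> > 0"
    "N u \<le> \<beta> * norm u" "N (u + v) \<le> N u + N v" "norm u \<le> N u"
    "0 \<le> h \<Longrightarrow> h \<le> h0 \<Longrightarrow> N (u + of_real h *s (F *v u)) \<le> (1 - a * h) * N u" for u v h
    by (simp_all add: contracting_seminorm_def)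
  define c :: "real^'n \<Rightarrow> complex^'n" where "c x = (\<chi> i. complex_of_real (x $ i))" for x
  have c: "norm (c x) = norm x" "c (x + y) = c x + c y" "c (x + h *\<^sub>R (M *v x)) = c x + of_real h *s (F *v c x)" for x y h
    by (auto simp: c_def norm_vec_def vec_eq_iff F_def matrix_vector_mult_def map_matrix_def)
  show thesis
  proof (rule that[of a h0 \<beta> "\<lambda>x. N (c x)"])
    show "norm x \<le> N (c x)" for x using N(6)[of "c x"] c(1) by simp
    show "N (c x) \<le> \<beta> * norm x" for x using N(4)[of "c x"] c(1) by simp
    show "N (c (x + y)) \<le> N (c x) + N (c y)" for x y using N(5) c(2) by simp
    show "N (c (x + h *\<^sub>R (M *v x))) \<le> (1 - a * h) * N (c x)" if "0 \<le> h" "h \<le> h0" for x h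
      unfolding c(3) by (rule N(7)[OF that])
  qed (use N in auto)
qed

section \<open>Lebesgue differentiation and integral form of the equation\<close>

lemma AE_lebesgue_on_iff_negligible:
  assumes "T \<in> sets lebesgue"
  shows "(AE t in lebesgue_on T. P t) \<longleftrightarrow> (\<exists>N. negligible N \<and> (\<forall>t\<in>T. t \<notin> N \<longrightarrow> P t))"
proof -
  have "(AE t in lebesgue_on T. P t) \<longleftrightarrow> (AE t in lebesgue. t \<in> T \<longrightarrow> P t)"
    using assms by (intro AE_restrict_space_iff) simp
  also have "\<dots> \<longleftrightarrow> (\<exists>N. negligible N \<and> (\<forall>t\<in>T. t \<notin> N \<longrightarrow> P t))"
    unfolding eventually_ae_filter negligible_iff_null_sets by auto
  finally show ?thesis .
qed

lemma right_derivative_ae: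
  fixes f F :: "real \<Rightarrow> 'b::euclidean_space"
  assumes int: "\<And>a b. f integrable_on {a..b}" and F: "\<And>a b. a \<le> b \<Longrightarrow> F b - F a = integral {a..b} f"
  obtains N where "negligible N" "\<And>x. x \<notin> N \<Longrightarrow> ((\<lambda>h. (F (x + h) - F x) /\<^sub>R h) \<longlongrightarrow> f x) (at_right 0)"
proof -
  obtain N where N: "negligible N" "\<And>x e. x \<notin> N \<Longrightarrow> 0 < e \<Longrightarrow>
       \<exists>d>0. \<forall>h. 0 < h \<and> h < d \<longrightarrow> norm (integral (cbox x (x + h *\<^sub>R One)) f /\<^sub>R h ^ DIM(real) - f x) < e"
    using integrable_ccontinuous_explicit[of f] int by (metis interval_cbox)
  show thesis
  proof (rule that[OF N(1)])
    fix x assume "x \<notin> N"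
    show "((\<lambda>h. (F (x + h) - F x) /\<^sub>R h) \<longlongrightarrow> f x) (at_right 0)"
    proof (rule tendstoI)
      fix e :: real assume "e > 0"
      then obtain d where d: "d > 0" "\<And>h. 0 < h \<Longrightarrow> h < d \<Longrightarrow> norm (integral {x..x + h} f /\<^sub>R h - f x) < e"
        using N(2)[OF \<open>x \<notin> N\<close> \<open>e > 0\<close>] by auto
      have "dist ((F (x + h) - F x) /\<^sub>R h) (f x) < e" if "0 < h" "h < d" for h
        using d(2)[OF that] F[of x "x + h"] that by (simp add: dist_norm)
      then show "\<forall>\<^sub>F h in at_right 0. dist ((F (x + h) - F x) /\<^sub>R h) (f x) < e"
        using d(1) by (auto simp: eventually_at_right_field)
    qed
  qed
qed

text \<open>Right derivatives of \<open>F\<close> and of its reflection together give the two-sided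
  derivative; reflection preserves null sets.\<close>

lemma lebesgue_differentiation_line:
  fixes f F :: "real \<Rightarrow> 'b::euclidean_space"
  assumes int: "\<And>a b. f integrable_on {a..b}" and F: "\<And>a b. a \<le> b \<Longrightarrow> F b - F a = integral {a..b} f"
  obtains N where "negligible N" "\<And>x. x \<notin> N \<Longrightarrow> (F has_vector_derivative f x) (at x)"
proof -
  obtain N1 where N1: "negligible N1" "\<And>x. x \<notin> N1 \<Longrightarrow> ((\<lambda>h. (F (x + h) - F x) /\<^sub>R h) \<longlongrightarrow> f x) (at_right 0)"
    using right_derivative_ae[OF int F] by blast
  have int': "(\<lambda>x. f (- x)) integrable_on {a..b}" for a b
  proof -
    have "((\<lambda>x. f (- x)) has_integral i) {- (- a)..- (- b)} \<longleftrightarrow> (f has_integral i) {- b..- a}" for i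
      by (rule has_integral_reflect_real)
    then show ?thesis using int[of "- b" "- a"] unfolding integrable_on_def by simp
  qed
  have F': "- F (- b) - (- F (- a)) = integral {a..b} (\<lambda>x. f (- x))" if "a \<le> b" for a b
    using F[of "- b" "- a"] that Henstock_Kurzweil_Integration.integral_reflect_real[of "- a" "- b" f] by simp
  obtain N2 where N2: "negligible N2" "\<And>x. x \<notin> N2 \<Longrightarrow> ((\<lambda>h. (- F (- (x + h)) - (- F (- x))) /\<^sub>R h) \<longlongrightarrow> f (- x)) (at_right 0)"
    using right_derivative_ae[OF int' F'] by blast
  have "uminus differentiable_on N2" unfolding differentiable_on_def by (auto intro!: derivative_intros)
  then have "negligible (uminus ` N2)" by (intro negligible_differentiable_image_negligible[OF _ N2(1)]) auto
  then have "negligible (N1 \<union> uminus ` N2)" using N1(1) by (rule negligible_Un[rotated])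
  moreover have "(F has_vector_derivative f x) (at x)" if x: "x \<notin> N1 \<union> uminus ` N2" for x
  proof -
    have "- x \<notin> N2" using x by force
    from N2(2)[OF this] have "((\<lambda>h. (- F (x - h) + F x) /\<^sub>R h) \<longlongrightarrow> f x) (at_right 0)" by simp
    moreover have "(- F (x - h) + F x) /\<^sub>R h = (F (x + - h) - F x) /\<^sub>R (- h)" for h
      by (simp add: scaleR_diff_right)
    ultimately have "((\<lambda>h. (F (x + - h) - F x) /\<^sub>R (- h)) \<longlongrightarrow> f x) (at_right 0)" by simp
    then have left: "((\<lambda>h. (F (x + h) - F x) /\<^sub>R h) \<longlongrightarrow> f x) (at_left 0)"
      by (subst filterlim_at_left_to_right) simp
    have "((\<lambda>h. (F (x + h) - F x) /\<^sub>R h) \<longlongrightarrow> f x) (at 0)"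
      using left N1(2)[of x] x by (simp add: filterlim_split_at)
    then have "((\<lambda>h. norm ((F (x + h) - F x) /\<^sub>R h - f x)) \<longlongrightarrow> 0) (at 0)"
      by (simp add: LIM_zero tendsto_norm_zero)
    moreover have "\<forall>\<^sub>F h in at 0. norm ((F (x + h) - F x) /\<^sub>R h - f x) = norm (F (x + h) - F x - h *\<^sub>R f x) / norm h"
    proof (rule eventually_at_topological[THEN iffD2], intro exI[of _ UNIV] conjI ballI impI)
      fix h :: real assume "h \<noteq> 0"
      then have "(F (x + h) - F x) /\<^sub>R h - f x = (F (x + h) - F x - h *\<^sub>R f x) /\<^sub>R h" by (simp add: scaleR_diff_right)
      then show "norm ((F (x + h) - F x) /\<^sub>R h - f x) = norm (F (x + h) - F x - h *\<^sub>R f x) / norm h"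
        by (simp add: divide_inverse mult.commute)
    qed auto
    ultimately have "((\<lambda>h. norm (F (x + h) - F x - h *\<^sub>R f x) / norm h) \<longlongrightarrow> 0) (at 0)"
      by (rule Lim_transform_eventually)
    then show ?thesis
      unfolding has_vector_derivative_def has_derivative_at by (simp add: bounded_linear_scaleR_left)
  qed
  ultimately show thesis using that by blast
qed

lemma L1loc_integrable:
  "v \<in> L1loc T \<Longrightarrow> {a..b} \<subseteq> T \<Longrightarrow> v absolutely_integrable_on {a..b}"
  by (auto simp: L1loc_def)

lemma time_domain_Icc: "time_domain T \<Longrightarrow> a \<in> T \<Longrightarrow> {a..b} \<subseteq> T"
  by (auto simp: time_domain_def)

text \<open>On the half-line \<open>f\<close> is continued by zero and \<open>F\<close> by a
  constant. The point 0 joins the exceptional set, so that derivatives are taken only at interior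
  points.\<close>

lemma lebesgue_differentiation:
  fixes f F :: "real \<Rightarrow> 'b::euclidean_space"
  assumes T: "time_domain T" and f: "f \<in> L1loc T"
    and F: "\<And>a b. a \<in> T \<Longrightarrow> b \<in> T \<Longrightarrow> a \<le> b \<Longrightarrow> F b - F a = integral {a..b} f"
  obtains N where "negligible N" "\<And>x. x \<in> T \<Longrightarrow> x \<notin> N \<Longrightarrow> x \<in> interior T \<and> (F has_vector_derivative f x) (at x)"
proof -
  define f0 where "f0 t = (if t \<in> T then f t else 0)" for t
  define F0 where "F0 t = (if t \<in> T then F t else F 0)" for t
  have fint: "f integrable_on {a..b}" if "{a..b} \<subseteq> T" for a b
    using L1loc_integrable[OF f that] by (rule set_lebesgue_integral_eq_integral)
  have Int: "{a..b} \<inter> T = (if T = UNIV then {a..b} else {max a 0..b})" "{a..b} \<inter> T \<subseteq> T" for a b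
    using T by (auto simp: time_domain_def)
  have int: "f0 integrable_on {a..b}" for a b
  proof -
    have "f integrable_on ({a..b} \<inter> T)" unfolding Int(1) using fint T by (auto simp: time_domain_def)
    then show ?thesis unfolding f0_def integrable_restrict_Int by (simp add: Int_commute)
  qed
  have dF: "F0 b - F0 a = integral {a..b} f0" if "a \<le> b" for a b
  proof -
    have "integral {a..b} f0 = integral ({a..b} \<inter> T) f" unfolding f0_def
      by (subst Int_commute) (rule integral_restrict_Int)
    also have "\<dots> = F0 b - F0 a"
    proof (cases "T = UNIV")
      case True then show ?thesis using F[of a b] that by (simp add: F0_def)
    next
      case False
      then have T0: "T = {0..}" using T by (simp add: time_domain_def)
      show ?thesis
      proof (cases "b < 0")
        case True then show ?thesis using that T0 Int(1)[of a b] by (simp add: F0_def)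
      next
        case False
        then have "F b - F (max a 0) = integral {max a 0..b} f" using that by (intro F) (auto simp: T0)
        then show ?thesis using False T0 Int(1)[of a b] by (auto simp: F0_def max_def)
      qed
    qed
    finally show ?thesis by simp
  qed
  obtain N where N: "negligible N" "\<And>x. x \<notin> N \<Longrightarrow> (F0 has_vector_derivative f0 x) (at x)"
    using lebesgue_differentiation_line[OF int dF] by blast
  have "x \<in> interior T \<and> (F has_vector_derivative f x) (at x)" if x: "x \<in> T" "x \<notin> insert 0 N" for x
  proof
    have "T = UNIV \<or> (T = {0..} \<and> x > 0)" using T x by (auto simp: time_domain_def)
    then show i: "x \<in> interior T" by (auto simp: interior_real_atLeast)
    have "(F0 has_vector_derivative f x) (at x)" using N(2)[of x] x by (simp add: f0_def)
    then show "(F has_vector_derivative f x) (at x)"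
      by (rule has_vector_derivative_transform_within_open[OF _ open_interior i])
        (use interior_subset in \<open>auto simp: F0_def\<close>)
  qed
  moreover have "negligible (insert 0 N)" using N(1) by (simp add: negligible_insert)
  ultimately show thesis using that by blast
qed

definition lure_rhs :: "real^'n^'n \<Rightarrow> real^'m^'n \<Rightarrow> real^'n^'m \<Rightarrow> (real^'m \<Rightarrow> real^'m) \<Rightarrow> (real \<Rightarrow> real^'m) \<Rightarrow> (real \<Rightarrow> real^'n) \<Rightarrow> real \<Rightarrow> real^'n" where
  "lure_rhs A B C f v x t = A *v x t - B *v f (C *v x t) + B *v v t"

text \<open>The integrated equation is used in place of \<open>behaviour\<close>, to which
  \<open>behaviour_iff_solution\<close> relates it: shifts, limits of solutions and changes of the
  input on null sets are immediate in this form.\<close>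

definition solution :: "real set \<Rightarrow> real^'n^'n \<Rightarrow> real^'m^'n \<Rightarrow> real^'n^'m \<Rightarrow> (real^'m \<Rightarrow> real^'m) \<Rightarrow> (real \<Rightarrow> real^'m) \<Rightarrow> (real \<Rightarrow> real^'n) \<Rightarrow> bool" where
  "solution T A B C f v x \<longleftrightarrow> v \<in> L1loc T \<and> continuous_on T x \<and>
    (\<forall>s\<in>T. \<forall>t\<in>T. s \<le> t \<longrightarrow> (lure_rhs A B C f v x has_integral (x t - x s)) {s..t})"

lemma bounded_linear_matrix: "bounded_linear ((*v) (M :: real^'n^'m))"
  by (rule matrix_vector_mul_bounded_linear)

lemma lure_rhs_L1loc:
  fixes x :: "real \<Rightarrow> real^'n"
  assumes f: "continuous_on UNIV f" and v: "v \<in> L1loc T" and x: "continuous_on T x"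
  shows "lure_rhs A B C f v x \<in> L1loc T"
  unfolding L1loc_def
proof (intro CollectI allI impI)
  fix a b assume ab: "{a..b} \<subseteq> T"
  have xc: "continuous_on {a..b} x" by (rule continuous_on_subset[OF x ab])
  have "continuous_on {a..b} (\<lambda>t. A *v x t - B *v f (C *v x t))"
    by (intro continuous_intros bounded_linear.continuous_on[OF bounded_linear_matrix] continuous_on_compose2[OF f] xc) auto
  then have "(\<lambda>t. A *v x t - B *v f (C *v x t)) absolutely_integrable_on {a..b}"
    by (rule absolutely_integrable_continuous_real)
  moreover have "((*v) B \<circ> v) absolutely_integrable_on {a..b}"
    by (rule absolutely_integrable_linear[OF L1loc_integrable[OF v ab] bounded_linear_matrix])
  ultimately have "(\<lambda>t. (A *v x t - B *v f (C *v x t)) + ((*v) B \<circ> v) t) absolutely_integrable_on {a..b}"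
    by (rule set_integral_add)
  then show "set_integrable lebesgue {a..b} (lure_rhs A B C f v x)"
    by (simp add: lure_rhs_def[abs_def] o_def)
qed

lemma primitive_continuous:
  fixes g x :: "real \<Rightarrow> 'b::euclidean_space"
  assumes T: "time_domain T" and g: "g \<in> L1loc T"
    and x: "\<And>a b. a \<in> T \<Longrightarrow> b \<in> T \<Longrightarrow> a \<le> b \<Longrightarrow> x b - x a = integral {a..b} g"
  shows "continuous_on T x"
  unfolding continuous_on_eq_continuous_within
proof
  fix t assume t: "t \<in> T"
  define c where "c = (if T = UNIV then t - 1 else 0)"
  have c: "c \<in> T" "c \<le> t" using T t by (auto simp: c_def time_domain_def)
  have sub: "{c..t + 1} \<subseteq> T" by (rule time_domain_Icc[OF T c(1)])
  have "continuous_on {c..t + 1} (\<lambda>s. x c + integral {c..s} g)"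
    by (intro continuous_intros indefinite_integral_continuous_1 set_lebesgue_integral_eq_integral(1) L1loc_integrable[OF g sub])
  then have "continuous_on {c..t + 1} x"
  proof (rule continuous_on_eq)
    fix s assume s: "s \<in> {c..t + 1}"
    then have "x s - x c = integral {c..s} g" using sub by (intro x[OF c(1)]) auto
    then show "x c + integral {c..s} g = x s" by (simp add: diff_eq_eq add.commute)
  qed
  then have "continuous (at t within {c..t + 1}) x" using c by (simp add: continuous_on_eq_continuous_within)
  moreover have "at t within T = at t within {c..t + 1}"
    by (rule at_within_nhd[of _ "{t - 1<..<t + 1}"]) (use T t in \<open>auto simp: c_def time_domain_def\<close>)
  ultimately show "continuous (at t within T) x" by simp
qed

lemma sets_lebesgue_time_domain: "time_domain T \<Longrightarrow> T \<in> sets lebesgue"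
  by (auto simp: time_domain_def)

lemma behaviour_iff_solution:
  fixes x :: "real \<Rightarrow> real^'n"
  assumes T: "time_domain T" and f: "continuous_on UNIV f"
  shows "(v, x) \<in> behaviour T A B C f \<longleftrightarrow> solution T A B C f v x"
proof
  assume "(v, x) \<in> behaviour T A B C f"
  then have v: "v \<in> L1loc T" and xW: "x \<in> W11loc T"
    and ae: "AE t in lebesgue_on T. (x has_vector_derivative lure_rhs A B C f v x t) (at t within T)"
    by (auto simp: behaviour_def lure_rhs_def)
  obtain g where g: "g \<in> L1loc T" "\<And>a b. a \<in> T \<Longrightarrow> b \<in> T \<Longrightarrow> a \<le> b \<Longrightarrow> x b - x a = integral {a..b} g"
    using xW unfolding W11loc_def by blast
  obtain N1 where N1: "negligible N1" "\<And>t. t \<in> T \<Longrightarrow> t \<notin> N1 \<Longrightarrow> (x has_vector_derivative lure_rhs A B C f v x t) (at t within T)"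
    using ae unfolding AE_lebesgue_on_iff_negligible[OF sets_lebesgue_time_domain[OF T]] by blast
  obtain N2 where N2: "negligible N2" "\<And>t. t \<in> T \<Longrightarrow> t \<notin> N2 \<Longrightarrow> t \<in> interior T \<and> (x has_vector_derivative g t) (at t)"
    using lebesgue_differentiation[OF T g] by blast
  have eq: "lure_rhs A B C f v x t = g t" if t: "t \<in> T" "t \<notin> N1 \<union> N2" for t
  proof -
    have "t \<in> interior T" "(x has_vector_derivative g t) (at t)" using N2(2)[of t] t by auto
    moreover have "(x has_vector_derivative lure_rhs A B C f v x t) (at t)"
      using N1(2)[of t] t at_within_interior[OF \<open>t \<in> interior T\<close>] by simp
    ultimately show ?thesis by (meson vector_derivative_unique_at)
  qed
  have "continuous_on T x" by (rule primitive_continuous[OF T g])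
  moreover have "(lure_rhs A B C f v x has_integral (x t - x s)) {s..t}" if st: "s \<in> T" "t \<in> T" "s \<le> t" for s t
  proof (rule has_integral_spike[OF negligible_Un[OF N1(1) N2(1)]])
    have sub: "{s..t} \<subseteq> T" by (rule time_domain_Icc[OF T st(1)])
    show "lure_rhs A B C f v x r = g r" if "r \<in> {s..t} - (N1 \<union> N2)" for r using eq[of r] that sub by blast
    have "g integrable_on {s..t}" by (rule set_lebesgue_integral_eq_integral(1)[OF L1loc_integrable[OF g(1) sub]])
    then show "(g has_integral (x t - x s)) {s..t}" using g(2)[OF st] by (simp add: has_integral_integral)
  qed
  ultimately show "solution T A B C f v x" using v by (simp add: solution_def)
next
  assume sol: "solution T A B C f v x"
  then have v: "v \<in> L1loc T" and xc: "continuous_on T x"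
    and int: "\<And>s t. s \<in> T \<Longrightarrow> t \<in> T \<Longrightarrow> s \<le> t \<Longrightarrow> (lure_rhs A B C f v x has_integral (x t - x s)) {s..t}"
    by (auto simp: solution_def)
  have L: "lure_rhs A B C f v x \<in> L1loc T" by (rule lure_rhs_L1loc[OF f v xc])
  have inc: "x b - x a = integral {a..b} (lure_rhs A B C f v x)" if "a \<in> T" "b \<in> T" "a \<le> b" for a b
    using int[OF that] by (simp add: integral_unique)
  obtain N where N: "negligible N" "\<And>t. t \<in> T \<Longrightarrow> t \<notin> N \<Longrightarrow> t \<in> interior T \<and> (x has_vector_derivative lure_rhs A B C f v x t) (at t)"
    using lebesgue_differentiation[OF T L inc] by blast
  have "AE t in lebesgue_on T. (x has_vector_derivative lure_rhs A B C f v x t) (at t within T)"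
    unfolding AE_lebesgue_on_iff_negligible[OF sets_lebesgue_time_domain[OF T]]
    using N has_vector_derivative_at_within by blast
  moreover have "x \<in> W11loc T" unfolding W11loc_def using L inc by blast
  ultimately show "(v, x) \<in> behaviour T A B C f" using v by (simp add: behaviour_def lure_rhs_def)
qed

lemma L1loc_shift:
  fixes v :: "real \<Rightarrow> 'b::euclidean_space"
  assumes v: "v \<in> L1loc T" and sub: "\<And>t. t \<in> T' \<Longrightarrow> t + \<tau> \<in> T"
  shows "(\<lambda>t. v (t + \<tau>)) \<in> L1loc T'"
  unfolding L1loc_def
proof (intro CollectI allI impI)
  fix a b assume ab: "{a..b} \<subseteq> T'"
  have "{a + \<tau>..b + \<tau>} \<subseteq> T"
  proof
    fix t assume "t \<in> {a + \<tau>..b + \<tau>}"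
    then have "t - \<tau> \<in> T'" using ab by auto
    then show "t \<in> T" using sub[of "t - \<tau>"] by simp
  qed
  then have i: "v absolutely_integrable_on {a + \<tau>..b + \<tau>}" by (rule L1loc_integrable[OF v])
  have shift: "(g has_integral I) {a + \<tau>..b + \<tau>} \<Longrightarrow> ((\<lambda>t. g (t + \<tau>)) has_integral I) {a..b}" for g :: "real \<Rightarrow> 'c::euclidean_space" and I
    using has_integral_shift_Icc_real[of g \<tau> I a b] by (simp add: o_def add.commute)
  have "v integrable_on {a + \<tau>..b + \<tau>}" "(\<lambda>t. norm (v t)) integrable_on {a + \<tau>..b + \<tau>}"
    using i by (auto simp: absolutely_integrable_on_def)
  then have "(\<lambda>t. v (t + \<tau>)) integrable_on {a..b}" "(\<lambda>t. norm (v (t + \<tau>))) integrable_on {a..b}"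
    using shift[of v] shift[of "\<lambda>t. norm (v t)"] unfolding integrable_on_def by blast+
  then show "set_integrable lebesgue {a..b} (\<lambda>t. v (t + \<tau>))" by (simp add: absolutely_integrable_on_def)
qed

lemma solution_shift:
  assumes sol: "solution T A B C f v x" and sub: "\<And>t. t \<in> T' \<Longrightarrow> t + \<tau> \<in> T"
  shows "solution T' A B C f (\<lambda>t. v (t + \<tau>)) (\<lambda>t. x (t + \<tau>))"
  unfolding solution_def
proof (intro conjI ballI impI)
  have s: "v \<in> L1loc T" "continuous_on T x"
    "\<And>s t. s \<in> T \<Longrightarrow> t \<in> T \<Longrightarrow> s \<le> t \<Longrightarrow> (lure_rhs A B C f v x has_integral (x t - x s)) {s..t}"
    using sol by (auto simp: solution_def)
  show "(\<lambda>t. v (t + \<tau>)) \<in> L1loc T'" by (rule L1loc_shift[OF s(1) sub])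
  show "continuous_on T' (\<lambda>t. x (t + \<tau>))"
    by (rule continuous_on_compose2[OF s(2)]) (auto intro!: continuous_intros sub)
  fix a b assume "a \<in> T'" "b \<in> T'" "a \<le> b"
  then have "(lure_rhs A B C f v x has_integral (x (b + \<tau>) - x (a + \<tau>))) {a + \<tau>..b + \<tau>}" by (intro s(3) sub) auto
  then have "((lure_rhs A B C f v x \<circ> (+) \<tau>) has_integral (x (b + \<tau>) - x (a + \<tau>))) {a..b}"
    by (simp add: has_integral_shift_Icc_real)
  moreover have "lure_rhs A B C f v x \<circ> (+) \<tau> = lure_rhs A B C f (\<lambda>t. v (t + \<tau>)) (\<lambda>t. x (t + \<tau>))"
    by (auto simp: fun_eq_iff lure_rhs_def add.commute)
  ultimately show "(lure_rhs A B C f (\<lambda>t. v (t + \<tau>)) (\<lambda>t. x (t + \<tau>)) has_integral (x (b + \<tau>) - x (a + \<tau>))) {a..b}" by simp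
qed

section \<open>Integral inequalities\<close>

text \<open>Replaces a.e. differentiation of \<open>\<phi>\<close>.\<close>

lemma increment_le_of_local:
  fixes \<phi> H G :: "real \<Rightarrow> real"
  assumes "a \<le> b" and loc: "\<And>\<eta>. \<eta> > 0 \<Longrightarrow> \<exists>d>0. \<forall>s t. a \<le> s \<longrightarrow> s \<le> t \<longrightarrow> t \<le> b \<longrightarrow> t - s < d \<longrightarrow>
      \<phi> t - \<phi> s \<le> H t - H s + \<eta> * (G t - G s)"
  shows "\<phi> b - \<phi> a \<le> H b - H a"
proof (rule field_le_epsilon)
  fix e :: real assume "e > 0"
  define \<eta> where "\<eta> = e / (\<bar>G b - G a\<bar> + 1)"
  have "\<eta> > 0" using \<open>e > 0\<close> by (simp add: \<eta>_def add_nonneg_pos)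
  then obtain d where d: "d > 0" "\<And>s t. a \<le> s \<Longrightarrow> s \<le> t \<Longrightarrow> t \<le> b \<Longrightarrow> t - s < d \<Longrightarrow>
      \<phi> t - \<phi> s \<le> H t - H s + \<eta> * (G t - G s)" using loc by blast
  obtain n :: nat where n: "real n > (b - a) / d" using reals_Archimedean2 by blast
  then have "n > 0" using \<open>a \<le> b\<close> d(1) by (cases n) (auto simp: divide_less_0_iff)
  define h where "h = (b - a) / n"
  have h: "h \<ge> 0" "h < d" "real n * h = b - a"
    using n \<open>n > 0\<close> \<open>a \<le> b\<close> d(1) by (auto simp: h_def pos_divide_less_eq mult.commute)
  have "\<phi> (a + real k * h) - \<phi> a \<le> H (a + real k * h) - H a + \<eta> * (G (a + real k * h) - G a)" if "k \<le> n" for k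
    using that
  proof (induction k)
    case (Suc k)
    have "real (Suc k) * h \<le> real n * h" using Suc.prems h(1) by (intro mult_right_mono) auto
    then have "a + real (Suc k) * h \<le> b" using h(3) by simp
    moreover have "a + real (Suc k) * h - (a + real k * h) = h" by (simp add: algebra_simps)
    ultimately have "\<phi> (a + real (Suc k) * h) - \<phi> (a + real k * h) \<le> H (a + real (Suc k) * h) - H (a + real k * h)
        + \<eta> * (G (a + real (Suc k) * h) - G (a + real k * h))"
      using h by (intro d(2)) auto
    with Suc show ?case by (simp add: right_diff_distrib)
  qed simp
  from this[of n] have "\<phi> b - \<phi> a \<le> H b - H a + \<eta> * (G b - G a)" using h(3) by simp
  also have "\<eta> * (G b - G a) \<le> \<eta> * (\<bar>G b - G a\<bar> + 1)" using \<open>\<eta> > 0\<close> by (intro mult_left_mono) auto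
  also have "\<dots> = e" by (simp add: \<eta>_def add_nonneg_pos less_imp_neq[THEN not_sym])
  finally show "\<phi> b - \<phi> a \<le> H b - H a + e" by simp
qed

text \<open>If \<open>U\<close> decreases while \<open>N\<close> is large, then from some time on \<open>U\<close> exceeds its value at an
  earlier instant with small \<open>N\<close> by at most \<open>m\<close>.\<close>

lemma decay_alternative:
  fixes U N :: "real \<Rightarrow> real"
  assumes cont: "continuous_on {t0..} N" and U: "\<And>t. t \<ge> t0 \<Longrightarrow> U t \<ge> 0" and "a > 0" "m > 0"
    and dec: "\<And>s t. t0 \<le> s \<Longrightarrow> s \<le> t \<Longrightarrow> U t - U s \<le> - a * integral {s..t} N + m * (t - s) + m"
    and t: "t \<ge> t0 + U t0 / m + 2"
  shows "\<exists>s\<in>{t0..t}. N s \<le> 2 * m / a \<and> U t \<le> U s + m"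
proof -
  have "U t0 / m \<ge> 0" using U[of t0] \<open>m > 0\<close> by simp
  then have tt: "t \<ge> t0" using t by linarith
  \<comment> \<open>While \<open>N\<close> is at least \<open>2 * m / a\<close>, the decay rate
    \<open>2 * m\<close> exceeds the growth rate \<open>m\<close>, which leaves a net rate of
    \<open>- m\<close>.\<close>
  have large: "U t - U s \<le> m - m * (t - s)" if s: "t0 \<le> s" "s \<le> t" and big: "\<And>r. s < r \<Longrightarrow> r \<le> t \<Longrightarrow> N r \<ge> 2 * m / a" for s
  proof -
    have int: "N integrable_on {s..t}"
      by (intro integrable_continuous_interval continuous_on_subset[OF cont]) (use s in auto)
    have "(2 * m / a) * (t - s) = integral {s..t} (\<lambda>r. 2 * m / a)" using s by simp
    \<comment> \<open>The lower bound on \<open>N\<close> is known only to the right of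
      \<open>s\<close>, so the comparison function is changed at this one point.\<close>
    also have "\<dots> = integral {s..t} (\<lambda>r. if r = s then N s else 2 * m / a)"
      by (rule integral_spike[of "{s}"]) auto
    also have "\<dots> \<le> integral {s..t} N"
    proof (rule integral_le[OF _ int])
      show "(\<lambda>r. if r = s then N s else 2 * m / a) integrable_on {s..t}"
        by (rule integrable_spike[of "\<lambda>r. 2 * m / a" _ "{s}"]) auto
    qed (use big in auto)
    finally have "a * ((2 * m / a) * (t - s)) \<le> a * integral {s..t} N" using \<open>a > 0\<close> by (intro mult_left_mono) auto
    then have "2 * m * (t - s) \<le> a * integral {s..t} N" using \<open>a > 0\<close> by simp
    then show ?thesis using dec[OF s] by (simp add: algebra_simps)
  qed
  define S where "S = {s \<in> {t0..t}. N s \<le> 2 * m / a}"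
  \<comment> \<open>Otherwise the net rate \<open>- m\<close> would make \<open>U t\<close>
    negative; the summand 2 in the waiting time pays for the additive \<open>m\<close>.\<close>
  have "S \<noteq> {}"
  proof
    assume "S = {}"
    then have big: "N r \<ge> 2 * m / a" if "t0 < r" "r \<le> t" for r using that by (force simp: S_def)
    have "U t - U t0 \<le> m - m * (t - t0)" by (rule large[OF order_refl tt big])
    moreover have "m * (U t0 / m + 2) \<le> m * (t - t0)" using t \<open>m > 0\<close> by (intro mult_left_mono) auto
    then have "U t0 + 2 * m \<le> m * (t - t0)" using \<open>m > 0\<close> by (simp add: distrib_left mult.commute)
    ultimately show False using U[OF tt] \<open>m > 0\<close> by linarith
  qed
  moreover have "compact S"
  proof -
    have "S = {t0..t} \<inter> N -` {..2 * m / a}" by (auto simp: S_def)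
    moreover have "closed ({t0..t} \<inter> N -` {..2 * m / a})"
      by (intro continuous_closed_preimage continuous_on_subset[OF cont]) auto
    moreover have "bounded S" by (rule bounded_subset[OF bounded_closed_interval[of t0 t]]) (auto simp: S_def)
    ultimately show ?thesis by (simp add: compact_eq_bounded_closed)
  qed
  \<comment> \<open>The last instant with small \<open>N\<close>; after it the net decay applies up
    to \<open>t\<close>.\<close>
  ultimately obtain s where s: "s \<in> S" "\<And>r. r \<in> S \<Longrightarrow> r \<le> s" using compact_attains_sup[of S] by blast
  have "U t - U s \<le> m - m * (t - s)"
  proof (rule large)
    show "N r \<ge> 2 * m / a" if "s < r" "r \<le> t" for r
    proof (rule ccontr)
      assume "\<not> ?thesis"
      then have "r \<in> S" using that s(1) by (auto simp: S_def)
      then show False using s(2) that by force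
    qed
  qed (use s in \<open>auto simp: S_def\<close>)
  moreover have "m * (t - s) \<ge> 0" using s(1) \<open>m > 0\<close> by (auto simp: S_def)
  ultimately show ?thesis using s(1) by (intro bexI[of _ s]) (auto simp: S_def)
qed

section \<open>Stability estimates for differences of solutions\<close>

lemma inner_absolutely_integrable:
  fixes g \<psi> :: "real \<Rightarrow> 'b::euclidean_space"
  assumes g: "continuous_on {s..t} g" and \<psi>: "\<psi> absolutely_integrable_on {s..t}"
  shows "(\<lambda>r. g r \<bullet> \<psi> r) absolutely_integrable_on {s..t}"
proof (rule absolutely_integrable_bounded_measurable_product[of "(\<bullet>)"])
  show "bilinear ((\<bullet>) :: 'b \<Rightarrow> 'b \<Rightarrow> real)" by (simp add: bilinear_conv_bounded_bilinear bounded_bilinear_inner)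
  show "g \<in> borel_measurable (lebesgue_on {s..t})" by (rule continuous_imp_measurable_on_sets_lebesgue[OF g]) simp
  show "bounded (g ` {s..t})" by (intro compact_imp_bounded compact_continuous_image g) simp
qed (use \<psi> in auto)

lemma mult_absolutely_integrable:
  fixes g \<psi> :: "real \<Rightarrow> real"
  assumes g: "continuous_on {s..t} g" and \<psi>: "\<psi> absolutely_integrable_on {s..t}"
  shows "(\<lambda>r. g r * \<psi> r) absolutely_integrable_on {s..t}"
  using inner_absolutely_integrable[OF g \<psi>] by simp

lemma integral_diff_Icc:
  fixes g :: "real \<Rightarrow> 'b::banach"
  assumes "g integrable_on {0..t}" "0 \<le> s" "s \<le> t"
  shows "integral {0..t} g - integral {0..s} g = integral {s..t} g"
  using Henstock_Kurzweil_Integration.integral_combine[OF assms(2,3,1)] by (simp add: diff_eq_eq add.commute)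

lemma integral_mono_off_negligible:
  fixes g h :: "real \<Rightarrow> real"
  assumes g: "g integrable_on {s..t}" and h: "h integrable_on {s..t}" and N: "negligible N"
    and le: "\<And>r. r \<in> {s..t} \<Longrightarrow> r \<notin> N \<Longrightarrow> g r \<le> h r"
  shows "integral {s..t} g \<le> integral {s..t} h"
proof -
  let ?g = "\<lambda>r. if r \<in> N then h r else g r"
  have "integral {s..t} g = integral {s..t} ?g" by (rule integral_spike[OF N]) auto
  also have "\<dots> \<le> integral {s..t} h"
  proof (rule integral_le[OF _ h])
    show "?g integrable_on {s..t}" by (rule integrable_spike[OF g N]) auto
  qed (use le in auto)
  finally show ?thesis .
qed

lemma integral_affine_combination:
  fixes n p :: "real \<Rightarrow> real"
  assumes "n integrable_on {s..t}" "p integrable_on {s..t}" "s \<le> t"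
  shows "integral {s..t} (\<lambda>r. \<alpha> * n r + (c + k * p r)) = \<alpha> * integral {s..t} n + (c * (t - s) + k * integral {s..t} p)"
proof -
  have c: "((\<lambda>r. c) has_integral c * (t - s)) {s..t}"
    using has_integral_const_real[of c s t] assms(3) by (simp add: mult.commute)
  show ?thesis
    by (rule integral_unique, rule has_integral_add[OF has_integral_mult_right[OF integrable_integral[OF assms(1)]]
        has_integral_add[OF c has_integral_mult_right[OF integrable_integral[OF assms(2)]]]])
qed

text \<open>\<open>P_A\<close> and \<open>P_B\<close> are what the matrix inequality amounts to,
  \<open>P_B\<close> being the identity between \<open>P B\<close> and the transpose of
  \<open>C\<close> that its zero block enforces. \<open>N\<close>, \<open>a\<close>,
  \<open>h0\<close> and \<open>\<beta>\<close> are supplied by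
  \<open>hurwitz_contracting_norm\<close>.\<close>

locale lure =
  fixes A P :: "real^'n^'n" and B :: "real^'m^'n" and C :: "real^'n^'m" and f :: "real^'m \<Rightarrow> real^'m"
    and H :: "real^'m^'n" and N :: "real^'n \<Rightarrow> real" and a h0 \<beta> :: real
  assumes f_cont: "continuous_on UNIV f"
    and P_sym: "\<And>x y. x \<bullet> (P *v y) = (P *v x) \<bullet> y"
    and P_pos: "\<And>x. x \<bullet> (P *v x) \<ge> 0"
    and P_A: "\<And>x. (P *v x) \<bullet> (A *v x) \<le> 0"
    and P_B: "\<And>x u. (P *v x) \<bullet> (B *v u) = (C *v x) \<bullet> u"
    and N_props: "a > 0" "h0 > 0" "\<beta> > 0" "\<And>x. norm x \<le> N x" "\<And>x. N x \<le> \<beta> * norm x"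
      "\<And>x y. N (x + y) \<le> N x + N y" "\<And>x h. 0 \<le> h \<Longrightarrow> h \<le> h0 \<Longrightarrow> N (x + h *\<^sub>R ((A - H ** C) *v x)) \<le> (1 - a * h) * N x"
    and growth: "\<And>\<Gamma>. compact \<Gamma> \<Longrightarrow> \<exists>\<theta>\<in>class_K_inf. \<exists>\<alpha>\<in>class_K_inf. \<exists>\<mu>\<ge>0. \<exists>c\<ge>0. \<mu> * c \<ge> 1 \<and>
        (\<forall>y. \<forall>z\<in>\<Gamma>.
          norm (f (y + z) - f z) \<le> \<theta> (norm y) \<and>
          norm y * \<alpha> (norm y) \<le> y \<bullet> (f (y + z) - f z) \<and>
          (norm y > \<mu> \<longrightarrow> norm (f (y + z) - f z) \<le> c * (y \<bullet> (f (y + z) - f z))))"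
begin

abbreviation sol :: "(real \<Rightarrow> real^'m) \<Rightarrow> (real \<Rightarrow> real^'n) \<Rightarrow> bool" where
  "sol v x \<equiv> solution {0..} A B C f v x"

definition V :: "real^'n \<Rightarrow> real" where "V x = x \<bullet> (P *v x)"

lemma V_nonneg: "V x \<ge> 0" by (simp add: V_def P_pos)

lemma V_upper: obtains c where "c > 0" "\<And>x. V x \<le> c * (norm x)\<^sup>2"
proof -
  obtain K where K: "K > 0" "\<And>x. norm (P *v x) \<le> norm x * K"
    using bounded_linear.pos_bounded[OF bounded_linear_matrix[of P]] by blast
  have "V x \<le> K * (norm x)\<^sup>2" for x
  proof -
    have "V x \<le> norm x * norm (P *v x)" unfolding V_def by (rule norm_cauchy_schwarz)
    also have "\<dots> \<le> norm x * (norm x * K)" by (intro mult_left_mono K) auto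
    finally show ?thesis by (simp add: power2_eq_square mult_ac)
  qed
  then show thesis by (rule that[OF K(1)])
qed

text \<open>Cauchy--Schwarz for the semi-inner product of \<open>P\<close>, applied to \<open>x\<close> and \<open>B C x\<close>.\<close>

lemma output_le_V: obtains \<kappa> where "\<kappa> > 0" "\<And>x. norm (C *v x) \<le> \<kappa> * sqrt (V x)"
proof -
  obtain c where c: "c > 0" "\<And>x. V x \<le> c * (norm x)\<^sup>2" using V_upper by blast
  obtain K where K: "K > 0" "\<And>x. norm (B *v x) \<le> norm x * K"
    using bounded_linear.pos_bounded[OF bounded_linear_matrix[of B]] by blast
  define \<kappa> where "\<kappa> = sqrt c * K"
  have "\<kappa> > 0" using c K by (simp add: \<kappa>_def)
  have "norm (C *v x) \<le> \<kappa> * sqrt (V x)" for x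
  proof (cases "C *v x = 0")
    case True then show ?thesis using \<open>\<kappa> > 0\<close> V_nonneg by simp
  next
    case False
    define w where "w = B *v (C *v x)"
    define y where "y = norm (C *v x)"
    have "y > 0" using False by (simp add: y_def)
    have Pxw: "(P *v x) \<bullet> w = y\<^sup>2" by (simp add: w_def P_B y_def power2_norm_eq_inner)
    have Vw: "V w \<le> (\<kappa> * y)\<^sup>2"
    proof -
      have "V w \<le> c * (norm w)\<^sup>2" by (rule c)
      also have "\<dots> \<le> c * (y * K)\<^sup>2" unfolding w_def y_def using c K by (intro mult_left_mono power_mono) auto
      finally show ?thesis using c by (simp add: \<kappa>_def power_mult_distrib mult_ac)
    qed
    have quad: "0 \<le> V x - 2 * s * y\<^sup>2 + s\<^sup>2 * V w" for s
    proof -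
      have "V (x - s *\<^sub>R w) = V x - 2 * s * ((P *v x) \<bullet> w) + s\<^sup>2 * V w"
        unfolding V_def using P_sym[of w x] P_sym[of x w]
        by (simp add: matrix_vector_mult_diff_distrib matrix_vector_mult_scaleR inner_diff_left inner_diff_right
            power2_eq_square inner_commute algebra_simps)
      then show ?thesis using V_nonneg[of "x - s *\<^sub>R w"] by (simp add: Pxw)
    qed
    \<comment> \<open>The minimiser of the quadratic in \<open>quad\<close> after \<open>V w\<close>
      is replaced by its upper bound.\<close>
    define s where "s = 1 / \<kappa>\<^sup>2"
    have s: "s > 0" using \<open>\<kappa> > 0\<close> by (simp add: s_def)
    have "s\<^sup>2 * V w \<le> s\<^sup>2 * (\<kappa> * y)\<^sup>2" using Vw by (intro mult_left_mono) auto
    also have "\<dots> = s * y\<^sup>2" using \<open>\<kappa> > 0\<close> by (simp add: s_def power2_eq_square)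
    finally have "s * y\<^sup>2 \<le> V x" using quad[of s] by simp
    then have "y\<^sup>2 \<le> \<kappa>\<^sup>2 * V x" using \<open>\<kappa> > 0\<close> by (simp add: s_def pos_divide_le_eq mult.commute)
    also have "\<dots> = (\<kappa> * sqrt (V x))\<^sup>2" using V_nonneg by (simp add: power_mult_distrib)
    finally have "y\<^sup>2 \<le> (\<kappa> * sqrt (V x))\<^sup>2" .
    moreover have "0 \<le> \<kappa> * sqrt (V x)" using \<open>\<kappa> > 0\<close> V_nonneg[of x] by simp
    ultimately show ?thesis unfolding y_def by (rule power2_le_imp_le)
  qed
  then show thesis by (rule that[OF \<open>\<kappa> > 0\<close>])
qed

text \<open>Bounds the drive that remains when the difference equation is written with
  \<open>A - H ** C\<close>; \<open>y\<close>, \<open>u\<close> and \<open>d\<close> stand for the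
  differences of outputs, nonlinearities and inputs.\<close>

lemma gain_bound: obtains b where "b > 0" "\<And>y u d. \<beta> * norm (H *v y - B *v u + B *v d) \<le> b * (norm y + norm u + norm d)"
proof -
  obtain KH where KH: "KH > 0" "\<And>x. norm (H *v x) \<le> norm x * KH"
    using bounded_linear.pos_bounded[OF bounded_linear_matrix[of H]] by blast
  obtain KB where KB: "KB > 0" "\<And>x. norm (B *v x) \<le> norm x * KB"
    using bounded_linear.pos_bounded[OF bounded_linear_matrix[of B]] by blast
  define b where "b = \<beta> * (KH + KB)"
  have "\<beta> * norm (H *v y - B *v u + B *v d) \<le> b * (norm y + norm u + norm d)" for y u d
  proof -
    have "norm (H *v y - B *v u + B *v d) \<le> norm y * KH + norm u * KB + norm d * KB"
      by (intro norm_triangle_le norm_triangle_le_diff add_mono KH KB)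
    also have "\<dots> \<le> norm y * (KH + KB) + norm u * (KH + KB) + norm d * (KH + KB)"
      using KH KB by (intro add_mono mult_left_mono) auto
    finally have "\<beta> * norm (H *v y - B *v u + B *v d) \<le> \<beta> * ((norm y + norm u + norm d) * (KH + KB))"
      using N_props(3) by (intro mult_left_mono) (auto simp: distrib_right)
    then show ?thesis by (simp add: b_def mult_ac)
  qed
  moreover have "b > 0" using N_props(3) KH(1) KB(1) by (simp add: b_def)
  ultimately show thesis using that[of b] by simp
qed

lemma cont_matrix: "continuous_on S g \<Longrightarrow> continuous_on S (\<lambda>t. M *v g t)" for M :: "real^'k^'l"
  by (rule bounded_linear.continuous_on[OF bounded_linear_matrix])

lemma N_lipschitz: "\<bar>N x - N y\<bar> \<le> \<beta> * norm (x - y)"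
proof -
  have "N x \<le> N (x - y) + N y" "N y \<le> N (y - x) + N x" using N_props(6)[of "x - y" y] N_props(6)[of "y - x" x] by simp_all
  then show ?thesis using N_props(5)[of "x - y"] N_props(5)[of "y - x"] by (simp add: norm_minus_commute)
qed

lemma N_continuous: "continuous_on S N"
proof (rule continuous_onI)
  fix x and e :: real assume "e > 0"
  have "dist (N x') (N x) \<le> e" if "dist x' x < e / \<beta>" for x'
  proof -
    have "dist (N x') (N x) \<le> \<beta> * norm (x' - x)" using N_lipschitz[of x' x] by (simp add: dist_real_def)
    also have "\<dots> \<le> \<beta> * (e / \<beta>)" using that N_props(3) by (intro mult_left_mono) (auto simp: dist_norm)
    finally show ?thesis using N_props(3) by simp
  qed
  then show "\<exists>d>0. \<forall>x'\<in>S. dist x' x < d \<longrightarrow> dist (N x') (N x) \<le> e"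
    using \<open>e > 0\<close> N_props(3) by (intro exI[of _ "e / \<beta>"]) auto
qed

context
  fixes v1 v2 x1 x2 e d D
  assumes sol1: "sol v1 x1" and sol2: "sol v2 x2"
  defines "e \<equiv> \<lambda>t. x1 t - x2 t" and "d \<equiv> \<lambda>t. v1 t - v2 t"
    and "D \<equiv> \<lambda>t. f (C *v x1 t) - f (C *v x2 t)"
begin

lemma cont_x: "continuous_on {0..} x1" "continuous_on {0..} x2" "continuous_on {0..} e"
  using sol1 sol2 by (auto simp: solution_def e_def intro!: continuous_intros)

lemma cont_D: "continuous_on {0..} D"
  unfolding D_def by (intro continuous_intros continuous_on_compose2[OF f_cont] cont_matrix cont_x) auto

lemma d_absolutely_integrable: "0 \<le> s \<Longrightarrow> d absolutely_integrable_on {s..t}"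
  unfolding d_def using sol1 sol2 by (intro set_integral_diff L1loc_integrable[of _ "{0..}"]) (auto simp: solution_def)

lemma norm_d_integrable: "0 \<le> s \<Longrightarrow> (\<lambda>r. norm (d r)) absolutely_integrable_on {s..t}"
  by (rule absolutely_integrable_norm[OF d_absolutely_integrable, unfolded o_def])

definition "\<psi> r = A *v e r - B *v D r + B *v d r"

lemma \<psi>_integral: "0 \<le> s \<Longrightarrow> s \<le> t \<Longrightarrow> (\<psi> has_integral (e t - e s)) {s..t}"
proof -
  assume st: "0 \<le> s" "s \<le> t"
  have "(lure_rhs A B C f v1 x1 has_integral (x1 t - x1 s)) {s..t}" "(lure_rhs A B C f v2 x2 has_integral (x2 t - x2 s)) {s..t}"
    using sol1 sol2 st by (auto simp: solution_def)
  from has_integral_diff[OF this] have "((\<lambda>r. lure_rhs A B C f v1 x1 r - lure_rhs A B C f v2 x2 r) has_integral (x1 t - x1 s - (x2 t - x2 s))) {s..t}" .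
  moreover have "(\<lambda>r. lure_rhs A B C f v1 x1 r - lure_rhs A B C f v2 x2 r) = \<psi>"
    by (auto simp: fun_eq_iff \<psi>_def lure_rhs_def e_def d_def D_def matrix_vector_mult_diff_distrib)
  moreover have "x1 t - x1 s - (x2 t - x2 s) = e t - e s" by (simp add: e_def)
  ultimately show ?thesis by simp
qed

lemma \<psi>_absolutely_integrable: "0 \<le> s \<Longrightarrow> \<psi> absolutely_integrable_on {s..t}"
proof -
  assume s: "0 \<le> s"
  have c: "continuous_on {s..t} (\<lambda>r. A *v e r - B *v D r)"
    by (rule continuous_on_subset[of "{0..}"]) (use s in \<open>auto intro!: continuous_intros cont_matrix cont_x cont_D\<close>)
  have "((*v) B \<circ> d) absolutely_integrable_on {s..t}"
    by (rule absolutely_integrable_linear[OF d_absolutely_integrable[OF s] bounded_linear_matrix])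
  from set_integral_add(1)[OF absolutely_integrable_continuous_real[OF c] this]
  show ?thesis by (simp add: \<psi>_def[abs_def] o_def)
qed

text \<open>Over a short interval the increment of \<open>V\<close> is exactly the inner product of
  the increment of \<open>e\<close> with the sum of \<open>P e\<close> at both ends. Uniform
  continuity replaces that sum by \<open>2 P e r\<close> at the price of a small multiple of the
  integral of \<open>norm (\<psi> r)\<close>. Then \<open>P_A\<close> removes the linear part, and
  \<open>P_B\<close> turns the rest into outputs.\<close>

lemma V_increment:
  assumes st: "0 \<le> s" "s \<le> t"
  shows "V (e t) - V (e s) \<le> integral {s..t} (\<lambda>r. - 2 * ((C *v e r) \<bullet> D r) + 2 * (norm (C *v e r) * norm (d r)))"
proof -
  have Pe: "continuous_on {0..} (\<lambda>r. P *v e r)" by (intro cont_matrix cont_x)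
  have i1: "(\<lambda>r. 2 * ((P *v e r) \<bullet> \<psi> r)) absolutely_integrable_on {s'..t'}" if "0 \<le> s'" for s' t'
    by (intro set_integrable_mult_right inner_absolutely_integrable continuous_on_subset[OF Pe] \<psi>_absolutely_integrable) (use that in auto)
  have i2: "(\<lambda>r. norm (\<psi> r)) absolutely_integrable_on {s'..t'}" if "0 \<le> s'" for s' t'
    by (rule absolutely_integrable_norm[OF \<psi>_absolutely_integrable[OF that], unfolded o_def])
  note hk = set_lebesgue_integral_eq_integral(1)
  let ?H = "\<lambda>t. integral {0..t} (\<lambda>r. 2 * ((P *v e r) \<bullet> \<psi> r))"
  let ?G = "\<lambda>t. integral {0..t} (\<lambda>r. norm (\<psi> r))"
  have "V (e t) - V (e s) \<le> ?H t - ?H s"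
  proof (rule increment_le_of_local[OF st(2), where G = ?G])
    fix \<eta> :: real assume "\<eta> > 0"
    have "uniformly_continuous_on {s..t} (\<lambda>r. P *v e r)"
      by (intro compact_uniformly_continuous continuous_on_subset[OF Pe]) (use st in auto)
    then obtain \<delta> where \<delta>: "\<delta> > 0" "\<And>r r'. r \<in> {s..t} \<Longrightarrow> r' \<in> {s..t} \<Longrightarrow> dist r' r < \<delta> \<Longrightarrow> dist (P *v e r') (P *v e r) < \<eta>/2"
      using \<open>\<eta> > 0\<close> unfolding uniformly_continuous_on_def by (meson half_gt_zero)
    show "\<exists>\<delta>>0. \<forall>s' t'. s \<le> s' \<longrightarrow> s' \<le> t' \<longrightarrow> t' \<le> t \<longrightarrow> t' - s' < \<delta> \<longrightarrow>
        V (e t') - V (e s') \<le> ?H t' - ?H s' + \<eta> * (?G t' - ?G s')"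
    proof (intro exI[of _ \<delta>] conjI allI impI \<delta>(1))
      fix s' t' assume s't': "s \<le> s'" "s' \<le> t'" "t' \<le> t" "t' - s' < \<delta>"
      then have s'0: "0 \<le> s'" using st by simp
      have Heq: "?H t' - ?H s' = integral {s'..t'} (\<lambda>r. 2 * ((P *v e r) \<bullet> \<psi> r))"
        by (rule integral_diff_Icc[OF hk[OF i1]]) (use s'0 s't' in auto)
      have Geq: "?G t' - ?G s' = integral {s'..t'} (\<lambda>r. norm (\<psi> r))"
        by (rule integral_diff_Icc[OF hk[OF i2]]) (use s'0 s't' in auto)
      let ?p = "P *v e t' + P *v e s'"
      have "V (e t') - V (e s') = ?p \<bullet> (e t' - e s')"
        unfolding V_def using P_sym[of "e t'" "e s'"]
        by (simp add: inner_diff_right inner_add_left inner_diff_left inner_add_right inner_commute)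
      moreover have hi: "((\<lambda>r. ?p \<bullet> \<psi> r) has_integral (?p \<bullet> (e t' - e s'))) {s'..t'}"
        using has_integral_linear[OF \<psi>_integral[OF s'0 s't'(2)] bounded_linear_inner_right[of ?p]] by (simp add: o_def)
      ultimately have "V (e t') - V (e s') = integral {s'..t'} (\<lambda>r. ?p \<bullet> \<psi> r)" by (simp add: integral_unique)
      also have "\<dots> \<le> integral {s'..t'} (\<lambda>r. 2 * ((P *v e r) \<bullet> \<psi> r) + \<eta> * norm (\<psi> r))"
      proof (rule integral_le)
        show "(\<lambda>r. ?p \<bullet> \<psi> r) integrable_on {s'..t'}" using hi by blast
        show "(\<lambda>r. 2 * ((P *v e r) \<bullet> \<psi> r) + \<eta> * norm (\<psi> r)) integrable_on {s'..t'}"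
          by (rule integrable_add[OF hk[OF i1[OF s'0]] integrable_on_mult_right[OF hk[OF i2[OF s'0]]]])
        fix r assume r: "r \<in> {s'..t'}"
        have "dist (P *v e t') (P *v e r) < \<eta>/2" "dist (P *v e s') (P *v e r) < \<eta>/2"
          using r s't' by (intro \<delta>(2); simp add: dist_real_def)+
        then have "norm ((P *v e t' - P *v e r) + (P *v e s' - P *v e r)) \<le> \<eta>/2 + \<eta>/2"
          unfolding dist_norm by (intro norm_triangle_le) simp
        then have "norm (?p - 2 *\<^sub>R (P *v e r)) \<le> \<eta>" by (simp add: scaleR_2 algebra_simps)
        then have "(?p - 2 *\<^sub>R (P *v e r)) \<bullet> \<psi> r \<le> \<eta> * norm (\<psi> r)"
          by (meson mult_right_mono norm_cauchy_schwarz norm_ge_zero order_trans)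
        then show "?p \<bullet> \<psi> r \<le> 2 * ((P *v e r) \<bullet> \<psi> r) + \<eta> * norm (\<psi> r)" by (simp add: inner_diff_left)
      qed
      also have "\<dots> = integral {s'..t'} (\<lambda>r. 2 * ((P *v e r) \<bullet> \<psi> r)) + \<eta> * integral {s'..t'} (\<lambda>r. norm (\<psi> r))"
        using hk[OF i1[OF s'0]] hk[OF i2[OF s'0]]
        by (simp add: Henstock_Kurzweil_Integration.integral_add integrable_on_mult_right)
      finally show "V (e t') - V (e s') \<le> ?H t' - ?H s' + \<eta> * (?G t' - ?G s')" unfolding Heq Geq .
    qed
  qed
  also have "?H t - ?H s = integral {s..t} (\<lambda>r. 2 * ((P *v e r) \<bullet> \<psi> r))"
    by (rule integral_diff_Icc[OF hk[OF i1]]) (use st in auto)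
  also have "\<dots> \<le> integral {s..t} (\<lambda>r. - 2 * ((C *v e r) \<bullet> D r) + 2 * (norm (C *v e r) * norm (d r)))"
  proof (rule integral_le)
    show "(\<lambda>r. 2 * ((P *v e r) \<bullet> \<psi> r)) integrable_on {s..t}" by (rule hk[OF i1[OF st(1)]])
    have "continuous_on {s..t} (\<lambda>r. (C *v e r) \<bullet> D r)"
      by (rule continuous_on_subset[of "{0..}"]) (use st in \<open>auto intro!: continuous_intros cont_matrix cont_x cont_D\<close>)
    then have X: "(\<lambda>r. (C *v e r) \<bullet> D r) integrable_on {s..t}" by (rule integrable_continuous_interval)
    have "continuous_on {s..t} (\<lambda>r. norm (C *v e r))"
      by (rule continuous_on_subset[of "{0..}"]) (use st in \<open>auto intro!: continuous_intros cont_matrix cont_x\<close>)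
    then have Y: "(\<lambda>r. norm (C *v e r) * norm (d r)) integrable_on {s..t}"
      by (intro hk mult_absolutely_integrable norm_d_integrable st)
    show "(\<lambda>r. - 2 * ((C *v e r) \<bullet> D r) + 2 * (norm (C *v e r) * norm (d r))) integrable_on {s..t}"
      by (rule integrable_add[OF integrable_on_mult_right[OF X] integrable_on_mult_right[OF Y]])
    fix r assume "r \<in> {s..t}"
    have "(P *v e r) \<bullet> \<psi> r = (P *v e r) \<bullet> (A *v e r) - (C *v e r) \<bullet> D r + (C *v e r) \<bullet> d r"
      by (simp add: \<psi>_def inner_add_right inner_diff_right P_B)
    moreover have "(C *v e r) \<bullet> d r \<le> norm (C *v e r) * norm (d r)" by (rule norm_cauchy_schwarz)
    ultimately show "2 * ((P *v e r) \<bullet> \<psi> r) \<le> - 2 * ((C *v e r) \<bullet> D r) + 2 * (norm (C *v e r) * norm (d r))"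
      using P_A[of "e r"] by simp
  qed
  finally show ?thesis .
qed

text \<open>\<open>N\<close> need not be differentiable, so a short increment of \<open>e\<close> is
  compared with one Euler step of \<open>A - H ** C\<close>. The step contracts, and subadditivity
  leaves the remainder \<open>R\<close>, which is bounded by the integral of the drive plus an
  oscillation term.\<close>

lemma N_increment:
  assumes b: "\<And>y u d. \<beta> * norm (H *v y - B *v u + B *v d) \<le> b * (norm y + norm u + norm d)"
    and st: "0 \<le> s" "s \<le> t"
  shows "N (e t) - N (e s) \<le> integral {s..t} (\<lambda>r. - a * N (e r) + b * (norm (C *v e r) + norm (D r) + norm (d r)))"
proof -
  define F where "F = A - H ** C"
  define g where "g r = H *v (C *v e r) - B *v D r + B *v d r" for r
  have \<psi>F: "\<psi> r = F *v e r + g r" for r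
    by (simp add: \<psi>_def F_def g_def matrix_vector_mult_diff_rdistrib matrix_vector_mul_assoc)
  note hk = set_lebesgue_integral_eq_integral(1)
  have cN: "continuous_on {0..} (\<lambda>r. N (e r))" by (rule continuous_on_compose2[OF N_continuous cont_x(3)]) auto
  have cn: "continuous_on {0..} (\<lambda>r. norm (C *v e r) + norm (D r))" by (intro continuous_intros cont_matrix cont_x cont_D)
  let ?w = "\<lambda>r. - a * N (e r) + b * (norm (C *v e r) + norm (D r) + norm (d r))"
  have ib: "(\<lambda>r. b * (norm (C *v e r) + norm (D r) + norm (d r))) integrable_on {s'..t'}" if "0 \<le> s'" for s' t'
  proof -
    have "(\<lambda>r. norm (C *v e r) + norm (D r)) integrable_on {s'..t'}"
      by (intro integrable_continuous_interval continuous_on_subset[OF cn]) (use that in auto)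
    from integrable_add[OF this hk[OF norm_d_integrable[OF that]]] show ?thesis by (rule integrable_on_mult_right)
  qed
  have iw: "?w integrable_on {s'..t'}" if "0 \<le> s'" for s' t'
  proof -
    have "(\<lambda>r. N (e r)) integrable_on {s'..t'}"
      by (intro integrable_continuous_interval continuous_on_subset[OF cN]) (use that in auto)
    then have "(\<lambda>r. - a * N (e r)) integrable_on {s'..t'}" by (rule integrable_on_mult_right)
    then show ?thesis by (rule integrable_add[OF _ ib[OF that]])
  qed
  let ?H = "\<lambda>t. integral {0..t} ?w"
  obtain KF where KF: "KF > 0" "\<And>x. norm (F *v x) \<le> norm x * KF"
    using bounded_linear.pos_bounded[OF bounded_linear_matrix[of F]] by blast
  have "N (e t) - N (e s) \<le> ?H t - ?H s"
  proof (rule increment_le_of_local[OF st(2), where G = "\<lambda>t. t"])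
    fix \<eta> :: real assume "\<eta> > 0"
    \<comment> \<open>Freezing \<open>F e\<close> at the left end costs
      \<open>\<beta> * KF * \<omega>\<close> per unit of time, freezing \<open>N e\<close> costs
      \<open>a * \<beta> * \<omega>\<close>; together this is \<open>\<eta>\<close>.\<close>
    define \<omega> where "\<omega> = \<eta> / (\<beta> * KF + a * \<beta>)"
    have pos: "\<beta> * KF + a * \<beta> > 0" using N_props KF by (simp add: add_pos_pos)
    then have "\<omega> > 0" using \<open>\<eta> > 0\<close> by (simp add: \<omega>_def)
    have "uniformly_continuous_on {s..t} e"
      by (intro compact_uniformly_continuous continuous_on_subset[OF cont_x(3)]) (use st in auto)
    then obtain \<delta> where \<delta>: "\<delta> > 0" "\<And>r r'. r \<in> {s..t} \<Longrightarrow> r' \<in> {s..t} \<Longrightarrow> dist r' r < \<delta> \<Longrightarrow> dist (e r') (e r) < \<omega>"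
      using \<open>\<omega> > 0\<close> unfolding uniformly_continuous_on_def by meson
    show "\<exists>\<delta>>0. \<forall>s' t'. s \<le> s' \<longrightarrow> s' \<le> t' \<longrightarrow> t' \<le> t \<longrightarrow> t' - s' < \<delta> \<longrightarrow>
        N (e t') - N (e s') \<le> ?H t' - ?H s' + \<eta> * (t' - s')"
    proof (intro exI[of _ "min \<delta> h0"] conjI allI impI)
      show "min \<delta> h0 > 0" using \<delta> N_props by simp
      fix s' t' assume s't': "s \<le> s'" "s' \<le> t'" "t' \<le> t" "t' - s' < min \<delta> h0"
      then have s'0: "0 \<le> s'" using st by simp
      have Heq: "?H t' - ?H s' = integral {s'..t'} ?w"
        by (rule integral_diff_Icc[OF iw]) (use s'0 s't' in auto)
      have osc: "norm (e r - e s') \<le> \<omega>" if "r \<in> {s'..t'}" for r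
        using \<delta>(2)[of s' r] that s't' by (auto simp: dist_norm dist_real_def intro: less_imp_le)
      define R where "R = e t' - (e s' + (t' - s') *\<^sub>R (F *v e s'))"
      have hi: "((\<lambda>r. \<psi> r - F *v e s') has_integral R) {s'..t'}"
      proof -
        have "((\<lambda>r. F *v e s') has_integral (t' - s') *\<^sub>R (F *v e s')) {s'..t'}"
          using has_integral_const_real[of "F *v e s'" s' t'] s't' by simp
        from has_integral_diff[OF \<psi>_integral[OF s'0 s't'(2)] this] show ?thesis by (simp add: R_def algebra_simps)
      qed
      let ?b = "\<lambda>r. b * (norm (C *v e r) + norm (D r) + norm (d r))"
      have ic: "(\<lambda>r. c) integrable_on {s'..t'}" for c :: real by (rule integrable_const_ivl)
      have NR: "N R \<le> \<beta> * (KF * \<omega>) * (t' - s') + integral {s'..t'} ?b"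
      proof -
        have hi': "((\<lambda>r. \<beta> *\<^sub>R (\<psi> r - F *v e s')) has_integral \<beta> *\<^sub>R R) {s'..t'}" by (rule has_integral_cmul[OF hi])
        have "norm (integral {s'..t'} (\<lambda>r. \<beta> *\<^sub>R (\<psi> r - F *v e s'))) \<le> integral {s'..t'} (\<lambda>r. \<beta> * (KF * \<omega>) + ?b r)"
        proof (rule Henstock_Kurzweil_Integration.integral_norm_bound_integral)
          show "(\<lambda>r. \<beta> *\<^sub>R (\<psi> r - F *v e s')) integrable_on {s'..t'}" using hi' by blast
          show "(\<lambda>r. \<beta> * (KF * \<omega>) + ?b r) integrable_on {s'..t'}" by (rule integrable_add[OF ic ib[OF s'0]])
          fix r assume r: "r \<in> {s'..t'}"
          have "\<psi> r - F *v e s' = F *v (e r - e s') + g r" by (simp add: \<psi>F matrix_vector_mult_diff_distrib)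
          moreover have "norm (F *v (e r - e s')) \<le> KF * \<omega>"
            unfolding mult.commute[of KF] by (rule order_trans[OF KF(2) mult_right_mono[OF osc[OF r] less_imp_le[OF KF(1)]]])
          ultimately have "norm (\<psi> r - F *v e s') \<le> KF * \<omega> + norm (g r)"
            by (metis add_right_mono norm_triangle_ineq order_trans)
          then have "\<beta> * norm (\<psi> r - F *v e s') \<le> \<beta> * (KF * \<omega>) + \<beta> * norm (g r)"
            using N_props(3) by (simp add: distrib_left[symmetric])
          also have "\<beta> * norm (g r) \<le> ?b r" unfolding g_def by (rule b)
          finally show "norm (\<beta> *\<^sub>R (\<psi> r - F *v e s')) \<le> \<beta> * (KF * \<omega>) + ?b r" using N_props(3) by simp
        qed
        moreover have "integral {s'..t'} (\<lambda>r. \<beta> *\<^sub>R (\<psi> r - F *v e s')) = \<beta> *\<^sub>R R" by (rule integral_unique[OF hi'])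
        moreover have "integral {s'..t'} (\<lambda>r. \<beta> * (KF * \<omega>) + ?b r) = \<beta> * (KF * \<omega>) * (t' - s') + integral {s'..t'} ?b"
          using s't' by (subst Henstock_Kurzweil_Integration.integral_add[OF ic ib[OF s'0]]) simp
        ultimately have "\<beta> * norm R \<le> \<beta> * (KF * \<omega>) * (t' - s') + integral {s'..t'} ?b" using N_props(3) by simp
        then show ?thesis using N_props(5)[of R] by linarith
      qed
      have "integral {s'..t'} (\<lambda>r. - a * (N (e s') + \<beta> * \<omega>) + ?b r) \<le> integral {s'..t'} ?w"
      proof (rule integral_le[OF integrable_add[OF ic ib[OF s'0]] iw[OF s'0]])
        fix r assume r: "r \<in> {s'..t'}"
        have "\<bar>N (e r) - N (e s')\<bar> \<le> \<beta> * \<omega>"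
          by (rule order_trans[OF N_lipschitz mult_left_mono[OF osc[OF r] less_imp_le[OF N_props(3)]]])
        then have "N (e r) \<le> N (e s') + \<beta> * \<omega>" by linarith
        then have "a * N (e r) \<le> a * (N (e s') + \<beta> * \<omega>)" using N_props(1) by (intro mult_left_mono) auto
        then show "- a * (N (e s') + \<beta> * \<omega>) + ?b r \<le> ?w r" by simp
      qed
      moreover have "integral {s'..t'} (\<lambda>r. - a * (N (e s') + \<beta> * \<omega>) + ?b r) = - a * (N (e s') + \<beta> * \<omega>) * (t' - s') + integral {s'..t'} ?b"
        using s't' by (subst Henstock_Kurzweil_Integration.integral_add[OF ic ib[OF s'0]]) simp
      ultimately have low: "- a * (N (e s') + \<beta> * \<omega>) * (t' - s') + integral {s'..t'} ?b \<le> ?H t' - ?H s'" using Heq by simp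
      have "e t' = (e s' + (t' - s') *\<^sub>R (F *v e s')) + R" by (simp add: R_def)
      then have "N (e t') \<le> N (e s' + (t' - s') *\<^sub>R (F *v e s')) + N R" using N_props(6) by metis
      also have "N (e s' + (t' - s') *\<^sub>R (F *v e s')) \<le> (1 - a * (t' - s')) * N (e s')"
        unfolding F_def using s't' by (intro N_props(7)) auto
      finally have up: "N (e t') \<le> (1 - a * (t' - s')) * N (e s') + N R" by simp
      have "\<eta> * (t' - s') = (\<beta> * KF + a * \<beta>) * \<omega> * (t' - s')" using pos by (simp add: \<omega>_def)
      then show "N (e t') - N (e s') \<le> ?H t' - ?H s' + \<eta> * (t' - s')"
        using up NR low by (simp add: algebra_simps)
    qed
  qed
  also have "?H t - ?H s = integral {s..t} ?w" by (rule integral_diff_Icc[OF iw]) (use st in auto)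
  finally show ?thesis .
qed

end

text \<open>Collects the requirements of the uniform estimate, with \<open>x2\<close> as the
  reference solution. The second absorbs the cross term of \<open>V_increment\<close> into half of
  the dissipation; it is available for bounded input differences and for bounded output differences.
  In the third, the summand 1 accommodates intervals shorter than a unit.\<close>

definition admissible where
  "admissible \<Gamma> Y \<delta> v1 x1 v2 x2 \<longleftrightarrow> sol v1 x1 \<and> sol v2 x2 \<and> (\<forall>t\<ge>0. C *v x2 t \<in> \<Gamma>) \<and>
    (\<exists>Z. negligible Z \<and> (\<forall>r\<ge>0. r \<notin> Z \<longrightarrow> norm (C *v (x1 r - x2 r)) * norm (v1 r - v2 r) \<le>
      (C *v (x1 r - x2 r)) \<bullet> (f (C *v x1 r) - f (C *v x2 r)) / 2 + Y * norm (v1 r - v2 r))) \<and>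
    (\<forall>s t. 0 \<le> s \<longrightarrow> s \<le> t \<longrightarrow> integral {s..t} (\<lambda>r. norm (v1 r - v2 r)) \<le> \<delta> * (t - s + 1))"

text \<open>\<open>T\<close> is fixed before the solutions. This uniformity lets one waiting time
  serve all translates of a solution and all starting points in the far past.\<close>

abbreviation attracted where
  "attracted \<Gamma> Y \<delta> r T \<eta> \<equiv> \<forall>v1 x1 v2 x2. admissible \<Gamma> Y \<delta> v1 x1 v2 x2 \<longrightarrow> norm (x1 0 - x2 0) \<le> r \<longrightarrow>
    (\<forall>t\<ge>T. norm (x1 t - x2 t) \<le> \<eta>)"

abbreviation inputs_admissible where
  "inputs_admissible \<Gamma> Y D \<equiv> \<forall>\<delta> v1 x1 v2 x2. sol v1 x1 \<longrightarrow> sol v2 x2 \<longrightarrow> (\<forall>t\<ge>0. C *v x2 t \<in> \<Gamma>) \<longrightarrow>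
    (AE t in lebesgue_on {0..}. norm (v1 t - v2 t) \<le> D) \<longrightarrow>
    (\<forall>r\<ge>0. integral {r..r + 1} (\<lambda>r. norm (v1 r - v2 r)) \<le> \<delta>) \<longrightarrow> admissible \<Gamma> Y \<delta> v1 x1 v2 x2"

abbreviation close_outputs where
  "close_outputs \<Gamma> \<delta> \<eta> \<equiv> \<forall>v1 x1 v2 x2 t0. sol v1 x1 \<longrightarrow> sol v2 x2 \<longrightarrow> (\<forall>t\<ge>0. C *v x2 t \<in> \<Gamma>) \<longrightarrow> t0 \<ge> 0 \<longrightarrow>
    (AE t in lebesgue_on {t0..}. norm (v1 t - v2 t) \<le> \<delta>) \<longrightarrow> (\<exists>T. \<forall>t\<ge>T. norm (x1 t - x2 t) \<le> \<eta>)"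

text \<open>Two applications of the decay alternative: first to \<open>N + b K V\<close>, which makes \<open>V\<close> and hence the
  output difference small, then to \<open>N\<close> alone with the improved bound on the output.\<close>

lemma core_estimate:
  assumes b: "b > 0" "\<And>y u d. \<beta> * norm (H *v y - B *v u + B *v d) \<le> b * (norm y + norm u + norm d)"
    and k: "k > 0" "\<And>x. norm (C *v x) \<le> k * sqrt (V x)" and cV: "cV > 0" "\<And>x. V x \<le> cV * (norm x)\<^sup>2"
    and const: "Y \<ge> 0" "K \<ge> 1" "\<epsilon> > 0" "\<delta> > 0"
    and star: "\<And>y z. z \<in> \<Gamma> \<Longrightarrow> norm y + norm (f (y + z) - f z) \<le> \<epsilon> + K * (y \<bullet> (f (y + z) - f z))"
    and \<theta>: "\<And>y z. z \<in> \<Gamma> \<Longrightarrow> norm (f (y + z) - f z) \<le> \<theta> (norm y)" "\<And>u w. 0 \<le> u \<Longrightarrow> u \<le> w \<Longrightarrow> \<theta> u \<le> \<theta> w" "\<And>u. 0 \<le> u \<Longrightarrow> 0 \<le> \<theta> u"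
    and m_def: "m = b * \<epsilon> + (b + 2 * Y * (b * K)) * \<delta>" and vb_def: "vb = (2 * m / a + m) / (b * K) + cV * (2 * m / a)\<^sup>2"
    and ys_def: "ys = k * sqrt vb" and m2_def: "m2 = b * (ys + \<theta> ys + \<delta>)"
  shows "\<exists>T. attracted \<Gamma> Y \<delta> r0 T (2 * m2 / a + m2)"
proof -
  have a: "a > 0" by (rule N_props(1))
  have bK: "b * K > 0" using b(1) const(2) by simp
  have "(b + 2 * Y * (b * K)) * \<delta> \<ge> 0" using b(1) bK const by (intro mult_nonneg_nonneg add_nonneg_nonneg) auto
  then have m: "m > 0" using b(1) const by (simp add: m_def add_pos_nonneg)
  have vb: "vb \<ge> 0" using m a bK cV by (simp add: vb_def)
  have ys: "ys \<ge> 0" using vb k by (simp add: ys_def)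
  have m2: "m2 > 0" using b(1) ys \<theta>(3)[OF ys] const(4) by (simp add: m2_def add_nonneg_pos)
  \<comment> \<open>\<open>u0\<close> bounds \<open>U\<close> at time 0 and \<open>u1\<close> bounds
    it from \<open>T1\<close> on; the waiting times are those of
    \<open>decay_alternative\<close>.\<close>
  define u0 where "u0 = \<beta> * r0 + b * K * (cV * r0\<^sup>2)"
  define u1 where "u1 = 2 * m / a + b * K * (cV * (2 * m / a)\<^sup>2) + m"
  define T1 where "T1 = u0 / m + 2"
  define T where "T = T1 + u1 / m2 + 2"
  have "norm (x1 t - x2 t) \<le> 2 * m2 / a + m2"
    if adm: "admissible \<Gamma> Y \<delta> v1 x1 v2 x2" and init: "norm (x1 0 - x2 0) \<le> r0" and t: "t \<ge> T" for v1 x1 v2 x2 t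
  proof -
    define e where "e t = x1 t - x2 t" for t
    define d where "d t = v1 t - v2 t" for t
    define D where "D t = f (C *v x1 t) - f (C *v x2 t)" for t
    define q where "q t = (C *v e t) \<bullet> D t" for t
    have s: "sol v1 x1" "sol v2 x2" using adm by (auto simp: admissible_def)
    have \<Gamma>: "C *v x2 t \<in> \<Gamma>" if "t \<ge> 0" for t using adm that by (auto simp: admissible_def)
    obtain Z where Z: "negligible Z" "\<And>r. r \<ge> 0 \<Longrightarrow> r \<notin> Z \<Longrightarrow> norm (C *v e r) * norm (d r) \<le> q r / 2 + Y * norm (d r)"
      using adm unfolding admissible_def e_def d_def D_def q_def by auto
    have step: "integral {s..t} (\<lambda>r. norm (d r)) \<le> \<delta> * (t - s + 1)" if "0 \<le> s" "s \<le> t" for s t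
      using adm that unfolding admissible_def d_def by auto
    have Df: "D r = f (C *v e r + C *v x2 r) - f (C *v x2 r)" for r
      by (simp add: D_def e_def matrix_vector_mult_diff_distrib)
    note hk = set_lebesgue_integral_eq_integral(1)
    have ce: "continuous_on {0..} e" using cont_x(3)[OF s] by (simp add: e_def[abs_def])
    have cD: "continuous_on {0..} D" using cont_D[OF s] by (simp add: D_def[abs_def])
    have i: "(\<lambda>r. N (e r)) integrable_on {s..t}" "(\<lambda>r. norm (C *v e r)) integrable_on {s..t}" "(\<lambda>r. norm (D r)) integrable_on {s..t}"
       "q integrable_on {s..t}" if "0 \<le> s" for s t
    proof -
      have "continuous_on {0..} (\<lambda>r. N (e r))" by (rule continuous_on_compose2[OF N_continuous ce]) auto
      moreover have "continuous_on {0..} (\<lambda>r. norm (C *v e r))" by (intro continuous_intros cont_matrix ce)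
      moreover have "continuous_on {0..} (\<lambda>r. norm (D r))" by (intro continuous_intros cD)
      moreover have "continuous_on {0..} q" unfolding q_def[abs_def] by (intro continuous_intros cont_matrix ce cD)
      moreover have "{s..t} \<subseteq> {0..}" using that by auto
      ultimately show "(\<lambda>r. N (e r)) integrable_on {s..t}" "(\<lambda>r. norm (C *v e r)) integrable_on {s..t}" "(\<lambda>r. norm (D r)) integrable_on {s..t}"
         "q integrable_on {s..t}" by (meson continuous_on_subset integrable_continuous_interval)+
    qed
    have id: "(\<lambda>r. norm (d r)) integrable_on {s..t}" if "0 \<le> s" for s t
      using hk[OF norm_d_integrable[OF s that]] by (simp add: d_def)
    have ic: "(\<lambda>r. c) integrable_on {s..t}" for c s t :: real by (rule integrable_const_ivl)
    have Ninc: "N (e t) - N (e s) \<le> integral {s..t} (\<lambda>r. - a * N (e r) + b * (norm (C *v e r) + norm (D r) + norm (d r)))"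
      if "0 \<le> s" "s \<le> t" for s t
      using N_increment[OF s b(2) that] unfolding e_def d_def D_def .
    have Vinc: "V (e t) - V (e s) \<le> integral {s..t} (\<lambda>r. - q r + 2 * Y * norm (d r))"
      if st: "0 \<le> s" "s \<le> t" for s t
    proof -
      have "V (e t) - V (e s) \<le> integral {s..t} (\<lambda>r. - 2 * q r + 2 * (norm (C *v e r) * norm (d r)))"
        using V_increment[OF s st] unfolding e_def d_def D_def q_def .
      also have "\<dots> \<le> integral {s..t} (\<lambda>r. - q r + 2 * Y * norm (d r))"
      proof (rule integral_mono_off_negligible[OF _ _ Z(1)])
        have "continuous_on {s..t} (\<lambda>r. norm (C *v e r))"
          by (rule continuous_on_subset[of "{0..}"]) (use st in \<open>auto intro!: continuous_intros cont_matrix ce\<close>)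
        then have yd: "(\<lambda>r. norm (C *v e r) * norm (d r)) integrable_on {s..t}"
          using norm_d_integrable[OF s st(1)] unfolding d_def by (intro hk mult_absolutely_integrable)
        show "(\<lambda>r. - 2 * q r + 2 * (norm (C *v e r) * norm (d r))) integrable_on {s..t}"
          by (rule integrable_add[OF integrable_on_mult_right[OF i(4)[OF st(1)]] integrable_on_mult_right[OF yd]])
        show "(\<lambda>r. - q r + 2 * Y * norm (d r)) integrable_on {s..t}"
          by (rule integrable_add[OF integrable_neg[OF i(4)[OF st(1)]] integrable_on_mult_right[OF id[OF st(1)]]])
        show "- 2 * q r + 2 * (norm (C *v e r) * norm (d r)) \<le> - q r + 2 * Y * norm (d r)" if "r \<in> {s..t}" "r \<notin> Z" for r
          using Z(2)[of r] that st by auto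
      qed
      finally show ?thesis .
    qed
    \<comment> \<open>The weight \<open>b * K\<close> makes the dissipation in \<open>V\<close>
      cancel the term \<open>b * K * q\<close> that the drive of \<open>N\<close> produces.\<close>
    define U where "U t = N (e t) + b * K * V (e t)" for t
    have Nnn: "N x \<ge> 0" for x using N_props(4)[of x] norm_ge_zero order_trans by blast
    have Unn: "U t \<ge> 0" for t using Nnn V_nonneg bK by (simp add: U_def)
    have Vle: "V x \<le> cV * (N x)\<^sup>2" for x
    proof -
      have "cV * (norm x)\<^sup>2 \<le> cV * (N x)\<^sup>2" using cV N_props(4)[of x] by (intro mult_left_mono power_mono) auto
      then show ?thesis using cV(2)[of x] by linarith
    qed
    have Udec: "U t - U s \<le> - a * integral {s..t} (\<lambda>r. N (e r)) + m * (t - s) + m" if st: "0 \<le> s" "s \<le> t" for s t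
    proof -
      let ?n = "\<lambda>r. - a * N (e r) + b * (norm (C *v e r) + norm (D r) + norm (d r))"
      let ?v = "\<lambda>r. - q r + 2 * Y * norm (d r)"
      let ?w = "\<lambda>r. - a * N (e r) + (b * \<epsilon> + (b + 2 * Y * (b * K)) * norm (d r))"
      have in1: "?n integrable_on {s..t}"
        by (rule integrable_add[OF integrable_on_mult_right[OF i(1)[OF st(1)]]
            integrable_on_mult_right[OF integrable_add[OF integrable_add[OF i(2)[OF st(1)] i(3)[OF st(1)]] id[OF st(1)]]]])
      have in2: "?v integrable_on {s..t}"
        by (rule integrable_add[OF integrable_neg[OF i(4)[OF st(1)]] integrable_on_mult_right[OF id[OF st(1)]]])
      have in2': "(\<lambda>r. b * K * ?v r) integrable_on {s..t}" by (rule integrable_on_mult_right[OF in2])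
      have in3: "?w integrable_on {s..t}"
        by (rule integrable_add[OF integrable_on_mult_right[OF i(1)[OF st(1)]] integrable_add[OF ic integrable_on_mult_right[OF id[OF st(1)]]]])
      have "U t - U s = (N (e t) - N (e s)) + b * K * (V (e t) - V (e s))" by (simp add: U_def right_diff_distrib)
      also have "\<dots> \<le> integral {s..t} ?n + b * K * integral {s..t} ?v"
        using bK by (intro add_mono mult_left_mono Ninc Vinc st) auto
      also have "\<dots> = integral {s..t} (\<lambda>r. ?n r + b * K * ?v r)"
        using Henstock_Kurzweil_Integration.integral_add[OF in1 in2'] by simp
      also have "\<dots> \<le> integral {s..t} ?w"
      proof (rule integral_le[OF integrable_add[OF in1 in2'] in3])
        fix r assume r: "r \<in> {s..t}"
        have "norm (C *v e r) + norm (D r) \<le> \<epsilon> + K * q r" unfolding q_def Df using r st by (intro star \<Gamma>) auto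
        then have "b * (norm (C *v e r) + norm (D r)) \<le> b * (\<epsilon> + K * q r)" using b(1) by (intro mult_left_mono) auto
        then show "?n r + b * K * ?v r \<le> ?w r" by (simp add: algebra_simps)
      qed
      also have "\<dots> = - a * integral {s..t} (\<lambda>r. N (e r)) + (b * \<epsilon> * (t - s) + (b + 2 * Y * (b * K)) * integral {s..t} (\<lambda>r. norm (d r)))"
        by (rule integral_affine_combination[OF i(1)[OF st(1)] id[OF st(1)] st(2)])
      also have "\<dots> \<le> - a * integral {s..t} (\<lambda>r. N (e r)) + (b * \<epsilon> * (t - s) + (b + 2 * Y * (b * K)) * (\<delta> * (t - s + 1)))"
        using b(1) bK const(1) by (intro add_mono mult_left_mono order_refl step st) auto
      also have "\<dots> \<le> - a * integral {s..t} (\<lambda>r. N (e r)) + (m * (t - s) + m)"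
      proof -
        have "0 \<le> b * \<epsilon>" using b(1) const by simp
        then show ?thesis by (simp add: m_def algebra_simps)
      qed
      finally show ?thesis by simp
    qed
    have cN: "continuous_on {0..} (\<lambda>r. N (e r))" by (rule continuous_on_compose2[OF N_continuous ce]) auto
    have U0: "U 0 \<le> u0"
    proof -
      have r0: "r0 \<ge> 0" using init norm_ge_zero order_trans by blast
      have "N (e 0) \<le> \<beta> * r0" using N_props(5)[of "e 0"] mult_left_mono[OF init less_imp_le[OF N_props(3)]] unfolding e_def by linarith
      moreover have "V (e 0) \<le> cV * r0\<^sup>2"
        using cV(2)[of "e 0"] mult_left_mono[OF power_mono[OF init norm_ge_zero, of 2] less_imp_le[OF cV(1)]] unfolding e_def by linarith
      then have "b * K * V (e 0) \<le> b * K * (cV * r0\<^sup>2)" using bK by (intro mult_left_mono) auto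
      ultimately show ?thesis by (simp add: U_def u0_def)
    qed
    have "u0 \<ge> 0" using U0 Unn[of 0] by linarith
    then have T1: "T1 \<ge> 0" using m by (simp add: T1_def)
    have late: "U t \<le> u1" if "t \<ge> T1" for t
    proof -
      have "U 0 / m \<le> u0 / m" using U0 m by (intro divide_right_mono) auto
      then have "t \<ge> 0 + U 0 / m + 2" using that unfolding T1_def by linarith
      from decay_alternative[OF cN Unn a m Udec this] obtain s where s: "N (e s) \<le> 2 * m / a" "U t \<le> U s + m" by blast
      have "V (e s) \<le> cV * (2 * m / a)\<^sup>2"
        using Vle[of "e s"] mult_left_mono[OF power_mono[OF s(1) Nnn, of 2] less_imp_le[OF cV(1)]] by linarith
      then have "b * K * V (e s) \<le> b * K * (cV * (2 * m / a)\<^sup>2)" using bK by (intro mult_left_mono) auto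
      then show ?thesis using s by (simp add: U_def u1_def)
    qed
    have ysb: "norm (C *v e t) \<le> ys" if "t \<ge> T1" for t
    proof -
      have "b * K * V (e t) \<le> u1" using late[OF that] Nnn[of "e t"] by (simp add: U_def)
      then have "V (e t) \<le> u1 / (b * K)" using bK by (simp add: pos_le_divide_eq mult.commute)
      also have "\<dots> = vb"
      proof -
        have "u1 = 2 * m / a + m + b * K * (cV * (2 * m / a)\<^sup>2)" by (simp add: u1_def)
        moreover have bK0: "b * K \<noteq> 0" using bK by linarith
        ultimately show ?thesis unfolding vb_def
          by (simp only: add_divide_distrib[of _ "b * K * (cV * (2 * m / a)\<^sup>2)"] nonzero_mult_div_cancel_left[OF bK0])
      qed
      finally have "sqrt (V (e t)) \<le> sqrt vb" by simp
      then have "k * sqrt (V (e t)) \<le> ys" unfolding ys_def using k(1) by (intro mult_left_mono) auto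
      then show ?thesis using k(2)[of "e t"] by linarith
    qed
    have Ndec: "N (e t) - N (e s) \<le> - a * integral {s..t} (\<lambda>r. N (e r)) + m2 * (t - s) + m2" if st: "T1 \<le> s" "s \<le> t" for s t
    proof -
      have s0: "0 \<le> s" using T1 st by linarith
      let ?n = "\<lambda>r. - a * N (e r) + b * (norm (C *v e r) + norm (D r) + norm (d r))"
      let ?w = "\<lambda>r. - a * N (e r) + (b * (ys + \<theta> ys) + b * norm (d r))"
      have in1: "?n integrable_on {s..t}"
        by (rule integrable_add[OF integrable_on_mult_right[OF i(1)[OF s0]]
            integrable_on_mult_right[OF integrable_add[OF integrable_add[OF i(2)[OF s0] i(3)[OF s0]] id[OF s0]]]])
      have in3: "?w integrable_on {s..t}"
        by (rule integrable_add[OF integrable_on_mult_right[OF i(1)[OF s0]] integrable_add[OF ic integrable_on_mult_right[OF id[OF s0]]]])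
      have "N (e t) - N (e s) \<le> integral {s..t} ?n" by (rule Ninc[OF s0 st(2)])
      also have "\<dots> \<le> integral {s..t} ?w"
      proof (rule integral_le[OF in1 in3])
        fix r assume r: "r \<in> {s..t}"
        have y: "norm (C *v e r) \<le> ys" using r st by (intro ysb) auto
        have "norm (D r) \<le> \<theta> (norm (C *v e r))" unfolding Df using r s0 by (intro \<theta>(1) \<Gamma>) auto
        also have "\<dots> \<le> \<theta> ys" by (rule \<theta>(2)[OF norm_ge_zero y])
        finally have "b * (norm (C *v e r) + norm (D r)) \<le> b * (ys + \<theta> ys)" using b(1) y by (intro mult_left_mono add_mono) auto
        then show "?n r \<le> ?w r" by (simp add: distrib_left)
      qed
      also have "\<dots> = - a * integral {s..t} (\<lambda>r. N (e r)) + (b * (ys + \<theta> ys) * (t - s) + b * integral {s..t} (\<lambda>r. norm (d r)))"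
        by (rule integral_affine_combination[OF i(1)[OF s0] id[OF s0] st(2)])
      also have "\<dots> \<le> - a * integral {s..t} (\<lambda>r. N (e r)) + (b * (ys + \<theta> ys) * (t - s) + b * (\<delta> * (t - s + 1)))"
        using b(1) by (intro add_mono mult_left_mono order_refl step s0 st) auto
      also have "\<dots> \<le> - a * integral {s..t} (\<lambda>r. N (e r)) + (m2 * (t - s) + m2)"
      proof -
        have "0 \<le> b * (ys + \<theta> ys)" using b(1) ys \<theta>(3)[OF ys] by simp
        then show ?thesis by (simp add: m2_def algebra_simps)
      qed
      finally show ?thesis by simp
    qed
    have cN1: "continuous_on {T1..} (\<lambda>r. N (e r))" by (rule continuous_on_subset[OF cN]) (use T1 in auto)
    have "N (e T1) \<le> u1"
    proof -
      have "b * K * V (e T1) \<ge> 0" using bK V_nonneg by simp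
      then show ?thesis using late[of T1] by (simp add: U_def)
    qed
    then have "N (e T1) / m2 \<le> u1 / m2" using m2 by (intro divide_right_mono) auto
    then have "t \<ge> T1 + N (e T1) / m2 + 2" using t unfolding T_def by linarith
    from decay_alternative[OF cN1 Nnn a m2 Ndec this] have "N (e t) \<le> 2 * m2 / a + m2" by force
    then show ?thesis using N_props(4)[of "e t"] by (simp add: e_def)
  qed
  then show ?thesis by blast
qed

section \<open>Consequences of the growth condition and choice of constants\<close>

text \<open>Turns the growth condition into the forms that are used. Only finite constants and a
  monotone gain remain, so comparison functions do not appear in later estimates.\<close>

lemma growth_bounds:
  assumes \<Gamma>: "compact \<Gamma>"
  obtains \<theta> :: "real \<Rightarrow> real" where
    "\<And>y z. z \<in> \<Gamma> \<Longrightarrow> norm (f (y + z) - f z) \<le> \<theta> (norm y)" "\<And>u w. 0 \<le> u \<Longrightarrow> u \<le> w \<Longrightarrow> \<theta> u \<le> \<theta> w" "\<And>u. 0 \<le> u \<Longrightarrow> 0 \<le> \<theta> u"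
    "\<And>h. h > 0 \<Longrightarrow> \<exists>u>0. u + \<theta> u \<le> h"
    "\<And>e. e > 0 \<Longrightarrow> \<exists>K\<ge>1. \<forall>y. \<forall>z\<in>\<Gamma>. norm y + norm (f (y + z) - f z) \<le> e + K * (y \<bullet> (f (y + z) - f z))"
    "\<And>D. \<exists>Y\<ge>0. \<forall>y. \<forall>z\<in>\<Gamma>. \<forall>p. 0 \<le> p \<longrightarrow> p \<le> D \<longrightarrow> norm y * p \<le> y \<bullet> (f (y + z) - f z) / 2 + Y * p"
    "\<And>y z. z \<in> \<Gamma> \<Longrightarrow> y \<bullet> (f (y + z) - f z) \<ge> 0"
proof -
  obtain \<theta> \<alpha> \<mu> c where K: "\<theta> \<in> class_K_inf" "\<alpha> \<in> class_K_inf" "\<mu> \<ge> 0" "c \<ge> 0"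
    and g: "\<And>y z. z \<in> \<Gamma> \<Longrightarrow> norm (f (y + z) - f z) \<le> \<theta> (norm y)"
      "\<And>y z. z \<in> \<Gamma> \<Longrightarrow> norm y * \<alpha> (norm y) \<le> y \<bullet> (f (y + z) - f z)"
      "\<And>y z. z \<in> \<Gamma> \<Longrightarrow> norm y > \<mu> \<Longrightarrow> norm (f (y + z) - f z) \<le> c * (y \<bullet> (f (y + z) - f z))"
    using growth[OF \<Gamma>] by blast
  have cK: "continuous_on {0..} \<phi>" "strict_mono_on {0..} \<phi>" "\<phi> 0 = 0" "\<not> bounded (\<phi> ` {0..})"
    if "\<phi> \<in> class_K_inf" for \<phi> using that by (auto simp: class_K_inf_def class_K_def)
  have mono: "\<phi> u \<le> \<phi> w" if "\<phi> \<in> class_K_inf" "0 \<le> u" "u \<le> w" for \<phi> u w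
    using strict_mono_onD[OF cK(2)[OF that(1)], of u w] that by (cases "u = w") auto
  have pos: "\<phi> u > 0" if "\<phi> \<in> class_K_inf" "u > 0" for \<phi> u
    using strict_mono_onD[OF cK(2)[OF that(1)], of 0 u] cK(3)[OF that(1)] that by auto
  have nonneg: "\<phi> u \<ge> 0" if "\<phi> \<in> class_K_inf" "u \<ge> 0" for \<phi> u
    using mono[OF that(1) order_refl that(2)] cK(3)[OF that(1)] by simp
  have q: "y \<bullet> (f (y + z) - f z) \<ge> 0" if "z \<in> \<Gamma>" for y z
    using g(2)[OF that, of y] nonneg[OF K(2), of "norm y"] by (meson mult_nonneg_nonneg norm_ge_zero order_trans)
  have small: "\<exists>u>0. u + \<theta> u \<le> h" if "h > 0" for h
  proof -
    obtain d where d: "d > 0" "\<And>u. u \<in> {0..} \<Longrightarrow> dist u 0 < d \<Longrightarrow> dist (\<theta> u) (\<theta> 0) < h/2"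
      using cK(1)[OF K(1)] \<open>h > 0\<close> unfolding continuous_on_iff by (metis atLeast_iff half_gt_zero order_refl)
    define u where "u = min (d/2) (h/2)"
    have u: "u > 0" "u < d" "u \<le> h/2" using d(1) \<open>h > 0\<close> by (auto simp: u_def)
    have "dist (\<theta> u) (\<theta> 0) < h/2" using u by (intro d(2)) auto
    then have "\<theta> u \<le> h/2" using cK(3)[OF K(1)] by (simp add: dist_real_def)
    then have "u + \<theta> u \<le> h" using u(3) by simp
    then show ?thesis using u(1) by blast
  qed
  have star: "\<exists>K\<ge>1. \<forall>y. \<forall>z\<in>\<Gamma>. norm y + norm (f (y + z) - f z) \<le> e + K * (y \<bullet> (f (y + z) - f z))" if eps: "e > 0" for e
  proof -
    obtain u where u: "u > 0" "u + \<theta> u \<le> e" using small[OF eps] by blast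
    \<comment> \<open>For \<open>norm y\<close> below \<open>u\<close> the tolerance
      \<open>e\<close> suffices. Otherwise the dissipation is at least
      \<open>u * \<alpha> u\<close>; the summands of \<open>L\<close> then pay for
      \<open>norm y\<close>, for the nonlinearity up to \<open>\<mu>\<close>, and for the
      nonlinearity beyond \<open>\<mu>\<close>.\<close>
    define L where "L = 1 + 1 / \<alpha> u + \<theta> \<mu> / (u * \<alpha> u) + c"
    have \<alpha>u: "\<alpha> u > 0" by (rule pos[OF K(2) u(1)])
    have \<theta>\<mu>: "\<theta> \<mu> / (u * \<alpha> u) \<ge> 0" using nonneg[OF K(1,3)] u(1) \<alpha>u by simp
    have "L \<ge> 1" using \<alpha>u \<theta>\<mu> K(4) by (simp add: L_def)
    moreover have "norm y + norm (f (y + z) - f z) \<le> e + L * (y \<bullet> (f (y + z) - f z))" if z: "z \<in> \<Gamma>" for y z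
    proof -
      define Q where "Q = y \<bullet> (f (y + z) - f z)"
      have Q: "Q \<ge> 0" unfolding Q_def by (rule q[OF z])
      show ?thesis
      proof (cases "norm y < u")
        case True
        have "\<theta> (norm y) \<le> \<theta> u" using True by (intro mono[OF K(1)]) auto
        then have "norm y + norm (f (y + z) - f z) \<le> e" using g(1)[OF z, of y] u(2) True by linarith
        moreover have "0 \<le> L * Q" using Q \<open>L \<ge> 1\<close> by simp
        ultimately show ?thesis by (simp add: Q_def)
      next
        case False
        have \<alpha>y: "\<alpha> u \<le> \<alpha> (norm y)" using False u(1) by (intro mono[OF K(2)]) auto
        have Q1: "norm y * \<alpha> u \<le> Q" unfolding Q_def
          by (rule order_trans[OF mult_left_mono[OF \<alpha>y norm_ge_zero] g(2)[OF z]])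
        then have y1: "norm y \<le> 1 / \<alpha> u * Q" using \<alpha>u by (simp add: pos_le_divide_eq)
        have "u * \<alpha> u \<le> norm y * \<alpha> u" using False \<alpha>u by (intro mult_right_mono) auto
        then have uQ: "u * \<alpha> u \<le> Q" using Q1 by linarith
        have "norm (f (y + z) - f z) \<le> \<theta> \<mu> / (u * \<alpha> u) * Q + c * Q"
        proof (cases "norm y > \<mu>")
          case True
          have "0 \<le> \<theta> \<mu> / (u * \<alpha> u) * Q" using \<theta>\<mu> Q by (rule mult_nonneg_nonneg)
          then show ?thesis using g(3)[OF z True] unfolding Q_def[symmetric] by linarith
        next
          case False
          then have "\<theta> (norm y) \<le> \<theta> \<mu>" by (intro mono[OF K(1)]) auto
          then have "norm (f (y + z) - f z) \<le> \<theta> \<mu>" using g(1)[OF z, of y] by linarith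
          also have "\<theta> \<mu> = \<theta> \<mu> / (u * \<alpha> u) * (u * \<alpha> u)" using u(1) \<alpha>u by simp
          also have "\<dots> \<le> \<theta> \<mu> / (u * \<alpha> u) * Q" by (rule mult_left_mono[OF uQ \<theta>\<mu>])
          finally show ?thesis using K(4) Q by (simp add: add_increasing2)
        qed
        then have "norm y + norm (f (y + z) - f z) \<le> L * Q" using y1 Q unfolding L_def distrib_right mult_1_left by linarith
        then show ?thesis using eps unfolding Q_def by linarith
      qed
    qed
    ultimately show ?thesis by blast
  qed
  have Y: "\<exists>Y\<ge>0. \<forall>y. \<forall>z\<in>\<Gamma>. \<forall>p. 0 \<le> p \<longrightarrow> p \<le> D \<longrightarrow> norm y * p \<le> y \<bullet> (f (y + z) - f z) / 2 + Y * p" for D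
  proof -
    \<comment> \<open>For \<open>norm y\<close> above such a \<open>Y\<close>, half of the
      dissipation dominates \<open>norm y * p\<close>; below it, \<open>Y * p\<close> does.
      Unboundedness of \<open>\<alpha>\<close> provides it.\<close>
    have "\<exists>Y\<ge>0. \<alpha> Y \<ge> 2 * D"
    proof (rule ccontr)
      assume "\<not> ?thesis"
      then have lt: "\<alpha> Y < 2 * D" if "Y \<ge> 0" for Y using that by force
      have "bounded (\<alpha> ` {0..})"
        unfolding bounded_iff using lt nonneg[OF K(2)] by (intro exI[of _ "2 * D"]) (auto intro: less_imp_le)
      then show False using cK(4)[OF K(2)] by blast
    qed
    then obtain Y where Y: "Y \<ge> 0" "\<alpha> Y \<ge> 2 * D" by blast
    have "norm y * p \<le> y \<bullet> (f (y + z) - f z) / 2 + Y * p" if z: "z \<in> \<Gamma>" and p: "0 \<le> p" "p \<le> D" for y z p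
    proof (cases "norm y \<le> Y")
      case True
      then have "norm y * p \<le> Y * p" using p by (intro mult_right_mono)
      then show ?thesis using q[OF z, of y] by linarith
    next
      case False
      have "2 * p \<le> \<alpha> (norm y)" using Y p mono[OF K(2) Y(1), of "norm y"] False by linarith
      then have "norm y * (2 * p) \<le> norm y * \<alpha> (norm y)" by (rule mult_left_mono) simp
      then have "norm y * p \<le> y \<bullet> (f (y + z) - f z) / 2" using g(2)[OF z, of y] by linarith
      moreover have "0 \<le> Y * p" using Y p by simp
      ultimately show ?thesis by linarith
    qed
    then show ?thesis using Y(1) by blast
  qed
  show thesis by (rule that[OF g(1) mono[OF K(1)] nonneg[OF K(1)] small star Y q])
qed

text \<open>For input differences of a fixed, not necessarily small, size; the gain is in
  \<open>G\<close> not depending on the initial distance \<open>r0\<close>.\<close>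

lemma asymptotic_bound:
  assumes \<Gamma>: "compact \<Gamma>" and "Y \<ge> 0" "\<delta> > 0"
  obtains G where "\<And>r0. \<exists>T. attracted \<Gamma> Y \<delta> r0 T G"
proof -
  obtain \<theta> where \<theta>: "\<And>y z. z \<in> \<Gamma> \<Longrightarrow> norm (f (y + z) - f z) \<le> \<theta> (norm y)" "\<And>u w. 0 \<le> u \<Longrightarrow> u \<le> w \<Longrightarrow> \<theta> u \<le> \<theta> w"
      "\<And>u. 0 \<le> u \<Longrightarrow> 0 \<le> \<theta> u"
    "\<And>e. e > 0 \<Longrightarrow> \<exists>K\<ge>1. \<forall>y. \<forall>z\<in>\<Gamma>. norm y + norm (f (y + z) - f z) \<le> e + K * (y \<bullet> (f (y + z) - f z))"
    by (rule growth_bounds[OF \<Gamma>]) (rule that; assumption)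
  obtain K where K: "K \<ge> 1" "\<And>y z. z \<in> \<Gamma> \<Longrightarrow> norm y + norm (f (y + z) - f z) \<le> 1 + K * (y \<bullet> (f (y + z) - f z))"
    using \<theta>(4)[of 1] by force
  obtain b where b: "b > 0" "\<And>y u d. \<beta> * norm (H *v y - B *v u + B *v d) \<le> b * (norm y + norm u + norm d)" using gain_bound by blast
  obtain k where k: "k > 0" "\<And>x. norm (C *v x) \<le> k * sqrt (V x)" using output_le_V by blast
  obtain cV where cV: "cV > 0" "\<And>x. V x \<le> cV * (norm x)\<^sup>2" using V_upper by blast
  show thesis
    by (rule that[OF core_estimate[OF b k cV assms(2) K(1) zero_less_one assms(3) K(2) \<theta>(1-3) refl refl refl refl]])
qed

text \<open>\<open>K\<close> may blow up as \<open>\<epsilon>\<close> decreases, but it enters the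
  bound for \<open>V\<close> only as a divisor and through \<open>\<delta>\<close>, which is chosen
  after \<open>K\<close>. So all constants of \<open>core_estimate\<close> become small.\<close>

lemma asymptotically_small:
  assumes \<Gamma>: "compact \<Gamma>" and "Y \<ge> 0" "\<eta> > 0"
  obtains \<delta> where "\<delta> > 0" "\<And>r0. \<exists>T. attracted \<Gamma> Y \<delta> r0 T \<eta>"
proof -
  obtain \<theta> where \<theta>: "\<And>y z. z \<in> \<Gamma> \<Longrightarrow> norm (f (y + z) - f z) \<le> \<theta> (norm y)" "\<And>u w. 0 \<le> u \<Longrightarrow> u \<le> w \<Longrightarrow> \<theta> u \<le> \<theta> w"
      "\<And>u. 0 \<le> u \<Longrightarrow> 0 \<le> \<theta> u" "\<And>\<eta>. \<eta> > 0 \<Longrightarrow> \<exists>u>0. u + \<theta> u \<le> \<eta>"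
    "\<And>\<epsilon>. \<epsilon> > 0 \<Longrightarrow> \<exists>K\<ge>1. \<forall>y. \<forall>z\<in>\<Gamma>. norm y + norm (f (y + z) - f z) \<le> \<epsilon> + K * (y \<bullet> (f (y + z) - f z))"
    by (rule growth_bounds[OF \<Gamma>]) (rule that; assumption)
  obtain b where b: "b > 0" "\<And>y u d. \<beta> * norm (H *v y - B *v u + B *v d) \<le> b * (norm y + norm u + norm d)" using gain_bound by blast
  obtain k where k: "k > 0" "\<And>x. norm (C *v x) \<le> k * sqrt (V x)" using output_le_V by blast
  obtain cV where cV: "cV > 0" "\<And>x. V x \<le> cV * (norm x)\<^sup>2" using V_upper by blast
  have a: "a > 0" by (rule N_props(1))
  define c1 where "c1 = 2 / a + 1"
  have c1: "c1 > 0" using a by (simp add: c1_def add_pos_pos)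
  have "\<eta> / (2 * c1 * b) > 0" using \<open>\<eta> > 0\<close> c1 b(1) by simp
  then obtain u where u: "u > 0" "u + \<theta> u \<le> \<eta> / (2 * c1 * b)" using \<theta>(4) by blast
  \<comment> \<open>The constants are chosen backwards: \<open>vb \<le> w\<close> gives an output
    bound \<open>ys \<le> u\<close>, and \<open>W\<close> is such that
    \<open>vb \<le> \<epsilon> * W\<close> once \<open>m \<le> 2 * b * \<epsilon>\<close>.\<close>
  define w where "w = (u / k)\<^sup>2"
  have "w > 0" using u k by (simp add: w_def)
  define W where "W = 2 * c1 + cV * (4 * b / a)\<^sup>2"
  have W: "W > 0" using c1 cV by (simp add: W_def add_pos_nonneg)
  define \<epsilon> where "\<epsilon> = min 1 (w / W)"
  have \<epsilon>: "\<epsilon> > 0" "\<epsilon> \<le> 1" "\<epsilon> * W \<le> w" using \<open>w > 0\<close> W by (auto simp: \<epsilon>_def min_def pos_le_divide_eq field_simps)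
  obtain K where K: "K \<ge> 1" "\<And>y z. z \<in> \<Gamma> \<Longrightarrow> norm y + norm (f (y + z) - f z) \<le> \<epsilon> + K * (y \<bullet> (f (y + z) - f z))"
    using \<theta>(5)[OF \<epsilon>(1)] by auto
  \<comment> \<open>The first bound makes the input contribution to \<open>m\<close> at most
    \<open>b * \<epsilon>\<close>, the second keeps its contribution to \<open>m2\<close> within
    half of the target.\<close>
  define \<delta> where "\<delta> = min (\<epsilon> / (1 + 2 * Y * K)) (\<eta> / (2 * c1 * b))"
  have YK: "1 + 2 * Y * K > 0" using \<open>Y \<ge> 0\<close> K(1) by (simp add: add_pos_nonneg)
  have \<delta>: "\<delta> > 0" "\<delta> * (1 + 2 * Y * K) \<le> \<epsilon>" "\<delta> \<le> \<eta> / (2 * c1 * b)"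
    using \<epsilon>(1) YK \<open>\<eta> / (2 * c1 * b) > 0\<close> by (auto simp: \<delta>_def min_le_iff_disj pos_le_divide_eq[symmetric])
  define m where "m = b * \<epsilon> + (b + 2 * Y * (b * K)) * \<delta>"
  define vb where "vb = (2 * m / a + m) / (b * K) + cV * (2 * m / a)\<^sup>2"
  define ys where "ys = k * sqrt vb"
  define m2 where "m2 = b * (ys + \<theta> ys + \<delta>)"
  have "m = b * \<epsilon> + b * (\<delta> * (1 + 2 * Y * K))" by (simp add: m_def algebra_simps)
  then have m: "m \<le> 2 * b * \<epsilon>" "m \<ge> 0"
    using mult_left_mono[OF \<delta>(2) less_imp_le[OF b(1)]] b(1) \<epsilon>(1) \<delta>(1) YK by (auto intro!: add_nonneg_nonneg mult_nonneg_nonneg less_imp_le)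
  have "(2 * m / a + m) / (b * K) = c1 * m / (b * K)" by (simp add: c1_def distrib_right)
  also have "\<dots> \<le> c1 * m / b" using c1 m b(1) K(1) by (intro divide_left_mono) (auto intro!: mult_nonneg_nonneg mult_pos_pos)
  also have "\<dots> \<le> c1 * (2 * b * \<epsilon>) / b" using c1 m b(1) by (intro divide_right_mono mult_left_mono) auto
  also have "\<dots> = 2 * c1 * \<epsilon>" using b(1) by simp
  finally have vb1: "(2 * m / a + m) / (b * K) \<le> 2 * c1 * \<epsilon>" .
  have "(2 * m / a)\<^sup>2 \<le> (2 * (2 * b * \<epsilon>) / a)\<^sup>2" using m a by (intro power_mono divide_right_mono mult_left_mono) auto
  also have "\<dots> = (4 * b / a)\<^sup>2 * (\<epsilon> * \<epsilon>)" by (simp add: power2_eq_square)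
  also have "\<dots> \<le> (4 * b / a)\<^sup>2 * \<epsilon>" using \<epsilon> by (intro mult_left_mono) (auto intro: mult_left_le)
  finally have "cV * (2 * m / a)\<^sup>2 \<le> cV * ((4 * b / a)\<^sup>2 * \<epsilon>)" using cV(1) by (intro mult_left_mono) auto
  then have "vb \<le> \<epsilon> * W" using vb1 by (simp add: vb_def W_def algebra_simps)
  then have "vb \<le> w" using \<epsilon>(3) by linarith
  then have "sqrt vb \<le> u / k" unfolding w_def using u k by (intro real_le_lsqrt) auto
  then have ys_le: "ys \<le> u" using k(1) by (simp add: ys_def pos_le_divide_eq mult.commute)
  have "vb \<ge> 0" unfolding vb_def using m a b(1) K(1) cV(1) by (intro add_nonneg_nonneg divide_nonneg_nonneg mult_nonneg_nonneg) auto
  then have ys0: "ys \<ge> 0" using k(1) by (simp add: ys_def)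
  have "ys + \<theta> ys + \<delta> \<le> \<eta> / (2 * c1 * b) + \<eta> / (2 * c1 * b)"
    using ys_le \<theta>(2)[OF ys0 ys_le] u(2) \<delta>(3) by linarith
  then have "c1 * b * (ys + \<theta> ys + \<delta>) \<le> c1 * b * (\<eta> / (2 * c1 * b) + \<eta> / (2 * c1 * b))"
    using c1 b(1) by (intro mult_left_mono) auto
  also have "\<dots> = \<eta>" using c1 b(1) by (simp add: field_simps)
  finally have fin: "2 * m2 / a + m2 \<le> \<eta>" by (simp add: m2_def c1_def algebra_simps)
  show thesis
  proof (rule that[OF \<delta>(1)])
    fix r0
    have "\<exists>T. attracted \<Gamma> Y \<delta> r0 T (2 * m2 / a + m2)"
      by (rule core_estimate[OF b k cV assms(2) K(1) \<epsilon>(1) \<delta>(1) K(2) \<theta>(1-3) m_def vb_def ys_def m2_def])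
    then obtain T where T: "attracted \<Gamma> Y \<delta> r0 T (2 * m2 / a + m2)" by (rule exE)
    show "\<exists>T. attracted \<Gamma> Y \<delta> r0 T \<eta>"
    proof (intro exI[of _ T] allI impI)
      fix v1 x1 v2 x2 t assume h: "admissible \<Gamma> Y \<delta> v1 x1 v2 x2" "norm (x1 0 - x2 0) \<le> r0" "t \<ge> T"
      show "norm (x1 t - x2 t) \<le> \<eta>" by (rule order_trans[OF T[rule_format, OF h] fin])
    qed
  qed
qed

end

section \<open>Stepanov almost periodicity and the Bochner transform\<close>

text \<open>Truncating with \<^const>\<open>closest_point\<close> onto a ball makes both limits below dominated.\<close>

lemma L1_continuous_approximation:
  fixes v :: "real \<Rightarrow> 'b::euclidean_space"
  assumes v: "v absolutely_integrable_on {a..b}" and "e > 0"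
  obtains g where "continuous_on UNIV g" "integral {a..b} (\<lambda>r. norm (v r - g r)) \<le> e"
proof -
  let ?M = "lebesgue_on {a..b}"
  have vi: "integrable ?M v" using v by (simp add: integrable_restrict_space set_integrable_def)
  have vm: "v \<in> borel_measurable ?M" using vi by simp
  define P :: "nat \<Rightarrow> 'b \<Rightarrow> 'b" where "P k = closest_point (cball 0 (real k))" for k
  have Pc: "continuous_on UNIV (P k)" for k
    unfolding P_def by (rule continuous_on_closest_point) auto
  have Pn: "norm (P k x) \<le> real k" for k x
    using closest_point_in_set[of "cball (0::'b) (real k)" x] by (simp add: P_def)
  have Pid: "P k x = x" if "norm x \<le> real k" for k x
    unfolding P_def using that by (intro closest_point_self) simp
  have Ple: "norm (P k x) \<le> norm x" for k x
  proof (cases "norm x \<le> real k")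
    case False then show ?thesis using Pn[of k x] by linarith
  qed (simp add: Pid)
  have Pm: "(\<lambda>r. P k (h r)) \<in> borel_measurable ?M" if "h \<in> borel_measurable ?M" for k h
    by (rule borel_measurable_continuous_on[OF Pc that])
  have "(\<lambda>k. LINT r|?M. norm (v r - P k (v r))) \<longlonglongrightarrow> (LINT r|?M. 0)"
  proof (rule integral_dominated_convergence[where w = "\<lambda>r. 2 * norm (v r)"])
    show "AE r in ?M. (\<lambda>k. norm (v r - P k (v r))) \<longlonglongrightarrow> 0"
    proof (rule AE_I2, rule tendsto_eventually)
      fix r
      obtain k0 :: nat where "norm (v r) \<le> real k0" using real_arch_simple by blast
      then show "\<forall>\<^sub>F k in sequentially. norm (v r - P k (v r)) = 0"
        unfolding eventually_sequentially by (intro exI[of _ k0]) (auto simp: Pid)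
    qed
    show "AE r in ?M. norm (norm (v r - P k (v r))) \<le> 2 * norm (v r)" for k
      using Ple by (intro AE_I2) (auto intro!: order_trans[OF norm_triangle_ineq4])
  qed (use vi vm Pm[OF vm] in auto)
  then have "\<forall>\<^sub>F k in sequentially. (LINT r|?M. norm (v r - P k (v r))) < e/2"
    by (rule order_tendstoD(2)) (use \<open>e > 0\<close> in simp)
  then obtain k where k: "(LINT r|?M. norm (v r - P k (v r))) < e/2" by (meson eventually_happens' sequentially_bot)
  have "v measurable_on {a..b}" using vm by (simp add: measurable_on_iff_borel_measurable)
  then obtain Z G where Z: "negligible Z" and G: "\<And>n. continuous_on UNIV (G n)"
    "\<And>r. r \<notin> Z \<Longrightarrow> (\<lambda>n. G n r) \<longlonglongrightarrow> (if r \<in> {a..b} then v r else 0)" unfolding measurable_on_def by blast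
  have PG: "continuous_on UNIV (\<lambda>r. P k (G n r))" for n by (rule continuous_on_compose2[OF Pc G(1)]) auto
  have PGm: "(\<lambda>r. P k (G n r)) \<in> borel_measurable ?M" for n
    by (rule continuous_imp_measurable_on_sets_lebesgue[OF continuous_on_subset[OF PG]]) auto
  have "(\<lambda>n. LINT r|?M. norm (P k (v r) - P k (G n r))) \<longlonglongrightarrow> (LINT r|?M. 0)"
  proof (rule integral_dominated_convergence[where w = "\<lambda>r. 2 * real k"])
    show "AE r in ?M. (\<lambda>n. norm (P k (v r) - P k (G n r))) \<longlonglongrightarrow> 0"
      unfolding AE_lebesgue_on_iff_negligible[OF fmeasurableD[OF lmeasurable_interval(1)]]
    proof (intro exI[of _ Z] conjI Z ballI impI)
      fix r assume "r \<in> {a..b}" "r \<notin> Z"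
      then have "(\<lambda>n. G n r) \<longlonglongrightarrow> v r" using G(2)[of r] by simp
      then have "(\<lambda>n. P k (G n r)) \<longlonglongrightarrow> P k (v r)"
        by (rule continuous_on_tendsto_compose[OF Pc]) auto
      then have "(\<lambda>n. norm (P k (v r) - P k (G n r))) \<longlonglongrightarrow> norm (P k (v r) - P k (v r))" by (intro tendsto_intros)
      then show "(\<lambda>n. norm (P k (v r) - P k (G n r))) \<longlonglongrightarrow> 0" by simp
    qed
    show "AE r in ?M. norm (norm (P k (v r) - P k (G n r))) \<le> 2 * real k" for n
    proof (rule AE_I2)
      fix r
      have "norm (P k (v r) - P k (G n r)) \<le> real k + real k" by (intro norm_triangle_le_diff add_mono Pn)
      then show "norm (norm (P k (v r) - P k (G n r))) \<le> 2 * real k" by simp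
    qed
    show "integrable ?M (\<lambda>r. 2 * real k)" by (rule finite_measure.integrable_const) (simp add: finite_measure_lebesgue_on)
  qed (use Pm[OF vm] PGm in auto)
  then have "\<forall>\<^sub>F n in sequentially. (LINT r|?M. norm (P k (v r) - P k (G n r))) < e/2"
    by (rule order_tendstoD(2)) (use \<open>e > 0\<close> in simp)
  then obtain n where n: "(LINT r|?M. norm (P k (v r) - P k (G n r))) < e/2" by (meson eventually_happens' sequentially_bot)
  have iPv: "integrable ?M (\<lambda>r. P k (v r))" by (rule Bochner_Integration.integrable_bound[OF vi Pm[OF vm]]) (use Ple in auto)
  have iPG: "integrable ?M (\<lambda>r. P k (G n r))"
    using absolutely_integrable_continuous_real[OF continuous_on_subset[OF PG]] by (simp add: integrable_restrict_space set_integrable_def)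
  have "(LINT r|?M. norm (v r - P k (G n r))) \<le> (LINT r|?M. norm (v r - P k (v r)) + norm (P k (v r) - P k (G n r)))"
    by (rule integral_mono) (use vi iPv iPG norm_diff_triangle_ineq in \<open>auto intro: norm_diff_triangle_le\<close>)
  also have "\<dots> \<le> e" using k n vi iPv iPG by simp
  finally have "(LINT r|?M. norm (v r - P k (G n r))) \<le> e" .
  moreover have "(LINT r|?M. norm (v r - P k (G n r))) = integral {a..b} (\<lambda>r. norm (v r - P k (G n r)))"
    using vi iPG by (intro lebesgue_integral_eq_integral) auto
  ultimately show thesis using that[OF PG[of n]] by simp
qed

lemma integrable_lebesgue01_iff:
  fixes f :: "real \<Rightarrow> 'b::euclidean_space"
  shows "integrable lebesgue01 f \<longleftrightarrow> f absolutely_integrable_on {0..1}"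
  by (simp add: integrable_restrict_space set_integrable_def)

lemma norm_abs_L1unit_diff:
  fixes f g :: "real \<Rightarrow> 'b::euclidean_space"
  assumes "f absolutely_integrable_on {0..1}" "g absolutely_integrable_on {0..1}"
  shows "norm (abs_L1unit f - abs_L1unit g) = integral {0..1} (\<lambda>s. norm (f s - g s))"
proof -
  have i: "integrable lebesgue01 f" "integrable lebesgue01 g" using assms by (simp_all add: integrable_lebesgue01_iff)
  have "norm (abs_L1unit f - abs_L1unit g) = (LINT s|lebesgue01. norm (f s - g s))"
    using i by (simp add: minus_L1unit.abs_eq norm_L1unit.abs_eq L1rel_def)
  also have "\<dots> = integral {0..1} (\<lambda>s. norm (f s - g s))" using i by (intro lebesgue_integral_eq_integral) auto
  finally show ?thesis .
qed

lemma L1loc_shift_integrable: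
  fixes v :: "real \<Rightarrow> 'b::euclidean_space"
  assumes v: "v \<in> L1loc T" and sub: "{a + c..b + c} \<subseteq> T"
  shows "(\<lambda>s. v (s + c)) absolutely_integrable_on {a..b}"
proof (rule L1loc_integrable)
  show "(\<lambda>s. v (s + c)) \<in> L1loc {a..b}" by (rule L1loc_shift[OF v]) (use sub in auto)
qed simp

lemma L1loc_shift_integrable_diff:
  fixes u v :: "real \<Rightarrow> 'b::euclidean_space"
  assumes u: "u \<in> L1loc T" "{a + s..b + s} \<subseteq> T" and v: "v \<in> L1loc T'" "{a + t..b + t} \<subseteq> T'"
  shows "(\<lambda>r. norm (u (r + s) - v (r + t))) integrable_on {a..b}"
proof -
  have "(\<lambda>r. u (r + s) - v (r + t)) absolutely_integrable_on {a..b}"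
    by (intro set_integral_diff L1loc_shift_integrable[OF u] L1loc_shift_integrable[OF v])
  then show ?thesis by (simp add: absolutely_integrable_on_def)
qed

lemma norm_bochner_diff:
  fixes u v :: "real \<Rightarrow> 'b::euclidean_space"
  assumes u: "u \<in> L1loc T" "{s..s + 1} \<subseteq> T" and v: "v \<in> L1loc T'" "{t..t + 1} \<subseteq> T'"
  shows "norm (bochner_transform u s - bochner_transform v t) = integral {0..1} (\<lambda>r. norm (u (r + s) - v (r + t)))"
proof -
  have "(\<lambda>r. u (s + r)) absolutely_integrable_on {0..1}" "(\<lambda>r. v (t + r)) absolutely_integrable_on {0..1}"
    using L1loc_shift_integrable[OF u(1), of 0 s 1] L1loc_shift_integrable[OF v(1), of 0 t 1] u(2) v(2)
    by (simp_all add: add.commute)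
  from norm_abs_L1unit_diff[OF this] show ?thesis by (simp add: bochner_transform_def add.commute)
qed

lemma norm_bochner_diff_translate:
  fixes u v :: "real \<Rightarrow> 'b::euclidean_space"
  assumes u: "u \<in> L1loc T" "{s..s + 1} \<subseteq> T" and v: "v \<in> L1loc T'" "{s + \<tau>..s + \<tau> + 1} \<subseteq> T'"
  shows "norm (bochner_transform u s - bochner_transform v (s + \<tau>)) = integral {s..s + 1} (\<lambda>r. norm (u r - v (r + \<tau>)))"
  using norm_bochner_diff[OF u v] integral_shift_Icc_real[of 0 1 "\<lambda>r. norm (u r - v (r + \<tau>))" s]
  by (simp add: algebra_simps o_def)

text \<open>Makes the theory of Bohr almost periodic functions with values in a Banach space
  available for the Stepanov class.\<close>

lemma stepanov_periods_eq:
  fixes v :: "real \<Rightarrow> 'b::euclidean_space"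
  assumes T: "time_domain T" and v: "v \<in> L1loc T"
  shows "stepanov_periods T v e = bohr_periods T (bochner_transform v) e"
proof -
  have "integral {a..a + 1} (\<lambda>s. norm (v (s + \<tau>) - v s)) = norm (bochner_transform v a - bochner_transform v (a + \<tau>))"
    if "\<tau> \<in> T" "a \<in> T" for a \<tau>
  proof -
    have "a + \<tau> \<in> T" using T that by (auto simp: time_domain_def)
    from norm_bochner_diff_translate[OF v time_domain_Icc[OF T that(2)] v time_domain_Icc[OF T this]]
    show ?thesis by (simp add: norm_minus_commute)
  qed
  then show ?thesis by (auto simp: stepanov_periods_def bohr_periods_def)
qed

text \<open>Continuity of translation in the integral norm: approximate \<open>v\<close> by a
  continuous function on a window that contains all nearby translates.\<close>

lemma continuous_bochner:
  fixes v :: "real \<Rightarrow> 'b::euclidean_space"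
  assumes T: "time_domain T" and v: "v \<in> L1loc T"
  shows "continuous_on T (bochner_transform v)"
  unfolding continuous_on_iff
proof (intro ballI allI impI)
  fix t and e :: real assume t: "t \<in> T" and "e > 0"
  define a where "a = (if T = UNIV then t - 1 else max 0 (t - 1))"
  have a: "a \<in> T" "\<And>s. s \<in> T \<Longrightarrow> dist s t < 1 \<Longrightarrow> a \<le> s" using T t by (auto simp: a_def time_domain_def dist_real_def)
  note sub = time_domain_Icc[OF T a(1)]
  obtain g where g: "continuous_on UNIV g" "integral {a..t + 2} (\<lambda>r. norm (v r - g r)) \<le> e/4"
    using L1_continuous_approximation[OF L1loc_integrable[OF v sub], of "e/4" "t + 2"] \<open>e > 0\<close> by (metis zero_less_divide_iff zero_less_numeral)
  have gL: "g \<in> L1loc UNIV"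
    unfolding L1loc_def using absolutely_integrable_continuous_real[OF continuous_on_subset[OF g(1)]] by auto
  have near: "norm (bochner_transform v s - bochner_transform g s) \<le> e/4" if s: "s \<in> T" "dist s t < 1" for s
  proof -
    have "norm (bochner_transform v s - bochner_transform g s) = integral {s..s + 1} (\<lambda>r. norm (v r - g r))"
      using norm_bochner_diff_translate[OF v time_domain_Icc[OF T s(1)] gL, of 0] by simp
    also have "\<dots> \<le> integral {a..t + 2} (\<lambda>r. norm (v r - g r))"
    proof (rule integral_subset_le)
      show "{s..s + 1} \<subseteq> {a..t + 2}" using a(2)[OF s] s(2) by (auto simp: dist_real_def)
      show "(\<lambda>r. norm (v r - g r)) integrable_on {s..s + 1}"
        using L1loc_shift_integrable_diff[OF v _ gL, of s 0 "s + 1" 0] time_domain_Icc[OF T s(1)] by simp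
      show "(\<lambda>r. norm (v r - g r)) integrable_on {a..t + 2}"
        using L1loc_shift_integrable_diff[OF v _ gL, of a 0 "t + 2" 0] sub by simp
    qed auto
    finally show ?thesis using g(2) by linarith
  qed
  have "uniformly_continuous_on {a..t + 2} g"
    by (rule compact_uniformly_continuous[OF continuous_on_subset[OF g(1)]]) auto
  then obtain d where d: "d > 0" "\<And>x y. x \<in> {a..t + 2} \<Longrightarrow> y \<in> {a..t + 2} \<Longrightarrow> dist y x < d \<Longrightarrow> dist (g y) (g x) < e/4"
    unfolding uniformly_continuous_on_def using \<open>e > 0\<close> by (metis zero_less_divide_iff zero_less_numeral)
  have "dist (bochner_transform v s) (bochner_transform v t) < e" if s: "s \<in> T" "dist s t < min d 1" for s
  proof -
    have "norm (bochner_transform g s - bochner_transform g t) = integral {0..1} (\<lambda>r. norm (g (r + s) - g (r + t)))"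
      by (rule norm_bochner_diff[OF gL _ gL]) auto
    also have "\<dots> \<le> integral {0..1} (\<lambda>r::real. e/4)"
    proof (rule integral_le)
      show "(\<lambda>r. norm (g (r + s) - g (r + t))) integrable_on {0..1}" by (rule L1loc_shift_integrable_diff[OF gL _ gL]) auto
      fix r :: real assume r: "r \<in> {0..1}"
      have as: "a \<le> s" "a \<le> t" using a(2)[of s] a(2)[of t] s t by auto
      have "dist (g (r + s)) (g (r + t)) < e/4"
        by (rule d(2)) (use r s as in \<open>auto simp: dist_real_def\<close>)
      then show "norm (g (r + s) - g (r + t)) \<le> e/4" by (simp add: dist_norm)
    qed auto
    finally have g4: "norm (bochner_transform g s - bochner_transform g t) \<le> e/4" by simp
    have "norm (bochner_transform v s - bochner_transform v t) \<le> norm (bochner_transform v s - bochner_transform g s)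
        + norm (bochner_transform g s - bochner_transform g t) + norm (bochner_transform v t - bochner_transform g t)"
      using norm_triangle_ineq[of "bochner_transform v s - bochner_transform g s" "bochner_transform g s - bochner_transform g t"]
        norm_triangle_ineq4[of "bochner_transform v s - bochner_transform g t" "bochner_transform v t - bochner_transform g t"] by simp
    then show ?thesis using near[OF s(1)] near[OF t] g4 s \<open>e > 0\<close> by (simp add: dist_norm)
  qed
  then show "\<exists>d>0. \<forall>s\<in>T. dist s t < d \<longrightarrow> dist (bochner_transform v s) (bochner_transform v t) < e"
    using d(1) by (intro exI[of _ "min d 1"]) auto
qed

lemma S1_iff_bochner_AP:
  fixes v :: "real \<Rightarrow> 'b::euclidean_space"
  assumes "time_domain T"
  shows "v \<in> S1 T \<longleftrightarrow> v \<in> L1loc T \<and> bochner_transform v \<in> AP T"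
  using continuous_bochner[OF assms, of v] stepanov_periods_eq[OF assms, of v] by (simp add: S1_def AP_def cong: conj_cong)

lemma bochner_AE_eq:
  fixes u v :: "real \<Rightarrow> 'b::euclidean_space"
  assumes u: "u \<in> L1loc {0..}" and v: "v \<in> L1loc {0..}"
    and eq: "\<And>t. t \<ge> 0 \<Longrightarrow> bochner_transform u t = bochner_transform v t"
  shows "AE t in lebesgue_on {0..}. u t = v t"
proof -
  have "\<exists>N. negligible N \<and> (\<forall>s\<in>{0..1}. s \<notin> N \<longrightarrow> u (real n + s) = v (real n + s))" for n
  proof -
    have i: "integrable lebesgue01 (\<lambda>s. u (real n + s))" "integrable lebesgue01 (\<lambda>s. v (real n + s))"
      using L1loc_shift_integrable[OF u, of 0 "real n" 1] L1loc_shift_integrable[OF v, of 0 "real n" 1]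
      by (auto simp: integrable_lebesgue01_iff add.commute)
    have "L1rel (\<lambda>s. u (real n + s)) (\<lambda>s. v (real n + s))"
      using Quotient3_rel[OF Quotient3_L1unit, of "\<lambda>s. u (real n + s)" "\<lambda>s. v (real n + s)"] eq[of "real n"] i
      by (auto simp: bochner_transform_def L1rel_def)
    then show ?thesis unfolding L1rel_def by (subst (asm) AE_lebesgue_on_iff_negligible) auto
  qed
  then obtain N where N: "\<And>n. negligible (N n)" "\<And>n s. s \<in> {0..1} \<Longrightarrow> s \<notin> N n \<Longrightarrow> u (real n + s) = v (real n + s)"
    by metis
  show ?thesis
  proof (subst AE_lebesgue_on_iff_negligible)
    let ?N = "\<Union>n. (+) (real n) ` N n"
    have "negligible ?N" by (intro negligible_Union_nat negligible_translation N)
    moreover have "u t = v t" if "t \<ge> 0" "t \<notin> ?N" for t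
    proof -
      define n where "n = nat \<lfloor>t\<rfloor>"
      have n: "real n \<le> t" "t \<le> real n + 1" using that(1) unfolding n_def by linarith+
      have "t - real n \<notin> N n"
      proof
        assume "t - real n \<in> N n"
        then have "real n + (t - real n) \<in> ?N" by blast
        then show False using that(2) by simp
      qed
      from N(2)[OF _ this] n show ?thesis by simp
    qed
    ultimately show "\<exists>N. negligible N \<and> (\<forall>t\<in>{0..}. t \<notin> N \<longrightarrow> u t = v t)" by (intro exI[of _ ?N]) auto
  qed simp_all
qed

lemma bochner_cong_AE:
  fixes u v :: "real \<Rightarrow> 'b::euclidean_space"
  assumes u: "u \<in> L1loc {0..}" and v: "v \<in> L1loc {0..}" and ae: "AE t in lebesgue_on {0..}. u t = v t" and "t \<ge> 0"
  shows "bochner_transform u t = bochner_transform v t"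
proof -
  obtain N where N: "negligible N" "\<And>r. r \<ge> 0 \<Longrightarrow> r \<notin> N \<Longrightarrow> u r = v r"
    using ae by (subst (asm) AE_lebesgue_on_iff_negligible) auto
  have "norm (bochner_transform u t - bochner_transform v t) = integral {t..t + 1} (\<lambda>r. norm (u r - v r))"
    using norm_bochner_diff_translate[OF u _ v, of t 0] \<open>t \<ge> 0\<close> by simp
  also have "\<dots> = integral {t..t + 1} (\<lambda>r. 0)"
    by (rule integral_spike[OF N(1)]) (use N(2) \<open>t \<ge> 0\<close> in auto)
  finally show ?thesis by simp
qed

text \<open>The Bochner transform of \<open>w\<close> extends to the line as an almost periodic
  \<open>G\<close>, but a function with values in \<open>L1unit\<close> need not be a Bochner
  transform. So \<open>u\<close> is assembled from \<open>G\<close> at the integers, and agreement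
  elsewhere has to be proved.\<close>

lemma stepanov_extension:
  fixes w :: "real \<Rightarrow> 'b::euclidean_space"
  assumes w: "w \<in> S1 {0..}"
  shows "\<exists>u. u \<in> S1 UNIV \<and> (AE t in lebesgue_on {0..}. u t = w t)"
proof -
  have wL: "w \<in> L1loc {0..}" and wAP: "bochner_transform w \<in> AP {0..}" using w by (simp_all add: S1_iff_bochner_AP)
  obtain G where G: "G \<in> AP UNIV" "\<And>t. t \<ge> 0 \<Longrightarrow> G t = bochner_transform w t" using AP_extension[OF wAP] by metis
  define R where "R j = rep_L1unit (G (of_int j))" for j :: int
  have R: "R j absolutely_integrable_on {0..1}" "abs_L1unit (R j) = G (of_int j)" for j
    using Quotient3_rep_reflp[OF Quotient3_L1unit, of "G (of_int j)"] Quotient3_abs_rep[OF Quotient3_L1unit, of "G (of_int j)"]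
    by (simp_all add: R_def L1rel_def integrable_lebesgue01_iff)
  \<comment> \<open>Representatives of \<open>G\<close> at consecutive integers are glued on
    half-open unit cells; the right endpoint belongs to the next cell, hence the exception at 1
    below.\<close>
  define u where "u t = R \<lfloor>t\<rfloor> (t - of_int \<lfloor>t\<rfloor>)" for t
  have uR: "u (s + of_int j) = R j s" if "s \<in> {0..1}" "s \<notin> {1}" for s j
  proof -
    have "\<lfloor>s\<rfloor> = 0" using that by (simp add: floor_eq_iff)
    then show ?thesis by (simp add: u_def)
  qed
  have uc: "(\<lambda>s. u (s + of_int j)) absolutely_integrable_on {0..1}" for j
    by (rule absolutely_integrable_spike[OF R(1) negligible_sing[of 1]]) (use uR in auto)
  have ucell: "u absolutely_integrable_on {of_int j..of_int j + 1}" for j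
  proof -
    have "(\<lambda>s. u (s + of_int j)) \<in> L1loc {0..1}"
      unfolding L1loc_def by (auto intro: set_integrable_subset[OF uc])
    from L1loc_shift_integrable[OF this, of "of_int j" "- of_int j" "of_int j + 1"] show ?thesis by simp
  qed
  have ublock: "u absolutely_integrable_on {of_int j..of_int j + real n}" for j n
  proof (induction n)
    case 0 show ?case by (rule set_integrable_subset[OF ucell[of j]]) auto
  next
    case (Suc n)
    have "u absolutely_integrable_on {of_int j + real n..of_int j + real n + 1}" using ucell[of "j + int n"] by simp
    from absolutely_integrable_on_combine[OF Suc this] show ?case by (simp add: add_ac)
  qed
  have uL: "u \<in> L1loc UNIV"
    unfolding L1loc_def
  proof (intro CollectI allI impI)
    fix a b :: real
    define n where "n = nat \<lceil>b - of_int \<lfloor>a\<rfloor>\<rceil>"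
    have "b \<le> of_int \<lfloor>a\<rfloor> + real n" unfolding n_def by linarith
    then have "{a..b} \<subseteq> {of_int \<lfloor>a\<rfloor>..of_int \<lfloor>a\<rfloor> + real n}" by (auto intro: order_trans[OF of_int_floor_le])
    then show "set_integrable lebesgue {a..b} u" by (rule set_integrable_subset[OF ublock, rotated]) simp
  qed
  have bj: "bochner_transform u (of_int j) = G (of_int j)" for j
  proof -
    have "norm (abs_L1unit (\<lambda>s. u (s + of_int j)) - abs_L1unit (R j)) = integral {0..1} (\<lambda>s. norm (u (s + of_int j) - R j s))"
      by (rule norm_abs_L1unit_diff[OF uc R(1)])
    also have "\<dots> = integral {0..1} (\<lambda>s::real. 0)" by (rule integral_spike[OF negligible_sing[of 1]]) (use uR in auto)
    finally show ?thesis by (simp add: R(2) bochner_transform_def add.commute)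
  qed
  have bu: "bochner_transform u a = G a" for a
  proof -
    define j where "j = \<lfloor>a\<rfloor>"
    have j: "of_int j \<le> a" "a \<le> of_int j + 1" unfolding j_def by linarith+
    \<comment> \<open>The window at \<open>a\<close> is covered by two unit cells. On each of them
      \<open>u\<close> is close in the mean to \<open>w\<close> shifted by a large almost period of
      \<open>G\<close>, and for the shifted window the transform is known to be
      \<open>G\<close>.\<close>
    have le: "norm (bochner_transform u a - G a) \<le> 0 + e" if "e > 0" for e
    proof -
      define \<eta> where "\<eta> = e/3"
      obtain \<sigma> where \<sigma>: "\<sigma> \<in> bohr_periods UNIV G \<eta>" "\<sigma> \<ge> \<bar>of_int j\<bar>"
        using AP_large_period[OF G(1), of \<eta> "\<bar>of_int j\<bar>"] \<open>e > 0\<close> by (auto simp: \<eta>_def)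
      have \<sigma>0: "of_int j + \<sigma> \<ge> 0" "a + \<sigma> \<ge> 0" using \<sigma>(2) j(1) by linarith+
      have int: "(\<lambda>r. norm (u r - w (r + \<sigma>))) integrable_on {p..q}" if "of_int j \<le> p" for p q
        using L1loc_shift_integrable_diff[OF uL _ wL, of p 0 q \<sigma>] that \<sigma>0 by auto
      have cell: "integral {of_int i..of_int i + 1} (\<lambda>r. norm (u r - w (r + \<sigma>))) \<le> \<eta>" if "j \<le> i" for i
      proof -
        have "of_int i + \<sigma> \<ge> 0" using that \<sigma>0(1) by linarith
        then have "integral {of_int i..of_int i + 1} (\<lambda>r. norm (u r - w (r + \<sigma>))) = norm (G (of_int i) - G (of_int i + \<sigma>))"
          using norm_bochner_diff_translate[OF uL _ wL, of "of_int i" \<sigma>] by (simp add: bj G(2))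
        then show ?thesis using bohr_periodsD[OF \<sigma>(1), of "of_int i"] by simp
      qed
      have "norm (bochner_transform u a - bochner_transform w (a + \<sigma>)) = integral {a..a + 1} (\<lambda>r. norm (u r - w (r + \<sigma>)))"
        by (rule norm_bochner_diff_translate[OF uL _ wL]) (use \<sigma>0 in auto)
      also have "\<dots> \<le> integral {of_int j..of_int j + 2} (\<lambda>r. norm (u r - w (r + \<sigma>)))"
        by (rule integral_subset_le[OF _ int int]) (use j in auto)
      also have "\<dots> = integral {of_int j..of_int (j + 1)} (\<lambda>r. norm (u r - w (r + \<sigma>)))
          + integral {of_int (j + 1)..of_int (j + 1) + 1} (\<lambda>r. norm (u r - w (r + \<sigma>)))"
        using Henstock_Kurzweil_Integration.integral_combine[OF _ _ int[of "of_int j" "of_int j + 2"], of "of_int j + 1"] by (simp add: add.commute)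
      also have "\<dots> \<le> \<eta> + \<eta>" using cell[of j] cell[of "j + 1"] by simp
      finally have "norm (bochner_transform u a - G (a + \<sigma>)) \<le> 2 * \<eta>" by (simp add: G(2) \<sigma>0(2))
      moreover have "norm (G a - G (a + \<sigma>)) \<le> \<eta>" by (rule bohr_periodsD[OF \<sigma>(1)]) simp
      ultimately have "norm (bochner_transform u a - G a) \<le> 2 * \<eta> + \<eta>"
        using norm_triangle_ineq4[of "bochner_transform u a - G (a + \<sigma>)" "G a - G (a + \<sigma>)"] by simp
      then show ?thesis by (simp add: \<eta>_def)
    qed
    have "norm (bochner_transform u a - G a) \<le> 0" by (rule field_le_epsilon[OF le])
    then show ?thesis by simp
  qed
  have "u \<in> S1 UNIV" using uL G(1) bu by (simp add: S1_iff_bochner_AP ext[of "bochner_transform u" G])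
  moreover have "AE t in lebesgue_on {0..}. u t = w t"
  proof (rule bochner_AE_eq[OF _ wL])
    show "u \<in> L1loc {0..}" using uL by (simp add: L1loc_def)
  qed (simp add: bu G(2))
  ultimately show ?thesis by blast
qed

lemma L1loc_mono: "v \<in> L1loc T \<Longrightarrow> S \<subseteq> T \<Longrightarrow> v \<in> L1loc S"
  unfolding L1loc_def by blast

lemma s1_ext_props:
  fixes w :: "real \<Rightarrow> 'b::euclidean_space"
  assumes w: "w \<in> S1 {0..}"
  shows "s1_ext w \<in> S1 UNIV" "AE t in lebesgue_on {0..}. s1_ext w t = w t"
    "\<And>t. t \<ge> 0 \<Longrightarrow> bochner_transform (s1_ext w) t = bochner_transform w t"
proof -
  show u: "s1_ext w \<in> S1 UNIV" and ae: "AE t in lebesgue_on {0..}. s1_ext w t = w t"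
    using someI_ex[OF stepanov_extension[OF w]] by (simp_all add: s1_ext_def)
  fix t :: real assume "t \<ge> 0"
  then show "bochner_transform (s1_ext w) t = bochner_transform w t"
    by (intro bochner_cong_AE[OF _ _ ae]) (use u w in \<open>auto simp: S1_iff_bochner_AP intro: L1loc_mono\<close>)
qed

section \<open>Separating functionals and modules of Bochner transforms\<close>

lemma integrable_L1unit_moment:
  fixes f :: "real \<Rightarrow> 'b::euclidean_space"
  assumes "integrable lebesgue01 f"
  shows "integrable lebesgue01 (\<lambda>s. indicator {0..min c 1} s *\<^sub>R (f s \<bullet> i))"
proof -
  have "{0..min c 1} \<in> sets lebesgue01" by (subst sets_restrict_space_iff) auto
  then show ?thesis using assms by (intro integrable_mult_indicator) auto
qed

text \<open>The truncation \<^term>\<open>min c 1\<close> only makes the indicated set measurable in \<^term>\<open>lebesgue01\<close>.\<close>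

lift_definition L1unit_moment :: "real \<Rightarrow> 'b::euclidean_space \<Rightarrow> 'b L1unit \<Rightarrow> real"
  is "\<lambda>c i f. LINT s|lebesgue01. indicator {0..min c 1} s *\<^sub>R (f s \<bullet> i)"
proof -
  fix c and i :: 'b and f g :: "real \<Rightarrow> 'b" assume fg: "L1rel f g"
  show "(LINT s|lebesgue01. indicator {0..min c 1} s *\<^sub>R (f s \<bullet> i)) = (LINT s|lebesgue01. indicator {0..min c 1} s *\<^sub>R (g s \<bullet> i))"
  proof (rule integral_cong_AE)
    show "AE s in lebesgue01. indicator {0..min c 1} s *\<^sub>R (f s \<bullet> i) = indicator {0..min c 1} s *\<^sub>R (g s \<bullet> i)"
      using fg unfolding L1rel_def by (auto elim: eventually_mono)
    show "(\<lambda>s. indicator {0..min c 1} s *\<^sub>R (f s \<bullet> i)) \<in> borel_measurable lebesgue01"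
      "(\<lambda>s. indicator {0..min c 1} s *\<^sub>R (g s \<bullet> i)) \<in> borel_measurable lebesgue01"
      using fg by (auto simp only: L1rel_def intro: borel_measurable_integrable[OF integrable_L1unit_moment])
  qed
qed

lemma bounded_linear_L1unit_moment: "bounded_linear (L1unit_moment c (i :: 'b::euclidean_space))"
proof (rule bounded_linear_intro[where K = "norm i"])
  fix F G :: "'b L1unit" and r :: real
  show "L1unit_moment c i (F + G) = L1unit_moment c i F + L1unit_moment c i G"
  proof (transfer fixing: c i)
    fix f g :: "real \<Rightarrow> 'b" assume "L1rel f f" "L1rel g g"
    then have "integrable lebesgue01 (\<lambda>s. indicator {0..min c 1} s *\<^sub>R (f s \<bullet> i))" "integrable lebesgue01 (\<lambda>s. indicator {0..min c 1} s *\<^sub>R (g s \<bullet> i))"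
      by (auto simp only: L1rel_def intro: integrable_L1unit_moment)
    from Bochner_Integration.integral_add[OF this]
    show "(LINT s|lebesgue01. indicator {0..min c 1} s *\<^sub>R ((f s + g s) \<bullet> i)) =
        (LINT s|lebesgue01. indicator {0..min c 1} s *\<^sub>R (f s \<bullet> i)) + (LINT s|lebesgue01. indicator {0..min c 1} s *\<^sub>R (g s \<bullet> i))"
      by (simp add: inner_add_left distrib_left)
  qed
  show "L1unit_moment c i (r *\<^sub>R F) = r *\<^sub>R L1unit_moment c i F"
  proof (transfer fixing: c i r)
    fix f :: "real \<Rightarrow> 'b"
    show "(LINT s|lebesgue01. indicator {0..min c 1} s *\<^sub>R (r *\<^sub>R f s \<bullet> i)) = r *\<^sub>R (LINT s|lebesgue01. indicator {0..min c 1} s *\<^sub>R (f s \<bullet> i))"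
      unfolding integral_scaleR_right[symmetric] by (simp add: mult_ac)
  qed
  show "norm (L1unit_moment c i F) \<le> norm F * norm i"
  proof (transfer fixing: c i)
    fix f :: "real \<Rightarrow> 'b" assume "L1rel f f"
    then have f: "integrable lebesgue01 f" by (simp add: L1rel_def)
    have "norm (LINT s|lebesgue01. indicator {0..min c 1} s *\<^sub>R (f s \<bullet> i)) \<le> (LINT s|lebesgue01. norm (indicator {0..min c 1} s *\<^sub>R (f s \<bullet> i)))"
      by (rule integral_norm_bound)
    also have "\<dots> \<le> (LINT s|lebesgue01. norm (f s) * norm i)"
    proof (rule integral_mono)
      show "norm (indicator {0..min c 1} s *\<^sub>R (f s \<bullet> i)) \<le> norm (f s) * norm i" for s
        using Cauchy_Schwarz_ineq2[of "f s" i] by (auto simp: indicator_def)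
    qed (use f integrable_L1unit_moment[OF f] in auto)
    finally show "norm (LINT s|lebesgue01. indicator {0..min c 1} s *\<^sub>R (f s \<bullet> i)) \<le> (LINT s|lebesgue01. norm (f s)) * norm i" by simp
  qed
qed

text \<open>If all moments vanish, the primitive of the representative is zero, and differentiating
  it shows that the representative vanishes almost everywhere.\<close>

lemma separating_L1unit:
  "separating {L1unit_moment c i | c i. i \<in> (Basis :: 'b::euclidean_space set)}"
  unfolding separating_def
proof (intro conjI ballI allI impI)
  fix h :: "'b L1unit \<Rightarrow> real" assume "h \<in> {L1unit_moment c i | c i. i \<in> Basis}"
  then show "bounded_linear h" using bounded_linear_L1unit_moment by blast
next
  fix F :: "'b L1unit" assume 0: "\<forall>h\<in>{L1unit_moment c i | c i. i \<in> Basis}. h F = 0"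
  define f where "f = rep_L1unit F"
  have F: "F = abs_L1unit f" and f: "integrable lebesgue01 f"
    using Quotient3_rep_reflp[OF Quotient3_L1unit, of F] Quotient3_abs_rep[OF Quotient3_L1unit, of F] by (auto simp: f_def L1rel_def)
  have fa: "f absolutely_integrable_on {0..1}" using f by (simp add: integrable_lebesgue01_iff)
  have z: "integral {0..c} f = 0" if "0 \<le> c" "c \<le> 1" for c
  proof (rule euclidean_eqI)
    fix i :: 'b assume i: "i \<in> Basis"
    have "0 = L1unit_moment c i F" using 0 i by force
    also have "\<dots> = (LINT s|lebesgue01. indicator {0..c} s *\<^sub>R (f s \<bullet> i))"
      using f that unfolding F by (subst L1unit_moment.abs_eq) (auto simp: L1rel_def)
    also have "\<dots> = integral {0..1} (\<lambda>s. indicator {0..c} s *\<^sub>R (f s \<bullet> i))"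
      using integrable_L1unit_moment[OF f, of c i] that by (intro lebesgue_integral_eq_integral) auto
    also have "\<dots> = integral {0..1} (\<lambda>s. if s \<in> {0..c} then f s \<bullet> i else 0)" by (intro integral_cong) auto
    also have "\<dots> = integral {0..c} (\<lambda>s. f s \<bullet> i)"
    proof -
      have "{0..c} \<inter> {0..1} = {0..c}" using that by auto
      from integral_restrict_Int[of "{0..1}" "{0..c}" "\<lambda>s. f s \<bullet> i", unfolded this] show ?thesis .
    qed
    also have "\<dots> = integral {0..c} f \<bullet> i"
    proof (rule integral_component_eq)
      have "f absolutely_integrable_on {0..c}" by (rule set_integrable_subset[OF fa]) (use that in auto)
      then show "f integrable_on {0..c}" by (rule set_lebesgue_integral_eq_integral)
    qed
    finally show "integral {0..c} f \<bullet> i = 0 \<bullet> i" by simp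
  qed
  define g where "g s = (if s \<in> {0..1} then f s else 0)" for s
  have gu: "g integrable_on UNIV" unfolding g_def
    using fa by (subst integrable_restrict_UNIV) (auto dest: set_lebesgue_integral_eq_integral(1))
  have gi: "g integrable_on {a..b}" for a b by (rule integrable_on_subinterval[OF gu]) simp
  have "integral {a..b} g = 0" for a b
  proof (cases "max a 0 \<le> min b 1")
    case True
    have "integral {a..b} g = integral ({0..1} \<inter> {a..b}) f" unfolding g_def by (rule integral_restrict_Int)
    also have "{0..1} \<inter> {a..b} = {max a 0..min b 1}" by auto
    also have "integral {max a 0..min b 1} f = integral {0..min b 1} f - integral {0..max a 0} f"
    proof -
      have "f absolutely_integrable_on {0..min b 1}" by (rule set_integrable_subset[OF fa]) auto
      then have "f integrable_on {0..min b 1}" by (rule set_lebesgue_integral_eq_integral)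
      from Henstock_Kurzweil_Integration.integral_combine[OF _ True this] show ?thesis by (simp add: algebra_simps)
    qed
    finally show ?thesis using z True by simp
  next
    case False
    then have "{0..1} \<inter> {a..b} = {}" by auto
    then show ?thesis using integral_restrict_Int[of "{a..b}" "{0..1}" f] unfolding g_def by simp
  qed
  then obtain M where M: "negligible M" "\<And>s. s \<notin> M \<Longrightarrow> ((\<lambda>_. 0) has_vector_derivative g s) (at s)"
    using lebesgue_differentiation_line[OF gi, of "\<lambda>_. 0"] by auto
  have g0: "g s = 0" if "s \<notin> M" for s
    using vector_derivative_unique_at[OF M(2)[OF that] has_vector_derivative_const[of 0 "at s"]] .
  then have "AE s in lebesgue01. f s = 0"
  proof (subst AE_lebesgue_on_iff_negligible)
    show "\<exists>N. negligible N \<and> (\<forall>t\<in>{0..1}. t \<notin> N \<longrightarrow> f t = 0)"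
    proof (intro exI[of _ M] conjI M(1) ballI impI)
      fix t assume t: "t \<in> {0..1}" "t \<notin> M"
      have "g t = f t" unfolding g_def using t(1) by (rule if_P)
      then show "f t = 0" using g0[OF t(2)] by simp
    qed
  qed simp
  then have "L1rel f (\<lambda>_. 0)" using f by (simp add: L1rel_def)
  then show "F = 0" unfolding F zero_L1unit_def by (rule Quotient3_rel_abs[OF Quotient3_L1unit])
qed

lemma separating_euclidean: "separating {\<lambda>x. x \<bullet> i | i. i \<in> (Basis :: 'b::euclidean_space set)}"
  unfolding separating_def
proof (intro conjI ballI allI impI)
  fix x :: 'b assume "\<forall>h\<in>{\<lambda>x. x \<bullet> i | i. i \<in> Basis}. h x = 0"
  then have "x \<bullet> i = 0" if "i \<in> Basis" for i using that by force
  then show "x = 0" using euclidean_all_zero_iff[of x] by blast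
qed (auto intro: bounded_linear_inner_left)

lemma integral_le_of_unit_blocks:
  fixes g :: "real \<Rightarrow> real"
  assumes int: "\<And>a b. s \<le> a \<Longrightarrow> g integrable_on {a..b}" and nn: "\<And>r. g r \<ge> 0"
    and bl: "\<And>a. a \<ge> s \<Longrightarrow> integral {a..a + 1} g \<le> d" and "s \<le> t"
  shows "integral {s..t} g \<le> d * (t - s + 1)"
proof -
  have block: "integral {s..s + real n} g \<le> d * real n" for n
  proof (induction n)
    case (Suc n)
    have "integral {s..s + real (Suc n)} g = integral {s..s + real n} g + integral {s + real n..s + real n + 1} g"
      using Henstock_Kurzweil_Integration.integral_combine[OF _ _ int[of s "s + real (Suc n)"], of "s + real n"] by (simp add: add_ac)
    then show ?case using Suc bl[of "s + real n"] by (simp add: algebra_simps)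
  qed simp
  define n where "n = nat \<lceil>t - s\<rceil>"
  have n: "t - s \<le> real n" "real n \<le> t - s + 1" unfolding n_def using \<open>s \<le> t\<close> by linarith+
  have "0 \<le> integral {s..s + 1} g" by (rule integral_nonneg[OF int]) (use nn in auto)
  then have d: "d \<ge> 0" using bl[of s] by linarith
  have "integral {s..t} g \<le> integral {s..s + real n} g"
    by (rule integral_subset_le[OF _ int int]) (use n nn in auto)
  also have "\<dots> \<le> d * real n" by (rule block)
  also have "\<dots> \<le> d * (t - s + 1)" using d n by (intro mult_left_mono)
  finally show ?thesis .
qed

lemma L1loc_continuous:
  fixes U :: "real \<Rightarrow> 'b::euclidean_space"
  assumes "continuous_on UNIV U" shows "U \<in> L1loc UNIV"
  unfolding L1loc_def using absolutely_integrable_continuous_real[OF continuous_on_subset[OF assms]] by auto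

text \<open>If \<open>U (t + \<tau>)\<close> and \<open>U t\<close> differ by more than \<open>e\<close> at one point, then by uniform continuity by \<open>e/2\<close>
  on an interval of fixed length.\<close>

lemma bohr_periods_of_bochner:
  fixes U :: "real \<Rightarrow> 'b::euclidean_space"
  assumes U: "U \<in> AP UNIV" and "e > 0"
  shows "\<exists>\<delta>>0. bohr_periods UNIV (bochner_transform U) \<delta> \<subseteq> bohr_periods UNIV U e"
proof -
  have UL: "U \<in> L1loc UNIV" by (rule L1loc_continuous[OF AP_continuous[OF U]])
  have "e/4 > 0" using \<open>e > 0\<close> by simp
  from AP_uniformly_continuous[OF U this]
  obtain d where d: "d > 0" "\<And>s t. \<bar>s - t\<bar> < d \<Longrightarrow> norm (U s - U t) < e/4" by metis
  define h where "h = min (d/2) 1"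
  have h: "0 < h" "h \<le> 1" "h < d" using d(1) by (auto simp: h_def)
  have "norm (U t - U (t + \<tau>)) \<le> e" if \<tau>: "\<tau> \<in> bohr_periods UNIV (bochner_transform U) (h * e / 4)" for \<tau> t
  proof (rule ccontr)
    assume big: "\<not> ?thesis"
    have "h * (e/2) = integral {t..t + h} (\<lambda>r. e/2)" using h by simp
    also have "\<dots> \<le> integral {t..t + h} (\<lambda>r. norm (U r - U (r + \<tau>)))"
    proof (rule integral_le)
      show "(\<lambda>r. norm (U r - U (r + \<tau>))) integrable_on {t..t + h}"
        using L1loc_shift_integrable_diff[OF UL _ UL, of t 0 "t + h" \<tau>] by simp
      fix r assume "r \<in> {t..t + h}"
      then have "\<bar>r - t\<bar> < d" "\<bar>(r + \<tau>) - (t + \<tau>)\<bar> < d" using h by auto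
      then have near: "norm (U r - U t) < e/4" "norm (U (r + \<tau>) - U (t + \<tau>)) < e/4" using d(2)[of r t] d(2)[of "r + \<tau>" "t + \<tau>"] by simp_all
      have eq: "U t - U (t + \<tau>) = (U r - U (r + \<tau>)) - (U r - U t) + (U (r + \<tau>) - U (t + \<tau>))" by simp
      have tri: "norm (X - Y + Z) \<le> norm X + norm Y + norm Z" for X Y Z :: 'b
        by (rule order_trans[OF norm_triangle_ineq]) (simp add: norm_triangle_ineq4)
      have "norm (U t - U (t + \<tau>)) \<le> norm (U r - U (r + \<tau>)) + norm (U r - U t) + norm (U (r + \<tau>) - U (t + \<tau>))"
        by (subst eq) (rule tri)
      with near show "e/2 \<le> norm (U r - U (r + \<tau>))" using big by linarith
    qed (rule integrable_const_ivl)
    also have "\<dots> \<le> integral {t..t + 1} (\<lambda>r. norm (U r - U (r + \<tau>)))"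
      by (rule integral_subset_le) (use h L1loc_shift_integrable_diff[OF UL _ UL, of t 0 _ \<tau>] in auto)
    also have "\<dots> = norm (bochner_transform U t - bochner_transform U (t + \<tau>))"
      by (rule norm_bochner_diff_translate[OF UL _ UL, symmetric]) auto
    also have "\<dots> \<le> h * e / 4" by (rule bohr_periodsD[OF \<tau>]) simp
    finally show False using h \<open>e > 0\<close> by simp
  qed
  then show ?thesis using h \<open>e > 0\<close> by (intro exI[of _ "h * e / 4"]) (auto simp: bohr_periods_def)
qed

lemma bochner_periods_of_bohr:
  fixes U :: "real \<Rightarrow> 'b::euclidean_space"
  assumes U: "U \<in> AP UNIV"
  shows "bohr_periods UNIV U e \<subseteq> bohr_periods UNIV (bochner_transform U) e"
proof
  have UL: "U \<in> L1loc UNIV" by (rule L1loc_continuous[OF AP_continuous[OF U]])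
  fix \<tau> assume \<tau>: "\<tau> \<in> bohr_periods UNIV U e"
  have "norm (bochner_transform U t - bochner_transform U (t + \<tau>)) \<le> e" for t
  proof -
    have "norm (bochner_transform U t - bochner_transform U (t + \<tau>)) = integral {t..t + 1} (\<lambda>r. norm (U r - U (r + \<tau>)))"
      by (rule norm_bochner_diff_translate[OF UL _ UL]) auto
    also have "\<dots> \<le> integral {t..t + 1} (\<lambda>r. e)"
    proof (rule integral_le)
      show "(\<lambda>r. norm (U r - U (r + \<tau>))) integrable_on {t..t + 1}"
        using L1loc_shift_integrable_diff[OF UL _ UL, of t 0 "t + 1" \<tau>] by simp
    qed (use bohr_periodsD[OF \<tau>] in \<open>simp_all add: integrable_const_ivl\<close>)
    finally show ?thesis by simp
  qed
  then show "\<tau> \<in> bohr_periods UNIV (bochner_transform U) e" by (simp add: bohr_periods_def)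
qed

lemma freq_module_le_of_periods:
  fixes F :: "real \<Rightarrow> 'a::banach" and z :: "real \<Rightarrow> 'b::banach"
  assumes L: "separating (L :: ('a \<Rightarrow> real) set)" and F: "F \<in> AP UNIV" and z: "z \<in> AP UNIV"
    and per: "\<And>e. e > 0 \<Longrightarrow> \<exists>d>0. \<forall>\<tau>\<ge>0. \<tau> \<in> bohr_periods UNIV F d \<longrightarrow> \<tau> \<in> bohr_periods UNIV z e"
  shows "freq_module z \<subseteq> freq_module F"
proof (rule freq_module_subset[OF real_subgroup_freq_module], rule subsetI)
  fix \<omega> assume "\<omega> \<in> freq_spectrum z"
  then have "\<not> fourier_null \<omega> z" by (simp add: freq_spectrum_eq[OF z])
  from AP_spectrum_in_module[OF L F z per real_subgroup_freq_module _ this] show "\<omega> \<in> freq_module F"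
    using freq_spectrum_eq[OF F] freq_spectrum_subset_module[of F] by blast
qed

text \<open>Up to a change of tolerance \<open>U\<close> and its transform have the same almost
  periods, and these determine the module.\<close>

lemma freq_module_bochner:
  fixes U :: "real \<Rightarrow> 'b::euclidean_space"
  assumes U: "U \<in> AP UNIV" and bU: "bochner_transform U \<in> AP UNIV"
  shows "freq_module (bochner_transform U) = freq_module U"
proof (rule antisym)
  show "freq_module (bochner_transform U) \<subseteq> freq_module U"
    by (rule freq_module_le_of_periods[OF separating_euclidean U bU]) (use bochner_periods_of_bohr[OF U] in blast)
  show "freq_module U \<subseteq> freq_module (bochner_transform U)"
    by (rule freq_module_le_of_periods[OF separating_L1unit bU U]) (use bohr_periods_of_bochner[OF U] in blast)
qed

section \<open>Comparison functions and essential suprema\<close>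

lemma Linf_norm_AE:
  assumes g: "g \<in> Linf T"
  shows "AE t in lebesgue_on T. norm (g t) \<le> Linf_norm T g"
proof -
  let ?g = "\<lambda>t. ereal (norm (g t))"
  obtain M where M: "g \<in> borel_measurable (lebesgue_on T)" "AE t in lebesgue_on T. norm (g t) \<le> M"
    using g by (auto simp: Linf_def)
  have "esssup (lebesgue_on T) ?g \<le> ereal M"
    by (rule esssup_I) (use M in auto)
  then have top: "esssup (lebesgue_on T) ?g \<noteq> \<infinity>" by auto
  have ae: "AE t in lebesgue_on T. ?g t \<le> esssup (lebesgue_on T) ?g" by (rule esssup_AE)
  show ?thesis
  proof (cases "esssup (lebesgue_on T) ?g")
    case (real r)
    then show ?thesis using ae by (simp add: Linf_norm_def)
  next
    case PInf then show ?thesis using top by simp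
  next
    \<comment> \<open>The essential supremum can be minus infinity only over a null set, where the
      claim is vacuous.\<close>
    case MInf
    then show ?thesis using ae by (auto elim: eventually_mono)
  qed
qed

lemma Linf_norm_le:
  assumes m: "g \<in> borel_measurable (lebesgue_on T)" and le: "AE t in lebesgue_on T. norm (g t) \<le> c" and "c \<ge> 0"
  shows "Linf_norm T g \<le> c"
proof -
  have "esssup (lebesgue_on T) (\<lambda>t. ereal (norm (g t))) \<le> ereal c"
    by (rule esssup_I) (use m le in auto)
  then show ?thesis unfolding Linf_norm_def using \<open>c \<ge> 0\<close>
    by (cases "esssup (lebesgue_on T) (\<lambda>t. ereal (norm (g t)))") auto
qed

text \<open>Over a null set the essential supremum is infinite with either sign;
  \<open>real_of_ereal\<close> sends both to 0.\<close>

lemma Linf_norm_nonneg: "Linf_norm T g \<ge> 0"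
proof (cases "AE t in lebesgue_on T. False")
  case True
  show ?thesis
  proof (cases "(\<lambda>t. ereal (norm (g t))) \<in> borel_measurable (lebesgue_on T)")
    case m: True
    have "esssup (lebesgue_on T) (\<lambda>t. ereal (norm (g t))) \<le> - \<infinity>" by (rule esssup_I[OF m]) (use True in auto)
    then show ?thesis by (simp add: Linf_norm_def)
  next
    case False then show ?thesis by (simp add: Linf_norm_def esssup_non_measurable top_ereal_def)
  qed
next
  case False
  have "0 \<le> esssup (lebesgue_on T) (\<lambda>t. ereal (norm (g t)))"
  proof (rule ccontr)
    assume n: "\<not> ?thesis"
    have "AE t in lebesgue_on T. ereal (norm (g t)) \<le> esssup (lebesgue_on T) (\<lambda>t. ereal (norm (g t)))" by (rule esssup_AE)
    then have "AE t in lebesgue_on T. False"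
    proof eventually_elim
      case (elim t)
      have "0 \<le> ereal (norm (g t))" by simp
      then show ?case using elim n by (meson order_trans)
    qed
    then show False using False by blast
  qed
  then show ?thesis by (simp add: Linf_norm_def real_of_ereal_pos)
qed

lemma Linf_diff:
  fixes g h :: "real \<Rightarrow> 'b::euclidean_space"
  assumes "g \<in> Linf T" "h \<in> Linf T"
  shows "(\<lambda>t. g t - h t) \<in> Linf T"
proof -
  obtain M1 M2 where M: "g \<in> borel_measurable (lebesgue_on T)" "h \<in> borel_measurable (lebesgue_on T)"
    "AE t in lebesgue_on T. norm (g t) \<le> M1" "AE t in lebesgue_on T. norm (h t) \<le> M2" using assms by (auto simp: Linf_def)
  have "AE t in lebesgue_on T. norm (g t - h t) \<le> M1 + M2"
    using M(3,4) by eventually_elim (rule norm_triangle_le_diff, simp)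
  then show ?thesis using M(1,2) by (auto simp: Linf_def)
qed

lemma Linf_subset:
  fixes g :: "real \<Rightarrow> 'b::euclidean_space"
  assumes g: "g \<in> Linf T" and S: "S \<subseteq> T" "S \<in> sets lebesgue" "T \<in> sets lebesgue"
  shows "g \<in> Linf S"
proof -
  obtain M where M: "g \<in> borel_measurable (lebesgue_on T)" "AE t in lebesgue_on T. norm (g t) \<le> M"
    using g by (auto simp: Linf_def)
  have "g \<in> borel_measurable (lebesgue_on S)" by (rule measurable_restrict_mono[OF M(1) S(1)])
  moreover have "AE t in lebesgue_on S. norm (g t) \<le> M"
    using M(2) S unfolding AE_lebesgue_on_iff_negligible[OF S(3)] AE_lebesgue_on_iff_negligible[OF S(2)] by blast
  ultimately show ?thesis by (auto simp: Linf_def)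
qed

text \<open>The average of \<open>\<gamma>\<close> over \<open>[s, 2s]\<close> is at least \<open>\<gamma> s\<close>, nondecreasing and, unlike \<open>\<gamma>\<close> itself, continuous.\<close>

lemma class_K_majorant:
  fixes \<gamma> :: "real \<Rightarrow> real"
  assumes mono: "\<And>s t. 0 \<le> s \<Longrightarrow> s \<le> t \<Longrightarrow> \<gamma> s \<le> \<gamma> t" and nn: "\<And>s. 0 \<le> s \<Longrightarrow> 0 \<le> \<gamma> s"
    and small: "\<And>h. h > 0 \<Longrightarrow> \<exists>\<delta>>0. \<gamma> \<delta> \<le> h"
  obtains \<theta> where "\<theta> \<in> class_K" "\<And>s. s \<ge> 0 \<Longrightarrow> \<gamma> s \<le> \<theta> s"
proof -
  define I where "I s = integral {0..s} \<gamma>" for s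
  \<comment> \<open>The summand \<open>s\<close> makes the nondecreasing average strictly
    increasing. At \<open>s = 0\<close> the quotient is 0 by the convention for division by zero,
    which is the value a class K function needs.\<close>
  define \<theta> where "\<theta> s = s + (I (2 * s) - I s) / s" for s
  have int: "\<gamma> integrable_on {a..b}" if "0 \<le> a" for a b
    by (rule integrable_on_mono_on) (use that mono in \<open>auto simp: mono_on_def\<close>)
  have Idiff: "I t - I s = integral {s..t} \<gamma>" if "0 \<le> s" "s \<le> t" for s t
    using Henstock_Kurzweil_Integration.integral_combine[OF that int[of 0 t]] by (simp add: I_def)
  have bounds: "(t - s) * \<gamma> s \<le> I t - I s" "I t - I s \<le> (t - s) * \<gamma> t" if "0 \<le> s" "s \<le> t" for s t
  proof -
    have "integral {s..t} (\<lambda>_. \<gamma> s) \<le> integral {s..t} \<gamma>" by (rule integral_le[OF _ int]) (use that mono in auto)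
    moreover have "integral {s..t} \<gamma> \<le> integral {s..t} (\<lambda>_. \<gamma> t)" by (rule integral_le[OF int]) (use that mono in auto)
    ultimately show "(t - s) * \<gamma> s \<le> I t - I s" "I t - I s \<le> (t - s) * \<gamma> t" using that by (simp_all add: Idiff)
  qed
  have avg: "\<gamma> s \<le> (I (2 * s) - I s) / s" "(I (2 * s) - I s) / s \<le> \<gamma> (2 * s)" if "s > 0" for s
    using bounds[of s "2 * s"] that by (simp_all add: pos_le_divide_eq pos_divide_le_eq mult.commute)
  have \<theta>0: "\<theta> 0 = 0" by (simp add: \<theta>_def)
  \<comment> \<open>Rescaling to the fixed interval from 1 to 2 makes monotonicity of the average in
    \<open>s\<close> visible.\<close>
  have avg_scale: "((\<lambda>r. \<gamma> (s * r)) has_integral ((I (2 * s) - I s) / s)) {1..2}" if "s > 0" for s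
  proof -
    have "(\<gamma> has_integral (I (2 * s) - I s)) (cbox s (2 * s))"
      using integrable_integral[OF int[of s "2 * s"]] that by (simp add: Idiff)
    from has_integral_affinity[OF this, of s 0] that
    have "((\<lambda>x. \<gamma> (s * x)) has_integral ((I (2 * s) - I s) / s)) ((\<lambda>x. x / s) ` {s..2 * s})" by simp
    moreover have "(\<lambda>x. x / s) ` {s..2 * s} = {1..2}" using that
      by (auto simp: pos_le_divide_eq pos_divide_le_eq image_iff intro!: bexI[of _ "_ * s"])
    ultimately show ?thesis by simp
  qed
  have strict: "\<theta> s < \<theta> t" if "0 \<le> s" "s < t" for s t
  proof (cases "s = 0")
    case True
    have "0 < t + (I (2 * t) - I t) / t" using avg(1)[of t] nn[of t] that by simp
    then show ?thesis using True \<theta>0 by (simp add: \<theta>_def)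
  next
    case False
    have "(I (2 * s) - I s) / s \<le> (I (2 * t) - I t) / t"
      by (rule has_integral_le[OF avg_scale avg_scale]) (use False that in \<open>auto intro!: mono\<close>)
    then show ?thesis using that by (simp add: \<theta>_def)
  qed
  have cI: "continuous_on {0..b} I" for b unfolding I_def by (rule indefinite_integral_continuous_1[OF int]) simp
  have cont: "continuous_on {0..} \<theta>"
    unfolding continuous_on_eq_continuous_within
  proof
    fix s :: real assume s: "s \<in> {0..}"
    show "continuous (at s within {0..}) \<theta>"
    proof (cases "s = 0")
      case True
      have "\<exists>d>0. \<forall>t\<in>{0..}. dist t 0 < d \<longrightarrow> dist (\<theta> t) (\<theta> 0) < e" if "e > 0" for e
      proof -
        obtain \<delta> where \<delta>: "\<delta> > 0" "\<gamma> \<delta> \<le> e/2" using small[of "e/2"] \<open>e > 0\<close> by auto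
        have "dist (\<theta> t) (\<theta> 0) < e" if t: "t \<in> {0..}" "dist t 0 < min (\<delta>/2) (e/2)" for t
        proof (cases "t = 0")
          case False
          then have t0: "t > 0" "2 * t \<le> \<delta>" "t < e/2" using t by (auto simp: dist_real_def)
          then have "\<gamma> (2 * t) \<le> \<gamma> \<delta>" by (intro mono) auto
          then have "\<theta> t < e" "\<theta> t \<ge> 0" using avg[OF t0(1)] nn[of t] t0 \<delta>(2) by (auto simp: \<theta>_def)
          then show ?thesis by (simp add: \<theta>0 dist_real_def)
        qed (use \<open>e > 0\<close> in simp)
        then show ?thesis using \<delta>(1) \<open>e > 0\<close> by (intro exI[of _ "min (\<delta>/2) (e/2)"]) auto
      qed
      then show ?thesis unfolding continuous_within_eps_delta True by (auto simp: dist_commute)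
    next
      case False
      then have s0: "s > 0" using s by simp
      have cc: "isCont I r" if "r > 0" for r
        using continuous_on_interior[OF cI[of "r + 1"], of r] that by simp
      have "isCont \<theta> s" unfolding \<theta>_def
        using s0 cc[OF s0] isCont_o2[of s "\<lambda>s. 2 * s" I] cc[of "2 * s"] by (intro continuous_intros) auto
      then show ?thesis by (rule continuous_at_imp_continuous_at_within)
    qed
  qed
  have "strict_mono_on {0..} \<theta>" by (auto simp: strict_mono_on_def strict)
  then have "\<theta> \<in> class_K" using cont \<theta>0 by (simp add: class_K_def)
  moreover have "\<gamma> s \<le> \<theta> s" if "s \<ge> 0" for s
  proof (cases "s = 0")
    case True
    have "\<gamma> 0 \<le> 0 + h" if "h > 0" for h
    proof -
      obtain \<delta> where "\<delta> > 0" "\<gamma> \<delta> \<le> h" using small[OF \<open>h > 0\<close>] by blast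
      then show ?thesis using mono[of 0 \<delta>] by simp
    qed
    from field_le_epsilon[OF this] have "\<gamma> 0 \<le> 0" .
    then show ?thesis using True \<theta>0 by simp
  next
    case False
    then show ?thesis using that avg(1)[of s] by (simp add: \<theta>_def)
  qed
  ultimately show thesis by (rule that)
qed

lemma AP_norm_le_of_eventually:
  fixes u :: "real \<Rightarrow> 'a::banach"
  assumes u: "u \<in> AP UNIV" and le: "\<And>t. t \<ge> c \<Longrightarrow> norm (u t) \<le> e"
  shows "norm (u t) \<le> e"
proof (rule field_le_epsilon)
  fix h :: real assume "h > 0"
  from AP_large_period[OF u _ this] obtain \<tau> where \<tau>: "\<tau> \<in> bohr_periods UNIV u h" "\<tau> \<ge> c - t" by (metis time_domain_intros(2))
  have "norm (u t) \<le> norm (u t - u (t + \<tau>)) + norm (u (t + \<tau>))" using norm_triangle_sub[of "u t" "u (t + \<tau>)"] by simp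
  also have "\<dots> \<le> h + e" using bohr_periodsD[OF \<tau>(1), of t] le[of "t + \<tau>"] \<tau>(2) by (intro add_mono) auto
  finally show "norm (u t) \<le> e + h" by simp
qed

lemma solution_cong_AE:
  assumes s: "solution {0..} A B C f u x" and v: "v \<in> L1loc {0..}" and ae: "AE t in lebesgue_on {0..}. u t = v t"
  shows "solution {0..} A B C f v x"
  unfolding solution_def
proof (intro conjI ballI impI v)
  show "continuous_on {0..} x" using s by (simp add: solution_def)
  obtain N where N: "negligible N" "\<And>r. r \<ge> 0 \<Longrightarrow> r \<notin> N \<Longrightarrow> u r = v r"
    using ae by (subst (asm) AE_lebesgue_on_iff_negligible) auto
  fix a b :: real assume ab: "a \<in> {0..}" "b \<in> {0..}" "a \<le> b"
  show "(lure_rhs A B C f v x has_integral x b - x a) {a..b}"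
  proof (rule has_integral_spike[OF N(1)])
    show "(lure_rhs A B C f u x has_integral x b - x a) {a..b}" using s ab by (simp add: solution_def)
    show "lure_rhs A B C f v x r = lure_rhs A B C f u x r" if "r \<in> {a..b} - N" for r
      using N(2)[of r] that ab by (simp add: lure_rhs_def)
  qed
qed

lemma solution_subset: "solution T A B C f v x \<Longrightarrow> S \<subseteq> T \<Longrightarrow> solution S A B C f v x"
  unfolding solution_def by (blast intro: L1loc_mono continuous_on_subset)

section \<open>Convergence of solutions\<close>

lemma AE_half_line_shift:
  assumes ae: "AE t in lebesgue_on {c..}. Q t"
  shows "AE t in lebesgue_on {0..}. Q (t + c :: real)"
proof -
  obtain Z where Z: "negligible Z" "\<And>r. r \<ge> c \<Longrightarrow> r \<notin> Z \<Longrightarrow> Q r"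
    using ae by (subst (asm) AE_lebesgue_on_iff_negligible) auto
  have "negligible ((\<lambda>t. - c + t) ` Z)" by (rule negligible_translation[OF Z(1)])
  moreover have "Q (t + c)" if "t \<ge> 0" "t \<notin> (\<lambda>t. - c + t) ` Z" for t
  proof (rule Z(2))
    show "t + c \<notin> Z"
    proof
      assume "t + c \<in> Z"
      then have "- c + (t + c) \<in> (\<lambda>t. - c + t) ` Z" by (rule imageI)
      then show False using that(2) by simp
    qed
  qed (use that in simp)
  ultimately show ?thesis by (subst AE_lebesgue_on_iff_negligible) auto
qed

context lure
begin

lemma sol_shift: "sol v x \<Longrightarrow> \<tau> \<ge> 0 \<Longrightarrow> sol (\<lambda>t. v (t + \<tau>)) (\<lambda>t. x (t + \<tau>))"
  by (rule solution_shift) auto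

lemma sol_continuous: "sol v x \<Longrightarrow> continuous_on {0..} x"
  by (simp add: solution_def)

lemma output_compact: obtains \<Gamma> where "compact \<Gamma>" "\<And>x. norm x \<le> R \<Longrightarrow> C *v x \<in> \<Gamma>"
proof -
  obtain K where K: "K > 0" "\<And>x. norm (C *v x) \<le> norm x * K"
    using bounded_linear.pos_bounded[OF bounded_linear_matrix[of C]] by blast
  have "C *v x \<in> cball 0 (R * K)" if "norm x \<le> R" for x
  proof -
    have "norm (C *v x) \<le> R * K" by (rule order_trans[OF K(2) mult_right_mono[OF that less_imp_le[OF K(1)]]])
    then show ?thesis by simp
  qed
  with compact_cball show thesis by (rule that)
qed

text \<open>First source of admissible pairs: for input differences bounded by \<open>D\<close> the
  cross term is handled by the constant \<open>Y\<close> that \<open>growth_bounds\<close> assigns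
  to \<open>D\<close>.\<close>

lemma admissible_bounded:
  assumes \<Gamma>: "compact \<Gamma>"
  shows "\<exists>Y\<ge>0. inputs_admissible \<Gamma> Y D"
proof -
  have "\<exists>Y\<ge>0. \<forall>y. \<forall>z\<in>\<Gamma>. \<forall>p. 0 \<le> p \<longrightarrow> p \<le> D \<longrightarrow> norm y * p \<le> y \<bullet> (f (y + z) - f z) / 2 + Y * p"
    by (rule growth_bounds[OF \<Gamma>])
  then obtain Y where Y: "Y \<ge> 0" "\<And>y z p. z \<in> \<Gamma> \<Longrightarrow> 0 \<le> p \<Longrightarrow> p \<le> D \<Longrightarrow> norm y * p \<le> y \<bullet> (f (y + z) - f z) / 2 + Y * p"
    by blast
  show ?thesis
  proof (intro exI[of _ Y] conjI Y(1) allI impI)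
    fix d v1 x1 v2 x2
    assume s: "sol v1 x1" "sol v2 x2" and g': "\<forall>t\<ge>0. C *v x2 t \<in> \<Gamma>"
      and ae: "AE t in lebesgue_on {0..}. norm (v1 t - v2 t) \<le> D"
      and bl': "\<forall>a\<ge>0. integral {a..a + 1} (\<lambda>r. norm (v1 r - v2 r)) \<le> d"
    note g = g'[rule_format] and bl = bl'[rule_format]
    obtain Z where Z: "negligible Z" "\<And>r. r \<ge> 0 \<Longrightarrow> r \<notin> Z \<Longrightarrow> norm (v1 r - v2 r) \<le> D"
      using ae by (subst (asm) AE_lebesgue_on_iff_negligible) auto
    have in1: "(\<lambda>r. norm (v1 r - v2 r)) integrable_on {a..b}" if "0 \<le> a" for a b
      by (rule set_lebesgue_integral_eq_integral(1)[OF norm_d_integrable[OF s that]])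
    show "admissible \<Gamma> Y d v1 x1 v2 x2"
      unfolding admissible_def
    proof (intro conjI s allI impI g)
      show "\<exists>Z. negligible Z \<and> (\<forall>r\<ge>0. r \<notin> Z \<longrightarrow> norm (C *v (x1 r - x2 r)) * norm (v1 r - v2 r) \<le>
          (C *v (x1 r - x2 r)) \<bullet> (f (C *v x1 r) - f (C *v x2 r)) / 2 + Y * norm (v1 r - v2 r))"
      proof (intro exI[of _ Z] conjI Z(1) allI impI)
        fix r :: real assume r: "0 \<le> r" "r \<notin> Z"
        have "C *v (x1 r - x2 r) + C *v x2 r = C *v x1 r" by (simp add: matrix_vector_mult_diff_distrib)
        then show "norm (C *v (x1 r - x2 r)) * norm (v1 r - v2 r) \<le>
            (C *v (x1 r - x2 r)) \<bullet> (f (C *v x1 r) - f (C *v x2 r)) / 2 + Y * norm (v1 r - v2 r)"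
          using Y(2)[OF g[OF r(1)] norm_ge_zero Z(2)[OF r], of "C *v (x1 r - x2 r)"] by simp
      qed
      fix s' t :: real assume "0 \<le> s'" "s' \<le> t"
      then show "integral {s'..t} (\<lambda>r. norm (v1 r - v2 r)) \<le> d * (t - s' + 1)"
        by (intro integral_le_of_unit_blocks in1 bl) auto
    qed
  qed
qed

lemma unit_block_le_of_AE:
  assumes s: "sol v1 x1" "sol v2 x2" and ae: "AE t in lebesgue_on {0..}. norm (v1 t - v2 t) \<le> d" and "p \<ge> 0"
  shows "integral {p..p + 1} (\<lambda>r. norm (v1 r - v2 r)) \<le> d"
proof -
  obtain Z where Z: "negligible Z" "\<And>r. r \<ge> 0 \<Longrightarrow> r \<notin> Z \<Longrightarrow> norm (v1 r - v2 r) \<le> d"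
    using ae by (subst (asm) AE_lebesgue_on_iff_negligible) auto
  have "integral {p..p + 1} (\<lambda>r. norm (v1 r - v2 r)) \<le> integral {p..p + 1} (\<lambda>r. d)"
    by (rule integral_mono_off_negligible[OF set_lebesgue_integral_eq_integral(1)[OF norm_d_integrable[OF s \<open>p \<ge> 0\<close>]] integrable_const_ivl Z(1)])
      (use Z(2) \<open>p \<ge> 0\<close> in auto)
  then show ?thesis by simp
qed

text \<open>\<open>Y\<close> depends on a bound for the input difference, and the tolerance depends
  on \<open>Y\<close>. Fixing the bound 1 beforehand avoids the circularity.\<close>

lemma eventually_close_of_small_input:
  assumes \<Gamma>: "compact \<Gamma>" and "h > 0"
  shows "\<exists>d>0. close_outputs \<Gamma> d h"
proof -
  obtain Y where Y: "Y \<ge> 0" "inputs_admissible \<Gamma> Y 1"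
    using admissible_bounded[OF \<Gamma>, of 1] by (elim exE conjE) (rule that)
  obtain d where d: "d > 0" "\<And>r0. \<exists>T. attracted \<Gamma> Y d r0 T h" using asymptotically_small[OF \<Gamma> Y(1) \<open>h > 0\<close>] by metis
  show ?thesis
  proof (rule exI[of _ "min d 1"], intro conjI allI impI)
    show "min d 1 > 0" using d(1) by simp
    fix v1 x1 v2 x2 and t0 :: real
    assume s: "sol v1 x1" "sol v2 x2" and g: "\<forall>t\<ge>0. C *v x2 t \<in> \<Gamma>" and t0: "t0 \<ge> 0"
      and ae: "AE t in lebesgue_on {t0..}. norm (v1 t - v2 t) \<le> min d 1"
    note s' = sol_shift[OF s(1) t0] sol_shift[OF s(2) t0]
    have ae': "AE t in lebesgue_on {0..}. norm (v1 (t + t0) - v2 (t + t0)) \<le> min d 1" by (rule AE_half_line_shift[OF ae])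
    have ae1: "AE t in lebesgue_on {0..}. norm (v1 (t + t0) - v2 (t + t0)) \<le> 1" "AE t in lebesgue_on {0..}. norm (v1 (t + t0) - v2 (t + t0)) \<le> d"
      using ae' by (auto elim: eventually_mono)
    have adm: "admissible \<Gamma> Y d (\<lambda>t. v1 (t + t0)) (\<lambda>t. x1 (t + t0)) (\<lambda>t. v2 (t + t0)) (\<lambda>t. x2 (t + t0))"
    proof (rule Y(2)[rule_format])
      show "C *v x2 (t + t0) \<in> \<Gamma>" if "0 \<le> t" for t using g t0 that by simp
      show "integral {p..p + 1} (\<lambda>r. norm (v1 (r + t0) - v2 (r + t0))) \<le> d" if "0 \<le> p" for p
        by (rule unit_block_le_of_AE[OF s' ae1(2) that])
    qed (rule s' ae1)+
    obtain T where T: "attracted \<Gamma> Y d (norm (x1 (0 + t0) - x2 (0 + t0))) T h" using d(2)[of "norm (x1 (0 + t0) - x2 (0 + t0))"] by (rule exE)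
    have "norm (x1 t - x2 t) \<le> h" if "t \<ge> T + t0" for t
      using T[rule_format, OF adm order_refl, of "t - t0"] that by simp
    then show "\<exists>T. \<forall>t\<ge>T. norm (x1 t - x2 t) \<le> h" by blast
  qed
qed

lemma eventually_bounded_of_bounded_input:
  assumes \<Gamma>: "compact \<Gamma>"
  shows "\<exists>G. \<forall>v1 x1 v2 x2. sol v1 x1 \<longrightarrow> sol v2 x2 \<longrightarrow> (\<forall>t\<ge>0. C *v x2 t \<in> \<Gamma>) \<longrightarrow>
    (AE t in lebesgue_on {0..}. norm (v1 t - v2 t) \<le> D) \<longrightarrow> (\<exists>T. \<forall>t\<ge>T. norm (x1 t - x2 t) \<le> G)"
proof -
  obtain Y where Y: "Y \<ge> 0" "inputs_admissible \<Gamma> Y D"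
    using admissible_bounded[OF \<Gamma>, of D] by (elim exE conjE) (rule that)
  define \<delta> where "\<delta> = max D 1"
  have "\<delta> > 0" by (simp add: \<delta>_def)
  obtain G where G: "\<And>r0. \<exists>T. attracted \<Gamma> Y \<delta> r0 T G" using asymptotic_bound[OF \<Gamma> Y(1) \<open>\<delta> > 0\<close>] by metis
  show ?thesis
  proof (rule exI[of _ G], intro allI impI)
    fix v1 x1 v2 x2
    assume s: "sol v1 x1" "sol v2 x2" and g: "\<forall>t\<ge>0. C *v x2 t \<in> \<Gamma>"
      and ae: "AE t in lebesgue_on {0..}. norm (v1 t - v2 t) \<le> D"
    have ae': "AE t in lebesgue_on {0..}. norm (v1 t - v2 t) \<le> \<delta>"
      using ae by (auto simp: \<delta>_def elim: eventually_mono)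
    have adm: "admissible \<Gamma> Y \<delta> v1 x1 v2 x2"
    proof (rule Y(2)[rule_format])
      show "C *v x2 t \<in> \<Gamma>" if "0 \<le> t" for t using g that by simp
      show "integral {p..p + 1} (\<lambda>r. norm (v1 r - v2 r)) \<le> \<delta>" if "0 \<le> p" for p
        by (rule unit_block_le_of_AE[OF s ae' that])
    qed (rule s ae)+
    obtain T where T: "attracted \<Gamma> Y \<delta> (norm (x1 0 - x2 0)) T G" using G[of "norm (x1 0 - x2 0)"] by (rule exE)
    have "norm (x1 t - x2 t) \<le> G" if "t \<ge> T" for t by (rule T[rule_format, OF adm order_refl that])
    then show "\<exists>T. \<forall>t\<ge>T. norm (x1 t - x2 t) \<le> G" by blast
  qed
qed

text \<open>For integrable \<open>v1 - v2\<close> the form \<open>V\<close> stays bounded along \<open>x1 - x2\<close>: at the maximum of \<open>V\<close> over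
  \<open>[0, t]\<close>, \<open>V \<le> V(0) + 2 \<kappa> I sqrt V\<close> with \<open>I = \<integral> |v1 - v2|\<close>.\<close>

lemma output_difference_bounded:
  assumes s: "sol v1 x1" "sol v2 x2" and int: "(\<lambda>r. norm (v1 r - v2 r)) integrable_on {0..}"
  obtains Y where "Y \<ge> 0" "\<And>t. t \<ge> 0 \<Longrightarrow> norm (C *v (x1 t - x2 t)) \<le> Y"
proof -
  obtain k where k: "k > 0" "\<And>x. norm (C *v x) \<le> k * sqrt (V x)" using output_le_V by blast
  define e where "e t = x1 t - x2 t" for t
  define D where "D t = f (C *v x1 t) - f (C *v x2 t)" for t
  define d where "d t = v1 t - v2 t" for t
  define I where "I = integral {0..} (\<lambda>r. norm (d r))"
  have id: "(\<lambda>r. norm (d r)) integrable_on {0..t}" for t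
    using set_lebesgue_integral_eq_integral(1)[OF norm_d_integrable[OF s order_refl]] by (simp add: d_def)
  have Ile: "integral {0..t} (\<lambda>r. norm (d r)) \<le> I" for t
    unfolding I_def by (rule integral_subset_le[OF _ id]) (use int in \<open>auto simp: d_def\<close>)
  have I0: "I \<ge> 0" unfolding I_def by (rule integral_nonneg) (use int in \<open>auto simp: d_def\<close>)
  have ce: "continuous_on {0..} e" using cont_x(3)[OF s] by (simp add: e_def[abs_def])
  have cD: "continuous_on {0..} D" using cont_D[OF s] by (simp add: D_def[abs_def])
  have cV: "continuous_on {0..} (\<lambda>t. V (e t))" unfolding V_def by (intro continuous_intros cont_matrix ce)
  \<comment> \<open>At the maximum, \<open>\<rho> \<le> 1\<close> or division of
    \<open>\<rho> * \<rho> \<le> V (e 0) + 2 * k * I * \<rho>\<close> by \<open>\<rho>\<close>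
    bounds \<open>\<rho>\<close> by the second entry.\<close>
  define X where "X = max 1 (V (e 0) + 2 * k * I)"
  have "norm (C *v e t) \<le> k * X" if t: "t \<ge> 0" for t
  proof -
    have "\<exists>r\<in>{0..t}. \<forall>r'\<in>{0..t}. V (e r') \<le> V (e r)"
      by (rule continuous_attains_sup) (use t in \<open>auto intro: continuous_on_subset[OF cV]\<close>)
    then obtain r where r: "r \<in> {0..t}" "\<And>r'. r' \<in> {0..t} \<Longrightarrow> V (e r') \<le> V (e r)" by blast
    define \<rho> where "\<rho> = sqrt (V (e r))"
    have \<rho>: "\<rho> \<ge> 0" "\<rho> * \<rho> = V (e r)" using V_nonneg by (simp_all add: \<rho>_def)
    have i1: "(\<lambda>u. - 2 * ((C *v e u) \<bullet> D u) + 2 * (norm (C *v e u) * norm (d u))) integrable_on {0..r}"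
    proof (rule integrable_add[OF integrable_on_mult_right integrable_on_mult_right])
      have "continuous_on {0..} (\<lambda>u. (C *v e u) \<bullet> D u)" by (intro continuous_intros cont_matrix ce cD)
      then show "(\<lambda>u. (C *v e u) \<bullet> D u) integrable_on {0..r}"
        by (intro integrable_continuous_interval) (rule continuous_on_subset, auto)
      have "continuous_on {0..} (\<lambda>u. norm (C *v e u))" by (intro continuous_intros cont_matrix ce)
      then have "continuous_on {0..r} (\<lambda>u. norm (C *v e u))" by (rule continuous_on_subset) auto
      from mult_absolutely_integrable[OF this norm_d_integrable[OF s order_refl]]
      show "(\<lambda>u. norm (C *v e u) * norm (d u)) integrable_on {0..r}"
        by (simp add: d_def set_lebesgue_integral_eq_integral(1))
    qed
    have "V (e r) - V (e 0) \<le> integral {0..r} (\<lambda>u. - 2 * ((C *v e u) \<bullet> D u) + 2 * (norm (C *v e u) * norm (d u)))"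
      using V_increment[OF s order_refl, of r] r(1) by (simp add: e_def D_def d_def)
    also have "\<dots> \<le> integral {0..r} (\<lambda>u. 2 * k * \<rho> * norm (d u))"
    proof (rule integral_le[OF i1 integrable_on_mult_right[OF id]])
      fix u assume u: "u \<in> {0..r}"
      have "compact {C *v x2 u}" by simp
      then have q: "y \<bullet> (f (y + C *v x2 u) - f (C *v x2 u)) \<ge> 0" for y
        by (rule growth_bounds) auto
      have "(C *v e u) \<bullet> D u \<ge> 0"
        using q[of "C *v e u"] by (simp add: e_def D_def matrix_vector_mult_diff_distrib)
      moreover have "norm (C *v e u) \<le> k * \<rho>"
      proof -
        have "sqrt (V (e u)) \<le> \<rho>" unfolding \<rho>_def using r(2)[of u] u r(1) by simp
        then have "k * sqrt (V (e u)) \<le> k * \<rho>" using k(1) by simp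
        then show ?thesis using k(2)[of "e u"] by linarith
      qed
      then have "norm (C *v e u) * norm (d u) \<le> k * \<rho> * norm (d u)" by (rule mult_right_mono) simp
      ultimately show "- 2 * ((C *v e u) \<bullet> D u) + 2 * (norm (C *v e u) * norm (d u)) \<le> 2 * k * \<rho> * norm (d u)" by simp
    qed
    also have "\<dots> = 2 * k * \<rho> * integral {0..r} (\<lambda>u. norm (d u))" by simp
    also have "\<dots> \<le> 2 * k * \<rho> * I" using k(1) \<rho>(1) by (intro mult_left_mono Ile) auto
    finally have quad: "\<rho> * \<rho> \<le> V (e 0) + 2 * k * I * \<rho>" unfolding \<rho>(2) by (simp add: mult_ac)
    have "\<rho> \<le> X"
    proof (cases "\<rho> \<le> 1")
      case False
      have "V (e 0) * 1 \<le> V (e 0) * \<rho>" using False V_nonneg by (intro mult_left_mono) auto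
      then have "\<rho> * \<rho> \<le> (V (e 0) + 2 * k * I) * \<rho>" using quad by (simp add: distrib_right)
      then have "\<rho> \<le> V (e 0) + 2 * k * I" using False by (simp add: mult_le_cancel_right)
      then show ?thesis by (simp add: X_def)
    qed (simp add: X_def)
    have "sqrt (V (e t)) \<le> \<rho>" unfolding \<rho>_def using r(2)[of t] t by simp
    then have "k * sqrt (V (e t)) \<le> k * X" using k(1) \<open>\<rho> \<le> X\<close> by (intro mult_left_mono) auto
    then show ?thesis using k(2)[of "e t"] by linarith
  qed
  moreover have "k * X \<ge> 0" using k(1) by (simp add: X_def)
  ultimately show thesis using that[of "k * X"] by (simp add: e_def)
qed

text \<open>Second source of admissible pairs: the input difference may be unbounded, but the output
  difference is bounded by \<open>Y\<close>, so the cross term is at most \<open>Y\<close> times the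
  input difference. After a late start the remaining integral is below any
  \<open>\<delta>\<close>.\<close>

lemma converge_of_integrable_input:
  assumes s: "sol v1 x1" "sol v2 x2" and int: "(\<lambda>r. norm (v1 r - v2 r)) integrable_on {0..}"
    and bdd: "\<And>t. t \<ge> 0 \<Longrightarrow> norm (x2 t) \<le> R"
  shows "((\<lambda>t. x1 t - x2 t) \<longlongrightarrow> 0) at_top"
proof (rule tendstoI)
  fix h :: real assume "h > 0"
  then have "h/2 > 0" by simp
  obtain \<Gamma> where \<Gamma>: "compact \<Gamma>" "\<And>x. norm x \<le> R \<Longrightarrow> C *v x \<in> \<Gamma>" using output_compact by blast
  obtain Y where Y: "Y \<ge> 0" "\<And>t. t \<ge> 0 \<Longrightarrow> norm (C *v (x1 t - x2 t)) \<le> Y" using output_difference_bounded[OF s int] by blast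
  obtain \<delta> where \<delta>: "\<delta> > 0" "\<And>r0. \<exists>T. attracted \<Gamma> Y \<delta> r0 T (h/2)" using asymptotically_small[OF \<Gamma>(1) Y(1) \<open>h/2 > 0\<close>] by metis
  let ?d = "\<lambda>r. norm (v1 r - v2 r)"
  have id: "?d integrable_on {a..b}" if "0 \<le> a" for a b
    by (rule set_lebesgue_integral_eq_integral(1)[OF norm_d_integrable[OF s that]])
  have "(\<lambda>k. integral {0..} (\<lambda>r. if r \<in> {0..real k} then ?d r else 0)) \<longlonglongrightarrow> integral {0..} ?d"
  proof (rule dominated_convergence(2)[OF _ int])
    show "(\<lambda>r. if r \<in> {0..real k} then ?d r else 0) integrable_on {0..}" for k
    proof -
      have "{0..real k} \<inter> {0..} = {0..real k}" by auto
      then show ?thesis using id[of 0 "real k"] integrable_restrict_Int[of "{0..real k}" ?d "{0..}"] by simp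
    qed
    show "norm (if r \<in> {0..real k} then ?d r else 0) \<le> ?d r" for k r by simp
    show "(\<lambda>k. if r \<in> {0..real k} then ?d r else 0) \<longlonglongrightarrow> ?d r" if "r \<in> {0..}" for r
    proof (rule tendsto_eventually)
      obtain k0 :: nat where "r \<le> real k0" using real_arch_simple by blast
      then show "\<forall>\<^sub>F k in sequentially. (if r \<in> {0..real k} then ?d r else 0) = ?d r"
        unfolding eventually_sequentially using that by (intro exI[of _ k0]) auto
    qed
  qed
  from LIMSEQ_D[OF this \<delta>(1)] obtain k where
    k: "norm (integral {0..} (\<lambda>r. if r \<in> {0..real k} then ?d r else 0) - integral {0..} ?d) < \<delta>" by blast
  define t0 where "t0 = real k"
  have t0: "t0 \<ge> 0" by (simp add: t0_def)
  have "integral {0..} (\<lambda>r. if r \<in> {0..t0} then ?d r else 0) = integral {0..t0} ?d"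
  proof -
    have "{0..t0} \<inter> {0..} = {0..t0}" by auto
    then show ?thesis using integral_restrict_Int[of "{0..}" "{0..t0}" ?d] by simp
  qed
  then have kt: "integral {0..} ?d - integral {0..t0} ?d < \<delta>" using k by (simp add: t0_def)
  have tail: "integral {a..b} ?d \<le> \<delta>" if "t0 \<le> a" "a \<le> b" for a b
  proof -
    have "integral {0..a} ?d + integral {a..b} ?d = integral {0..b} ?d"
      by (rule Henstock_Kurzweil_Integration.integral_combine) (use that t0 id in auto)
    moreover have "integral {0..b} ?d \<le> integral {0..} ?d"
      by (rule integral_subset_le[OF _ id int]) auto
    moreover have "integral {0..t0} ?d \<le> integral {0..a} ?d"
      by (rule integral_subset_le[OF _ id id]) (use that in auto)
    then have "integral {0..} ?d - integral {0..a} ?d < \<delta>" using kt by linarith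
    ultimately show ?thesis by linarith
  qed
  have g: "C *v x2 t \<in> \<Gamma>" if "t \<ge> 0" for t using \<Gamma>(2) bdd that by blast
  have adm: "admissible \<Gamma> Y \<delta> (\<lambda>t. v1 (t + t0)) (\<lambda>t. x1 (t + t0)) (\<lambda>t. v2 (t + t0)) (\<lambda>t. x2 (t + t0))"
    unfolding admissible_def
  proof (intro conjI allI impI)
    show "sol (\<lambda>t. v1 (t + t0)) (\<lambda>t. x1 (t + t0))" "sol (\<lambda>t. v2 (t + t0)) (\<lambda>t. x2 (t + t0))" using s t0(1) by (auto intro: sol_shift)
    show "C *v x2 (t + t0) \<in> \<Gamma>" if "0 \<le> t" for t using g that t0 by simp
    show "\<exists>Z. negligible Z \<and> (\<forall>r\<ge>0. r \<notin> Z \<longrightarrow> norm (C *v (x1 (r + t0) - x2 (r + t0))) * ?d (r + t0) \<le>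
        (C *v (x1 (r + t0) - x2 (r + t0))) \<bullet> (f (C *v x1 (r + t0)) - f (C *v x2 (r + t0))) / 2 + Y * ?d (r + t0))"
    proof (intro exI[of _ "{}"] conjI negligible_empty allI impI)
      fix r :: real assume r: "0 \<le> r"
      have "compact {C *v x2 (r + t0)}" by simp
      then have q: "y \<bullet> (f (y + C *v x2 (r + t0)) - f (C *v x2 (r + t0))) \<ge> 0" for y
        by (rule growth_bounds) auto
      have "(C *v (x1 (r + t0) - x2 (r + t0))) \<bullet> (f (C *v x1 (r + t0)) - f (C *v x2 (r + t0))) \<ge> 0"
        using q[of "C *v (x1 (r + t0) - x2 (r + t0))"] by (simp add: matrix_vector_mult_diff_distrib)
      moreover have "norm (C *v (x1 (r + t0) - x2 (r + t0))) * ?d (r + t0) \<le> Y * ?d (r + t0)"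
        by (rule mult_right_mono[OF Y(2) norm_ge_zero]) (use r t0 in simp)
      ultimately show "norm (C *v (x1 (r + t0) - x2 (r + t0))) * ?d (r + t0) \<le>
        (C *v (x1 (r + t0) - x2 (r + t0))) \<bullet> (f (C *v x1 (r + t0)) - f (C *v x2 (r + t0))) / 2 + Y * ?d (r + t0)" by linarith
    qed
    fix a b :: real assume ab: "0 \<le> a" "a \<le> b"
    have "integral {a..b} (\<lambda>r. ?d (r + t0)) = integral {a + t0..b + t0} ?d"
      using integral_shift_Icc_real[of a b ?d t0] by (simp add: o_def add.commute)
    also have "\<dots> \<le> \<delta>" by (rule tail) (use ab in auto)
    also have "\<dots> \<le> \<delta> * (b - a + 1)" using ab \<delta>(1) by simp
    finally show "integral {a..b} (\<lambda>r. ?d (r + t0)) \<le> \<delta> * (b - a + 1)" .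
  qed
  obtain T where T: "attracted \<Gamma> Y \<delta> (norm (x1 (0 + t0) - x2 (0 + t0))) T (h/2)" using \<delta>(2)[of "norm (x1 (0 + t0) - x2 (0 + t0))"] by (rule exE)
  have "norm (x1 t - x2 t) < h" if "t \<ge> T + t0" for t
    using T[rule_format, OF adm order_refl, of "t - t0"] that \<open>h > 0\<close> by simp
  then show "\<forall>\<^sub>F t in at_top. dist (x1 t - x2 t) 0 < h"
    unfolding eventually_at_top_linorder by (intro exI[of _ "T + t0"]) simp
qed

end

section \<open>The almost periodic response\<close>

lemma AE_half_line_translate:
  assumes ae: "AE t in lebesgue_on {0..}. Q t" and "\<tau> \<ge> 0"
  shows "AE t in lebesgue_on {0..}. Q (t + \<tau> :: real)"
proof (rule AE_half_line_shift)
  show "AE t in lebesgue_on {\<tau>..}. Q t"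
    using ae \<open>\<tau> \<ge> 0\<close> by (subst AE_lebesgue_on_iff_negligible, simp, subst (asm) AE_lebesgue_on_iff_negligible) auto
qed

lemma bohr_periods_mono: "e \<le> e' \<Longrightarrow> bohr_periods T v e \<subseteq> bohr_periods T v e'"
  unfolding bohr_periods_def by (auto intro: order_trans)

context
  fixes w :: "real \<Rightarrow> 'b::euclidean_space"
  assumes w: "w \<in> S1 {0..}"
begin

lemma S1_L1loc: "w \<in> L1loc {0..}" and S1_bochner_AP: "bochner_transform w \<in> AP {0..}"
  using w by (simp_all add: S1_iff_bochner_AP)

lemma s1_ext_L1loc: "s1_ext w \<in> L1loc UNIV" and s1_ext_bochner_AP: "bochner_transform (s1_ext w) \<in> AP UNIV"
  using s1_ext_props(1)[OF w] by (simp_all add: S1_iff_bochner_AP)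

lemma stepanov_periods_half_line: "stepanov_periods {0..} w e = bohr_periods {0..} (bochner_transform w) e"
  by (rule stepanov_periods_eq[OF _ S1_L1loc]) simp

lemma bochner_periods_ext_iff:
  assumes "\<sigma> \<ge> 0"
  shows "\<sigma> \<in> bohr_periods UNIV (bochner_transform (s1_ext w)) e \<longleftrightarrow> \<sigma> \<in> stepanov_periods {0..} w e"
proof
  assume "\<sigma> \<in> bohr_periods UNIV (bochner_transform (s1_ext w)) e"
  then have "norm (bochner_transform (s1_ext w) t - bochner_transform (s1_ext w) (t + \<sigma>)) \<le> e" for t
    by (simp add: bohr_periods_def)
  then have "norm (bochner_transform w t - bochner_transform w (t + \<sigma>)) \<le> e" if "t \<ge> 0" for t
    using s1_ext_props(3)[OF w] assms that by (metis add_nonneg_nonneg)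
  then show "\<sigma> \<in> stepanov_periods {0..} w e" using assms by (simp add: stepanov_periods_half_line bohr_periods_def)
next
  assume "\<sigma> \<in> stepanov_periods {0..} w e"
  then have \<sigma>: "\<sigma> \<in> bohr_periods {0..} (bochner_transform w) e" by (simp add: stepanov_periods_half_line)
  show "\<sigma> \<in> bohr_periods UNIV (bochner_transform (s1_ext w)) e"
  proof (rule bohr_periods_half_line_imp[OF s1_ext_bochner_AP])
    fix t :: real assume "0 \<le> t"
    then show "norm (bochner_transform (s1_ext w) t - bochner_transform (s1_ext w) (t + \<sigma>)) \<le> e"
      using bohr_periodsD[OF \<sigma>, of t] s1_ext_props(3)[OF w] assms by simp
  qed
qed

end

context lure
begin

text \<open>The translate solves the equation with translated input and starts within
  \<open>R + R\<close> of \<open>z\<close>, whatever \<open>\<tau>\<close> is. Hence one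
  \<open>T\<close> works for all almost periods at once.\<close>

lemma asymptotic_almost_periods:
  assumes w: "w \<in> S1 {0..}" and wM: "AE t in lebesgue_on {0..}. norm (w t) \<le> M" and z: "sol w z"
    and zR: "\<And>t. t \<ge> 0 \<Longrightarrow> norm (z t) \<le> R" and "e > 0"
  shows "\<exists>d>0. \<exists>T. \<forall>\<tau>\<in>stepanov_periods {0..} w d. \<forall>t\<ge>T. norm (z t - z (t + \<tau>)) \<le> e"
proof -
  obtain \<Gamma> where \<Gamma>: "compact \<Gamma>" "\<And>x. norm x \<le> R \<Longrightarrow> C *v x \<in> \<Gamma>" using output_compact by blast
  obtain Y where Y: "Y \<ge> 0" "inputs_admissible \<Gamma> Y (M + M)"
    using admissible_bounded[OF \<Gamma>(1), of "M + M"] by (elim exE conjE) (rule that)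
  obtain d where d: "d > 0" "\<And>r0. \<exists>T. attracted \<Gamma> Y d r0 T e" using asymptotically_small[OF \<Gamma>(1) Y(1) \<open>e > 0\<close>] by metis
  obtain T where T: "attracted \<Gamma> Y d (R + R) T e" using d(2)[of "R + R"] by (rule exE)
  have "norm (z t - z (t + \<tau>)) \<le> e" if \<tau>: "\<tau> \<in> stepanov_periods {0..} w d" and t: "t \<ge> T" for \<tau> t
  proof -
    have \<tau>0: "\<tau> \<ge> 0" and st: "\<And>p. p \<ge> 0 \<Longrightarrow> integral {p..p + 1} (\<lambda>s. norm (w (s + \<tau>) - w s)) \<le> d"
      using \<tau> by (auto simp: stepanov_periods_def)
    have adm: "admissible \<Gamma> Y d (\<lambda>t. w (t + \<tau>)) (\<lambda>t. z (t + \<tau>)) w z"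
    proof (rule Y(2)[rule_format])
      show "sol (\<lambda>t. w (t + \<tau>)) (\<lambda>t. z (t + \<tau>))" by (rule sol_shift[OF z \<tau>0])
      show "AE t in lebesgue_on {0..}. norm (w (t + \<tau>) - w t) \<le> M + M"
        using AE_half_line_translate[OF wM \<tau>0] wM
        by eventually_elim (rule norm_triangle_le_diff, rule add_mono)
    qed (use \<Gamma>(2) zR z st in auto)
    have "norm (z (0 + \<tau>) - z 0) \<le> R + R"
      using zR[of \<tau>] zR[of 0] \<tau>0 norm_triangle_ineq4[of "z \<tau>" "z 0"] by simp
    from T[rule_format, OF adm this t] show ?thesis by (simp add: norm_minus_commute)
  qed
  then show ?thesis using d(1) by blast
qed

text \<open>The response is the limit of the translates \<open>z (t + \<tau>\<^sub>k)\<close> for almost periods \<open>\<tau>\<^sub>k \<rightarrow> \<infinity>\<close> of \<open>w\<close>.\<close>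

lemma almost_periodic_response:
  assumes w: "w \<in> S1 {0..}" and wM: "AE t in lebesgue_on {0..}. norm (w t) \<le> M" and z: "sol w z"
    and zR: "\<And>t. t \<ge> 0 \<Longrightarrow> norm (z t) \<le> R"
  obtains zu where "zu \<in> AP UNIV" "\<And>\<epsilon>. \<epsilon> > 0 \<Longrightarrow> \<exists>d>0. stepanov_periods {0..} w d \<subseteq> bohr_periods UNIV zu \<epsilon>"
    "solution UNIV A B C f (s1_ext w) zu"
proof -
  define e where "e k = 1 / (real k + 1)" for k
  have e0: "e k > 0" for k by (simp add: e_def add_pos_nonneg)
  have emono: "e k \<le> e j" if "j \<le> k" for j k using that unfolding e_def by (intro divide_left_mono) auto
  have "\<exists>\<tau>. \<tau> \<in> bohr_periods {0..} (bochner_transform w) (e k) \<and> \<tau> \<ge> real k" for k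
    using AP_large_period[OF S1_bochner_AP[OF w] _ e0[of k], of "real k"] by (metis time_domain_intros(1))
  then obtain \<tau> where \<tau>: "\<And>k. \<tau> k \<in> bohr_periods {0..} (bochner_transform w) (e k)" "\<And>k. \<tau> k \<ge> real k" by metis
  have \<tau>lim: "filterlim \<tau> at_top sequentially"
    by (rule filterlim_at_top_mono[OF filterlim_real_sequentially]) (use \<tau>(2) in simp)
  have period: "\<exists>d>0. \<exists>T. \<forall>\<tau>\<in>stepanov_periods {0..} w d. \<forall>t\<ge>T. norm (z t - z (t + \<tau>)) \<le> \<epsilon>" if "\<epsilon> > 0" for \<epsilon>
    by (rule asymptotic_almost_periods[OF w wM z zR that])
  have cauchy: "\<exists>N. \<forall>j\<ge>N. \<forall>k\<ge>N. \<forall>t\<ge>c. norm (z (t + \<tau> j) - z (t + \<tau> k)) < \<epsilon>" if "\<epsilon> > 0" for c \<epsilon>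
  proof -
    obtain d T where d: "d > 0" "\<forall>\<tau>\<in>stepanov_periods {0..} w d. \<forall>t\<ge>T. norm (z t - z (t + \<tau>)) \<le> \<epsilon>/2"
      using period[of "\<epsilon>/2"] \<open>\<epsilon> > 0\<close> by auto
    obtain N1 :: nat where N1: "2 / d \<le> real N1" using real_arch_simple by blast
    obtain N2 :: nat where N2: "T - c \<le> real N2" using real_arch_simple by blast
    \<comment> \<open>\<open>N1\<close> makes \<open>e j + e k \<le> d\<close>, so that differences
      of the chosen almost periods are again Stepanov \<open>d\<close>-periods; \<open>N2\<close>
      moves \<open>t + \<tau> j\<close> past \<open>T\<close>.\<close>
    define N where "N = max N1 N2"
    have "2 / d \<le> real N + 1" using N1 unfolding N_def by linarith
    then have eN: "2 * e N \<le> d" using d(1) by (simp add: e_def pos_divide_le_eq pos_le_divide_eq mult.commute add_pos_nonneg)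
    have N2': "T - c \<le> real N" using N2 unfolding N_def by linarith
    have close: "norm (z (t + \<tau> j) - z (t + \<tau> k)) \<le> \<epsilon>/2" if "N \<le> j" "N \<le> k" "\<tau> j \<le> \<tau> k" "t \<ge> c" for j k t
    proof -
      have "\<tau> k - \<tau> j \<in> bohr_periods {0..} (bochner_transform w) (e j + e k)"
        by (rule bohr_periods_diff[OF S1_bochner_AP[OF w] _ \<tau>(1) \<tau>(1) that(3)]) simp
      moreover have "e j + e k \<le> d" using emono[OF that(1)] emono[OF that(2)] eN by linarith
      ultimately have "\<tau> k - \<tau> j \<in> stepanov_periods {0..} w d"
        using bohr_periods_mono unfolding stepanov_periods_half_line[OF w] by blast
      moreover have "t + \<tau> j \<ge> T"
      proof -
        have "real N \<le> real j" using that(1) by simp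
        then show ?thesis using \<tau>(2)[of j] N2' that(4) by linarith
      qed
      ultimately have "norm (z (t + \<tau> j) - z (t + \<tau> j + (\<tau> k - \<tau> j))) \<le> \<epsilon>/2" using d(2) by blast
      then show ?thesis by simp
    qed
    have "norm (z (t + \<tau> j) - z (t + \<tau> k)) < \<epsilon>" if "N \<le> j" "N \<le> k" "t \<ge> c" for j k t
    proof (cases "\<tau> j \<le> \<tau> k")
      case True show ?thesis using close[OF that(1,2) True that(3)] \<open>\<epsilon> > 0\<close> by linarith
    next
      case False
      then have "\<tau> k \<le> \<tau> j" by simp
      from close[OF that(2,1) this that(3)] show ?thesis using \<open>\<epsilon> > 0\<close> by (simp add: norm_minus_commute)
    qed
    then show ?thesis by blast
  qed
  obtain zu where zu: "\<And>c. uniform_limit {c..} (\<lambda>k t. z (t + \<tau> k)) zu sequentially"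
    using uniform_limit_of_Cauchy[of z \<tau>, OF cauchy] by blast
  have per: "\<exists>S. relatively_dense {0..} S \<and> (\<forall>\<sigma>\<in>S. \<exists>c. \<forall>t\<ge>c. norm (z t - z (t + \<sigma>)) \<le> \<epsilon>)" if eps: "\<epsilon> > 0" for \<epsilon>
  proof -
    obtain d T where d: "d > 0" "\<forall>\<tau>\<in>stepanov_periods {0..} w d. \<forall>t\<ge>T. norm (z t - z (t + \<tau>)) \<le> \<epsilon>"
      using period[OF eps] by blast
    have "relatively_dense {0..} (stepanov_periods {0..} w d)" using w d(1) by (simp add: S1_def)
    with d(2) show ?thesis by (intro exI[of _ "stepanov_periods {0..} w d"]) blast
  qed
  note zuAP = AP_line_limit(1)[OF sol_continuous[OF z] \<tau>lim zu per]
  have zuP: "\<exists>d>0. stepanov_periods {0..} w d \<subseteq> bohr_periods UNIV zu \<epsilon>" if eps: "\<epsilon> > 0" for \<epsilon>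
  proof -
    obtain d T where d: "d > 0" "\<forall>\<tau>\<in>stepanov_periods {0..} w d. \<forall>t\<ge>T. norm (z t - z (t + \<tau>)) \<le> \<epsilon>"
      using period[OF eps] by blast
    have "\<sigma> \<in> bohr_periods UNIV zu \<epsilon>" if "\<sigma> \<in> stepanov_periods {0..} w d" for \<sigma>
      by (rule AP_line_limit(2)[OF sol_continuous[OF z] \<tau>lim zu per bspec[OF d(2) that]])
    then show ?thesis using d(1) by blast
  qed
  define u where "u = s1_ext w"
  define h where "h x = A *v x - B *v f (C *v x)" for x
  have hc: "continuous_on UNIV h"
    unfolding h_def by (intro continuous_intros cont_matrix continuous_on_compose2[OF f_cont]) auto
  have rhs: "lure_rhs A B C f v x r = h (x r) + B *v v r" for v x r by (simp add: lure_rhs_def h_def)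
  have "bounded (h ` cball 0 R)"
    by (intro compact_imp_bounded compact_continuous_image continuous_on_subset[OF hc]) auto
  then obtain b where "\<forall>y\<in>h ` cball 0 R. norm y \<le> b" unfolding bounded_iff by blast
  then have b: "norm (h x) \<le> b" if "norm x \<le> R" for x using that by simp
  have sol: "(lure_rhs A B C f u zu has_integral (zu t - zu s)) {s..t}" if st: "s \<le> t" for s t
  proof -
    \<comment> \<open>Skipping the first \<open>K\<close> almost periods keeps the translated
      interval in the half-line for every \<open>k\<close>.\<close>
    define K where "K = nat \<lceil>\<bar>s\<bar>\<rceil>"
    define \<sigma> where "\<sigma> k = \<tau> (k + K)" for k
    have \<sigma>s: "s + \<sigma> k \<ge> 0" for k
    proof -
      have "\<bar>s\<bar> \<le> real K" unfolding K_def by linarith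
      then show ?thesis using \<tau>(2)[of "k + K"] unfolding \<sigma>_def by (simp add: abs_le_iff)
    qed
    have lim: "(\<lambda>k. z (r + \<sigma> k)) \<longlonglongrightarrow> zu r" for r
      unfolding \<sigma>_def by (rule LIMSEQ_ignore_initial_segment[OF tendsto_uniform_limitI[OF zu[of r]]]) simp
    have zc: "continuous_on {s..t} (\<lambda>r. z (r + \<sigma> k))" for k
      by (rule continuous_on_compose2[OF sol_continuous[OF z]]) (use \<sigma>s[of k] in \<open>auto intro!: continuous_intros\<close>)
    have hi: "(\<lambda>r. h (z (r + \<sigma> k))) integrable_on {s..t}" for k
      by (intro integrable_continuous_interval continuous_on_compose2[OF hc zc]) simp
    have hb: "norm (h (z (r + \<sigma> k))) \<le> b" if "r \<in> {s..t}" for r k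
      by (intro b zR) (use that \<sigma>s[of k] in auto)
    have hl: "(\<lambda>k. h (z (r + \<sigma> k))) \<longlonglongrightarrow> h (zu r)" for r
      by (rule continuous_on_tendsto_compose[OF hc lim]) auto
    note dom = dominated_convergence[where f = "\<lambda>k r. h (z (r + \<sigma> k))" and h = "\<lambda>_. b" and S = "{s..t}", OF hi integrable_const_ivl hb hl]
    have uL: "u \<in> L1loc UNIV" unfolding u_def by (rule s1_ext_L1loc[OF w])
    have wi: "(\<lambda>r. w (r + \<sigma> k)) integrable_on {s..t}" for k
      using L1loc_shift_integrable[OF S1_L1loc[OF w], of s "\<sigma> k" t] \<sigma>s[of k] by (auto dest: set_lebesgue_integral_eq_integral(1))
    have ui: "u integrable_on {s..t}"
      using L1loc_integrable[OF uL, of s t] by (auto dest: set_lebesgue_integral_eq_integral(1))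
    define J where "J = integral {s..t} u"
    define Jk where "Jk k = integral {s..t} (\<lambda>r. w (r + \<sigma> k))" for k
    \<comment> \<open>Since \<open>\<sigma> k\<close> is an almost period of the extension, the
      translated inputs converge to it in the mean on every bounded interval. For the input term
      convergence of the integrals is enough, while the state terms converge by domination.\<close>
    have Jb: "norm (Jk k - J) \<le> e k * (t - s + 1)" for k
    proof -
      have di: "(\<lambda>r. norm (u r - w (r + \<sigma> k))) integrable_on {p..q}" if "s \<le> p" for p q
        using L1loc_shift_integrable_diff[OF uL _ S1_L1loc[OF w], of p 0 q "\<sigma> k"] \<sigma>s[of k] that by auto
      have \<sigma>0: "\<sigma> k \<ge> 0" using \<tau>(2)[of "k + K"] unfolding \<sigma>_def by linarith
      have "\<sigma> k \<in> bohr_periods {0..} (bochner_transform w) (e k)"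
        using \<tau>(1)[of "k + K"] bohr_periods_mono[OF emono[of k "k + K"]] unfolding \<sigma>_def by auto
      then have per: "\<sigma> k \<in> bohr_periods UNIV (bochner_transform u) (e k)"
        unfolding u_def bochner_periods_ext_iff[OF w \<sigma>0] stepanov_periods_half_line[OF w] .
      have block: "integral {p..p + 1} (\<lambda>r. norm (u r - w (r + \<sigma> k))) \<le> e k" if "p \<ge> s" for p
      proof -
        have p0: "p + \<sigma> k \<ge> 0" using that \<sigma>s[of k] by linarith
        have "integral {p..p + 1} (\<lambda>r. norm (u r - w (r + \<sigma> k))) = norm (bochner_transform u p - bochner_transform w (p + \<sigma> k))"
          by (rule norm_bochner_diff_translate[OF uL _ S1_L1loc[OF w], symmetric]) (use p0 in auto)
        also have "\<dots> = norm (bochner_transform u p - bochner_transform u (p + \<sigma> k))"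
          unfolding u_def using s1_ext_props(3)[OF w p0] by simp
        also have "\<dots> \<le> e k" by (rule bohr_periodsD[OF per]) simp
        finally show ?thesis .
      qed
      have "norm (J - Jk k) = norm (integral {s..t} (\<lambda>r. u r - w (r + \<sigma> k)))"
        unfolding J_def Jk_def by (subst Henstock_Kurzweil_Integration.integral_diff[OF ui wi]) simp
      also have "\<dots> \<le> integral {s..t} (\<lambda>r. norm (u r - w (r + \<sigma> k)))"
        by (rule Henstock_Kurzweil_Integration.integral_norm_bound_integral[OF integrable_diff[OF ui wi] di]) auto
      also have "\<dots> \<le> e k * (t - s + 1)" by (rule integral_le_of_unit_blocks[OF di _ block st]) auto
      finally show ?thesis by (simp add: norm_minus_commute)
    qed
    have elim: "(\<lambda>k. e k * (t - s + 1)) \<longlonglongrightarrow> 0"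
      using tendsto_mult_left_zero[OF LIMSEQ_inverse_real_of_nat, of "t - s + 1"] by (simp add: e_def inverse_eq_divide add.commute)
    have "(\<lambda>k. Jk k - J) \<longlonglongrightarrow> 0"
      by (rule Lim_null_comparison[OF _ elim], rule always_eventually, rule allI, rule Jb)
    then have Jlim: "Jk \<longlonglongrightarrow> J" by (rule LIM_zero_cancel)
    have Bl: "bounded_linear ((*v) B)" by (rule bounded_linear_matrix)
    have eq: "z (t + \<sigma> k) - z (s + \<sigma> k) = integral {s..t} (\<lambda>r. h (z (r + \<sigma> k))) + B *v Jk k" for k
    proof -
      have "solution {s..} A B C f (\<lambda>r. w (r + \<sigma> k)) (\<lambda>r. z (r + \<sigma> k))"
        by (rule solution_shift[OF z]) (use \<sigma>s[of k] in auto)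
      then have "(lure_rhs A B C f (\<lambda>r. w (r + \<sigma> k)) (\<lambda>r. z (r + \<sigma> k)) has_integral (z (t + \<sigma> k) - z (s + \<sigma> k))) {s..t}"
        using st by (simp add: solution_def)
      moreover have "((\<lambda>r. h (z (r + \<sigma> k)) + B *v w (r + \<sigma> k)) has_integral
          (integral {s..t} (\<lambda>r. h (z (r + \<sigma> k))) + B *v Jk k)) {s..t}"
        unfolding Jk_def
        using has_integral_add[OF integrable_integral[OF hi] has_integral_linear[OF integrable_integral[OF wi] Bl]] by (simp add: o_def)
      ultimately show ?thesis by (simp add: rhs[abs_def] has_integral_unique)
    qed
    have "(\<lambda>k. integral {s..t} (\<lambda>r. h (z (r + \<sigma> k))) + B *v Jk k) \<longlonglongrightarrow> integral {s..t} (\<lambda>r. h (zu r)) + B *v J"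
      by (intro tendsto_add dom(2) bounded_linear.tendsto[OF Bl Jlim])
    moreover have "(\<lambda>k. z (t + \<sigma> k) - z (s + \<sigma> k)) \<longlonglongrightarrow> zu t - zu s" by (intro tendsto_diff lim)
    ultimately have "zu t - zu s = integral {s..t} (\<lambda>r. h (zu r)) + B *v J"
      unfolding eq by (intro LIMSEQ_unique)
    moreover have "((\<lambda>r. h (zu r) + B *v u r) has_integral (integral {s..t} (\<lambda>r. h (zu r)) + B *v J)) {s..t}"
      unfolding J_def
      using has_integral_add[OF integrable_integral[OF dom(1)] has_integral_linear[OF integrable_integral[OF ui] Bl]] by (simp add: o_def)
    ultimately show ?thesis by (simp add: rhs[abs_def])
  qed
  have "solution UNIV A B C f u zu"
    unfolding solution_def using s1_ext_L1loc[OF w] AP_continuous[OF zuAP] sol by (simp add: u_def)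
  from that[OF zuAP zuP this[unfolded u_def]] show thesis .
qed

end

lemma AP_imp_S1:
  fixes U :: "real \<Rightarrow> 'b::euclidean_space"
  assumes U: "U \<in> AP UNIV" shows "U \<in> S1 UNIV"
proof -
  have L: "U \<in> L1loc UNIV" by (rule L1loc_continuous[OF AP_continuous[OF U]])
  have "relatively_dense UNIV (bohr_periods UNIV (bochner_transform U) e)" if "e > 0" for e
  proof -
    have "relatively_dense UNIV (bohr_periods UNIV U e)" using U that by (simp add: AP_def)
    then show ?thesis using bochner_periods_of_bohr[OF U, of e] unfolding relatively_dense_def by fast
  qed
  then show ?thesis using L by (simp add: S1_iff_bochner_AP AP_def continuous_bochner)
qed

text \<open>\<open>s1_ext w\<close> is determined only up to null sets, but its Bochner transform is
  unique; the comparison with the continuous extension is therefore made between transforms.\<close>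

lemma freq_module_bochner_s1_ext:
  fixes w :: "real \<Rightarrow> 'b::euclidean_space"
  assumes w: "w \<in> S1 {0..}" and ap: "w \<in> AP {0..}"
  shows "freq_module (bochner_transform (s1_ext w)) = freq_module (ap_ext w)"
proof -
  obtain U where U: "U \<in> AP UNIV" "\<And>t. t \<ge> 0 \<Longrightarrow> U t = w t" using AP_extension[OF ap] by metis
  have US: "U \<in> S1 UNIV" by (rule AP_imp_S1[OF U(1)])
  then have bU: "bochner_transform U \<in> AP UNIV" and UL: "U \<in> L1loc UNIV" by (simp_all add: S1_iff_bochner_AP)
  have "bochner_transform U t = bochner_transform w t" if "t \<ge> 0" for t
    by (rule bochner_cong_AE[OF L1loc_mono[OF UL] S1_L1loc[OF w] _ that]) (use U(2) in auto)
  then have "bochner_transform (s1_ext w) = bochner_transform U"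
    by (intro AP_eqI_half_line[OF s1_ext_bochner_AP[OF w] bU]) (simp add: s1_ext_props(3)[OF w])
  then show ?thesis using freq_module_bochner[OF U(1) bU] ap_ext_eqI[OF U] by simp
qed

context lure
begin

context
  fixes w zu
  assumes w: "w \<in> S1 {0..}" and zuAP: "zu \<in> AP UNIV"
    and zuP: "\<And>\<epsilon>. \<epsilon> > 0 \<Longrightarrow> \<exists>\<delta>>0. stepanov_periods {0..} w \<delta> \<subseteq> bohr_periods UNIV zu \<epsilon>"
    and zuS: "solution UNIV A B C f (s1_ext w) zu"
begin

lemma response_sol: "sol w zu"
  by (rule solution_cong_AE[OF solution_subset[OF zuS] S1_L1loc[OF w] s1_ext_props(2)[OF w]]) simp

lemma response_converge:
  assumes x: "sol v x" and int: "set_integrable lebesgue {0..} (\<lambda>t. v t - w t)"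
  shows "((\<lambda>t. x t - zu t) \<longlongrightarrow> 0) at_top"
proof -
  obtain R where R: "R > 0" "\<And>t. norm (zu t) \<le> R" using AP_bounded[OF zuAP] by metis
  have "(\<lambda>r. norm (v r - w r)) integrable_on {0..}"
    using int by (simp add: absolutely_integrable_on_def)
  from converge_of_integrable_input[OF x response_sol this R(2)] show ?thesis .
qed

lemma response_asymptotically_AP:
  assumes x: "continuous_on {0..} x" and lim: "((\<lambda>t. x t - zu t) \<longlongrightarrow> 0) at_top"
  shows "x \<in> AAP" "t \<ge> 0 \<Longrightarrow> ap_part x t = zu t"
proof -
  have zu0: "zu \<in> AP {0..}" by (rule AP_restrict[OF zuAP])
  have c: "(\<lambda>t. x t - zu t) \<in> C0"
    using lim x AP_continuous[OF zu0] by (auto simp: C0_def intro: continuous_intros)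
  show "x \<in> AAP"
    unfolding AAP_def mem_Collect_eq by (rule bexI[OF _ zu0], rule bexI[OF _ c]) simp
  assume t: "t \<ge> 0"
  have "\<exists>u. u \<in> AP {0..} \<and> (\<lambda>t. x t - u t) \<in> C0" using zu0 c by blast
  from someI_ex[OF this] have p: "ap_part x \<in> AP {0..}" "(\<lambda>t. x t - ap_part x t) \<in> C0" by (simp_all add: ap_part_def)
  have "((\<lambda>t. (x t - zu t) - (x t - ap_part x t)) \<longlongrightarrow> 0 - 0) at_top"
    by (rule tendsto_diff[OF lim]) (use p(2) in \<open>simp add: C0_def\<close>)
  then have "((\<lambda>t. ap_part x t - zu t) \<longlongrightarrow> 0) at_top" by simp
  from AP_eqI_tendsto[OF p(1) zu0 _ this] t show "ap_part x t = zu t" by simp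
qed

lemma response_unique:
  assumes z: "z \<in> AP {0..}" "sol w z" and t: "t \<ge> 0"
  shows "z t = zu t"
proof -
  have "((\<lambda>t. z t - zu t) \<longlongrightarrow> 0) at_top" by (rule response_converge[OF z(2)]) simp
  from AP_eqI_tendsto[OF z(1) AP_restrict[OF zuAP] _ this] t show ?thesis by simp
qed

text \<open>A period of the input is a Stepanov almost period for every tolerance, hence an almost
  period of the response for every tolerance.\<close>

lemma response_periodic:
  assumes \<tau>: "\<tau> > 0" and per: "AE t in lebesgue_on {0..}. w (t + \<tau>) = w t"
  shows "zu (t + \<tau>) = zu t"
proof -
  obtain N where N: "negligible N" "\<And>r. r \<ge> 0 \<Longrightarrow> r \<notin> N \<Longrightarrow> w (r + \<tau>) = w r"
    using per by (subst (asm) AE_lebesgue_on_iff_negligible) auto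
  have "\<tau> \<in> stepanov_periods {0..} w d" if "d > 0" for d
  proof -
    have "integral {p..p + 1} (\<lambda>s. norm (w (s + \<tau>) - w s)) = integral {p..p + 1} (\<lambda>s::real. 0)" if "p \<ge> 0" for p
      by (rule integral_spike[OF N(1)]) (use N(2) that in auto)
    then show ?thesis using \<tau> \<open>d > 0\<close> by (simp add: stepanov_periods_def)
  qed
  then have "\<tau> \<in> bohr_periods UNIV zu e" if "e > 0" for e using zuP[OF that] by blast
  then have "norm (zu t - zu (t + \<tau>)) \<le> 0 + e" if "e > 0" for e using bohr_periodsD[of \<tau> UNIV zu e t] that by simp
  from field_le_epsilon[OF this] show ?thesis by simp
qed

text \<open>Shifting to the far past turns the uniform decay of differences into uniqueness.\<close>

lemma bounded_solution_unique:
  assumes bd: "bounded (range y)" and y: "solution UNIV A B C f (s1_ext w) y"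
  shows "y = zu"
proof
  fix t
  define u where "u = s1_ext w"
  obtain R where R: "R > 0" "\<And>t. norm (zu t) \<le> R" using AP_bounded[OF zuAP] by metis
  obtain R' where R': "\<And>t. norm (y t) \<le> R'" using bd unfolding bounded_iff by auto
  obtain \<Gamma> where \<Gamma>: "compact \<Gamma>" "\<And>x. norm x \<le> R \<Longrightarrow> C *v x \<in> \<Gamma>" using output_compact by blast
  obtain Y where Y: "Y \<ge> 0" "inputs_admissible \<Gamma> Y 1"
    using admissible_bounded[OF \<Gamma>(1), of 1] by (elim exE conjE) (rule that)
  have "norm (y t - zu t) \<le> 0 + h" if h: "h > 0" for h
  proof -
    obtain d where d: "d > 0" "\<And>r0. \<exists>T. attracted \<Gamma> Y d r0 T h" using asymptotically_small[OF \<Gamma>(1) Y(1) h] by metis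
    obtain T where T: "attracted \<Gamma> Y d (R' + R) T h" using d(2)[of "R' + R"] by (rule exE)
    have sh: "sol (\<lambda>r. u (r + (t - T))) (\<lambda>r. y (r + (t - T)))" "sol (\<lambda>r. u (r + (t - T))) (\<lambda>r. zu (r + (t - T)))"
      unfolding u_def by (rule solution_shift[OF y]; simp) (rule solution_shift[OF zuS]; simp)
    have adm: "admissible \<Gamma> Y d (\<lambda>r. u (r + (t - T))) (\<lambda>r. y (r + (t - T))) (\<lambda>r. u (r + (t - T))) (\<lambda>r. zu (r + (t - T)))"
      by (rule Y(2)[rule_format, OF sh]) (use \<Gamma>(2) R(2) d(1) in auto)
    have "norm (y (0 + (t - T)) - zu (0 + (t - T))) \<le> R' + R"
      by (rule order_trans[OF norm_triangle_ineq4 add_mono[OF R' R(2)]])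
    from T[rule_format, OF adm this order_refl] show ?thesis by simp
  qed
  from field_le_epsilon[OF this] show "y t = zu t" by simp
qed

lemma response_module: "freq_module zu \<subseteq> freq_module (bochner_transform (s1_ext w))"
proof (rule freq_module_le_of_periods[OF separating_L1unit s1_ext_bochner_AP[OF w] zuAP])
  fix e :: real assume "e > 0"
  from zuP[OF this] show "\<exists>d>0. \<forall>\<tau>\<ge>0. \<tau> \<in> bohr_periods UNIV (bochner_transform (s1_ext w)) d \<longrightarrow> \<tau> \<in> bohr_periods UNIV zu e"
    using bochner_periods_ext_iff[OF w] by blast
qed

lemma response_converge_Linf:
  assumes x: "sol v x" and v: "v \<in> Linf {0..}" "w \<in> Linf {0..}"
    and lim: "((\<lambda>t. Linf_norm {t<..} (\<lambda>s. v s - w s)) \<longlongrightarrow> 0) at_top"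
  shows "((\<lambda>t. x t - zu t) \<longlongrightarrow> 0) at_top"
proof (rule tendstoI)
  fix h :: real assume "h > 0"
  then have "h/2 > 0" by simp
  obtain R where R: "R > 0" "\<And>t. norm (zu t) \<le> R" using AP_bounded[OF zuAP] by metis
  obtain \<Gamma> where \<Gamma>: "compact \<Gamma>" "\<And>x. norm x \<le> R \<Longrightarrow> C *v x \<in> \<Gamma>" using output_compact by blast
  obtain d where d: "d > 0" "close_outputs \<Gamma> d (h/2)"
    using eventually_close_of_small_input[OF \<Gamma>(1) \<open>h/2 > 0\<close>] by (elim exE conjE) (rule that)
  from tendstoD[OF lim d(1)] obtain c where c: "\<And>t. t \<ge> c \<Longrightarrow> dist (Linf_norm {t<..} (\<lambda>s. v s - w s)) 0 < d"
    unfolding eventually_at_top_linorder by blast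
  define t0 where "t0 = max c 0"
  have t0: "t0 \<ge> c" "t0 \<ge> 0" by (simp_all add: t0_def)
  have "(\<lambda>s. v s - w s) \<in> Linf {t0<..}"
    by (rule Linf_subset[OF Linf_diff[OF v]]) (use t0 in auto)
  from Linf_norm_AE[OF this] have "AE s in lebesgue_on {t0<..}. norm (v s - w s) \<le> d"
    by eventually_elim (use c[OF t0(1)] in auto)
  then obtain N where N: "negligible N" "\<And>r. r > t0 \<Longrightarrow> r \<notin> N \<Longrightarrow> norm (v r - w r) \<le> d"
    by (subst (asm) AE_lebesgue_on_iff_negligible) auto
  have ae: "AE s in lebesgue_on {t0..}. norm (v s - w s) \<le> d"
  proof (subst AE_lebesgue_on_iff_negligible)
    show "\<exists>N. negligible N \<and> (\<forall>t\<in>{t0..}. t \<notin> N \<longrightarrow> norm (v t - w t) \<le> d)"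
      by (intro exI[of _ "insert t0 N"]) (use N in auto)
  qed simp
  have "\<exists>T. \<forall>t\<ge>T. norm (x t - zu t) \<le> h/2"
    by (rule d(2)[rule_format, OF x response_sol _ t0(2) ae]) (use \<Gamma>(2) R(2) in blast)
  then obtain T where T: "\<And>t. t \<ge> T \<Longrightarrow> norm (x t - zu t) \<le> h/2" by blast
  then show "\<forall>\<^sub>F t in at_top. dist (x t - zu t) 0 < h"
    unfolding eventually_at_top_linorder by (intro exI[of _ T]) (use \<open>h > 0\<close> in force)
qed

lemma AP_response_norm_le:
  assumes xap: "xap \<in> AP {0..}" and ev: "\<exists>T. \<forall>t\<ge>T. norm (xap t - zu t) \<le> c" and t: "t \<ge> 0"
  shows "norm (xap t - zu t) \<le> c"
proof -
  obtain X where X: "X \<in> AP UNIV" "\<And>t. t \<ge> 0 \<Longrightarrow> X t = xap t" using AP_extension[OF xap] by metis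
  obtain T where T: "\<And>t. t \<ge> T \<Longrightarrow> norm (xap t - zu t) \<le> c" using ev by blast
  have "norm (X t - zu t) \<le> c"
    by (rule AP_norm_le_of_eventually[OF AP_minus[OF X(1) zuAP], of "max T 0"]) (use X(2) T in auto)
  then show ?thesis using X(2)[OF t] by simp
qed

text \<open>The gain is majorized starting from the supremum of all deviations for inputs within \<open>\<Delta>\<close> of \<open>w\<close>.\<close>

lemma response_gain:
  assumes wL: "w \<in> Linf {0..}"
  shows "\<exists>\<theta>\<in>class_K. \<forall>v xap. sol v xap \<longrightarrow> v \<in> Linf {0..} \<longrightarrow> xap \<in> AP {0..} \<longrightarrow>
    Linf_norm {0..} (\<lambda>t. xap t - zu t) \<le> \<theta> (Linf_norm {0..} (\<lambda>t. v t - w t))"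
proof -
  obtain R where R: "R > 0" "\<And>t. norm (zu t) \<le> R" using AP_bounded[OF zuAP] by metis
  obtain \<Gamma> where \<Gamma>: "compact \<Gamma>" "\<And>x. norm x \<le> R \<Longrightarrow> C *v x \<in> \<Gamma>" using output_compact by blast
  have g: "\<forall>t\<ge>0. C *v zu t \<in> \<Gamma>" using \<Gamma>(2) R(2) by blast
  \<comment> \<open>Inserting 0 keeps the set nonempty and makes its supremum nonnegative.\<close>
  define S where "S \<Delta> = insert 0 {norm (xap t - zu t) | v xap t. sol v xap \<and> xap \<in> AP {0..} \<and> t \<ge> 0 \<and>
      (AE t in lebesgue_on {0..}. norm (v t - w t) \<le> \<Delta>)}" for \<Delta>
  have bdd: "bdd_above (S \<Delta>)" for \<Delta>
  proof -
    obtain G where G: "\<forall>v1 x1 v2 x2. sol v1 x1 \<longrightarrow> sol v2 x2 \<longrightarrow> (\<forall>t\<ge>0. C *v x2 t \<in> \<Gamma>) \<longrightarrow>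
      (AE t in lebesgue_on {0..}. norm (v1 t - v2 t) \<le> \<Delta>) \<longrightarrow> (\<exists>T. \<forall>t\<ge>T. norm (x1 t - x2 t) \<le> G)"
      using eventually_bounded_of_bounded_input[OF \<Gamma>(1), of \<Delta>] by (rule exE)
    have "s \<le> max G 0" if "s \<in> S \<Delta>" for s
      using that unfolding S_def
    proof (elim insertE CollectE exE conjE)
      fix v xap t assume s: "s = norm (xap t - zu t)" "sol v xap" "xap \<in> AP {0..}" "t \<ge> 0"
        and ae: "AE t in lebesgue_on {0..}. norm (v t - w t) \<le> \<Delta>"
      have "\<exists>T. \<forall>t\<ge>T. norm (xap t - zu t) \<le> G" using G s(2) response_sol g ae by blast
      from AP_response_norm_le[OF s(3) this s(4)] show ?thesis using s(1) by simp
    qed simp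
    then show ?thesis by (rule bdd_aboveI)
  qed
  define \<gamma> where "\<gamma> \<Delta> = Sup (S \<Delta>)" for \<Delta>
  have mono: "\<gamma> s \<le> \<gamma> t" if "s \<le> t" for s t
    unfolding \<gamma>_def
  proof (rule cSup_subset_mono[OF _ bdd])
    have "AE r in lebesgue_on {0..}. norm (v r - w r) \<le> t" if "AE r in lebesgue_on {0..}. norm (v r - w r) \<le> s" for v
      using that by eventually_elim (use \<open>s \<le> t\<close> in simp)
    then show "S s \<subseteq> S t" unfolding S_def by blast
  qed (simp add: S_def)
  have nn: "0 \<le> \<gamma> s" for s unfolding \<gamma>_def by (rule cSup_upper[OF _ bdd]) (simp add: S_def)
  have small: "\<exists>d>0. \<gamma> d \<le> h" if h: "h > 0" for h
  proof -
    obtain d where d: "d > 0" "close_outputs \<Gamma> d h"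
      using eventually_close_of_small_input[OF \<Gamma>(1) h] by (elim exE conjE) (rule that)
    have "s \<le> h" if "s \<in> S d" for s
      using that unfolding S_def
    proof (elim insertE CollectE exE conjE)
      fix v xap t assume s: "s = norm (xap t - zu t)" "sol v xap" "xap \<in> AP {0..}" "t \<ge> 0"
        and ae: "AE t in lebesgue_on {0..}. norm (v t - w t) \<le> d"
      have "\<exists>T. \<forall>t\<ge>T. norm (xap t - zu t) \<le> h" using d(2) s(2) response_sol g ae by blast
      from AP_response_norm_le[OF s(3) this s(4)] show ?thesis using s(1) by simp
    qed (use h in simp)
    then have "\<gamma> d \<le> h" unfolding \<gamma>_def by (intro cSup_least) (auto simp: S_def)
    then show ?thesis using d(1) by blast
  qed
  obtain \<theta> where \<theta>: "\<theta> \<in> class_K" "\<And>s. s \<ge> 0 \<Longrightarrow> \<gamma> s \<le> \<theta> s"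
    using class_K_majorant[of \<gamma>, OF mono nn small] by blast
  show ?thesis
  proof (rule bexI[OF _ \<theta>(1)], intro allI impI)
    fix v xap assume x: "sol v xap" and v: "v \<in> Linf {0..}" and xap: "xap \<in> AP {0..}"
    define \<Delta> where "\<Delta> = Linf_norm {0..} (\<lambda>t. v t - w t)"
    have \<Delta>: "\<Delta> \<ge> 0" unfolding \<Delta>_def by (rule Linf_norm_nonneg)
    have ae: "AE t in lebesgue_on {0..}. norm (v t - w t) \<le> \<Delta>"
      unfolding \<Delta>_def by (rule Linf_norm_AE[OF Linf_diff[OF v wL]])
    have "norm (xap t - zu t) \<le> \<gamma> \<Delta>" if "t \<ge> 0" for t
      unfolding \<gamma>_def by (rule cSup_upper[OF _ bdd]) (use x xap that ae in \<open>auto simp: S_def\<close>)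
    then have le: "norm (xap t - zu t) \<le> \<theta> \<Delta>" if "t \<ge> 0" for t using \<theta>(2)[OF \<Delta>] that by force
    show "Linf_norm {0..} (\<lambda>t. xap t - zu t) \<le> \<theta> \<Delta>"
    proof (rule Linf_norm_le)
      have "continuous_on {0..} (\<lambda>t. xap t - zu t)"
        by (intro continuous_intros AP_continuous xap AP_restrict[OF zuAP])
      then show "(\<lambda>t. xap t - zu t) \<in> borel_measurable (lebesgue_on {0..})"
        by (rule continuous_imp_measurable_on_sets_lebesgue) simp
      show "AE t in lebesgue_on {0..}. norm (xap t - zu t) \<le> \<theta> \<Delta>" by (rule AE_I2) (use le in simp)
      show "0 \<le> \<theta> \<Delta>" using le[of 0] norm_ge_zero order_trans by blast
    qed
  qed
qed

end

end

section \<open>From the matrix inequality to passivity, and assembly of the result\<close>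

definition block_vec :: "real^'n \<Rightarrow> real^'m \<Rightarrow> real^('n + 'm)" where
  "block_vec a b = (\<chi> i. case i of Inl k \<Rightarrow> a $ k | Inr k \<Rightarrow> b $ k)"

lemma sum_UNIV_Plus:
  fixes g :: "'n::finite + 'm::finite \<Rightarrow> 'c::comm_monoid_add"
  shows "(\<Sum>i\<in>UNIV. g i) = (\<Sum>k\<in>UNIV. g (Inl k)) + (\<Sum>k\<in>UNIV. g (Inr k))"
  using sum.Plus[of "UNIV :: 'n set" "UNIV :: 'm set" g] by (simp add: UNIV_Plus_UNIV o_def)

lemma inner_block_vec: "block_vec a b \<bullet> block_vec a' b' = a \<bullet> a' + b \<bullet> b'"
  by (simp add: inner_vec_def sum_UNIV_Plus block_vec_def)

lemma block_matrix_mult: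
  "block_matrix M11 M12 M21 M22 *v block_vec a b = block_vec (M11 *v a + M12 *v b) (M21 *v a + M22 *v b)"
  by (simp add: vec_eq_iff matrix_vector_mult_def sum_UNIV_Plus block_vec_def block_matrix_def split: sum.split)

lemma inner_transpose_matrix:
  fixes M :: "real^'n^'m"
  shows "x \<bullet> (transpose M *v y) = (M *v x) \<bullet> y"
  by (metis dot_lmul_matrix inner_commute transpose_matrix_vector)

text \<open>Because of the zero block the quadratic form is affine in the second component. An
  affine function bounded above is constant, so its linear part vanishes.\<close>

lemma passivity_conditions:
  fixes A P :: "real^'n^'n" and B :: "real^'m^'n" and C :: "real^'n^'m"
  assumes sym: "transpose P = P"
    and neg: "neg_semidef (block_matrix (transpose A ** P + P ** A) (P ** B - transpose C) (transpose B ** P - C) 0)"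
  shows "(P *v x) \<bullet> (A *v x) \<le> 0" "(P *v x) \<bullet> (B *v u) = (C *v x) \<bullet> u"
proof -
  have P: "y \<bullet> (P *v y') = (P *v y) \<bullet> y'" for y y' using inner_transpose_matrix[of y P y'] by (simp add: sym)
  have form: "2 * ((P *v a) \<bullet> (A *v a)) + 2 * ((P *v a) \<bullet> (B *v b) - (C *v a) \<bullet> b) \<le> 0" for a b
  proof -
    have "block_vec a b \<bullet> (block_matrix (transpose A ** P + P ** A) (P ** B - transpose C) (transpose B ** P - C) 0 *v block_vec a b) \<le> 0"
      using neg by (simp add: neg_semidef_def)
    moreover have "a \<bullet> ((transpose A ** P + P ** A) *v a) = 2 * ((P *v a) \<bullet> (A *v a))"
    proof -
      have "a \<bullet> ((transpose A ** P + P ** A) *v a) = a \<bullet> (transpose A *v (P *v a)) + a \<bullet> (P *v (A *v a))"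
        by (simp only: matrix_vector_mult_add_rdistrib inner_add_right matrix_vector_mul_assoc[symmetric])
      also have "\<dots> = (A *v a) \<bullet> (P *v a) + (P *v a) \<bullet> (A *v a)" by (simp only: inner_transpose_matrix P)
      finally show ?thesis by (simp add: inner_commute)
    qed
    moreover have "a \<bullet> ((P ** B - transpose C) *v b) = (P *v a) \<bullet> (B *v b) - (C *v a) \<bullet> b"
    proof -
      have "a \<bullet> ((P ** B - transpose C) *v b) = a \<bullet> (P *v (B *v b)) - a \<bullet> (transpose C *v b)"
        by (simp only: matrix_vector_mult_diff_rdistrib inner_diff_right matrix_vector_mul_assoc[symmetric])
      then show ?thesis by (simp only: inner_transpose_matrix P)
    qed
    moreover have "b \<bullet> ((transpose B ** P - C) *v a) = (P *v a) \<bullet> (B *v b) - (C *v a) \<bullet> b"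
    proof -
      have "b \<bullet> ((transpose B ** P - C) *v a) = b \<bullet> (transpose B *v (P *v a)) - b \<bullet> (C *v a)"
        by (simp only: matrix_vector_mult_diff_rdistrib inner_diff_right matrix_vector_mul_assoc[symmetric])
      also have "\<dots> = (B *v b) \<bullet> (P *v a) - b \<bullet> (C *v a)" by (simp only: inner_transpose_matrix)
      finally show ?thesis by (simp add: inner_commute)
    qed
    ultimately show ?thesis
      by (simp add: block_matrix_mult inner_block_vec inner_add_right)
  qed
  show A: "(P *v x) \<bullet> (A *v x) \<le> 0" using form[of x 0] by simp
  show "(P *v x) \<bullet> (B *v u) = (C *v x) \<bullet> u"
  proof (rule ccontr)
    define l where "l = (P *v x) \<bullet> (B *v u) - (C *v x) \<bullet> u"
    define q where "q = (P *v x) \<bullet> (A *v x)"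
    assume "\<not> ?thesis"
    then have l: "l \<noteq> 0" by (simp add: l_def)
    have "2 * q + 2 * (c * l) \<le> 0" for c
      using form[of x "c *\<^sub>R u"] by (simp add: q_def l_def matrix_vector_mult_scaleR right_diff_distrib)
    \<comment> \<open>This multiple of \<open>u\<close> gives the form the value 2.\<close>
    from this[of "(1 - q) / l"] l show False by simp
  qed
qed

theorem proposition5p2:
  fixes A :: "real^'n^'n" and B :: "real^'m^'n" and C :: "real^'n^'m"
    and f :: "real^'m \<Rightarrow> real^'m" and w :: "real \<Rightarrow> real^'m"
  assumes f_lip: "local_lipschitz (UNIV :: real set) UNIV (\<lambda>_. f)"
    and w: "w \<in> S1 {0..} \<inter> Linf {0..}"
    and i: "detectable C A"
    and ii: "\<exists>P :: real^'n^'n. pos_semidef P \<and>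
      neg_semidef (block_matrix (transpose A ** P + P ** A) (P ** B - transpose C)
                                (transpose B ** P - C)       0)"
    and iii: "\<forall>\<Gamma> :: (real^'m) set. compact \<Gamma> \<longrightarrow>
      (\<exists>\<theta>\<in>class_K_inf. \<exists>\<alpha>\<in>class_K_inf. \<exists>\<mu>\<ge>0. \<exists>c\<ge>0. \<mu> * c \<ge> 1 \<and>
        (\<forall>y. \<forall>z\<in>\<Gamma>.
          norm (f (y + z) - f z) \<le> \<theta> (norm y) \<and>
          norm y * \<alpha> (norm y) \<le> y \<bullet> (f (y + z) - f z) \<and>
          (norm y > \<mu> \<longrightarrow> norm (f (y + z) - f z) \<le> c * (y \<bullet> (f (y + z) - f z)))))"
    and iv: "\<exists>z. (w, z) \<in> behaviour {0..} A B C f \<and> bounded (z ` {0..})"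
  defines "is_ap_response \<equiv> \<lambda>z :: real \<Rightarrow> real^'n. z \<in> AP {0..} \<and> (w, z) \<in> behaviour {0..} A B C f \<and>
      (\<forall>\<epsilon>>0. \<exists>\<delta>>0. stepanov_periods {0..} w \<delta> \<subseteq> bohr_periods {0..} z \<epsilon>)"
  shows "\<exists>zap. is_ap_response zap \<and>
    (\<forall>z. is_ap_response z \<longrightarrow> (\<forall>t\<ge>0. z t = zap t)) \<and>
    \<comment> \<open>(a)\<close>
    (\<forall>v x. (v, x) \<in> behaviour {0..} A B C f \<and> set_integrable lebesgue {0..} (\<lambda>t. v t - w t) \<longrightarrow>
       ((\<lambda>t. x t - zap t) \<longlongrightarrow> 0) at_top \<and> x \<in> AAP \<and> (\<forall>t\<ge>0. ap_part x t = zap t)) \<and>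
    \<comment> \<open>(b)\<close>
    (\<forall>\<tau>>0. (AE t in lebesgue_on {0..}. w (t + \<tau>) = w t) \<longrightarrow> (\<forall>t\<ge>0. zap (t + \<tau>) = zap t)) \<and>
    \<comment> \<open>(c)\<close>
    (s1_ext w, ap_ext zap) \<in> behaviour UNIV A B C f \<and>
    (\<forall>y. bounded (range y) \<and> (s1_ext w, y) \<in> behaviour UNIV A B C f \<longrightarrow> y = ap_ext zap) \<and>
    \<comment> \<open>(d)\<close>
    freq_module (ap_ext zap) \<subseteq> freq_module (bochner_transform (s1_ext w)) \<and>
    (w \<in> AP {0..} \<longrightarrow> freq_module (bochner_transform (s1_ext w)) = freq_module (ap_ext w)) \<and>
    \<comment> \<open>(1)\<close>
    (\<forall>v x. (v, x) \<in> behaviour_inf A B C f \<and> v \<in> Linf {0..} \<and>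
       ((\<lambda>t. Linf_norm {t<..} (\<lambda>s. v s - w s)) \<longlongrightarrow> 0) at_top \<longrightarrow>
       ((\<lambda>t. x t - zap t) \<longlongrightarrow> 0) at_top) \<and>
    \<comment> \<open>(2)\<close>
    (\<exists>\<theta>\<in>class_K. \<forall>v xap. (v, xap) \<in> behaviour_inf A B C f \<and> v \<in> S1 {0..} \<inter> Linf {0..} \<and>
       xap \<in> AP {0..} \<longrightarrow>
       Linf_norm {0..} (\<lambda>t. xap t - zap t) \<le> \<theta> (Linf_norm {0..} (\<lambda>t. v t - w t)))"
proof -
  have f_cont: "continuous_on UNIV f"
    by (rule local_lipschitz_continuous_on[OF f_lip]) simp
  obtain P where P: "transpose P = P" "\<And>x. x \<bullet> (P *v x) \<ge> 0"
    and neg: "neg_semidef (block_matrix (transpose A ** P + P ** A) (P ** B - transpose C) (transpose B ** P - C) 0)"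
    using ii by (auto simp: pos_semidef_def)
  obtain H where H: "hurwitz (A - H ** C)" using i by (auto simp: detectable_def)
  obtain N a h0 \<beta> where N: "a > 0" "h0 > 0" "\<beta> > 0" "\<And>x. norm x \<le> N x" "\<And>x. N x \<le> \<beta> * norm x"
    "\<And>x y. N (x + y) \<le> N x + N y" "\<And>x h. 0 \<le> h \<Longrightarrow> h \<le> h0 \<Longrightarrow> N (x + h *\<^sub>R ((A - H ** C) *v x)) \<le> (1 - a * h) * N x"
    using hurwitz_contracting_norm[OF H] by metis
  interpret L: lure A P B C f H N a h0 \<beta>
  proof
    show "x \<bullet> (P *v y) = (P *v x) \<bullet> y" for x y using inner_transpose_matrix[of x P y] by (simp add: P(1))
    show "(P *v x) \<bullet> (A *v x) \<le> 0" "(P *v x) \<bullet> (B *v u) = (C *v x) \<bullet> u" for x u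
      by (rule passivity_conditions[OF P(1) neg])+
  qed (rule f_cont P(2) N iii[rule_format] | assumption)+
  have half: "(v, x) \<in> behaviour {0..} A B C f \<longleftrightarrow> L.sol v x" for v x
    by (rule behaviour_iff_solution[OF _ f_cont]) (simp add: time_domain_def)
  have line: "(v, x) \<in> behaviour UNIV A B C f \<longleftrightarrow> solution UNIV A B C f v x" for v x
    by (rule behaviour_iff_solution[OF _ f_cont]) (simp add: time_domain_def)
  have wS: "w \<in> S1 {0..}" and wL: "w \<in> Linf {0..}" using w by auto
  obtain M where M: "AE t in lebesgue_on {0..}. norm (w t) \<le> M" using wL by (auto simp: Linf_def)
  obtain z R where z: "L.sol w z" and R: "\<And>t. t \<ge> 0 \<Longrightarrow> norm (z t) \<le> R"
    using iv unfolding half bounded_iff by auto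
  show ?thesis
  proof (rule L.almost_periodic_response[OF wS M z R])
    fix zu assume zu: "zu \<in> AP UNIV" "\<And>\<epsilon>. \<epsilon> > 0 \<Longrightarrow> \<exists>\<delta>>0. stepanov_periods {0..} w \<delta> \<subseteq> bohr_periods UNIV zu \<epsilon>"
      "solution UNIV A B C f (s1_ext w) zu"
    note zu' = wS zu
    \<comment> \<open>The witness is the response on the whole line; it is its own extension, so (c)
      and (d) become statements about \<open>zu\<close>.\<close>
    have ext: "ap_ext zu = zu" by (rule ap_ext_eqI[OF zu(1)]) simp
    have response: "is_ap_response zu"
      unfolding is_ap_response_def half
    proof (intro conjI allI impI)
      show "zu \<in> AP {0..}" by (rule AP_restrict[OF zu(1)])
      show "L.sol w zu" by (rule L.response_sol[OF zu'])
      fix \<epsilon> :: real assume "\<epsilon> > 0"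
      from zu(2)[OF this] obtain \<delta> where \<delta>: "\<delta> > 0" "stepanov_periods {0..} w \<delta> \<subseteq> bohr_periods UNIV zu \<epsilon>" by blast
      have "stepanov_periods {0..} w \<delta> \<subseteq> bohr_periods {0..} zu \<epsilon>"
      proof
        fix \<tau> assume "\<tau> \<in> stepanov_periods {0..} w \<delta>"
        then have "\<tau> \<ge> 0" "\<tau> \<in> bohr_periods UNIV zu \<epsilon>" using \<delta>(2) by (auto simp: stepanov_periods_def)
        then show "\<tau> \<in> bohr_periods {0..} zu \<epsilon>" by (simp add: bohr_periods_def)
      qed
      then show "\<exists>\<delta>>0. stepanov_periods {0..} w \<delta> \<subseteq> bohr_periods {0..} zu \<epsilon>" using \<delta>(1) by blast
    qed
    show ?thesis
    proof (rule exI[of _ zu], intro conjI)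
      show "is_ap_response zu" by (rule response)
      show "\<forall>z. is_ap_response z \<longrightarrow> (\<forall>t\<ge>0. z t = zu t)"
        unfolding is_ap_response_def half using L.response_unique[OF zu'] by blast
      show "\<forall>v x. (v, x) \<in> behaviour {0..} A B C f \<and> set_integrable lebesgue {0..} (\<lambda>t. v t - w t) \<longrightarrow>
         ((\<lambda>t. x t - zu t) \<longlongrightarrow> 0) at_top \<and> x \<in> AAP \<and> (\<forall>t\<ge>0. ap_part x t = zu t)"
        unfolding half
      proof (intro allI impI, elim conjE)
        fix v x assume x: "L.sol v x" and int: "set_integrable lebesgue {0..} (\<lambda>t. v t - w t)"
        have lim: "((\<lambda>t. x t - zu t) \<longlongrightarrow> 0) at_top" by (rule L.response_converge[OF zu' x int])
        show "((\<lambda>t. x t - zu t) \<longlongrightarrow> 0) at_top \<and> x \<in> AAP \<and> (\<forall>t\<ge>0. ap_part x t = zu t)"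
          using lim L.response_asymptotically_AP[OF zu' L.sol_continuous[OF x] lim] by blast
      qed
      show "\<forall>\<tau>>0. (AE t in lebesgue_on {0..}. w (t + \<tau>) = w t) \<longrightarrow> (\<forall>t\<ge>0. zu (t + \<tau>) = zu t)"
        using L.response_periodic[OF zu'] by blast
      show "(s1_ext w, ap_ext zu) \<in> behaviour UNIV A B C f" unfolding line ext by (rule zu(3))
      show "\<forall>y. bounded (range y) \<and> (s1_ext w, y) \<in> behaviour UNIV A B C f \<longrightarrow> y = ap_ext zu"
        unfolding line ext using L.bounded_solution_unique[OF zu'] by blast
      show "freq_module (ap_ext zu) \<subseteq> freq_module (bochner_transform (s1_ext w))"
        unfolding ext by (rule L.response_module[OF zu'])
      show "w \<in> AP {0..} \<longrightarrow> freq_module (bochner_transform (s1_ext w)) = freq_module (ap_ext w)"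
        using freq_module_bochner_s1_ext[OF wS] by blast
      show "\<forall>v x. (v, x) \<in> behaviour_inf A B C f \<and> v \<in> Linf {0..} \<and>
         ((\<lambda>t. Linf_norm {t<..} (\<lambda>s. v s - w s)) \<longlongrightarrow> 0) at_top \<longrightarrow> ((\<lambda>t. x t - zu t) \<longlongrightarrow> 0) at_top"
      proof (intro allI impI, elim conjE)
        fix v x assume x: "(v, x) \<in> behaviour_inf A B C f" and v: "v \<in> Linf {0..}"
          and lim: "((\<lambda>t. Linf_norm {t<..} (\<lambda>s. v s - w s)) \<longlongrightarrow> 0) at_top"
        have "L.sol v x" using x by (simp add: behaviour_inf_def half)
        from L.response_converge_Linf[OF zu' this v wL lim] show "((\<lambda>t. x t - zu t) \<longlongrightarrow> 0) at_top" .
      qed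
      have "\<exists>\<theta>\<in>class_K. \<forall>v xap. L.sol v xap \<longrightarrow> v \<in> Linf {0..} \<longrightarrow> xap \<in> AP {0..} \<longrightarrow>
          Linf_norm {0..} (\<lambda>t. xap t - zu t) \<le> \<theta> (Linf_norm {0..} (\<lambda>t. v t - w t))"
        by (rule L.response_gain[OF zu' wL])
      then obtain \<theta> where \<theta>: "\<theta> \<in> class_K" "\<forall>v xap. L.sol v xap \<longrightarrow> v \<in> Linf {0..} \<longrightarrow> xap \<in> AP {0..} \<longrightarrow>
          Linf_norm {0..} (\<lambda>t. xap t - zu t) \<le> \<theta> (Linf_norm {0..} (\<lambda>t. v t - w t))"
        by (elim bexE) (rule that)
      show "\<exists>\<theta>\<in>class_K. \<forall>v xap. (v, xap) \<in> behaviour_inf A B C f \<and> v \<in> S1 {0..} \<inter> Linf {0..} \<and>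
         xap \<in> AP {0..} \<longrightarrow>
         Linf_norm {0..} (\<lambda>t. xap t - zu t) \<le> \<theta> (Linf_norm {0..} (\<lambda>t. v t - w t))"
      proof (rule bexI[OF _ \<theta>(1)], intro allI impI, elim conjE)
        fix v xap assume x: "(v, xap) \<in> behaviour_inf A B C f" and v: "v \<in> S1 {0..} \<inter> Linf {0..}" and xap: "xap \<in> AP {0..}"
        have "L.sol v xap" using x by (simp add: behaviour_inf_def half)
        then show "Linf_norm {0..} (\<lambda>t. xap t - zu t) \<le> \<theta> (Linf_norm {0..} (\<lambda>t. v t - w t))"
          using \<theta>(2) v xap by blast
      qed
    qed
  qed
qed

end
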